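(* Let $\mathcal K$ be either the class of all tensor products of Kirillov–Reshetikhin crystals $B^{r,s}$ of type $A_n^{(1)}$, or the class of all tensor products of Kirillov–Reshetikhin crystals $B^{1,s}$ of type $D_n^{(1)}$. There exists a unique family of bijections $\bar\phi:P(B,\lambda)\to\mathrm{RC}(L,\lambda)$ (for $B\in\mathcal K$ with multiplicity array $L$, and $\lambda\in\bar P^+$) such that the empty path maps to the empty rigged configuration, and: 1. If $B=B^1\otimes B'$ with $B^1=B^{1,1}$, let $\mathrm{lh}(B)=B'$ with multiplicity array $\mathrm{lh}(L)$. Then $\bar\phi\circ\mathrm{lh}=\bar\delta\circ\bar\phi$ as maps $P(B,\lambda)\to\bigcup_{\mu\in\lambda^-}\mathrm{RC}(\mathrm{lh}(L),\mu)$. 2. If $B=B^{r,s}\otimes B'$ with $s\ge2$ (and $r=1$ in type $D_n^{(1)}$), let $\mathrm{ls}(B)=B^{r,1}\otimes B^{r,s-1}\otimes B'$ with multiplicity array $\mathrm{ls}(L)$. Then $\bar\phi\circ\mathrm{ls}=\bar j\circ\bar\phi$ as maps $P(B,\lambda)\to\mathrm{RC}(\mathrm{ls}(L),\lambda)$. 3. In type $A_n^{(1)}$, if $B=B^{r,1}\otimes B'$ with $r\ge2$, let $\mathrm{lb}(B)=B^{1,1}\otimes B^{r-1,1}\otimes B'$ with multiplicity array $\mathrm{lb}(L)$. Then $\bar\phi\circ\mathrm{lb}=\bar i\circ\bar\phi$ as maps $P(B,\lambda)\to\mathrm{RC}(\mathrm{lb}(L),\lambda)$.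
   Context: **Crystals.** Nodes $\{0\}\cup\bar I$, $\bar I=\{1,\dots,n\}$; $\bar{\mathfrak g}$ the simple Lie algebra with nodes $\bar I$, dominant weights $\bar P^+$, fundamental weights $\bar\Lambda_a$, $(\alpha_a|\alpha_b)$ its Cartan matrix. Tensor products: $e_i(b_2\otimes b_1)=e_i(b_2)\otimes b_1$ if $\varepsilon_i(b_2)>\varphi_i(b_1)$, else $b_2\otimes e_i(b_1)$; $f_i(b_2\otimes b_1)=f_i(b_2)\otimes b_1$ if $\varepsilon_i(b_2)\ge\varphi_i(b_1)$, else $b_2\otimes f_i(b_1)$. $P(B,\lambda)$ is the set of $b\in B$ of weight $\lambda$ with $\varepsilon_i(b)=0$ for all $i\in\bar I$. In type $A_n^{(1)}$, $B^{r,s}\cong B(s\bar\Lambda_r)$ consists of semistandard tableaux of $r\times s$ rectangular shape in $\{1,\dots,n+1\}$; in type $D_n^{(1)}$, $B^s=B^{1,s}\cong B(s\bar\Lambda_1)$ consists of words of length $s$ in the crystal $B^1=\{1<\dots<n,\bar n<\dots<\bar1\}$ (via $B(s\bar\Lambda_1)\hookrightarrow B(\bar\Lambda_1)^{\otimes s}$). $\lambda^-$ is the set of $\mu\in\bar P^+$ such that $B(\lambda)$ occurs in $B^1\otimes B(\mu)$. **Path maps.** $\mathrm{lh}$ drops the left tensor factor. $\mathrm{ls}$ replaces the left factor $b\in B^{r,s}$ by its leftmost column (letter) in $B^{r,1}$ tensored with the rest in $B^{r,s-1}$. $\mathrm{lb}$ replaces the left factor, a column $b\in B^{r,1}$, by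 its bottom entry in $B^{1,1}$ tensored with the rest in $B^{r-1,1}$. **Rigged configurations.** $L_i^{(a)}$ is the number of factors $B^{a,i}$ of $B$. $\mathrm{RC}(L,\lambda)$ is the set of $(\nu,J)$: $\nu=(\nu^{(a)})_{a\in\bar I}$ partitions with $m_i^{(a)}$ parts of size $i$ in $\nu^{(a)}$, $\sum i m_i^{(a)}\alpha_a=\sum iL_i^{(a)}\bar\Lambda_a-\lambda$, vacancy numbers $p_i^{(a)}=\sum_j\min(i,j)L_j^{(a)}-\sum_b(\alpha_a|\alpha_b)\sum_j\min(i,j)m_j^{(b)}\ge0$ for all $a\in\bar I,i\ge1$, and $J^{(a,i)}$ a multiset of $m_i^{(a)}$ integers in $[0,p_i^{(a)}]$, attached as riggings to the parts ("strings") of length $i$ of $\nu^{(a)}$. $J^{(a,i)}$ is singular if it has a part $p_i^{(a)}$; a string $(i,x)$ is singular if $x=p_i^{(a)}$. **RC maps.** $\bar j(\nu,J)=(\nu,J)$. $\bar i$ adds a singular string of length $1$ to $(\nu,J)^{(a)}$ for each $1\le a<r$. $\bar\delta$ is the following algorithm. *Type $A_n^{(1)}$*: $\ell^{(0)}=1$; for $a=1,\dots,n$ let $\ell^{(a)}$ be the least $i\ge\ell^{(a-1)}$ with $J^{(a,i)}$ singular; if none exists stop. *Type $D_n^{(1)}$*: do the same for $a=1,\dots,n-2$; if not stopped, find minimal $i,j\ge\ell^{(n-2)}$ with $J^{(n-1,i)}$, $J^{(n,j)}$ singular; if neither exists stop; if only $i$ (only $j$) exists, set $\ell^{(n-1)}=i$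 ($\ell^{(n)}=j$) and stop; if both exist set $\ell^{(n-1)}=i,\ell^{(n)}=j$, $\bar\ell^{(n-1)}=\max(i,j)$, and for $a=n-2,\dots,1$ let $\bar\ell^{(a)}$ be the least $i\ge\bar\ell^{(a+1)}$ with $J^{(a,i)}$ singular (having two parts $p_i^{(a)}$ if $i=\ell^{(a)}$), stopping if none exists. Undefined $\ell^{(a)},\bar\ell^{(a)}$ are $\infty$. $\bar\delta(\nu,J)$ is obtained by removing one box from each selected string (a singular string of length $\ell^{(a)}$ in $(\nu,J)^{(a)}$ for each finite $\ell^{(a)}$, and one of length $\bar\ell^{(a)}$ for each finite $\bar\ell^{(a)}$, $a\le n-2$), making the shortened strings singular for the new vacancy numbers (computed with $\mathrm{lh}(L)$), and leaving all other riggings unchanged. *)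

theory Defs
  imports Main "HOL-Library.FuncSet" "HOL-Library.Multiset" "HOL-Library.Extended_Nat"
    "HOL-Library.Groups_Big_Fun"
begin

section \<open>Cartan data\<close>

datatype cartan_type = TypeA nat | TypeD nat

fun valid_type :: "cartan_type \<Rightarrow> bool" where
  "valid_type (TypeA n) = (1 \<le> n)"
| "valid_type (TypeD n) = (4 \<le> n)"

fun nodes :: "cartan_type \<Rightarrow> nat set" where
  "nodes (TypeA n) = {1..n}"
| "nodes (TypeD n) = {1..n}"

text \<open>In type \<open>D\<^sub>n\<close> the nodes \<open>n - 1\<close> and \<open>n\<close> are the two spin nodes.\<close>

fun adjacent :: "cartan_type \<Rightarrow> nat \<Rightarrow> nat \<Rightarrow> bool" where
  "adjacent (TypeA n) a b = (a = b + 1 \<or> b = a + 1)"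
| "adjacent (TypeD n) a b =
     ((a < n \<and> b < n \<and> (a = b + 1 \<or> b = a + 1)) \<or> (a = n \<and> b = n - 2) \<or> (a = n - 2 \<and> b = n))"

definition cartan :: "cartan_type \<Rightarrow> nat \<Rightarrow> nat \<Rightarrow> int" where
  "cartan T a b = (if a = b then 2 else if adjacent T a b then - 1 else 0)"

text \<open>A weight is given by its coefficients on the fundamental weights; the coefficients outside
  \<open>nodes T\<close> vanish. In particular the simple root \<open>\<alpha>\<^sub>a\<close> is the row \<open>cartan T a\<close>.\<close>

type_synonym weight = "nat \<Rightarrow> int"

definition dominant_weights :: "cartan_type \<Rightarrow> weight set" where
  "dominant_weights T = {lam. (\<forall>a\<in>nodes T. 0 \<le> lam a) \<and> (\<forall>a. a \<notin> nodes T \<longrightarrow> lam a = 0)}"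

definition simple_root :: "cartan_type \<Rightarrow> nat \<Rightarrow> weight" where
  "simple_root T a = (\<lambda>b. if b \<in> nodes T then cartan T a b else 0)"

definition fundamental_weight :: "nat \<Rightarrow> weight" where
  "fundamental_weight a = (\<lambda>b. if b = a then 1 else 0)"


section \<open>Classical crystals and their tensor products\<close>

record 'b crystal =
  wt :: "'b \<Rightarrow> weight"
  ce :: "nat \<Rightarrow> 'b \<Rightarrow> 'b option"
  cf :: "nat \<Rightarrow> 'b \<Rightarrow> 'b option"

primrec iterate :: "('b \<Rightarrow> 'b option) \<Rightarrow> nat \<Rightarrow> 'b \<Rightarrow> 'b option" where
  "iterate g 0 b = Some b"
| "iterate g (Suc k) b = Option.bind (g b) (iterate g k)"

definition eps :: "'b crystal \<Rightarrow> nat \<Rightarrow> 'b \<Rightarrow> nat" where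
  "eps C i b = Max {k. iterate (ce C i) k b \<noteq> None}"

definition phi :: "'b crystal \<Rightarrow> nat \<Rightarrow> 'b \<Rightarrow> nat" where
  "phi C i b = Max {k. iterate (cf C i) k b \<noteq> None}"

text \<open>The pair \<open>(b\<^sub>2, b\<^sub>1)\<close> stands for \<open>b\<^sub>2 \<otimes> b\<^sub>1\<close>. The convention is opposite to Kashiwara's.\<close>

definition tensor :: "'b crystal \<Rightarrow> 'c crystal \<Rightarrow> ('b \<times> 'c) crystal" where
  "tensor C\<^sub>2 C\<^sub>1 =
    \<lparr> wt = (\<lambda>(b\<^sub>2, b\<^sub>1) a. wt C\<^sub>2 b\<^sub>2 a + wt C\<^sub>1 b\<^sub>1 a),
      ce = (\<lambda>i (b\<^sub>2, b\<^sub>1).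
        if eps C\<^sub>2 i b\<^sub>2 > phi C\<^sub>1 i b\<^sub>1 then map_option (\<lambda>b. (b, b\<^sub>1)) (ce C\<^sub>2 i b\<^sub>2)
        else map_option (\<lambda>b. (b\<^sub>2, b)) (ce C\<^sub>1 i b\<^sub>1)),
      cf = (\<lambda>i (b\<^sub>2, b\<^sub>1).
        if eps C\<^sub>2 i b\<^sub>2 \<ge> phi C\<^sub>1 i b\<^sub>1 then map_option (\<lambda>b. (b, b\<^sub>1)) (cf C\<^sub>2 i b\<^sub>2)
        else map_option (\<lambda>b. (b\<^sub>2, b)) (cf C\<^sub>1 i b\<^sub>1)) \<rparr>"

text \<open>A list \<open>[b\<^sub>k, \<dots>, b\<^sub>1]\<close> stands for \<open>b\<^sub>k \<otimes> \<dots> \<otimes> b\<^sub>1\<close>: the head is the leftmost tensor factor.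
  The crystal \<open>tensor_power C k\<close> is only meaningful on lists of length \<open>k\<close>.\<close>

primrec tensor_power :: "'b crystal \<Rightarrow> nat \<Rightarrow> 'b list crystal" where
  "tensor_power C 0 = \<lparr> wt = (\<lambda>_ _. 0), ce = (\<lambda>_ _. None), cf = (\<lambda>_ _. None) \<rparr>"
| "tensor_power C (Suc k) = (let X = tensor C (tensor_power C k) in
    \<lparr> wt = (\<lambda>b. wt X (hd b, tl b)),
      ce = (\<lambda>i b. map_option (\<lambda>(x, y). x # y) (ce X i (hd b, tl b))),
      cf = (\<lambda>i b. map_option (\<lambda>(x, y). x # y) (cf X i (hd b, tl b))) \<rparr>)"

definition list_crystal :: "'b crystal \<Rightarrow> 'b list crystal" where
  "list_crystal C =
    \<lparr> wt = (\<lambda>b. wt (tensor_power C (length b)) b),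
      ce = (\<lambda>i b. ce (tensor_power C (length b)) i b),
      cf = (\<lambda>i b. cf (tensor_power C (length b)) i b) \<rparr>"

text \<open>The elements reachable from \<open>u\<close> by lowering operators. If \<open>u\<close> is a highest weight element
  of weight \<open>\<lambda>\<close>, this is its connected component, a copy of \<open>B(\<lambda>)\<close>.\<close>

inductive_set component :: "'b crystal \<Rightarrow> nat set \<Rightarrow> 'b \<Rightarrow> 'b set"
  for C :: "'b crystal" and I :: "nat set" and u :: 'b where
  base: "u \<in> component C I u"
| step: "b \<in> component C I u \<Longrightarrow> i \<in> I \<Longrightarrow> cf C i b = Some b' \<Longrightarrow> b' \<in> component C I u"

text \<open>The set \<open>P(S, \<lambda>)\<close> for a classical crystal with element set \<open>S\<close>.\<close>

definition highest_weight_elements ::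
    "cartan_type \<Rightarrow> 'b crystal \<Rightarrow> 'b set \<Rightarrow> weight \<Rightarrow> 'b set" where
  "highest_weight_elements T C S lam = {b \<in> S. wt C b = lam \<and> (\<forall>i\<in>nodes T. eps C i b = 0)}"


section \<open>The vector crystal\<close>

text \<open>In type \<open>D\<^sub>n\<close> the barred letter \<open>i\<close> is the integer \<open>- i\<close>. The letter \<open>i\<close> has weight
  \<open>\<epsilon>\<^sub>i\<close>, with \<open>\<alpha>\<^sub>a = \<epsilon>\<^sub>a - \<epsilon>\<^sub>a\<^sub>+\<^sub>1\<close>, except that \<open>\<alpha>\<^sub>n = \<epsilon>\<^sub>n\<^sub>-\<^sub>1 + \<epsilon>\<^sub>n\<close> in type \<open>D\<^sub>n\<close>; the coefficient
  of a weight on \<open>\<Lambda>\<^sub>a\<close> is its pairing with \<open>\<alpha>\<^sub>a\<close>.\<close>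

fun letters :: "cartan_type \<Rightarrow> int set" where
  "letters (TypeA n) = {1..int n + 1}"
| "letters (TypeD n) = {1..int n} \<union> {- int n..- 1}"

fun letter_wt :: "cartan_type \<Rightarrow> int \<Rightarrow> weight" where
  "letter_wt (TypeA n) x = (\<lambda>a.
     if a \<notin> {1..n} then 0
     else (if x = int a then 1 else 0) - (if x = int a + 1 then 1 else 0))"
| "letter_wt (TypeD n) x = (\<lambda>a.
     if a \<notin> {1..n} then 0
     else sgn x * (if a < n
       then (if \<bar>x\<bar> = int a then 1 else 0) - (if \<bar>x\<bar> = int a + 1 then 1 else 0)
       else (if \<bar>x\<bar> = int n - 1 \<or> \<bar>x\<bar> = int n then 1 else 0)))"

fun letter_f :: "cartan_type \<Rightarrow> nat \<Rightarrow> int \<Rightarrow> int option" where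
  "letter_f (TypeA n) i x = (if i \<in> {1..n} \<and> x = int i then Some (int i + 1) else None)"
| "letter_f (TypeD n) i x =
    (if i \<in> {1..<n} then
       (if x = int i then Some (int i + 1)
        else if x = - (int i + 1) then Some (- int i) else None)
     else if i = n then
       (if x = int n - 1 then Some (- int n)
        else if x = int n then Some (- (int n - 1)) else None)
     else None)"

fun letter_e :: "cartan_type \<Rightarrow> nat \<Rightarrow> int \<Rightarrow> int option" where
  "letter_e (TypeA n) i x = (if i \<in> {1..n} \<and> x = int i + 1 then Some (int i) else None)"
| "letter_e (TypeD n) i x =
    (if i \<in> {1..<n} then
       (if x = int i + 1 then Some (int i)
        else if x = - int i then Some (- (int i + 1)) else None)
     else if i = n then
       (if x = - int n then Some (int n - 1)
        else if x = - (int n - 1) then Some (int n) else None)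
     else None)"

definition letter_crystal :: "cartan_type \<Rightarrow> int crystal" where
  "letter_crystal T = \<lparr> wt = letter_wt T, ce = letter_e T, cf = letter_f T \<rparr>"


section \<open>Kirillov-Reshetikhin crystals and paths\<close>

text \<open>A column is the list of its entries from bottom to top and a tableau is the list of its
  columns from left to right. With these orders the embedding of a tableau into a tensor power of
  the vector crystal (reading each column upwards, columns from left to right) is the identity on
  nested lists. A word of type \<open>D\<close> is a tableau whose columns have height one. A path
  \<open>b\<^sub>k \<otimes> \<dots> \<otimes> b\<^sub>1\<close> is the list \<open>[b\<^sub>k, \<dots>, b\<^sub>1]\<close> of its tableaux.\<close>

type_synonym column = "int list"
type_synonym tableau = "column list"
type_synonym path = "tableau list"

definition tableau_crystal :: "cartan_type \<Rightarrow> tableau crystal" where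
  "tableau_crystal T = list_crystal (list_crystal (letter_crystal T))"

definition path_crystal :: "cartan_type \<Rightarrow> path crystal" where
  "path_crystal T = list_crystal (tableau_crystal T)"

text \<open>In type \<open>D\<close> only \<open>B\<^sup>1\<^sup>,\<^sup>s\<close> is considered: the component of the word \<open>1 \<dots> 1\<close>
  in the \<open>s\<close>-th tensor power of the vector crystal.\<close>

fun KR :: "cartan_type \<Rightarrow> nat \<Rightarrow> nat \<Rightarrow> tableau set" where
  "KR (TypeA n) r s =
    {t. length t = s
      \<and> (\<forall>c\<in>set t. length c = r \<and> set c \<subseteq> letters (TypeA n) \<and> sorted_wrt (>) c)
      \<and> sorted_wrt (list_all2 (\<le>)) t}"
| "KR (TypeD n) r s =
    (if r = 1 then component (tableau_crystal (TypeD n)) (nodes (TypeD n)) (replicate s [1]) else {})"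

text \<open>A tensor product \<open>B\<close> of crystals \<open>B\<^sup>r\<^sup>,\<^sup>s\<close> is the list of the pairs \<open>(r, s)\<close>, leftmost
  factor first.\<close>

type_synonym kr_product = "(nat \<times> nat) list"

fun KR_products :: "cartan_type \<Rightarrow> kr_product set" where
  "KR_products (TypeA n) = {B. \<forall>(r, s)\<in>set B. 1 \<le> r \<and> r \<le> n \<and> 1 \<le> s}"
| "KR_products (TypeD n) = {B. \<forall>(r, s)\<in>set B. r = 1 \<and> 1 \<le> s}"

definition elements :: "cartan_type \<Rightarrow> kr_product \<Rightarrow> path set" where
  "elements T B = {b. list_all2 (\<lambda>t (r, s). t \<in> KR T r s) b B}"

definition paths :: "cartan_type \<Rightarrow> kr_product \<Rightarrow> weight \<Rightarrow> path set" where
  "paths T B lam = highest_weight_elements T (path_crystal T) (elements T B) lam"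

definition lh :: "path \<Rightarrow> path" where
  "lh b = tl b"

definition ls :: "path \<Rightarrow> path" where
  "ls b = [hd (hd b)] # tl (hd b) # tl b"

definition lb :: "path \<Rightarrow> path" where
  "lb b = (let c = hd (hd b) in [[hd c]] # [tl c] # tl b)"


section \<open>The highest weight crystals and the set of weights below a dominant weight\<close>

text \<open>The minuscule crystals (the vector crystal and, in type \<open>D\<close>, the two spin crystals), with
  elements identified with their weights.\<close>

definition minuscule_crystal :: "cartan_type \<Rightarrow> weight crystal" where
  "minuscule_crystal T =
    \<lparr> wt = (\<lambda>v. v),
      ce = (\<lambda>i v. if i \<in> nodes T \<and> v i = - 1
             then Some (\<lambda>b. v b + simple_root T i b) else None),
      cf = (\<lambda>i v. if i \<in> nodes T \<and> v i = 1
             then Some (\<lambda>b. v b - simple_root T i b) else None) \<rparr>"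

text \<open>A highest weight element of weight \<open>\<Lambda>\<^sub>a\<close> in a tensor product of minuscule crystals: the
  column \<open>a \<otimes> \<dots> \<otimes> 1\<close>, or the highest weight element of a spin crystal.\<close>

fun fundamental_element :: "cartan_type \<Rightarrow> nat \<Rightarrow> weight list" where
  "fundamental_element (TypeA n) a =
     map (\<lambda>k. letter_wt (TypeA n) (int k)) (rev [1..<Suc a])"
| "fundamental_element (TypeD n) a =
     (if a \<le> n - 2 then map (\<lambda>k. letter_wt (TypeD n) (int k)) (rev [1..<Suc a])
      else [fundamental_weight a])"

definition highest_element :: "cartan_type \<Rightarrow> weight \<Rightarrow> weight list" where
  "highest_element T \<mu> =
     concat (map (\<lambda>a. concat (replicate (nat (\<mu> a)) (fundamental_element T a)))
       (sorted_list_of_set (nodes T)))"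

text \<open>\<open>B(\<mu>)\<close>, realized inside a tensor product of minuscule crystals.\<close>

definition highest_weight_crystal :: "cartan_type \<Rightarrow> weight \<Rightarrow> weight list set" where
  "highest_weight_crystal T \<mu> =
     component (list_crystal (minuscule_crystal T)) (nodes T) (highest_element T \<mu>)"

text \<open>The set \<open>\<lambda>\<^sup>-\<close>. The copies of \<open>B(\<lambda>)\<close> in the classical crystal \<open>B\<^sup>1 \<otimes> B(\<mu>)\<close> are the components
  of its highest weight elements of weight \<open>\<lambda>\<close>.\<close>

definition weights_below :: "cartan_type \<Rightarrow> weight \<Rightarrow> weight set" where
  "weights_below T lam =
     {\<mu> \<in> dominant_weights T.
        highest_weight_elements T
          (tensor (letter_crystal T) (list_crystal (minuscule_crystal T)))
          (letters T \<times> highest_weight_crystal T \<mu>) lam \<noteq> {}}"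


section \<open>Rigged configurations\<close>

text \<open>\<open>L a i\<close> is \<open>L\<^sub>i\<^sup>(\<^sup>a\<^sup>)\<close>.\<close>

type_synonym multiplicity_array = "nat \<Rightarrow> nat \<Rightarrow> nat"

definition mult_array :: "kr_product \<Rightarrow> multiplicity_array" where
  "mult_array B a i = count_list B (a, i)"

text \<open>\<open>(\<nu>, J)\<^sup>(\<^sup>a\<^sup>)\<close> is the multiset of its strings \<open>(i, x)\<close>, where \<open>i\<close> is a part of \<open>\<nu>\<^sup>(\<^sup>a\<^sup>)\<close> and \<open>x\<close> its
  rigging. Partitions are multisets of parts.\<close>

type_synonym configuration = "nat \<Rightarrow> nat multiset"
type_synonym rigged_configuration = "nat \<Rightarrow> (nat \<times> int) multiset"

definition shape :: "rigged_configuration \<Rightarrow> configuration" where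
  "shape R a = image_mset fst (R a)"

text \<open>\<open>Sum_any\<close> is the sum of a finitely supported function. The vacancy number \<open>p\<^sub>i\<^sup>(\<^sup>a\<^sup>)\<close>:\<close>

definition vacancy :: "cartan_type \<Rightarrow> multiplicity_array \<Rightarrow> configuration \<Rightarrow> nat \<Rightarrow> nat \<Rightarrow> int" where
  "vacancy T L \<nu> a i =
     int (Sum_any (\<lambda>j. min i j * L a j))
     - (\<Sum>b\<in>nodes T. cartan T a b * int (\<Sum>j\<in>#\<nu> b. min i j))"

definition RC :: "cartan_type \<Rightarrow> multiplicity_array \<Rightarrow> weight \<Rightarrow> rigged_configuration set" where
  "RC T L lam = {R.
     (\<forall>a. a \<notin> nodes T \<longrightarrow> R a = {#})
     \<and> (\<forall>b\<in>nodes T. (\<Sum>a\<in>nodes T. int (\<Sum>i\<in>#shape R a. i) * simple_root T a b)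
          = int (Sum_any (\<lambda>i. i * L b i)) - lam b)
     \<and> (\<forall>a\<in>nodes T. \<forall>i\<ge>1. 0 \<le> vacancy T L (shape R) a i)
     \<and> (\<forall>a\<in>nodes T. \<forall>(i, x)\<in>#R a. 1 \<le> i \<and> 0 \<le> x \<and> x \<le> vacancy T L (shape R) a i)}"

definition empty_rc :: rigged_configuration where
  "empty_rc = (\<lambda>_. {#})"


section \<open>The maps on rigged configurations\<close>

definition singular_string ::
    "cartan_type \<Rightarrow> multiplicity_array \<Rightarrow> rigged_configuration \<Rightarrow> nat \<Rightarrow> nat \<Rightarrow> nat \<times> int" where
  "singular_string T L R a i = (i, vacancy T L (shape R) a i)"

definition singular ::
    "cartan_type \<Rightarrow> multiplicity_array \<Rightarrow> rigged_configuration \<Rightarrow> nat \<Rightarrow> nat \<Rightarrow> bool" where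
  "singular T L R a i \<longleftrightarrow> singular_string T L R a i \<in># R a"

text \<open>The least \<open>i \<ge> l\<close> satisfying \<open>Q\<close>, and \<open>\<infinity>\<close> if there is none (so in particular if
  \<open>l = \<infinity>\<close>, which makes the algorithm stop).\<close>

definition least_from :: "enat \<Rightarrow> (nat \<Rightarrow> bool) \<Rightarrow> enat" where
  "least_from l Q = Inf {enat i |i. l \<le> enat i \<and> Q i}"

primrec ell_chain ::
    "cartan_type \<Rightarrow> multiplicity_array \<Rightarrow> rigged_configuration \<Rightarrow> nat \<Rightarrow> enat" where
  "ell_chain T L R 0 = 1"
| "ell_chain T L R (Suc a) = least_from (ell_chain T L R a) (singular T L R (Suc a))"

text \<open>\<open>\<l>\<^sup>(\<^sup>a\<^sup>)\<close>. In type \<open>D\<^sub>n\<close> the searches at both spin nodes start from \<open>\<l>\<^sup>(\<^sup>n\<^sup>-\<^sup>2\<^sup>)\<close>.\<close>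

fun ell :: "cartan_type \<Rightarrow> multiplicity_array \<Rightarrow> rigged_configuration \<Rightarrow> nat \<Rightarrow> enat" where
  "ell (TypeA n) L R a = ell_chain (TypeA n) L R a"
| "ell (TypeD n) L R a =
    (if a \<le> n - 2 then ell_chain (TypeD n) L R a
     else least_from (ell_chain (TypeD n) L R (n - 2)) (singular (TypeD n) L R a))"

text \<open>\<open>ell_bar_chain n L R k\<close> is the barred length at node \<open>n - 1 - k\<close> in type \<open>D\<^sub>n\<close>; the maximum
  is \<open>\<infinity>\<close> as soon as one of the two spin searches fails.\<close>

primrec ell_bar_chain ::
    "nat \<Rightarrow> multiplicity_array \<Rightarrow> rigged_configuration \<Rightarrow> nat \<Rightarrow> enat" where
  "ell_bar_chain n L R 0 = max (ell (TypeD n) L R (n - 1)) (ell (TypeD n) L R n)"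
| "ell_bar_chain n L R (Suc k) = (let a = n - 1 - Suc k in
     least_from (ell_bar_chain n L R k)
       (\<lambda>i. singular (TypeD n) L R a i
          \<and> (enat i = ell (TypeD n) L R a
              \<longrightarrow> 2 \<le> count (R a) (singular_string (TypeD n) L R a i))))"

definition ell_bar :: "nat \<Rightarrow> multiplicity_array \<Rightarrow> rigged_configuration \<Rightarrow> nat \<Rightarrow> enat" where
  "ell_bar n L R a = ell_bar_chain n L R (n - 1 - a)"

definition finite_length :: "enat \<Rightarrow> nat multiset" where
  "finite_length l = (case l of enat i \<Rightarrow> {#i#} | \<infinity> \<Rightarrow> {#})"

text \<open>The lengths of the strings selected in \<open>(\<nu>, J)\<^sup>(\<^sup>a\<^sup>)\<close>.\<close>

fun selected ::
    "cartan_type \<Rightarrow> multiplicity_array \<Rightarrow> rigged_configuration \<Rightarrow> nat \<Rightarrow> nat multiset" where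
  "selected (TypeA n) L R a =
     (if a \<in> {1..n} then finite_length (ell (TypeA n) L R a) else {#})"
| "selected (TypeD n) L R a =
     (if a \<in> {1..n} then finite_length (ell (TypeD n) L R a) else {#})
     + (if a \<in> {1..n - 2} then finite_length (ell_bar n L R a) else {#})"

text \<open>Removal of one box from each part; parts of length one disappear.\<close>

definition shorten :: "nat multiset \<Rightarrow> nat multiset" where
  "shorten M = {#i - 1. i \<in># filter_mset (\<lambda>i. 1 < i) M#}"

text \<open>The map \<open>\<delta>\<close>; the arguments are the arrays \<open>L\<close> and \<open>lh(L)\<close>.\<close>

definition delta ::
    "cartan_type \<Rightarrow> multiplicity_array \<Rightarrow> multiplicity_array
      \<Rightarrow> rigged_configuration \<Rightarrow> rigged_configuration" where
  "delta T L L' R =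
    (let S = selected T L R;
         \<nu>' = (\<lambda>a. shape R a - S a + shorten (S a))
     in (\<lambda>a. R a - image_mset (singular_string T L R a) (S a)
           + {#(i, vacancy T L' \<nu>' a i). i \<in># shorten (S a)#}))"

text \<open>The map \<open>j\<close>.\<close>

definition rc_j :: "rigged_configuration \<Rightarrow> rigged_configuration" where
  "rc_j R = R"

text \<open>The map \<open>i\<close>. The added strings are singular for the array \<open>L' = lb(L)\<close> and the enlarged
  configuration.\<close>

definition rc_i ::
    "cartan_type \<Rightarrow> multiplicity_array \<Rightarrow> nat \<Rightarrow> rigged_configuration \<Rightarrow> rigged_configuration" where
  "rc_i T L' r R =
    (let \<nu>' = (\<lambda>a. if 1 \<le> a \<and> a < r then add_mset 1 (shape R a) else shape R a)
     in (\<lambda>a. if 1 \<le> a \<and> a < r then add_mset (1, vacancy T L' \<nu>' a 1) (R a) else R a))"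

end

theory Submission
  imports Defs
begin

text \<open>Removing the leftmost letter of a path corresponds to a family of selected lengths, indexed by
  the poset of arrows of the vector crystal. Call such a family together with the
  rigged configurations before and after it a step. If both configurations are valid, then the
  lengths are at the same time the smallest possible ones for the first configuration (they are
  selected by \<open>\<delta>\<close>) and the largest possible ones for the second: wherever another choice
  were possible, a vacancy number would become negative. Conversely, either greedy choice preserves
  validity, because a nonnegative function that is concave wherever it vanishes cannot leave
  zero. So \<open>\<delta>\<close> is a bijection from the valid configurations onto pairs of a smaller valid
  configuration and a letter that keeps the weight dominant, which is how a highest weight path is
  built from the path without its leftmost letter.

  The maps \<open>lb\<close> and \<open>ls\<close> are injective on paths, with image described by an inequality between
  adjacent entries; the maps \<open>i\<close> and \<open>j\<close> are injective on rigged configurations. The images agree,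
  since the inequality between two letters (or columns) translates into an inequality between
  the lengths selected in successive steps, and this inequality expresses exactly the validity for the
  unsplit product. The bijection is thus determined, and constructed, by recursion on the product.\<close>

section \<open>The index poset of the vector crystal\<close>

text \<open>The letters of the vector crystal are the order ideals of its poset of arrows, so a
  monotone family of lengths names a letter through the set of indices of finite length. Vacancy
  numbers and weights are sums over coloured indices, and the colours around a node interleave alike
  in types A and D; the single identity \<open>slot_sum\<close> therefore serves both. The second
  difference of p_i at a node is 2 m_i minus a nonnegative neighbour term, so at a zero without
  strings both neighbouring values vanish too. The weight is treated as a function of the
  configuration: all dominant weights are handled at once, and the weights below lambda enter only
  at the end. The main obstacle is \<open>ls\<close> for columns of height r >= 2. Between the
  removal of an entry and that of its right neighbour, r - 1 other entries are removed, so single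
  lengths can no longer be compared. What survives is a nested family of simultaneously singular
  strings, carried through a column in either direction.\<close>

text \<open>Indices number the arrows of the vector crystal along which a letter can be lowered: \<open>a \<le> n\<close> stands for
  \<open>\<l>\<^sup>(\<^sup>a\<^sup>)\<close>, and in type \<open>D\<close> the index \<open>2 n - 1 - a\<close> for the barred length at node \<open>a\<close>. Two virtual
  indices are added: \<open>0\<close>, of length \<open>1\<close>, and \<open>top_index\<close>, of length \<open>\<infinity>\<close>. The indices coloured by
  the node \<open>a\<close> are \<open>a\<close> and \<open>upper T a\<close>; those coloured by its neighbours lie directly below \<open>a\<close>
  (\<open>lower\<close>), between the two (\<open>mid1\<close>, \<open>mid2\<close>), or directly above \<open>upper T a\<close> (\<open>above\<close>).\<close>

fun top_index :: "cartan_type \<Rightarrow> nat" where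
  "top_index (TypeA n) = n + 1"
| "top_index (TypeD n) = 2 * n - 1"

fun lower :: "cartan_type \<Rightarrow> nat \<Rightarrow> nat" where
  "lower (TypeA n) a = a - 1"
| "lower (TypeD n) a = (if a = n then n - 2 else a - 1)"

fun mid1 :: "cartan_type \<Rightarrow> nat \<Rightarrow> nat" where
  "mid1 (TypeA n) a = a + 1"
| "mid1 (TypeD n) a = (if a = n - 1 then n + 1 else a + 1)"

fun mid2 :: "cartan_type \<Rightarrow> nat \<Rightarrow> nat" where
  "mid2 (TypeA n) a = n + 1"
| "mid2 (TypeD n) a = (if a \<le> n - 2 then 2 * n - 2 - a else 2 * n - 1)"

fun upper :: "cartan_type \<Rightarrow> nat \<Rightarrow> nat" where
  "upper (TypeA n) a = n + 1"
| "upper (TypeD n) a = (if a \<le> n - 2 then 2 * n - 1 - a else 2 * n - 1)"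

fun above :: "cartan_type \<Rightarrow> nat \<Rightarrow> nat" where
  "above (TypeA n) a = n + 1"
| "above (TypeD n) a = (if a \<le> n - 2 then 2 * n - a else 2 * n - 1)"

lemma finite_nodes [simp]: "finite (nodes T)"
  by (cases T) auto

lemma zero_notin_nodes [simp]: "0 \<notin> nodes T"
  by (cases T) auto

lemma one_in_nodes: "valid_type T \<Longrightarrow> 1 \<in> nodes T"
  by (cases T) auto

text \<open>The numbering is a linear extension of the poset: relations go from smaller to larger
  numbers, unless the larger end is \<open>top_index\<close>. Both selections, upward for
  \<open>delta\<close> and downward for its inverse, can thus be treated by recursion on the
  number.\<close>

lemma index_order:
  assumes "valid_type T" "a \<in> nodes T"
  shows "lower T a < a" "lower T a = 0 \<longleftrightarrow> a = 1" "lower T a \<noteq> 0 \<Longrightarrow> lower T a \<in> nodes T"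
    "a < mid1 T a" "a < mid2 T a" "a < upper T a"
    "mid1 T a \<le> top_index T" "mid2 T a \<le> top_index T" "upper T a \<le> top_index T" "above T a \<le> top_index T"
    "upper T a \<noteq> top_index T \<Longrightarrow> mid1 T a < upper T a"
    "upper T a \<noteq> top_index T \<Longrightarrow> mid2 T a < upper T a"
    "upper T a \<noteq> top_index T \<Longrightarrow> upper T a < above T a"
    "upper T a = top_index T \<Longrightarrow> mid2 T a = top_index T"
    "upper T a = top_index T \<Longrightarrow> above T a = top_index T"
    "upper T a \<noteq> top_index T \<Longrightarrow> upper T a \<notin> nodes T"
    "a < top_index T"
proof -
  show "lower T a < a" "lower T a = 0 \<longleftrightarrow> a = 1" "lower T a \<noteq> 0 \<Longrightarrow> lower T a \<in> nodes T"
    using assms by (cases T; force)+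
  show "a < mid1 T a" "a < mid2 T a" "a < upper T a" "a < top_index T"
    using assms by (cases T; force)+
  show "mid1 T a \<le> top_index T" "mid2 T a \<le> top_index T" "upper T a \<le> top_index T" "above T a \<le> top_index T"
    using assms by (cases T; force)+
  show "upper T a \<noteq> top_index T \<Longrightarrow> mid1 T a < upper T a"
    "upper T a \<noteq> top_index T \<Longrightarrow> mid2 T a < upper T a"
    "upper T a \<noteq> top_index T \<Longrightarrow> upper T a < above T a"
    "upper T a = top_index T \<Longrightarrow> mid2 T a = top_index T"
    "upper T a = top_index T \<Longrightarrow> above T a = top_index T"
    "upper T a \<noteq> top_index T \<Longrightarrow> upper T a \<notin> nodes T"
    using assms by (cases T; simp split: if_splits; linarith)+
qed

lemma index_cases:
  assumes "valid_type T" "v < top_index T"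
  obtains "v = 0" | "v \<in> nodes T" | a where "a \<in> nodes T" "v = upper T a"
proof (cases T)
  case (TypeA n)
  then show ?thesis using assms that by fastforce
next
  case (TypeD n)
  show ?thesis
  proof (cases "v \<le> n")
    case True
    then show ?thesis using TypeD that by (cases "v = 0") auto
  next
    case False
    then have "2 * n - 1 - v \<in> nodes T" "v = upper T (2 * n - 1 - v)"
      using assms TypeD by auto
    then show ?thesis using that by blast
  qed
qed

lemma upper_inj:
  assumes "valid_type T" "a \<in> nodes T" "b \<in> nodes T" "upper T a = upper T b" "upper T a \<noteq> top_index T"
  shows "a = b"
  using assms by (cases T) (auto split: if_splits)

section \<open>Sums against the Cartan matrix, written over the index poset\<close>

lemma sum_indicator:
  fixes f :: "nat \<Rightarrow> int"
  shows "(\<Sum>b\<in>{1..n}. (if b = c then f b else 0)) = (if 1 \<le> c \<and> c \<le> n then f c else 0)"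
  by (simp add: sum.delta)

lemma cartan_sum_A:
  fixes Y :: "nat \<Rightarrow> int"
  assumes "1 \<le> a" "a \<le> n"
  shows "(\<Sum>b\<in>{1..n}. cartan (TypeA n) a b * Y b)
    = 2 * Y a - (if a = 1 then 0 else Y (a - 1)) - (if a = n then 0 else Y (a + 1))"
proof -
  have "(\<Sum>b\<in>{1..n}. cartan (TypeA n) a b * Y b) =
     (\<Sum>b\<in>{1..n}. (if b = a then 2 * Y b else 0) - (if b = a - 1 then Y b else 0) - (if b = a + 1 then Y b else 0))"
    using assms by (intro sum.cong) (auto simp: cartan_def)
  then show ?thesis
    using assms by (simp add: sum_subtractf sum_indicator) auto
qed

lemma cartan_sum_D:
  fixes Y :: "nat \<Rightarrow> int"
  assumes "1 \<le> a" "a \<le> n" "4 \<le> n"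
  shows "(\<Sum>b\<in>{1..n}. cartan (TypeD n) a b * Y b)
    = 2 * Y a - (if a = n then Y (n - 2) else if a = 1 then 0 else Y (a - 1))
      - (if a \<ge> n - 1 then 0 else Y (a + 1)) - (if a = n - 2 then Y n else 0)"
proof -
  have "cartan (TypeD n) a b * Y b = (if b = a then 2 * Y b else 0)
        - (if b = (if a = n then n - 2 else a - 1) then Y b else 0)
        - (if b = (if a \<ge> n - 1 then 0 else a + 1) then Y b else 0)
        - (if b = (if a = n - 2 then n else 0) then Y b else 0)" if "b \<in> {1..n}" for b
  proof -
    \<comment> \<open>With n = m + 4 the truncated differences n - 1 and n - 2 become sums, which
      can be compared by simplification.\<close>
    obtain m where m: "n = m + 4"
      using assms(3) by (metis add.commute le_Suc_ex)
    have 1: "1 \<le> b" "b \<le> m + 4"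
      using that m by auto
    consider "a < m + 2" | "a = m + 2" | "a = m + 3" | "a = m + 4"
      using assms m by linarith
    then show ?thesis
      using assms(1) 1 by cases (auto simp: cartan_def m)
  qed
  then have "(\<Sum>b\<in>{1..n}. cartan (TypeD n) a b * Y b) =
     (\<Sum>b\<in>{1..n}. (if b = a then 2 * Y b else 0)
        - (if b = (if a = n then n - 2 else a - 1) then Y b else 0)
        - (if b = (if a \<ge> n - 1 then 0 else a + 1) then Y b else 0)
        - (if b = (if a = n - 2 then n else 0) then Y b else 0))"
    by (intro sum.cong) auto
  also have "\<dots> = 2 * Y a - (if a = n then Y (n - 2) else if a = 1 then 0 else Y (a - 1))
      - (if a \<ge> n - 1 then 0 else Y (a + 1)) - (if a = n - 2 then Y n else 0)"
  proof -
    obtain m where m: "n = m + 4"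
      using assms(3) by (metis add.commute le_Suc_ex)
    consider "a = 1" | "1 < a" "a < m + 2" | "a = m + 2" | "a = m + 3" | "a = m + 4"
      using assms m by linarith
    then show ?thesis
      unfolding sum_subtractf sum_indicator m by cases auto
  qed
  finally show ?thesis .
qed

text \<open>The indices coloured by a neighbour of a are the four slots \<open>lower\<close>,
  \<open>mid1\<close>, \<open>mid2\<close> and \<open>above\<close>, as far as they are not virtual.
  The value at \<open>top_index\<close> is 0; the index 0, directly below node 1, has no colour, and
  the last summand corrects for it.\<close>

lemma slot_sum:
  fixes X :: "nat \<Rightarrow> int"
  assumes T: "valid_type T" and a: "a \<in> nodes T" and X: "X (top_index T) = 0"
  shows "(\<Sum>b\<in>nodes T. cartan T a b * (X b + X (upper T b)))
    = 2 * (X a + X (upper T a)) - (X (lower T a) + X (mid1 T a) + X (mid2 T a) + X (above T a))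
      + (if a = 1 then X 0 else 0)"
proof (cases T)
  case (TypeA n)
  then show ?thesis using T a X cartan_sum_A[of a n "\<lambda>b. X b + X (upper T b)"] by auto
next
  case (TypeD n)
  obtain m where m: "n = m + 4"
    using T TypeD by (metis add.commute le_Suc_ex valid_type.simps(2))
  define Y where "Y b = X b + X (upper T b)" for b
  have sum: "(\<Sum>b\<in>nodes T. cartan T a b * Y b)
    = 2 * Y a - (if a = n then Y (n - 2) else if a = 1 then 0 else Y (a - 1))
      - (if a \<ge> n - 1 then 0 else Y (a + 1)) - (if a = n - 2 then Y n else 0)"
    using cartan_sum_D[of a n Y] T a TypeD by simp
  have X0: "X (7 + 2 * m) = 0"
    using X TypeD m by simp
  consider "a = 1" | "1 < a" "a < m + 2" | "a = m + 2" | "a = m + 3" | "a = m + 4"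
    using a TypeD m by fastforce
  then have "(\<Sum>b\<in>nodes T. cartan T a b * Y b) =
    2 * (X a + X (upper T a)) - (X (lower T a) + X (mid1 T a) + X (mid2 T a) + X (above T a))
      + (if a = 1 then X 0 else 0)"
  proof cases
    case 1
    then show ?thesis unfolding sum by (simp add: Y_def TypeD m X0)
  next
    case 2
    then have "2 * n - 1 - (a - 1) = 2 * n - a" "2 * n - 1 - (a + 1) = 2 * n - 2 - a"
      using m by auto
    then show ?thesis
      unfolding sum using 2 by (simp add: Y_def TypeD m X0)
  next
    case 3
    then show ?thesis unfolding sum by (simp add: Y_def TypeD m X0) (simp add: add.commute)
  next
    case 4
    then show ?thesis unfolding sum by (simp add: Y_def TypeD m X0) (simp add: add.commute)
  next
    case 5
    then show ?thesis unfolding sum by (simp add: Y_def TypeD m X0) (simp add: add.commute)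
  qed
  then show ?thesis
    unfolding Y_def .
qed

lemma adjacent_sym: "adjacent T a b = adjacent T b a"
proof (cases T)
  case (TypeA n)
  then show ?thesis by (simp add: disj_commute)
next
  case (TypeD n)
  show ?thesis unfolding TypeD adjacent.simps by blast
qed

lemma cartan_sym: "cartan T a b = cartan T b a"
  by (auto simp: cartan_def adjacent_sym[of T a b])

section \<open>Vacancy numbers\<close>

definition part_sum :: "nat multiset \<Rightarrow> nat \<Rightarrow> int" where
  "part_sum M i = int (\<Sum>j\<in>#M. min i j)"

definition factor_sum :: "kr_product \<Rightarrow> nat \<Rightarrow> nat \<Rightarrow> int" where
  "factor_sum B a i = (\<Sum>(r, s)\<leftarrow>B. if r = a then int (min i s) else 0)"

definition factor_size :: "kr_product \<Rightarrow> nat \<Rightarrow> int" where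
  "factor_size B a = (\<Sum>(r, s)\<leftarrow>B. if r = a then int s else 0)"

text \<open>Sums over a multiplicity array become sums over the list of factors, where a factor can
  be split off or replaced at the head.\<close>

lemma Sum_any_mult_array:
  "int (Sum_any (\<lambda>j. f j * mult_array B a j)) = (\<Sum>(r, s)\<leftarrow>B. if r = a then int (f s) else 0)"
proof (induction B)
  case Nil
  show ?case by (simp add: mult_array_def)
next
  case (Cons q B)
  obtain r s where q: "q = (r, s)" by force
  have fin: "finite {j. f j * mult_array B a j \<noteq> 0}" for B
  proof (rule finite_subset)
    show "{j. f j * mult_array B a j \<noteq> 0} \<subseteq> snd ` set B"
    proof
      fix j assume "j \<in> {j. f j * mult_array B a j \<noteq> 0}"
      then have "count_list B (a, j) \<noteq> 0"
        by (simp add: mult_array_def)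
      then have "(a, j) \<in> set B"
        by (simp add: count_list_0_iff)
      then show "j \<in> snd ` set B"
        by force
    qed
  qed simp
  define g where "g j = (if j = s then (if r = a then f s else 0) else 0)" for j
  have "finite {j. g j \<noteq> 0}"
    by (rule finite_subset[of _ "{s}"]) (auto simp: g_def)
  then have "Sum_any (\<lambda>j. g j + f j * mult_array B a j) = Sum_any g + Sum_any (\<lambda>j. f j * mult_array B a j)"
    using Sum_any.distrib[OF _ fin] by blast
  moreover have "(\<lambda>j. f j * mult_array (q # B) a j) = (\<lambda>j. g j + f j * mult_array B a j)"
    by (auto simp: mult_array_def q g_def)
  moreover have "Sum_any g = (if r = a then f s else 0)"
    unfolding g_def by simp
  ultimately have "Sum_any (\<lambda>j. f j * mult_array (q # B) a j)
      = (if r = a then f s else 0) + Sum_any (\<lambda>j. f j * mult_array B a j)"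
    by (simp only:)
  then show ?case
    using Cons by (simp add: q)
qed

lemma vacancy_eq:
  "vacancy T (mult_array B) \<nu> a i =
    factor_sum B a i - (\<Sum>b\<in>nodes T. cartan T a b * part_sum (\<nu> b) i)"
  using Sum_any_mult_array[of "min i" B a]
  by (simp add: vacancy_def factor_sum_def part_sum_def)

abbreviation vac :: "cartan_type \<Rightarrow> kr_product \<Rightarrow> rigged_configuration \<Rightarrow> nat \<Rightarrow> nat \<Rightarrow> int" where
  "vac T B R \<equiv> vacancy T (mult_array B) (shape R)"

lemma part_sum_0 [simp]: "part_sum M 0 = 0"
  by (simp add: part_sum_def)

lemma part_sum_union [simp]: "part_sum (M + N) i = part_sum M i + part_sum N i"
  by (simp add: part_sum_def)

lemma part_sum_empty [simp]: "part_sum {#} i = 0"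
  by (simp add: part_sum_def)

lemma part_sum_add_mset [simp]: "part_sum (add_mset j M) i = int (min i j) + part_sum M i"
  by (simp add: part_sum_def)

lemma factor_sum_0 [simp]: "factor_sum B a 0 = 0"
  by (induction B) (auto simp: factor_sum_def)

lemma factor_sum_Nil [simp]: "factor_sum [] a i = 0"
  by (simp add: factor_sum_def)

lemma factor_sum_Cons [simp]:
  "factor_sum ((r, s) # B) a i = (if r = a then int (min i s) else 0) + factor_sum B a i"
  by (simp add: factor_sum_def)

lemma factor_size_Cons [simp]:
  "factor_size ((r, s) # B) a = (if r = a then int s else 0) + factor_size B a"
  by (simp add: factor_size_def)

lemma factor_size_Nil [simp]: "factor_size [] a = 0"
  by (simp add: factor_size_def)

lemma vacancy_0 [simp]: "vacancy T (mult_array B) \<nu> a 0 = 0"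
  by (simp add: vacancy_eq)

text \<open>As a function of i, min i j is linear except for a kink at i = j, where the slope falls
  from 1 to 0. Hence the second difference counts the parts equal to i, and likewise the factors of
  width i.\<close>

lemma part_sum_second_difference:
  "1 \<le> i \<Longrightarrow> part_sum M (i + 1) + part_sum M (i - 1) - 2 * part_sum M i = - int (count M i)"
  by (induction M) (auto simp: min_def)

lemma factor_sum_second_difference:
  assumes "1 \<le> i"
  shows "factor_sum B a (i + 1) + factor_sum B a (i - 1) - 2 * factor_sum B a i
    = - int (count_list B (a, i))"
proof (induction B)
  case (Cons q B)
  obtain r s where q: "q = (r, s)" by force
  have "int (min (i + 1) s) + int (min (i - 1) s) - 2 * int (min i s) = (if s = i then - 1 else 0)"
    using assms by auto
  then show ?case
    using Cons by (auto simp: q)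
qed simp

lemma vacancy_second_difference:
  assumes "1 \<le> i"
  shows "vacancy T (mult_array B) \<nu> a (i + 1) + vacancy T (mult_array B) \<nu> a (i - 1)
      - 2 * vacancy T (mult_array B) \<nu> a i
    = (\<Sum>b\<in>nodes T. cartan T a b * int (count (\<nu> b) i)) - int (count_list B (a, i))"
proof -
  have "vacancy T (mult_array B) \<nu> a (i + 1) + vacancy T (mult_array B) \<nu> a (i - 1)
      - 2 * vacancy T (mult_array B) \<nu> a i =
    (factor_sum B a (i + 1) + factor_sum B a (i - 1) - 2 * factor_sum B a i)
     - (\<Sum>b\<in>nodes T. cartan T a b * (part_sum (\<nu> b) (i + 1) + part_sum (\<nu> b) (i - 1) - 2 * part_sum (\<nu> b) i))"
    unfolding vacancy_eq by (simp add: algebra_simps sum.distrib sum_subtractf sum_distrib_left)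
  then show ?thesis
    unfolding part_sum_second_difference[OF assms] factor_sum_second_difference[OF assms]
    by (simp add: sum_negf)
qed

lemma part_sum_large: "\<forall>j\<in>#M. j \<le> i \<Longrightarrow> part_sum M i = int (\<Sum>\<^sub># M)"
  by (induction M) auto

lemma factor_sum_large: "\<forall>(r, s)\<in>set B. s \<le> i \<Longrightarrow> factor_sum B a i = factor_size B a"
  by (induction B) (auto simp: factor_sum_def factor_size_def)

text \<open>The weight equation in \<open>RC\<close>, solved for the weight. It is also the value at
  which the vacancy numbers become stationary, so identities between vacancy numbers turn into
  identities between weights as i grows.\<close>

definition rc_weight :: "cartan_type \<Rightarrow> kr_product \<Rightarrow> rigged_configuration \<Rightarrow> weight" where
  "rc_weight T B R = (\<lambda>a. if a \<in> nodes T
     then factor_size B a - (\<Sum>b\<in>nodes T. cartan T a b * int (\<Sum>\<^sub># (shape R b))) else 0)"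

lemma vacancy_eventually:
  assumes "a \<in> nodes T"
  shows "\<exists>N. \<forall>i\<ge>N. vac T B R a i = rc_weight T B R a"
proof -
  have "finite (snd ` set B \<union> (\<Union>b\<in>nodes T. set_mset (shape R b)))"
    by simp
  then obtain N where N: "\<forall>j\<in>snd ` set B \<union> (\<Union>b\<in>nodes T. set_mset (shape R b)). j \<le> N"
    using finite_nat_set_iff_bounded_le by metis
  show ?thesis
  proof (intro exI[of _ N] allI impI)
    fix i assume i: "N \<le> i"
    then have "part_sum (shape R b) i = int (\<Sum>\<^sub># (shape R b))" if "b \<in> nodes T" for b
      using N that by (intro part_sum_large) force
    moreover have "factor_sum B a i = factor_size B a"
      using N i by (intro factor_sum_large) force
    ultimately show "vac T B R a i = rc_weight T B R a"
      using assms by (simp add: vacancy_eq rc_weight_def)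
  qed
qed

text \<open>The vacancy function is a separate argument because the same strings are tested against
  the vacancy numbers of several products, for instance before and after \<open>ls\<close>. The
  clause for i = 0 agrees with \<open>RC\<close> since p_0 = 0.\<close>

definition valid_strings :: "(nat \<times> int) multiset \<Rightarrow> (nat \<Rightarrow> int) \<Rightarrow> bool" where
  "valid_strings M p \<longleftrightarrow> (\<forall>i. 0 \<le> p i) \<and> (\<forall>(i, x)\<in>#M. 1 \<le> i \<and> 0 \<le> x \<and> x \<le> p i)"

definition valid_rc :: "cartan_type \<Rightarrow> kr_product \<Rightarrow> rigged_configuration \<Rightarrow> bool" where
  "valid_rc T B R \<longleftrightarrow> (\<forall>a. a \<notin> nodes T \<longrightarrow> R a = {#})
     \<and> (\<forall>a\<in>nodes T. valid_strings (R a) (vac T B R a))"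

lemma vacancy_nonneg_cong: "(\<forall>i\<ge>1. 0 \<le> vacancy T (mult_array B) \<nu> a i) \<longleftrightarrow> (\<forall>i. 0 \<le> vacancy T (mult_array B) \<nu> a i)"
  by (metis One_nat_def Suc_leI not_gr_zero order_refl vacancy_0)

text \<open>Separates the conditions that do not involve the weight from the weight itself.
  Bijections can then be built on all valid configurations of a product and cut down to a single
  weight afterwards.\<close>

lemma RC_iff:
  assumes "lam \<in> dominant_weights T"
  shows "R \<in> RC T (mult_array B) lam \<longleftrightarrow> valid_rc T B R \<and> rc_weight T B R = lam"
proof -
  have "(\<forall>b\<in>nodes T. (\<Sum>a\<in>nodes T. int (\<Sum>i\<in>#shape R a. i) * simple_root T a b)
          = int (Sum_any (\<lambda>i. i * mult_array B b i)) - lam b) \<longleftrightarrow> rc_weight T B R = lam"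
  proof -
    have "(\<Sum>a\<in>nodes T. int (\<Sum>i\<in>#shape R a. i) * simple_root T a b)
        = (\<Sum>a\<in>nodes T. cartan T b a * int (\<Sum>\<^sub># (shape R a)))" if "b \<in> nodes T" for b
      using that by (intro sum.cong) (auto simp: simple_root_def cartan_sym[of T b])
    moreover have "int (Sum_any (\<lambda>i. i * mult_array B b i)) = factor_size B b" for b
      using Sum_any_mult_array[of "\<lambda>i. i" B b] by (simp add: factor_size_def)
    moreover have "a \<notin> nodes T \<Longrightarrow> lam a = 0" for a
      using assms by (simp add: dominant_weights_def)
    ultimately show ?thesis
      by (auto simp: rc_weight_def fun_eq_iff)
  qed
  then show ?thesis
    unfolding RC_def valid_rc_def valid_strings_def vacancy_nonneg_cong by auto
qed

text \<open>The weight is the stationary value of nonnegative vacancy numbers.\<close>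

lemma rc_weight_dominant:
  assumes "valid_rc T B R"
  shows "rc_weight T B R \<in> dominant_weights T"
proof -
  have "0 \<le> rc_weight T B R a" if a: "a \<in> nodes T" for a
  proof -
    obtain N where "vac T B R a N = rc_weight T B R a"
      using vacancy_eventually[OF a] by blast
    then show ?thesis
      using assms a unfolding valid_rc_def valid_strings_def by metis
  qed
  then show ?thesis
    by (simp add: dominant_weights_def rc_weight_def)
qed

section \<open>Runs of zero vacancy numbers\<close>

text \<open>A nonnegative function that is concave at its zeros stays zero along a run of them; the
  run must stop where the second difference is negative.\<close>

lemma zero_run_down:
  fixes p m q :: "nat \<Rightarrow> int"
  assumes nonneg: "\<And>i. 0 \<le> p i"
    and sd: "\<And>i. 1 \<le> i \<Longrightarrow> p (i + 1) + p (i - 1) - 2 * p i = 2 * m i - q i"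
    and "\<And>i. 0 \<le> q i" and "1 \<le> u" "u \<le> i"
    and m: "\<And>j. u \<le> j \<Longrightarrow> j \<le> i \<Longrightarrow> p j = 0 \<Longrightarrow> m j = 0" and q: "0 < q u"
  shows "0 < p i"
proof (rule ccontr)
  assume "\<not> 0 < p i"
  then have 0: "p i = 0"
    using nonneg[of i] by simp
  have "p j = 0" if "u \<le> j" "j \<le> i" for j
    using that(2,1)
  proof (induction rule: inc_induct)
    case (step j)
    then have "p (Suc j + 1) + p j = - q (Suc j)"
      using sd[of "Suc j"] m[of "Suc j"] by simp
    then show ?case
      using nonneg[of "Suc j + 1"] nonneg[of j] assms(3)[of "Suc j"] by linarith
  qed (rule 0)
  then have "p (u + 1) + p (u - 1) = - q u"
    using sd[of u] m[of u] assms by simp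
  then show False
    using nonneg[of "u + 1"] nonneg[of "u - 1"] q by linarith
qed

lemma zero_run_propagates_up:
  fixes p m q :: "nat \<Rightarrow> int"
  assumes nonneg: "\<And>i. 0 \<le> p i"
    and sd: "\<And>i. 1 \<le> i \<Longrightarrow> p (i + 1) + p (i - 1) - 2 * p i = 2 * m i - q i"
    and "\<And>i. 0 \<le> q i" and "1 \<le> i" "p i = 0" "i \<le> k"
    and m: "\<And>j. i \<le> j \<Longrightarrow> j < k \<Longrightarrow> p j = 0 \<Longrightarrow> m j = 0"
  shows "p k = 0"
  using \<open>i \<le> k\<close> m
proof (induction rule: dec_induct)
  case (step k)
  then have "p k = 0"
    by simp
  then have "p (k + 1) + p (k - 1) = - q k"
    using sd[of k] step assms by simp
  then show ?case
    using nonneg[of "k + 1"] nonneg[of "k - 1"] assms(3)[of k] by simp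
qed (rule \<open>p i = 0\<close>)

lemma zero_run_up:
  fixes p m q :: "nat \<Rightarrow> int"
  assumes nonneg: "\<And>i. 0 \<le> p i"
    and sd: "\<And>i. 1 \<le> i \<Longrightarrow> p (i + 1) + p (i - 1) - 2 * p i = 2 * m i - q i"
    and "\<And>i. 0 \<le> q i" and "1 \<le> i" "i \<le> u"
    and m: "\<And>j. i \<le> j \<Longrightarrow> j \<le> u \<Longrightarrow> p j = 0 \<Longrightarrow> m j = 0" and q: "0 < q u"
  shows "0 < p i"
proof (rule ccontr)
  assume "\<not> 0 < p i"
  then have "p i = 0"
    using nonneg[of i] by simp
  then have "p u = 0"
    using zero_run_propagates_up[OF nonneg sd assms(3), of i u] assms(4-6) by simp
  then have "p (u + 1) + p (u - 1) = - q u"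
    using sd[of u] m[of u] assms by simp
  then show False
    using nonneg[of "u + 1"] nonneg[of "u - 1"] q by linarith
qed

text \<open>On an unbounded range there may be no kink that ends the run; a later positive value
  ends it instead.\<close>

lemma zero_run_up_infinite:
  fixes p m q :: "nat \<Rightarrow> int"
  assumes nonneg: "\<And>i. 0 \<le> p i"
    and sd: "\<And>i. 1 \<le> i \<Longrightarrow> p (i + 1) + p (i - 1) - 2 * p i = 2 * m i - q i"
    and "\<And>i. 0 \<le> q i" and "1 \<le> i"
    and m: "\<And>j. i \<le> j \<Longrightarrow> p j = 0 \<Longrightarrow> m j = 0" and "i \<le> k" "0 < p k"
  shows "0 < p i"
  using zero_run_propagates_up[OF nonneg sd assms(3), of i k] nonneg[of i] assms(4-) by force

text \<open>In the following two lemmas one singular string of length \<open>v\<close> is disregarded.\<close>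

lemma zero_run_down_except:
  fixes p m q :: "nat \<Rightarrow> int"
  assumes nonneg: "\<And>i. 0 \<le> p i"
    and sd: "\<And>i. 1 \<le> i \<Longrightarrow> p (i + 1) + p (i - 1) - 2 * p i = 2 * m i - q i"
    and "\<And>i. 0 \<le> q i" and "1 \<le> u" "u \<le> i" "v \<le> u"
    and m: "\<And>j. u \<le> j \<Longrightarrow> j \<le> i \<Longrightarrow> p j = 0 \<Longrightarrow> m j = 0 \<or> j = v \<and> m j = 1" and q: "0 < q u"
    and v: "u = v \<Longrightarrow> 2 \<le> q v" "u = v \<Longrightarrow> q v = 2 \<Longrightarrow> 0 < p (v - 1)"
  shows "0 < p i"
proof (cases "u = v \<and> p v = 0")
  case True
  \<comment> \<open>Here the disregarded string lies at the end of the run, so the neighbours of v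
    sum to at most 2 - q v. As q v >= 2, this leaves only q v = 2 with both neighbours zero, which
    the last assumption excludes.\<close>
  then have "p (v + 1) + p (v - 1) = 2 * m v - q v" "m v = 0 \<or> m v = 1"
    using sd[of v] m[of v] assms by auto
  then show ?thesis
    using nonneg[of "v + 1"] nonneg[of "v - 1"] v True by auto
next
  case False
  then show ?thesis
    using assms by (intro zero_run_down[of p m q u i]) (auto dest: m)
qed

lemma zero_run_up_except:
  fixes p m q :: "nat \<Rightarrow> int"
  assumes nonneg: "\<And>i. 0 \<le> p i"
    and sd: "\<And>i. 1 \<le> i \<Longrightarrow> p (i + 1) + p (i - 1) - 2 * p i = 2 * m i - q i"
    and "\<And>i. 0 \<le> q i" and "1 \<le> i" "i \<le> u" "u \<le> v"
    and m: "\<And>j. i \<le> j \<Longrightarrow> j \<le> u \<Longrightarrow> p j = 0 \<Longrightarrow> m j = 0 \<or> j = v \<and> m j = 1" and q: "0 < q u"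
    and v: "u = v \<Longrightarrow> 2 \<le> q v" "u = v \<Longrightarrow> q v = 2 \<Longrightarrow> 0 < p (v + 1)"
  shows "0 < p i"
proof (cases "u = v \<and> p v = 0")
  case True
  then have "p (v + 1) + p (v - 1) = 2 * m v - q v" "m v = 0 \<or> m v = 1"
    using sd[of v] m[of v] assms by auto
  then show ?thesis
    using nonneg[of "v + 1"] nonneg[of "v - 1"] v True by auto
next
  case False
  then show ?thesis
    using assms by (intro zero_run_up[of p m q i u]) (auto dest: m)
qed

section \<open>Steps between rigged configurations\<close>

lemma finite_length_enat [simp]: "finite_length (enat i) = {#i#}"
  by (simp add: finite_length_def)

lemma finite_length_infinity [simp]: "finite_length \<infinity> = {#}"
  by (simp add: finite_length_def)

lemma in_finite_length [simp]: "i \<in># finite_length l \<longleftrightarrow> l = enat i"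
  by (cases l) auto

lemma least_from_eqI:
  assumes "u \<le> l" "\<And>i. l = enat i \<Longrightarrow> Q i" "\<And>i. Q i \<Longrightarrow> u \<le> enat i \<Longrightarrow> l \<le> enat i"
  shows "least_from u Q = l"
  unfolding least_from_def
proof (rule antisym)
  show "Inf {enat i |i. u \<le> enat i \<and> Q i} \<le> l"
    using assms(1,2) by (cases l) (auto intro!: Inf_lower)
  show "l \<le> Inf {enat i |i. u \<le> enat i \<and> Q i}"
    using assms(3) by (auto intro: Inf_greatest)
qed

lemma least_from_ge: "u \<le> least_from u Q"
  unfolding least_from_def by (auto intro: Inf_greatest)

lemma least_from_le: "Q i \<Longrightarrow> u \<le> enat i \<Longrightarrow> least_from u Q \<le> enat i"
  unfolding least_from_def by (auto intro!: Inf_lower)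

lemma least_from_sat:
  assumes "least_from u Q = enat i"
  shows "Q i"
proof -
  let ?S = "{enat i |i. u \<le> enat i \<and> Q i}"
  have "?S \<noteq> {}"
    using assms unfolding least_from_def by (metis Inf_empty enat.distinct(1) top_enat_def)
  then have "Inf ?S \<in> ?S"
    by (metis (no_types, lifting) Inf_enat_def LeastI all_not_in_conv)
  then show ?thesis
    using assms unfolding least_from_def by auto
qed

lemma least_from_infinity [simp]: "least_from \<infinity> Q = \<infinity>"
  using least_from_ge[of \<infinity> Q] by simp

text \<open>Order preserving maps from the index poset to lengths. The relations are stated node by
  node, as a node meets its slots, because that is how vacancy numbers compare them.\<close>

definition admissible :: "cartan_type \<Rightarrow> (nat \<Rightarrow> enat) \<Rightarrow> bool" where
  "admissible T l \<longleftrightarrow> l 0 = 1 \<and> l (top_index T) = \<infinity>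
    \<and> (\<forall>a\<in>nodes T. l (lower T a) \<le> l a \<and> l a \<le> l (mid1 T a) \<and> l a \<le> l (mid2 T a)
        \<and> l (mid1 T a) \<le> l (upper T a) \<and> l (mid2 T a) \<le> l (upper T a)
        \<and> l (upper T a) \<le> l (above T a))"

lemma admissibleD:
  assumes "admissible T l" "a \<in> nodes T"
  shows "l (lower T a) \<le> l a" "l a \<le> l (mid1 T a)" "l a \<le> l (mid2 T a)"
    "l (mid1 T a) \<le> l (upper T a)" "l (mid2 T a) \<le> l (upper T a)" "l (upper T a) \<le> l (above T a)"
    "l a \<le> l (upper T a)"
  using assms order_trans unfolding admissible_def by blast+

lemma admissible_ge_1:
  assumes "valid_type T" "admissible T l" "a \<in> nodes T"
  shows "1 \<le> l a"
  using assms(3)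
proof (induction a rule: less_induct)
  case (less a)
  have "1 \<le> l (lower T a)"
  proof (cases "lower T a = 0")
    case True
    then show ?thesis using assms by (simp add: admissible_def)
  next
    case False
    then show ?thesis using less index_order(1,3)[OF assms(1) less.prems] by blast
  qed
  then show ?case
    using admissibleD(1)[OF assms(2) less.prems] by (rule order_trans)
qed

lemma admissible_lower_ge_1:
  assumes "valid_type T" "admissible T l" "a \<in> nodes T"
  shows "1 \<le> l (lower T a)"
proof (cases "lower T a = 0")
  case True
  then show ?thesis using assms by (simp add: admissible_def)
next
  case False
  then show ?thesis using admissible_ge_1[OF assms(1,2)] index_order(3)[OF assms(1,3)] by blast
qed

text \<open>In type A and at the spin nodes \<open>upper T a\<close> is \<open>top_index\<close>, of
  length \<infinity>, and contributes nothing; this lets both types share one formula.\<close>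

definition sel :: "cartan_type \<Rightarrow> (nat \<Rightarrow> enat) \<Rightarrow> nat \<Rightarrow> nat multiset" where
  "sel T l a = (if a \<in> nodes T then finite_length (l a) + finite_length (l (upper T a)) else {#})"

lemma sel_ge_1:
  assumes "valid_type T" "admissible T l" "i \<in># sel T l a"
  shows "1 \<le> i"
proof -
  have a: "a \<in> nodes T" and "l a = enat i \<or> l (upper T a) = enat i"
    using assms(3) by (auto simp: sel_def split: if_splits)
  then have "1 \<le> enat i"
    using admissible_ge_1[OF assms(1,2) a] admissibleD(7)[OF assms(2) a] by (metis order_trans)
  then show ?thesis by (simp add: one_enat_def)
qed

text \<open>Shortening a string of length l by one box lowers min i l by one exactly when l <= i.
  For the virtual index 0, of length 1, the same indicator equals min i 1, the contribution of a
  factor B^{1,1}.\<close>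

definition reached :: "enat \<Rightarrow> nat \<Rightarrow> int" where
  "reached l i = (if l \<le> enat i then 1 else 0)"

definition vacancy_change :: "cartan_type \<Rightarrow> (nat \<Rightarrow> enat) \<Rightarrow> nat \<Rightarrow> nat \<Rightarrow> int" where
  "vacancy_change T l a i = 2 * (reached (l a) i + reached (l (upper T a)) i)
     - (reached (l (lower T a)) i + reached (l (mid1 T a)) i + reached (l (mid2 T a)) i
        + reached (l (above T a)) i)"

text \<open>As i passes the slots around node a, the change runs through the values 0, -1, 1, 0, -1,
  1, 0, where some of the ranges may be empty. It is negative on the ranges passed over by the two
  searches at node a, and positive on those passed over by the inverse searches.\<close>

lemma vacancy_change_cases:
  assumes "admissible T l" "a \<in> nodes T"
  shows "enat i < l (lower T a) \<Longrightarrow> vacancy_change T l a i = 0"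
    "l (lower T a) \<le> enat i \<Longrightarrow> enat i < l a \<Longrightarrow> vacancy_change T l a i = - 1"
    "l a \<le> enat i \<Longrightarrow> enat i < l (mid1 T a) \<Longrightarrow> enat i < l (mid2 T a) \<Longrightarrow> vacancy_change T l a i = 1"
    "l (mid1 T a) \<le> enat i \<Longrightarrow> enat i < l (mid2 T a) \<Longrightarrow> vacancy_change T l a i = 0"
    "l (mid2 T a) \<le> enat i \<Longrightarrow> enat i < l (mid1 T a) \<Longrightarrow> vacancy_change T l a i = 0"
    "l (mid1 T a) \<le> enat i \<Longrightarrow> l (mid2 T a) \<le> enat i \<Longrightarrow> enat i < l (upper T a) \<Longrightarrow> vacancy_change T l a i = - 1"
    "l (upper T a) \<le> enat i \<Longrightarrow> enat i < l (above T a) \<Longrightarrow> vacancy_change T l a i = 1"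
    "l (above T a) \<le> enat i \<Longrightarrow> vacancy_change T l a i = 0"
  using admissibleD[OF assms] unfolding vacancy_change_def reached_def
  by (smt (verit) leD order_trans linorder_not_le le_less_trans less_le_trans)+

definition step :: "cartan_type \<Rightarrow> (nat \<Rightarrow> enat) \<Rightarrow> (nat \<Rightarrow> nat \<Rightarrow> int) \<Rightarrow> rigged_configuration
    \<Rightarrow> (nat \<Rightarrow> nat \<Rightarrow> int) \<Rightarrow> rigged_configuration \<Rightarrow> bool" where
  "step T l p R p' R' \<longleftrightarrow> admissible T l
    \<and> (\<forall>a. \<exists>K. R a = K + image_mset (\<lambda>i. (i, p a i)) (sel T l a)
          \<and> R' a = K + image_mset (\<lambda>i. (i, p' a i)) (shorten (sel T l a)))"

text \<open>A step between valid configurations. Its validity on both sides already forces the selected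
  lengths to be the ones chosen by the algorithm for \<open>\<delta>\<close>, and by that for its inverse.\<close>

definition valid_step :: "cartan_type \<Rightarrow> (nat \<Rightarrow> enat) \<Rightarrow> (nat \<Rightarrow> nat \<Rightarrow> int) \<Rightarrow> rigged_configuration
    \<Rightarrow> (nat \<Rightarrow> nat \<Rightarrow> int) \<Rightarrow> rigged_configuration \<Rightarrow> bool" where
  "valid_step T l p R p' R' \<longleftrightarrow> valid_type T \<and> step T l p R p' R'
    \<and> (\<forall>a\<in>nodes T. \<forall>i. p' a i = p a i + vacancy_change T l a i)
    \<and> (\<forall>a\<in>nodes T. valid_strings (R a) (p a) \<and> valid_strings (R' a) (p' a))"

lemma shorten_union [simp]: "shorten (M + N) = shorten M + shorten N"
  by (simp add: shorten_def)

lemma shorten_empty [simp]: "shorten {#} = {#}"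
  by (simp add: shorten_def)

lemma in_shorten: "i \<in># shorten M \<longleftrightarrow> 1 \<le> i \<and> i + 1 \<in># M"
  by (auto simp: shorten_def image_iff Bex_def)

lemma count_shorten: "1 \<le> i \<Longrightarrow> count (shorten M) i = count M (i + 1)"
proof (induction M)
  case (add x M)
  then show ?case
    by (cases "x = Suc i") (auto simp: shorten_def)
qed simp

lemma count_image_graph: "count (image_mset (\<lambda>i. (i, p i)) M) (i, x) = (if x = p i then count M i else 0)"
  by (induction M) auto

lemma valid_step_kept:
  assumes "valid_step T l p R p' R'" "a \<in> nodes T"
  obtains K where "R a = K + image_mset (\<lambda>i. (i, p a i)) (sel T l a)"
    "R' a = K + image_mset (\<lambda>i. (i, p' a i)) (shorten (sel T l a))"
    "\<And>i x. (i, x) \<in># K \<Longrightarrow> 1 \<le> i \<and> x \<le> p a i \<and> x \<le> p' a i"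
proof -
  obtain K where K: "R a = K + image_mset (\<lambda>i. (i, p a i)) (sel T l a)"
    "R' a = K + image_mset (\<lambda>i. (i, p' a i)) (shorten (sel T l a))"
    using assms unfolding valid_step_def step_def by meson
  have "1 \<le> i \<and> x \<le> p a i \<and> x \<le> p' a i" if "(i, x) \<in># K" for i x
  proof -
    have "(i, x) \<in># R a" "(i, x) \<in># R' a"
      using K that by auto
    moreover have "valid_strings (R a) (p a)" "valid_strings (R' a) (p' a)"
      using assms by (auto simp: valid_step_def)
    ultimately show ?thesis
      unfolding valid_strings_def by fastforce
  qed
  then show ?thesis
    using that K by blast
qed

lemma valid_stepD:
  assumes "valid_step T l p R p' R'"
  shows "valid_type T" "admissible T l"
    "\<And>a i. a \<in> nodes T \<Longrightarrow> p' a i = p a i + vacancy_change T l a i"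
    "\<And>a i. a \<in> nodes T \<Longrightarrow> 0 \<le> p a i" "\<And>a i. a \<in> nodes T \<Longrightarrow> 0 \<le> p' a i"
    "\<And>a. a \<in> nodes T \<Longrightarrow> valid_strings (R a) (p a)" "\<And>a. a \<in> nodes T \<Longrightarrow> valid_strings (R' a) (p' a)"
  using assms unfolding valid_step_def step_def valid_strings_def by blast+

text \<open>Between \<open>l (lower T a)\<close> and \<open>l a\<close> the vacancy number falls by
  one. A singular string in this range would be kept and end up with a rigging above its vacancy
  number.\<close>

lemma valid_step_first:
  assumes s: "valid_step T l p R p' R'" and a: "a \<in> nodes T" "(i, p a i) \<in># R a" and "l (lower T a) \<le> enat i"
  shows "l a \<le> enat i"
proof (rule ccontr)
  assume "\<not> l a \<le> enat i"
  then have i: "enat i < l a" by simp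
  note adm = valid_stepD(2)[OF s]
  obtain K where K: "R a = K + image_mset (\<lambda>i. (i, p a i)) (sel T l a)"
    "\<And>i x. (i, x) \<in># K \<Longrightarrow> 1 \<le> i \<and> x \<le> p a i \<and> x \<le> p' a i"
    using valid_step_kept[OF s a(1)] by metis
  have "i \<notin># sel T l a"
    using i admissibleD(7)[OF adm a(1)] a by (auto simp: sel_def)
  then have "(i, p a i) \<in># K"
    using a K(1) by auto
  then have "p a i \<le> p' a i"
    using K(2) by blast
  then show False
    using vacancy_change_cases(2)[OF adm a(1) assms(4) i] valid_stepD(3)[OF s a(1), of i] by simp
qed

text \<open>The same argument on the second range where the vacancy number falls. The one singular
  string it permits there is the string already consumed at index a, in a single copy.\<close>

lemma valid_step_second:
  assumes s: "valid_step T l p R p' R'" and a: "a \<in> nodes T" "(i, p a i) \<in># R a"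
    and "l (mid1 T a) \<le> enat i" "l (mid2 T a) \<le> enat i" "enat i < l (upper T a)"
  shows "l a = enat i \<and> count (R a) (i, p a i) = 1"
proof -
  note adm = valid_stepD(2)[OF s]
  obtain K where K: "R a = K + image_mset (\<lambda>i. (i, p a i)) (sel T l a)"
    "\<And>i x. (i, x) \<in># K \<Longrightarrow> 1 \<le> i \<and> x \<le> p a i \<and> x \<le> p' a i"
    using valid_step_kept[OF s a(1)] by metis
  have "(i, p a i) \<notin># K"
    using K(2)[of i "p a i"] vacancy_change_cases(6)[OF adm a(1) assms(4-6)] valid_stepD(3)[OF s a(1), of i]
    by auto
  then have "count (R a) (i, p a i) = count (sel T l a) i"
    unfolding K(1) by (simp add: count_image_graph not_in_iff)
  moreover have "count (finite_length (l (upper T a))) i = 0"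
    using assms(6) by (cases "l (upper T a)") auto
  moreover have "count (R a) (i, p a i) > 0"
    using a by simp
  ultimately show ?thesis
    using a by (cases "l a") (auto simp: sel_def split: if_splits)
qed

text \<open>Read backwards, the vacancy number falls on this range, so no kept string is singular
  after the step. Only a string shortened at \<open>upper T a\<close> can be, and only once.\<close>

lemma valid_step_first_back:
  assumes s: "valid_step T l p R p' R'" and a: "a \<in> nodes T" "(i, p' a i) \<in># R' a"
    and "l a \<le> enat i" "enat i < l (mid1 T a)" "enat i < l (mid2 T a)"
  shows "l (upper T a) = enat (i + 1) \<and> count (R' a) (i, p' a i) = 1"
proof -
  note adm = valid_stepD(2)[OF s]
  obtain K where K: "R' a = K + image_mset (\<lambda>i. (i, p' a i)) (shorten (sel T l a))"
    "\<And>i x. (i, x) \<in># K \<Longrightarrow> 1 \<le> i \<and> x \<le> p a i \<and> x \<le> p' a i"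
    using valid_step_kept[OF s a(1)] by metis
  have K': "(i, p' a i) \<notin># K"
    using K(2)[of i "p' a i"] vacancy_change_cases(3)[OF adm a(1) assms(4-6)] valid_stepD(3)[OF s a(1), of i]
    by auto
  have 1: "1 \<le> i"
    using assms(4) admissible_ge_1[OF valid_stepD(1)[OF s] adm a(1)]
    by (metis enat_ord_simps(1) one_enat_def order_trans)
  have "count (R' a) (i, p' a i) = count (sel T l a) (i + 1)"
    unfolding K(1) using K' 1 by (simp add: count_image_graph not_in_iff count_shorten)
  moreover have "count (finite_length (l a)) (i + 1) = 0"
    using assms(4) by (cases "l a") auto
  moreover have "count (R' a) (i, p' a i) > 0"
    using a by simp
  ultimately show ?thesis
    using a by (cases "l (upper T a)") (auto simp: sel_def split: if_splits)
qed

lemma valid_step_second_back: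
  assumes s: "valid_step T l p R p' R'" and a: "a \<in> nodes T" "(i, p' a i) \<in># R' a"
    and "l (upper T a) \<le> enat i"
  shows "l (above T a) \<le> enat i"
proof (rule ccontr)
  assume "\<not> ?thesis"
  then have i: "enat i < l (above T a)" by simp
  note adm = valid_stepD(2)[OF s]
  obtain K where K: "R' a = K + image_mset (\<lambda>i. (i, p' a i)) (shorten (sel T l a))"
    "\<And>i x. (i, x) \<in># K \<Longrightarrow> 1 \<le> i \<and> x \<le> p a i \<and> x \<le> p' a i"
    using valid_step_kept[OF s a(1)] by metis
  have "l a \<le> enat i"
    using admissibleD(7)[OF adm a(1)] assms(4) by (rule order_trans)
  then have "i + 1 \<notin># sel T l a"
    using assms(4) by (auto simp: sel_def)
  then have "(i, p' a i) \<in># K"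
    using a K(1) by (auto simp: in_shorten)
  then have "p' a i \<le> p a i"
    using K(2) by blast
  then show False
    using vacancy_change_cases(7)[OF adm a(1) assms(4) i] valid_stepD(3)[OF s a(1), of i] by simp
qed

lemma valid_step_selected:
  assumes s: "valid_step T l p R p' R'" and a: "a \<in> nodes T"
  shows "l a = enat i \<Longrightarrow> (i, p a i) \<in># R a"
    "l (upper T a) = enat i \<Longrightarrow> (i, p a i) \<in># R a"
    "l (upper T a) = enat i \<Longrightarrow> l a = enat i \<Longrightarrow> 2 \<le> count (R a) (i, p a i)"
proof -
  obtain K where K: "R a = K + image_mset (\<lambda>i. (i, p a i)) (sel T l a)"
    using valid_step_kept[OF s a] by metis
  show "l a = enat i \<Longrightarrow> (i, p a i) \<in># R a"
    "l (upper T a) = enat i \<Longrightarrow> (i, p a i) \<in># R a"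
    "l (upper T a) = enat i \<Longrightarrow> l a = enat i \<Longrightarrow> 2 \<le> count (R a) (i, p a i)"
    unfolding K using a by (auto simp: sel_def)
qed

lemma valid_step_shortened:
  assumes s: "valid_step T l p R p' R'" and a: "a \<in> nodes T" "1 \<le> i"
  shows "l a = enat (i + 1) \<Longrightarrow> (i, p' a i) \<in># R' a"
    "l (upper T a) = enat (i + 1) \<Longrightarrow> (i, p' a i) \<in># R' a"
    "l (upper T a) = enat (i + 1) \<Longrightarrow> l a = enat (i + 1) \<Longrightarrow> 2 \<le> count (R' a) (i, p' a i)"
proof -
  obtain K where K: "R' a = K + image_mset (\<lambda>i. (i, p' a i)) (shorten (sel T l a))"
    using valid_step_kept[OF s a(1)] by metis
  show "l a = enat (i + 1) \<Longrightarrow> (i, p' a i) \<in># R' a"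
    "l (upper T a) = enat (i + 1) \<Longrightarrow> (i, p' a i) \<in># R' a"
    "l (upper T a) = enat (i + 1) \<Longrightarrow> l a = enat (i + 1) \<Longrightarrow> 2 \<le> count (R' a) (i, p' a i)"
    unfolding K using a by (auto simp: sel_def in_shorten count_image_graph count_shorten intro!: image_eqI)
qed

text \<open>The selection rule of \<open>delta\<close> on the poset: each search starts at the
  largest length directly below. The two searches at a node look through the same strings, hence the
  demand for a second copy when their lengths coincide.\<close>

definition greedy :: "cartan_type \<Rightarrow> (nat \<Rightarrow> nat \<Rightarrow> int) \<Rightarrow> rigged_configuration \<Rightarrow> (nat \<Rightarrow> enat) \<Rightarrow> bool" where
  "greedy T p R l \<longleftrightarrow> l 0 = 1 \<and> l (top_index T) = \<infinity>
    \<and> (\<forall>a\<in>nodes T. l a = least_from (l (lower T a)) (\<lambda>i. (i, p a i) \<in># R a)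
        \<and> l (upper T a) = least_from (max (l (mid1 T a)) (l (mid2 T a)))
            (\<lambda>i. (i, p a i) \<in># R a \<and> (enat i = l a \<longrightarrow> 2 \<le> count (R a) (i, p a i))))"

lemma valid_step_greedy:
  assumes s: "valid_step T l p R p' R'"
  shows "greedy T p R l"
  unfolding greedy_def
proof (intro conjI ballI)
  note adm = valid_stepD(2)[OF s]
  show "l 0 = 1" "l (top_index T) = \<infinity>"
    using adm by (auto simp: admissible_def)
  fix a assume a: "a \<in> nodes T"
  show "l a = least_from (l (lower T a)) (\<lambda>i. (i, p a i) \<in># R a)"
    using admissibleD(1)[OF adm a] valid_step_selected(1)[OF s a] valid_step_first[OF s a]
    by (intro least_from_eqI[symmetric])
  show "l (upper T a) = least_from (max (l (mid1 T a)) (l (mid2 T a)))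
            (\<lambda>i. (i, p a i) \<in># R a \<and> (enat i = l a \<longrightarrow> 2 \<le> count (R a) (i, p a i)))"
  proof (intro least_from_eqI[symmetric])
    show "max (l (mid1 T a)) (l (mid2 T a)) \<le> l (upper T a)"
      using admissibleD(4,5)[OF adm a] by simp
    show "(i, p a i) \<in># R a \<and> (enat i = l a \<longrightarrow> 2 \<le> count (R a) (i, p a i))"
      if "l (upper T a) = enat i" for i
      using valid_step_selected(2,3)[OF s a] that by simp
    show "l (upper T a) \<le> enat i"
      if "(i, p a i) \<in># R a \<and> (enat i = l a \<longrightarrow> 2 \<le> count (R a) (i, p a i))"
        "max (l (mid1 T a)) (l (mid2 T a)) \<le> enat i" for i
      using valid_step_second[OF s a, of i] that by (metis linorder_not_le max.bounded_iff numeral_le_one_iff semiring_norm(69))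
  qed
qed

lemma greedy_unique:
  assumes T: "valid_type T" and l: "greedy T p R l" and l': "greedy T p R l'" and "v \<le> top_index T"
  shows "l v = l' v"
  using assms(4)
proof (induction v rule: less_induct)
  case (less v)
  show ?case
  proof (cases "v = top_index T")
    case True
    then show ?thesis using l l' by (simp add: greedy_def)
  next
    case False
    then have "v < top_index T" using less by simp
    with T show ?thesis
    proof (cases rule: index_cases)
      case 1
      then show ?thesis using l l' by (simp add: greedy_def)
    next
      case 2
      then have "l (lower T v) = l' (lower T v)"
        using less.IH[of "lower T v"] less.prems index_order(1)[OF T 2] by simp
      then show ?thesis
        using l l' 2 by (simp add: greedy_def)
    next
      case (3 a)
      then have "l (mid1 T a) = l' (mid1 T a)" "l (mid2 T a) = l' (mid2 T a)" "l a = l' a"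
        using less.IH less.prems index_order[OF T 3(1)] False by auto
      moreover have "l v = least_from (max (l (mid1 T a)) (l (mid2 T a)))
            (\<lambda>i. (i, p a i) \<in># R a \<and> (enat i = l a \<longrightarrow> 2 \<le> count (R a) (i, p a i)))"
        using l 3 unfolding greedy_def by blast
      moreover have "l' v = least_from (max (l' (mid1 T a)) (l' (mid2 T a)))
            (\<lambda>i. (i, p a i) \<in># R a \<and> (enat i = l' a \<longrightarrow> 2 \<le> count (R a) (i, p a i)))"
        using l' 3 unfolding greedy_def by blast
      ultimately show ?thesis
        by simp
    qed
  qed
qed

section \<open>The algorithm as a greedy step\<close>

text \<open>A small set of relations that generates the order. The condition
  \<open>upper T v = top_index T\<close> singles out, in type D, the spin node n - 1 below the upper
  index of n - 2, apart from pairs ending in \<open>top_index\<close>; the other relations from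
  \<open>mid1\<close> to \<open>upper\<close> follow by transitivity. Few relations are wanted
  because the forward and the backward selection provide inequalities from opposite ends.\<close>

definition covers :: "cartan_type \<Rightarrow> nat \<Rightarrow> nat \<Rightarrow> bool" where
  "covers T v w \<longleftrightarrow> w \<in> nodes T \<and> v = lower T w
     \<or> (\<exists>b\<in>nodes T. w = upper T b \<and> (v = mid1 T b \<and> upper T v = top_index T \<or> v = mid2 T b))"

lemma coversI:
  "w \<in> nodes T \<Longrightarrow> covers T (lower T w) w"
  "b \<in> nodes T \<Longrightarrow> upper T (mid1 T b) = top_index T \<Longrightarrow> covers T (mid1 T b) (upper T b)"
  "b \<in> nodes T \<Longrightarrow> covers T (mid2 T b) (upper T b)"
  unfolding covers_def by blast+

lemma monotone_imp_admissible:
  assumes T: "valid_type T" and l: "l 0 = 1" "l (top_index T) = \<infinity>"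
    and mono: "\<And>v w. covers T v w \<Longrightarrow> l v \<le> l w"
  shows "admissible T l"
  unfolding admissible_def
proof (intro conjI ballI)
  fix a assume a: "a \<in> nodes T"
  show 1: "l (lower T a) \<le> l a" "l (mid2 T a) \<le> l (upper T a)"
    using a by (auto intro: mono coversI)
  have "l a \<le> l (mid1 T a) \<and> l a \<le> l (mid2 T a) \<and> l (mid1 T a) \<le> l (upper T a) \<and> l (upper T a) \<le> l (above T a)"
  proof (cases T)
    case (TypeA n)
    have "l a \<le> l (Suc a)"
    proof (cases "a = n")
      case True
      then show ?thesis using l TypeA by simp
    next
      case False
      then show ?thesis using mono[OF coversI(1)[of "Suc a" T]] a TypeA by simp
    qed
    then show ?thesis using l TypeA by simp
  next
    case (TypeD n)
    obtain m where m: "n = m + 4"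
      using T TypeD by (metis add.commute le_Suc_ex valid_type.simps(2))
    have step1: "l v \<le> l (Suc v)" if "v \<le> m + 2" for v
      using mono[OF coversI(1)[of "Suc v" T]] that TypeD m by simp
    have spin: "l (m + 2) \<le> l (m + 4)"
      using mono[OF coversI(1)[of "m + 4" T]] TypeD m by simp
    have "upper T (m + 2) = m + 5" "upper T (m + 3) = top_index T" "mid1 T (m + 2) = m + 3" "mid2 T (m + 2) = m + 4"
      by (simp_all add: TypeD m)
    then have spin': "l (m + 3) \<le> l (m + 5)" "l (m + 4) \<le> l (m + 5)"
      using mono[OF coversI(2)[of "m + 2" T]] mono[OF coversI(3)[of "m + 2" T]] TypeD m
      by (simp_all only: nodes.simps atLeastAtMost_iff) auto
    \<comment> \<open>Above the spin nodes the indices form a chain: v and v + 1 are the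
      \<open>mid2\<close> and the \<open>upper\<close> index of the node b.\<close>
    have step2: "l v \<le> l (Suc v)" if "m + 5 \<le> v" "v < 2 * m + 6" for v
    proof -
      define b where "b = 2 * m + 6 - v"
      have "b \<in> nodes T" "upper T b = Suc v" "mid2 T b = v"
        using that TypeD m by (auto simp: b_def)
      then show ?thesis using mono[OF coversI(3)[of b T]] by simp
    qed
    have mid: "l v \<le> l w" if "v \<le> w" "w \<le> m + 3" for v w
      using that by (induction rule: dec_induct) (use step1 order_trans in \<open>fastforce+\<close>)
    have mid_n: "l v \<le> l (m + 5)" if "v \<le> m + 3" for v
      using mid[OF that] spin'(1) order_trans by blast
    have up: "l (m + 5) \<le> l w" if "m + 5 \<le> w" "w \<le> 2 * m + 6" for w
      using that by (induction rule: dec_induct) (use step2 order_trans in \<open>fastforce+\<close>)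
    have "l a \<le> l (mid1 T a)"
    proof -
      consider "a \<le> m + 2" | "a = m + 3" | "a = m + 4" using a TypeD m by fastforce
      then show ?thesis
      proof cases
        case 1
        then show ?thesis using step1[of a] TypeD m by simp
      next
        case 2
        then have "mid1 T a = m + 5" using TypeD m by simp
        then show ?thesis using spin'(1) 2 by simp
      next
        case 3
        then have "mid1 T a = m + 5" using TypeD m by simp
        then show ?thesis using spin'(2) 3 by simp
      qed
    qed
    moreover have "l a \<le> l (mid2 T a)"
    proof -
      consider "a < m + 2" | "a = m + 2" | "a \<ge> m + 3" by linarith
      then show ?thesis
      proof cases
        case 1
        then have "m + 5 \<le> 2 * m + 6 - a" "2 * m + 6 - a \<le> 2 * m + 6" by auto
        then have "l (m + 5) \<le> l (2 * m + 6 - a)" by (rule up)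
        moreover have "l a \<le> l (m + 5)" using mid_n[of a] 1 by simp
        moreover have "mid2 T a = 2 * m + 6 - a" using 1 TypeD m by simp
        ultimately show ?thesis by (simp only: order_trans)
      next
        case 2
        then have "mid2 T a = m + 4" using TypeD m by simp
        then show ?thesis using spin 2 by simp
      next
        case 3
        then have "mid2 T a = top_index T" using TypeD m by simp
        then show ?thesis using l by simp
      qed
    qed
    moreover have "l (mid1 T a) \<le> l (upper T a)"
    proof -
      consider "a < m + 2" | "a = m + 2" | "a \<ge> m + 3" by linarith
      then show ?thesis
      proof cases
        case 1
        then have "1 \<le> a" "m + 5 \<le> 2 * m + 7 - a" "2 * m + 7 - a \<le> 2 * m + 6"
          using a TypeD by auto
        then have "l (m + 5) \<le> l (2 * m + 7 - a)" by (intro up)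
        moreover have "l (a + 1) \<le> l (m + 5)" using mid_n[of "a + 1"] 1 by simp
        moreover have "mid1 T a = a + 1" "upper T a = 2 * m + 7 - a" using 1 TypeD m by simp_all
        ultimately show ?thesis by (simp only: order_trans)
      next
        case 2
        then have "mid1 T a = m + 3" "upper T a = m + 5" using TypeD m by simp_all
        then show ?thesis using spin' by simp
      next
        case 3
        then have "upper T a = top_index T" using TypeD m by simp
        then show ?thesis using l by simp
      qed
    qed
    moreover have "l (upper T a) \<le> l (above T a)"
    proof (cases "a \<le> m + 2")
      case True
      have "l (2 * m + 7 - a) \<le> l (2 * m + 8 - a)"
      proof (cases "a = 1")
        case True
        then have "2 * m + 8 - a = top_index T" using TypeD m by simp
        then show ?thesis using l by simp
      next
        case False
        moreover have "1 \<le> a" using a TypeD by simp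
        ultimately have "m + 5 \<le> 2 * m + 7 - a" "2 * m + 7 - a < 2 * m + 6"
          "Suc (2 * m + 7 - a) = 2 * m + 8 - a"
          using True by auto
        then show ?thesis using step2[of "2 * m + 7 - a"] by simp
      qed
      moreover have "upper T a = 2 * m + 7 - a" "above T a = 2 * m + 8 - a"
        using True TypeD m by simp_all
      ultimately show ?thesis by simp
    next
      case False
      then have "upper T a = above T a" using TypeD m by simp
      then show ?thesis by simp
    qed
    ultimately show ?thesis by blast
  qed
  then show "l a \<le> l (mid1 T a)" "l a \<le> l (mid2 T a)" "l (mid1 T a) \<le> l (upper T a)" "l (upper T a) \<le> l (above T a)"
    by auto
qed (use l in auto)

lemma greedy_admissible:
  assumes "valid_type T" "greedy T p R l"
  shows "admissible T l"
proof (rule monotone_imp_admissible[OF assms(1)])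
  show "l 0 = 1" "l (top_index T) = \<infinity>"
    using assms by (auto simp: greedy_def)
  show "l v \<le> l w" if vw: "covers T v w" for v w
    using vw unfolding covers_def
  proof (elim disjE conjE bexE)
    assume *: "w \<in> nodes T" "v = lower T w"
    then have "l w = least_from (l v) (\<lambda>i. (i, p w i) \<in># R w)"
      using assms(2) unfolding greedy_def by blast
    then show ?thesis by (simp only: least_from_ge)
  next
    fix b assume b: "b \<in> nodes T" "w = upper T b"
    then have "l w = least_from (max (l (mid1 T b)) (l (mid2 T b)))
        (\<lambda>i. (i, p b i) \<in># R b \<and> (enat i = l b \<longrightarrow> 2 \<le> count (R b) (i, p b i)))"
      using assms(2) unfolding greedy_def by blast
    then have *: "max (l (mid1 T b)) (l (mid2 T b)) \<le> l w"
      by (simp only: least_from_ge)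
    show ?thesis if "v = mid1 T b" "upper T v = top_index T"
      using * that by simp
    show ?thesis if "v = mid2 T b"
      using * that by simp
  qed
qed

section \<open>The lengths of the algorithm as a greedy selection\<close>

definition lengths :: "cartan_type \<Rightarrow> multiplicity_array \<Rightarrow> rigged_configuration \<Rightarrow> nat \<Rightarrow> enat" where
  "lengths T L R v = (case T of
     TypeA n \<Rightarrow> if v \<le> n then ell T L R v else \<infinity>
   | TypeD n \<Rightarrow> if v \<le> n then ell T L R v else if v < 2 * n - 1 then ell_bar n L R (2 * n - 1 - v) else \<infinity>)"

lemma ell_chain_mono: "a \<le> b \<Longrightarrow> ell_chain T L R a \<le> ell_chain T L R b"
  by (induction rule: dec_induct) (auto intro: order_trans least_from_ge)

lemma ell_bar_chain_mono: "a \<le> b \<Longrightarrow> ell_bar_chain n L R a \<le> ell_bar_chain n L R b"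
  by (induction rule: dec_induct) (auto intro: order_trans least_from_ge simp: Let_def)

lemma singular_eq: "singular T L R a = (\<lambda>i. (i, vacancy T L (shape R) a i) \<in># R a)"
  by (auto simp: singular_def singular_string_def)

text \<open>For a < n - 2 in type D the algorithm starts the barred search from the barred length at
  a + 1 alone. Taking the maximum with the unbarred length at a + 1 changes nothing: that length is
  bounded by the spin lengths, and these by all barred ones. At a = n - 2 the maximum is that of the
  two spin lengths.\<close>

lemma lengths_greedy:
  assumes T: "valid_type T"
  shows "greedy T (vacancy T L (shape R)) R (lengths T L R)"
proof (cases T)
  case (TypeA n)
  have "lengths T L R a = least_from (lengths T L R (lower T a)) (\<lambda>i. (i, vacancy T L (shape R) a i) \<in># R a)"
    if "a \<in> nodes T" for a
    using that TypeA by (cases a) (auto simp: lengths_def singular_eq)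
  then show ?thesis
    using TypeA T unfolding greedy_def by (auto simp: lengths_def)
next
  case (TypeD n)
  then have n: "4 \<le> n" using T by simp
  have lengths_low: "lengths T L R a = least_from (lengths T L R (lower T a)) (\<lambda>i. (i, vacancy T L (shape R) a i) \<in># R a)"
    if a: "a \<in> nodes T" for a
  proof (cases "a \<le> n - 2")
    case True
    then obtain b where b: "a = Suc b"
      using a TypeD by (cases a) auto
    then have "b \<le> n - 2" "Suc b \<noteq> n" "Suc b \<le> n" "b \<le> n"
      using True n by auto
    then show ?thesis
      using True n TypeD b by (simp add: lengths_def singular_eq)
  next
    case False
    then have "lower T a = n - 2" "a \<le> n"
      using a TypeD by auto
    then show ?thesis
      using False n TypeD by (simp add: lengths_def singular_eq)
  qed
  moreover have "lengths T L R (upper T a) = least_from (max (lengths T L R (mid1 T a)) (lengths T L R (mid2 T a)))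
            (\<lambda>i. (i, vacancy T L (shape R) a i) \<in># R a \<and> (enat i = lengths T L R a \<longrightarrow>
               2 \<le> count (R a) (i, vacancy T L (shape R) a i)))" if a: "a \<in> nodes T" for a
  proof (cases "a \<le> n - 2")
    case True
    define k where "k = n - 2 - a"
    have k: "n - 1 - a = Suc k" "n - 1 - Suc k = a" "1 \<le> a"
      using True a TypeD n by (auto simp: k_def)
    have "ell_bar_chain n L R k = max (lengths T L R (mid1 T a)) (lengths T L R (mid2 T a))"
    proof (cases "a = n - 2")
      case True
      then have "mid1 T a = n - 1" "mid2 T a = n" "k = 0"
        using n TypeD by (auto simp: k_def)
      then show ?thesis
        using TypeD n by (simp add: lengths_def)
    next
      case False
      then have "mid1 T a = Suc a" "mid2 T a = 2 * n - 2 - a" "n < 2 * n - 2 - a" "2 * n - 1 - (2 * n - 2 - a) = Suc a"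
        "2 * n - 2 - a < 2 * n - 1" "Suc a \<le> n - 2" "Suc a \<le> n" "n - 1 - Suc a = k"
        using n TypeD True by (auto simp: k_def)
      then have "lengths T L R (mid1 T a) = ell_chain T L R (Suc a)" "lengths T L R (mid2 T a) = ell_bar_chain n L R k"
        using TypeD by (simp_all add: lengths_def ell_bar_def)
      moreover have "ell_chain T L R (Suc a) \<le> ell_chain T L R (n - 2)"
        using \<open>Suc a \<le> n - 2\<close> by (rule ell_chain_mono)
      moreover have "ell_chain T L R (n - 2) \<le> ell_bar_chain n L R 0"
      proof -
        have "\<not> n - 1 \<le> n - 2" using n by simp
        then have "ell T L R (n - 1) \<ge> ell_chain T L R (n - 2)"
          unfolding TypeD ell.simps by (simp only: if_False least_from_ge)
        then show ?thesis unfolding TypeD by (simp add: le_max_iff_disj)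
      qed
      moreover have "ell_bar_chain n L R 0 \<le> ell_bar_chain n L R k"
        by (rule ell_bar_chain_mono) simp
      ultimately have "lengths T L R (mid1 T a) \<le> lengths T L R (mid2 T a)"
        by (simp only:)
      then show ?thesis
        using \<open>lengths T L R (mid2 T a) = ell_bar_chain n L R k\<close> by (simp add: max_absorb2)
    qed
    moreover have "lengths T L R (upper T a) = ell_bar_chain n L R (Suc k)"
    proof -
      have "upper T a = 2 * n - 1 - a" "n < 2 * n - 1 - a" "2 * n - 1 - (2 * n - 1 - a) = a" "2 * n - 1 - a < 2 * n - 1"
        using True n TypeD k by auto
      then show ?thesis
        using TypeD k by (simp add: lengths_def ell_bar_def)
    qed
    moreover have "lengths T L R a = ell T L R a"
    proof -
      have "a \<le> n" using True by simp
      then show ?thesis using TypeD by (simp add: lengths_def)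
    qed
    moreover have "ell_bar_chain n L R (Suc k) = least_from (ell_bar_chain n L R k)
        (\<lambda>i. (i, vacancy T L (shape R) a i) \<in># R a \<and> (enat i = ell T L R a \<longrightarrow>
               2 \<le> count (R a) (i, vacancy T L (shape R) a i)))"
      unfolding ell_bar_chain.simps k(2) Let_def singular_eq singular_string_def TypeD ..
    ultimately show ?thesis
      by (simp only:)
  next
    case False
    then have "mid2 T a = 2 * n - 1" "upper T a = 2 * n - 1" "\<not> 2 * n - 1 \<le> n"
      using TypeD n by auto
    then show ?thesis
      using TypeD by (simp add: lengths_def)
  qed
  moreover have "lengths T L R 0 = 1" "lengths T L R (top_index T) = \<infinity>"
    using TypeD n by (auto simp: lengths_def)
  ultimately show ?thesis
    unfolding greedy_def by blast
qed

lemma selected_eq_sel: "valid_type T \<Longrightarrow> selected T L R a = sel T (lengths T L R) a"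
  by (cases T) (auto simp: sel_def lengths_def)

lemma sel_cong:
  assumes "valid_type T" "\<And>v. v \<le> top_index T \<Longrightarrow> l v = l' v"
  shows "sel T l = sel T l'"
proof
  fix a
  show "sel T l a = sel T l' a"
    using index_order(9,17)[OF assms(1), of a] assms(2)[of a] assms(2)[of "upper T a"]
    by (simp add: sel_def less_imp_le)
qed

lemma selected_eq_sel_greedy:
  assumes "valid_type T" "greedy T (vacancy T L (shape R)) R l"
  shows "selected T L R = sel T l"
  using sel_cong[OF assms(1), of l "lengths T L R"] greedy_unique[OF assms(1,2) lengths_greedy[OF assms(1)]]
    selected_eq_sel[OF assms(1)] by auto

lemma shape_graph: "image_mset fst (image_mset (\<lambda>i. (i, p i)) M) = M"
  by (simp add: multiset.map_comp comp_def)

lemma step_imp_delta: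
  assumes "valid_type T" "step T l (vacancy T L (shape R)) R (vacancy T L' (shape R')) R'"
    "selected T L R = sel T l"
  shows "delta T L L' R = R'"
proof -
  obtain K where K: "\<And>a. R a = K a + image_mset (\<lambda>i. (i, vacancy T L (shape R) a i)) (sel T l a)"
    "\<And>a. R' a = K a + image_mset (\<lambda>i. (i, vacancy T L' (shape R') a i)) (shorten (sel T l a))"
    using assms(2) unfolding step_def by metis
  have "shape R a - sel T l a + shorten (sel T l a) = shape R' a" for a
    unfolding shape_def K(1)[of a] K(2)[of a] by (simp add: shape_graph)
  then have "delta T L L' R = (\<lambda>a. R a - image_mset (\<lambda>i. (i, vacancy T L (shape R) a i)) (sel T l a)
      + image_mset (\<lambda>i. (i, vacancy T L' (shape R') a i)) (shorten (sel T l a)))"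
    unfolding delta_def assms(3) Let_def singular_string_def by simp
  also have "\<dots> = R'"
  proof
    fix a
    show "R a - image_mset (\<lambda>i. (i, vacancy T L (shape R) a i)) (sel T l a)
      + image_mset (\<lambda>i. (i, vacancy T L' (shape R') a i)) (shorten (sel T l a)) = R' a"
      using K(1)[of a] K(2)[of a] by simp
  qed
  finally show ?thesis .
qed

text \<open>If both lengths at a node coincide, the selection rule guarantees two copies of the
  singular string, so the selected multiset really is contained in the strings.\<close>

lemma greedy_sel_subset:
  assumes "valid_type T" and g: "greedy T p R l"
  shows "image_mset (\<lambda>i. (i, p a i)) (sel T l a) \<subseteq># R a"
proof (cases "a \<in> nodes T")
  case False
  then show ?thesis by (simp add: sel_def)
next
  case a: True
  have 1: "(i, p a i) \<in># R a" if "l a = enat i" for i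
    using g a that unfolding greedy_def by (metis least_from_sat)
  have 2: "(i, p a i) \<in># R a \<and> (enat i = l a \<longrightarrow> 2 \<le> count (R a) (i, p a i))" if "l (upper T a) = enat i" for i
  proof -
    have "l (upper T a) = least_from (max (l (mid1 T a)) (l (mid2 T a)))
            (\<lambda>i. (i, p a i) \<in># R a \<and> (enat i = l a \<longrightarrow> 2 \<le> count (R a) (i, p a i)))"
      using g a unfolding greedy_def by blast
    then have "least_from (max (l (mid1 T a)) (l (mid2 T a)))
            (\<lambda>i. (i, p a i) \<in># R a \<and> (enat i = l a \<longrightarrow> 2 \<le> count (R a) (i, p a i))) = enat i"
      using that by (simp only:)
    then show ?thesis by (rule least_from_sat)
  qed
  show ?thesis
  proof (rule mset_subset_eqI)
    fix s :: "nat \<times> int"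
    obtain i x where s: "s = (i, x)" by force
    show "count (image_mset (\<lambda>i. (i, p a i)) (sel T l a)) s \<le> count (R a) s"
      unfolding s count_image_graph
      using 1[of i] 2[of i] a by (cases "l a"; cases "l (upper T a)")
        (auto simp: sel_def simp flip: count_greater_zero_iff)
  qed
qed

text \<open>\<open>delta\<close> computes new riggings from a shape formed by multiset subtraction.
  Since the selected strings are present, this is the shape of the result itself, as
  \<open>step\<close> requires.\<close>

lemma greedy_step:
  assumes T: "valid_type T" and g: "greedy T (vacancy T L (shape R)) R l"
  shows "step T l (vacancy T L (shape R)) R (vacancy T L' (shape (delta T L L' R))) (delta T L L' R)"
proof -
  let ?p = "vacancy T L (shape R)"
  define K where "K a = R a - image_mset (\<lambda>i. (i, ?p a i)) (sel T l a)" for a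
  have R: "R a = K a + image_mset (\<lambda>i. (i, ?p a i)) (sel T l a)" for a
    using greedy_sel_subset[OF T g, of a] by (simp add: K_def)
  define \<nu>' where "\<nu>' a = shape R a - sel T l a + shorten (sel T l a)" for a
  have d: "delta T L L' R = (\<lambda>a. K a + image_mset (\<lambda>i. (i, vacancy T L' \<nu>' a i)) (shorten (sel T l a)))"
    unfolding delta_def selected_eq_sel_greedy[OF T g] Let_def singular_string_def K_def \<nu>'_def by simp
  have "shape (delta T L L' R) a = \<nu>' a" for a
    unfolding shape_def \<nu>'_def d R[of a] by (simp add: shape_graph)
  then have "shape (delta T L L' R) = \<nu>'" by blast
  then have "delta T L L' R a = K a + image_mset (\<lambda>i. (i, vacancy T L' (shape (delta T L L' R)) a i)) (shorten (sel T l a))" for a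
    using d by simp
  then show ?thesis
    unfolding step_def using greedy_admissible[OF T g] R by blast
qed

lemma vacancy_change_sign:
  assumes "admissible T l" "a \<in> nodes T"
  shows "\<bar>vacancy_change T l a i\<bar> \<le> 1"
    "vacancy_change T l a i < 0 \<Longrightarrow> l (lower T a) \<le> enat i \<and> enat i < l a
      \<or> l (mid1 T a) \<le> enat i \<and> l (mid2 T a) \<le> enat i \<and> enat i < l (upper T a)"
    "vacancy_change T l a i > 0 \<Longrightarrow> l a \<le> enat i \<and> enat i < l (mid1 T a) \<and> enat i < l (mid2 T a)
      \<or> l (upper T a) \<le> enat i \<and> enat i < l (above T a)"
proof -
  define r where "r v \<longleftrightarrow> l v \<le> enat i" for v
  have "r a \<Longrightarrow> r (lower T a)" "r (mid1 T a) \<Longrightarrow> r a" "r (mid2 T a) \<Longrightarrow> r a" "r (upper T a) \<Longrightarrow> r (mid1 T a)"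
    "r (upper T a) \<Longrightarrow> r (mid2 T a)" "r (above T a) \<Longrightarrow> r (upper T a)"
    using admissibleD[OF assms] unfolding r_def by (meson order_trans)+
  then show "\<bar>vacancy_change T l a i\<bar> \<le> 1"
    "vacancy_change T l a i < 0 \<Longrightarrow> l (lower T a) \<le> enat i \<and> enat i < l a
      \<or> l (mid1 T a) \<le> enat i \<and> l (mid2 T a) \<le> enat i \<and> enat i < l (upper T a)"
    "vacancy_change T l a i > 0 \<Longrightarrow> l a \<le> enat i \<and> enat i < l (mid1 T a) \<and> enat i < l (mid2 T a)
      \<or> l (upper T a) \<le> enat i \<and> enat i < l (above T a)"
    unfolding vacancy_change_def reached_def not_le[symmetric] r_def[symmetric]
    by (cases "r a"; cases "r (lower T a)"; cases "r (mid1 T a)"; cases "r (mid2 T a)"; cases "r (upper T a)";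
      cases "r (above T a)"; simp)+
qed

lemma part_sum_shorten_finite_length:
  assumes "1 \<le> l"
  shows "part_sum (shorten (finite_length l)) i = part_sum (finite_length l) i - reached l i"
proof (cases l)
  case (enat j)
  then have "1 \<le> j"
    using assms by (simp add: one_enat_def)
  then show ?thesis
    using enat by (auto simp: shorten_def reached_def)
qed (simp add: reached_def)

lemma part_sum_shorten_sel:
  assumes "valid_type T" "admissible T l" "a \<in> nodes T"
  shows "part_sum (shorten (sel T l a)) i = part_sum (sel T l a) i - (reached (l a) i + reached (l (upper T a)) i)"
proof -
  have "1 \<le> l a" "1 \<le> l (upper T a)"
    using admissible_ge_1[OF assms] admissibleD(7)[OF assms(2,3)] by (auto intro: order_trans)
  then show ?thesis
    using assms(3) by (simp add: sel_def part_sum_shorten_finite_length)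
qed

text \<open>\<open>slot_sum\<close> for the indicators \<open>reached (l v) i\<close>. Its
  correction term at node 1 equals min i 1 and cancels against the removed factor B^{1,1}.\<close>

lemma vacancy_of_step:
  assumes T: "valid_type T" and l: "admissible T l" and a: "a \<in> nodes T"
    and R: "\<And>b. shape R b = N b + sel T l b" and R': "\<And>b. shape R' b = N b + shorten (sel T l b)"
  shows "vac T B R' a i = vac T ((1, 1) # B) R a i + vacancy_change T l a i"
proof -
  define X where "X v = reached (l v) i" for v
  have X: "X (top_index T) = 0" "X 0 = int (min i 1)"
    using l by (auto simp: X_def reached_def admissible_def one_enat_def)
  have "part_sum (shape R' b) i = part_sum (shape R b) i - (X b + X (upper T b))" if "b \<in> nodes T" for b
    using part_sum_shorten_sel[OF T l that, of i] by (simp add: R R' X_def)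
  then have "(\<Sum>b\<in>nodes T. cartan T a b * part_sum (shape R' b) i)
      = (\<Sum>b\<in>nodes T. cartan T a b * part_sum (shape R b) i - cartan T a b * (X b + X (upper T b)))"
    by (intro sum.cong) (auto simp: right_diff_distrib)
  then show ?thesis
    using slot_sum[where X = X, OF T a X(1)] X(2) by (auto simp: vacancy_eq vacancy_change_def X_def sum_subtractf)
qed

text \<open>The value of \<open>- vacancy_change\<close> for large i when exactly the indices in I
  have finite length; 0 is inserted because the virtual index 0 always does. It is \<Lambda>_1, the
  weight of the letter 1, minus one simple root for each arrow in I.\<close>

definition index_weight :: "cartan_type \<Rightarrow> nat set \<Rightarrow> weight" where
  "index_weight T I = (\<lambda>a. if a \<in> nodes T then
     of_bool (lower T a \<in> insert 0 I) + of_bool (mid1 T a \<in> I) + of_bool (mid2 T a \<in> I) + of_bool (above T a \<in> I)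
     - 2 * of_bool (a \<in> I) - 2 * of_bool (upper T a \<in> I) else 0)"

definition support :: "cartan_type \<Rightarrow> (nat \<Rightarrow> enat) \<Rightarrow> nat set" where
  "support T l = {v. 1 \<le> v \<and> v < top_index T \<and> l v \<noteq> \<infinity>}"

lemma vacancy_change_eventually:
  assumes T: "valid_type T" and l: "admissible T l" and a: "a \<in> nodes T"
  shows "\<exists>N. \<forall>i\<ge>N. vacancy_change T l a i = - index_weight T (support T l) a"
proof -
  let ?f = "\<lambda>v. of_bool (l v \<noteq> \<infinity>) :: int"
  define N where "N v = (case l v of enat j \<Rightarrow> j | \<infinity> \<Rightarrow> 0)" for v
  have N: "N v \<le> i \<Longrightarrow> reached (l v) i = ?f v" for v i
    by (cases "l v") (auto simp: N_def reached_def)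
  have mem: "v \<in> support T l \<longleftrightarrow> l v \<noteq> \<infinity>" if "1 \<le> v" "v \<le> top_index T" for v
    using that l by (cases "v = top_index T") (auto simp: support_def admissible_def)
  have low: "lower T a \<in> insert 0 (support T l) \<longleftrightarrow> l (lower T a) \<noteq> \<infinity>"
    using mem[of "lower T a"] index_order(1,17)[OF T a] l by (cases "lower T a = 0") (auto simp: admissible_def)
  have ge: "1 \<le> mid1 T a" "1 \<le> mid2 T a" "1 \<le> upper T a" "1 \<le> a" "a \<le> top_index T" "1 \<le> above T a"
    using index_order[OF T a] by (cases "upper T a = top_index T"; simp)+
  show ?thesis
  proof (intro exI[of _ "N a + N (upper T a) + N (lower T a) + N (mid1 T a) + N (mid2 T a) + N (above T a)"] allI impI)
    fix i assume "N a + N (upper T a) + N (lower T a) + N (mid1 T a) + N (mid2 T a) + N (above T a) \<le> i"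
    then show "vacancy_change T l a i = - index_weight T (support T l) a"
      using a ge index_order(7-10)[OF T a] by (simp only: vacancy_change_def N index_weight_def low mem) simp
  qed
qed

lemma rc_weight_of_step:
  assumes T: "valid_type T" and l: "admissible T l"
    and R: "\<And>b. shape R b = N b + sel T l b" and R': "\<And>b. shape R' b = N b + shorten (sel T l b)"
  shows "rc_weight T ((1, 1) # B) R a = rc_weight T B R' a + index_weight T (support T l) a"
proof (cases "a \<in> nodes T")
  case a: True
  obtain N1 N2 N3 where "\<forall>i\<ge>N1. vac T ((1, 1) # B) R a i = rc_weight T ((1, 1) # B) R a"
    "\<forall>i\<ge>N2. vac T B R' a i = rc_weight T B R' a"
    "\<forall>i\<ge>N3. vacancy_change T l a i = - index_weight T (support T l) a"
    using vacancy_eventually[OF a] vacancy_change_eventually[OF T l a] by metis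
  then have "vac T ((1, 1) # B) R a (N1 + N2 + N3) = rc_weight T ((1, 1) # B) R a"
    "vac T B R' a (N1 + N2 + N3) = rc_weight T B R' a"
    "vacancy_change T l a (N1 + N2 + N3) = - index_weight T (support T l) a"
    by simp_all
  then show ?thesis
    using vacancy_of_step[OF T l a R R', of B "N1 + N2 + N3"] by simp
qed (simp add: rc_weight_def index_weight_def)

section \<open>Validity of the result of the algorithm\<close>

text \<open>The concavity of p_i at node a that is due to the factors and to strings at adjacent
  nodes. The strings at a itself contribute 2 m_i with the opposite sign, so this is the
  \<open>q\<close> of the lemmas on zero runs.\<close>

definition nbr_count :: "cartan_type \<Rightarrow> kr_product \<Rightarrow> configuration \<Rightarrow> nat \<Rightarrow> nat \<Rightarrow> int" where
  "nbr_count T B \<nu> a i = int (count_list B (a, i)) - (\<Sum>b\<in>nodes T - {a}. cartan T a b * int (count (\<nu> b) i))"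

lemma cartan_diag: "cartan T a a = 2"
  by (simp add: cartan_def)

lemma cartan_off_diag: "a \<noteq> b \<Longrightarrow> cartan T a b \<le> 0"
  by (simp add: cartan_def)

lemma vacancy_second_difference_nbr:
  assumes "1 \<le> i" "a \<in> nodes T"
  shows "vacancy T (mult_array B) \<nu> a (i + 1) + vacancy T (mult_array B) \<nu> a (i - 1)
      - 2 * vacancy T (mult_array B) \<nu> a i = 2 * int (count (\<nu> a) i) - nbr_count T B \<nu> a i"
  unfolding vacancy_second_difference[OF assms(1)] nbr_count_def
  using sum.remove[OF finite_nodes assms(2), of "\<lambda>b. cartan T a b * int (count (\<nu> b) i)"]
  by (simp add: cartan_diag)

text \<open>In the applications X is an indicator of length i: a slot of value 1 is backed by a
  string of length i at the adjacent node, and the slot 0 by a factor of width i at node 1. Cartan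
  entries off the diagonal are nonpositive, so lower bounds for string counts give one for
  \<open>nbr_count\<close>.\<close>

lemma nbr_count_ge:
  fixes X :: "nat \<Rightarrow> int"
  assumes T: "valid_type T" and a: "a \<in> nodes T" and X: "X (top_index T) = 0"
    and le: "\<And>b. b \<in> nodes T \<Longrightarrow> X b + X (upper T b) \<le> int (count (\<nu> b) i)"
    and 0: "X 0 \<le> int (count_list B (1, i))"
  shows "X (lower T a) + X (mid1 T a) + X (mid2 T a) + X (above T a) \<le> nbr_count T B \<nu> a i"
proof -
  have "(\<Sum>b\<in>nodes T - {a}. cartan T a b * int (count (\<nu> b) i)) \<le> (\<Sum>b\<in>nodes T - {a}. cartan T a b * (X b + X (upper T b)))"
    using le by (intro sum_mono mult_left_mono_neg) (auto intro: cartan_off_diag)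
  moreover have "(\<Sum>b\<in>nodes T. cartan T a b * (X b + X (upper T b)))
      = 2 * (X a + X (upper T a)) + (\<Sum>b\<in>nodes T - {a}. cartan T a b * (X b + X (upper T b)))"
    using sum.remove[OF finite_nodes a, of "\<lambda>b. cartan T a b * (X b + X (upper T b))"] by (simp add: cartan_diag)
  moreover have "(if a = 1 then X 0 else 0) \<le> int (count_list B (a, i))"
    using 0 by auto
  ultimately show ?thesis
    using slot_sum[where X = X, OF T a X] unfolding nbr_count_def by linarith
qed

lemma nbr_count_nonneg: "0 \<le> nbr_count T B \<nu> a i"
proof -
  have "(\<Sum>b\<in>nodes T - {a}. cartan T a b * int (count (\<nu> b) i)) \<le> 0"
    by (intro sum_nonpos mult_nonpos_nonneg) (auto intro: cartan_off_diag)
  then show ?thesis by (simp add: nbr_count_def)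
qed

lemma count_shape_unique:
  assumes "\<And>y. (i, y) \<in># M \<Longrightarrow> y = x"
  shows "count (image_mset fst M) i = count M (i, x)"
  using assms
proof (induction M)
  case (add s M)
  obtain j y where s: "s = (j, y)" by force
  have "count (image_mset fst M) i = count M (i, x)"
    using add by simp
  moreover have "j = i \<Longrightarrow> y = x"
    using add.prems s by simp
  ultimately show ?case
    by (simp add: s)
qed simp

lemma finite_length_count: "count (finite_length l) i = (if l = enat i then 1 else 0)"
  by (cases l) auto

lemma greedy_count_le_shape:
  assumes "valid_type T" "greedy T p R l" "b \<in> nodes T"
  shows "of_bool (l b = enat i) + of_bool (l (upper T b) = enat i) \<le> int (count (shape R b) i)"
proof -
  have "sel T l b \<subseteq># shape R b"
    using image_mset_subseteq_mono[OF greedy_sel_subset[OF assms(1,2), of b], of fst]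
    by (simp add: shape_def shape_graph)
  then have "count (sel T l b) i \<le> count (shape R b) i"
    by (rule mset_subset_eq_count)
  then show ?thesis
    using assms(3) by (auto simp: sel_def finite_length_count split: if_splits)
qed

lemma valid_stringsI:
  assumes "\<And>i. 0 \<le> p i" "\<And>i x. (i, x) \<in># M \<Longrightarrow> 1 \<le> i \<and> 0 \<le> x \<and> x \<le> p i"
  shows "valid_strings M p"
  using assms unfolding valid_strings_def by fastforce

lemma valid_stringsD:
  assumes "valid_strings M p"
  shows "0 \<le> p i" "(i, x) \<in># M \<Longrightarrow> 1 \<le> i \<and> 0 \<le> x \<and> x \<le> p i"
  using assms unfolding valid_strings_def by auto

context
  fixes T B R l and p :: "nat \<Rightarrow> nat \<Rightarrow> int"
  defines "p \<equiv> vac T ((1, 1) # B) R"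
  assumes T: "valid_type T" and valid: "valid_rc T ((1, 1) # B) R" and g: "greedy T p R l"
begin

private lemma adm: "admissible T l"
  by (rule greedy_admissible[OF T g])

private lemma p_nonneg: "a \<in> nodes T \<Longrightarrow> 0 \<le> p a i"
  using valid by (simp add: valid_rc_def valid_strings_def p_def)

private lemma string_bounds: "a \<in> nodes T \<Longrightarrow> (i, x) \<in># R a \<Longrightarrow> 1 \<le> i \<and> 0 \<le> x \<and> x \<le> p a i"
  using valid valid_stringsD[of "R a" "p a"] unfolding valid_rc_def p_def by blast

private lemma second_difference:
  "a \<in> nodes T \<Longrightarrow> 1 \<le> i \<Longrightarrow> p a (i + 1) + p a (i - 1) - 2 * p a i
    = 2 * int (count (shape R a) i) - nbr_count T ((1, 1) # B) (shape R) a i"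
  unfolding p_def by (rule vacancy_second_difference_nbr)

private lemma slots_le_nbr_count:
  assumes a: "a \<in> nodes T"
  shows "of_bool (l (lower T a) = enat i) + of_bool (l (mid1 T a) = enat i) + of_bool (l (mid2 T a) = enat i)
    \<le> nbr_count T ((1, 1) # B) (shape R) a i"
proof -
  let ?X = "\<lambda>v. of_bool (l v = enat i) :: int"
  have "?X (top_index T) = 0" "?X 0 \<le> int (count_list ((1, 1) # B) (1, i))"
    using adm by (auto simp: admissible_def one_enat_def)
  then have "?X (lower T a) + ?X (mid1 T a) + ?X (mid2 T a) + ?X (above T a)
      \<le> nbr_count T ((1, 1) # B) (shape R) a i"
    by (intro nbr_count_ge[OF T a] greedy_count_le_shape[OF T g])
  moreover have "0 \<le> ?X (above T a)" by simp
  ultimately show ?thesis by linarith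
qed

text \<open>A vacancy number 0 squeezes all riggings of that length to 0, so every such string is
  singular.\<close>

private lemma zero_strings:
  assumes "a \<in> nodes T" "p a j = 0"
  shows "count (shape R a) j = count (R a) (j, p a j)"
  unfolding shape_def
proof (rule count_shape_unique)
  fix y assume "(j, y) \<in># R a"
  then show "y = p a j" using string_bounds[OF assms(1)] assms(2) by fastforce
qed

private lemma first_least: "a \<in> nodes T \<Longrightarrow> (i, p a i) \<in># R a \<Longrightarrow> l (lower T a) \<le> enat i \<Longrightarrow> l a \<le> enat i"
proof -
  assume a: "a \<in> nodes T" "(i, p a i) \<in># R a" "l (lower T a) \<le> enat i"
  have "l a = least_from (l (lower T a)) (\<lambda>i. (i, p a i) \<in># R a)"
    using g a(1) unfolding greedy_def by blast
  then show ?thesis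
    using a least_from_le[of "\<lambda>i. (i, p a i) \<in># R a"] by simp
qed

private lemma second_least:
  assumes a: "a \<in> nodes T" "(i, p a i) \<in># R a" "l (mid1 T a) \<le> enat i" "l (mid2 T a) \<le> enat i" "enat i < l (upper T a)"
  shows "l a = enat i \<and> count (R a) (i, p a i) = 1"
proof -
  let ?Q = "\<lambda>i. (i, p a i) \<in># R a \<and> (enat i = l a \<longrightarrow> 2 \<le> count (R a) (i, p a i))"
  have "l (upper T a) = least_from (max (l (mid1 T a)) (l (mid2 T a))) ?Q"
    using g a(1) unfolding greedy_def by blast
  then have "l (upper T a) \<le> enat i" if "?Q i"
    using a(3,4) least_from_le[of ?Q i "max (l (mid1 T a)) (l (mid2 T a))"] that by simp
  then have "\<not> ?Q i"
    using a(5) by (meson leD)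
  then have "l a = enat i" "\<not> 2 \<le> count (R a) (i, p a i)"
    using a(2) by auto
  moreover have "0 < count (R a) (i, p a i)"
    using a by simp
  ultimately show ?thesis
    by linarith
qed

text \<open>A zero of p in the range passed over would lie on a run of zeros free of strings, since
  a string there would be singular and be selected. The run reaches down to the start u of the
  search, where what has length u at the slot below makes \<open>nbr_count\<close> positive.\<close>

private lemma vacancy_pos_first:
  assumes a: "a \<in> nodes T" and i: "l (lower T a) \<le> enat i" "enat i < l a"
  shows "0 < p a i"
proof -
  obtain u where u: "l (lower T a) = enat u"
    using i by (cases "l (lower T a)") auto
  show ?thesis
  proof (rule zero_run_down[of "p a" "\<lambda>i. int (count (shape R a) i)" "nbr_count T ((1, 1) # B) (shape R) a" u])
    show "1 \<le> u" "u \<le> i"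
      using admissible_lower_ge_1[OF T adm a] u i by (simp_all add: one_enat_def)
    show "int (count (shape R a) j) = 0" if "u \<le> j" "j \<le> i" "p a j = 0" for j
    proof (rule ccontr)
      assume "int (count (shape R a) j) \<noteq> 0"
      then have "(j, p a j) \<in># R a"
        using zero_strings[OF a that(3)] by (simp flip: count_greater_zero_iff)
      then have "l a \<le> enat j"
        using first_least[OF a] that(1) u by simp
      then show False
        using i that(2) by (meson enat_ord_simps(1) leD order_trans)
    qed
    show "0 < nbr_count T ((1, 1) # B) (shape R) a u"
      using slots_le_nbr_count[OF a, of u] u by (auto simp: of_bool_def split: if_splits)
  qed (use p_nonneg[OF a] second_difference[OF a] nbr_count_nonneg in auto)
qed

text \<open>The same run, started at the maximum u of the two middle lengths; but the singular
  string consumed at index a may still lie on it and has to be disregarded.\<close>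

private lemma vacancy_pos_second:
  assumes a: "a \<in> nodes T" and i: "l (mid1 T a) \<le> enat i" "l (mid2 T a) \<le> enat i" "enat i < l (upper T a)"
  shows "0 < p a i"
proof -
  obtain u1 u2 v where u: "l (mid1 T a) = enat u1" "l (mid2 T a) = enat u2" "l a = enat v"
    using i admissibleD(2)[OF adm a] by (meson enat_ile order_trans)
  define u where "u = max u1 u2"
  have vu: "v \<le> u1" "v \<le> u2" "1 \<le> v"
    using admissibleD(2,3)[OF adm a] admissible_ge_1[OF T adm a] u by (auto simp: one_enat_def)
  note slots = slots_le_nbr_count[OF a, of u, unfolded u]
  show ?thesis
  proof (rule zero_run_down_except[of "p a" "\<lambda>i. int (count (shape R a) i)" "nbr_count T ((1, 1) # B) (shape R) a" u _ v])
    show "1 \<le> u" "u \<le> i" "v \<le> u"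
      using vu u i by (auto simp: u_def)
    show "int (count (shape R a) j) = 0 \<or> j = v \<and> int (count (shape R a) j) = 1"
      if "u \<le> j" "j \<le> i" "p a j = 0" for j
    proof (cases "(j, p a j) \<in># R a")
      case True
      have "enat j < l (upper T a)"
        using i that(2) by (meson enat_ord_simps(1) le_less_trans)
      then have "l a = enat j \<and> count (R a) (j, p a j) = 1"
        using second_least[OF a True] that u by (simp add: u_def)
      then show ?thesis
        using u zero_strings[OF a that(3)] by simp
    next
      case False
      then show ?thesis
        using zero_strings[OF a that(3)] by (simp add: not_in_iff)
    qed
    show "0 < nbr_count T ((1, 1) # B) (shape R) a u"
      using slots by (auto simp: u_def max_def of_bool_def split: if_splits)
    show "2 \<le> nbr_count T ((1, 1) # B) (shape R) a v" if "u = v"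
      using slots vu that by (auto simp: u_def max_def of_bool_def split: if_splits)
    \<comment> \<open>If the two middle slots already account for the value 2 of
      \<open>nbr_count\<close>, then \<open>lower T a\<close> does not have length v. So v - 1 still
      belongs to the first range, where p is positive.\<close>
    show "0 < p a (v - 1)" if uv: "u = v" "nbr_count T ((1, 1) # B) (shape R) a v = 2"
    proof (rule vacancy_pos_first[OF a])
      have "l (lower T a) \<noteq> enat v"
        using slots uv vu by (auto simp: u_def max_def of_bool_def split: if_splits)
      then show "l (lower T a) \<le> enat (v - 1)"
        using admissibleD(1)[OF adm a] u vu by (cases "l (lower T a)") auto
      show "enat (v - 1) < l a"
        using u vu by simp
    qed
  qed (use p_nonneg[OF a] second_difference[OF a] nbr_count_nonneg in auto)
qed

lemma greedy_valid_step:
  defines "R' \<equiv> delta T (mult_array ((1, 1) # B)) (mult_array B) R"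
  shows "valid_step T l p R (vac T B R') R'" "valid_rc T B R'"
    "rc_weight T ((1, 1) # B) R a = rc_weight T B R' a + index_weight T (support T l) a"
proof -
  define p' where "p' = vac T B R'"
  have s: "step T l p R p' R'"
    using greedy_step[OF T, of "mult_array ((1, 1) # B)" R l "mult_array B"] g
    unfolding R'_def p'_def p_def by simp
  then obtain K where K: "\<And>a. R a = K a + image_mset (\<lambda>i. (i, p a i)) (sel T l a)"
    "\<And>a. R' a = K a + image_mset (\<lambda>i. (i, p' a i)) (shorten (sel T l a))"
    unfolding step_def by metis
  have KR: "(i, x) \<in># R a" if "(i, x) \<in># K a" for i x a
    unfolding K(1)[of a] using that by simp
  have shapes: "shape R b = image_mset fst (K b) + sel T l b" "shape R' b = image_mset fst (K b) + shorten (sel T l b)" for b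
    unfolding shape_def K(1)[of b] K(2)[of b] by (simp_all add: shape_graph)
  show "rc_weight T ((1, 1) # B) R a = rc_weight T B R' a + index_weight T (support T l) a"
    by (rule rc_weight_of_step[OF T adm shapes])
  have change: "p' a i = p a i + vacancy_change T l a i" if "a \<in> nodes T" for a i
    unfolding p'_def p_def by (rule vacancy_of_step[OF T adm that shapes])
  \<comment> \<open>Where the vacancy number falls there is room for it: p is positive and no kept
    string is singular. Validity of the result rests on this.\<close>
  have neg: "0 < p a i \<and> (i, p a i) \<notin># K a" if a: "a \<in> nodes T" and change_neg: "vacancy_change T l a i < 0" for a i
  proof -
    consider "l (lower T a) \<le> enat i" "enat i < l a"
      | "l (mid1 T a) \<le> enat i" "l (mid2 T a) \<le> enat i" "enat i < l (upper T a)"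
      using vacancy_change_sign(2)[OF adm a change_neg] by blast
    then show ?thesis
    proof cases
      case 1
      have "(i, p a i) \<notin># K a"
        using first_least[OF a KR[of i "p a i" a] 1(1)] 1(2) by (meson leD)
      then show ?thesis
        using vacancy_pos_first[OF a 1] by blast
    next
      case 2
      have "(i, p a i) \<notin># K a"
      proof
        assume *: "(i, p a i) \<in># K a"
        then have "l a = enat i" and count: "count (R a) (i, p a i) = 1"
          using second_least[OF a KR[OF *] 2] by auto
        then have "i \<in># sel T l a"
          using a by (simp add: sel_def)
        then have "0 < count (image_mset (\<lambda>i. (i, p a i)) (sel T l a)) (i, p a i)"
          by simp
        moreover have "count (R a) (i, p a i) = count (K a) (i, p a i) + count (image_mset (\<lambda>i. (i, p a i)) (sel T l a)) (i, p a i)"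
          by (subst K(1)) (rule count_union)
        ultimately show False
          using * count by (simp flip: count_greater_zero_iff)
      qed
      then show ?thesis
        using vacancy_pos_second[OF a 2] by blast
    qed
  qed
  have ge: "- 1 \<le> vacancy_change T l a i" if a: "a \<in> nodes T" for a i
    using vacancy_change_sign(1)[OF adm a, of i] by linarith
  have p'_nonneg: "0 \<le> p' a i" if a: "a \<in> nodes T" for a i
    using neg[OF a, of i] ge[OF a, of i] change[OF a, of i] p_nonneg[OF a, of i] by linarith
  have str: "1 \<le> i \<and> 0 \<le> x \<and> x \<le> p' a i" if a: "a \<in> nodes T" and ix: "(i, x) \<in># R' a" for a i x
  proof (cases "(i, x) \<in># K a")
    case True
    then have *: "1 \<le> i" "0 \<le> x" "x \<le> p a i"
      using string_bounds[OF a KR] by blast+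
    have "x \<le> p' a i"
    proof (cases "vacancy_change T l a i < 0")
      case neg_case: True
      then have "x \<noteq> p a i"
        using neg[OF a] True by blast
      then show ?thesis
        using * ge[OF a, of i] change[OF a, of i] by linarith
    next
      case False
      then show ?thesis
        using * change[OF a, of i] by linarith
    qed
    then show ?thesis using * by blast
  next
    case False
    then have "x = p' a i" "i \<in># shorten (sel T l a)"
      using ix K(2)[of a] by auto
    then show ?thesis
      using p'_nonneg[OF a] by (simp add: in_shorten)
  qed
  have vs: "valid_strings (R' a) (p' a)" if a: "a \<in> nodes T" for a
    using p'_nonneg[OF a] str[OF a] by (rule valid_stringsI)
  have "R' a = {#}" if "a \<notin> nodes T" for a
  proof -
    have "R a = {#}" using valid that by (simp add: valid_rc_def)
    then show ?thesis using K(1)[of a] K(2)[of a] that by (simp add: sel_def)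
  qed
  then show "valid_rc T B R'"
    using vs unfolding valid_rc_def p'_def by blast
  show "valid_step T l p R (vac T B R') R'"
    using s change vs T valid unfolding valid_step_def p'_def[symmetric] valid_rc_def p_def by blast
qed

end

section \<open>The inverse algorithm\<close>

definition index_ideal :: "cartan_type \<Rightarrow> nat set \<Rightarrow> bool" where
  "index_ideal T I \<longleftrightarrow> I \<subseteq> {1..<top_index T} \<and> (\<forall>a\<in>nodes T.
     (a \<in> I \<longrightarrow> lower T a \<in> insert 0 I) \<and> (mid1 T a \<in> I \<longrightarrow> a \<in> I) \<and> (mid2 T a \<in> I \<longrightarrow> a \<in> I)
     \<and> (upper T a \<in> I \<longrightarrow> mid1 T a \<in> I \<and> mid2 T a \<in> I) \<and> (above T a \<in> I \<longrightarrow> upper T a \<in> I))"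

lemma index_idealD:
  assumes "index_ideal T I" "a \<in> nodes T"
  shows "a \<in> I \<Longrightarrow> lower T a \<in> insert 0 I" "mid1 T a \<in> I \<Longrightarrow> a \<in> I" "mid2 T a \<in> I \<Longrightarrow> a \<in> I"
    "upper T a \<in> I \<Longrightarrow> mid1 T a \<in> I" "upper T a \<in> I \<Longrightarrow> mid2 T a \<in> I" "above T a \<in> I \<Longrightarrow> upper T a \<in> I"
  using assms unfolding index_ideal_def by blast+

lemma support_downward:
  assumes "admissible T l" "w \<in> support T l" "l v \<le> l w" "1 \<le> v" "v \<le> top_index T"
  shows "v \<in> support T l"
proof -
  have "l v \<noteq> \<infinity>"
  proof
    assume "l v = \<infinity>"
    then have "l w = \<infinity>" using assms(3) by simp
    then show False using assms(2) by (simp add: support_def)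
  qed
  then have "v \<noteq> top_index T"
    using assms(1) by (auto simp: admissible_def)
  then show ?thesis
    using \<open>l v \<noteq> \<infinity>\<close> assms(4,5) by (simp add: support_def)
qed

lemma index_ideal_support:
  assumes "valid_type T" "admissible T l"
  shows "index_ideal T (support T l)"
  unfolding index_ideal_def
proof (intro conjI ballI impI)
  show "support T l \<subseteq> {1..<top_index T}"
    by (auto simp: support_def)
  fix a assume a: "a \<in> nodes T"
  note o = index_order[OF assms(1) a] and d = admissibleD[OF assms(2) a]
  have a1: "1 \<le> a"
    using a zero_notin_nodes[of T] by (cases a) auto
  show "lower T a \<in> insert 0 (support T l)" if "a \<in> support T l"
    using support_downward[OF assms(2) that d(1)] o(1,17) by (cases "lower T a = 0") auto
  show "a \<in> support T l" if "mid1 T a \<in> support T l"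
    using support_downward[OF assms(2) that d(2)] o(17) a1 by simp
  show "a \<in> support T l" if "mid2 T a \<in> support T l"
    using support_downward[OF assms(2) that d(3)] o(17) a1 by simp
  show "mid1 T a \<in> support T l" if "upper T a \<in> support T l"
    using support_downward[OF assms(2) that d(4)] o(4,7) by simp
  show "mid2 T a \<in> support T l" if "upper T a \<in> support T l"
    using support_downward[OF assms(2) that d(5)] o(5,8) by simp
  show "upper T a \<in> support T l" if "above T a \<in> support T l"
    using support_downward[OF assms(2) that d(6)] o(6,9) by simp
qed

definition greatest_below :: "enat \<Rightarrow> (nat \<Rightarrow> bool) \<Rightarrow> enat \<Rightarrow> bool" where
  "greatest_below b Q r \<longleftrightarrow> (\<exists>i. r = enat i \<and> r \<le> b \<and> Q i \<and> (\<forall>j. Q j \<and> enat j \<le> b \<longrightarrow> j \<le> i))"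

lemma greatest_below_exists:
  assumes "Q 0" "finite {j. Q j}"
  shows "\<exists>r. greatest_below b Q r"
proof -
  let ?S = "{j. Q j \<and> enat j \<le> b}"
  have fin: "finite ?S"
    using assms(2) by (rule rev_finite_subset) auto
  have "0 \<in> ?S"
    using assms(1) by (simp flip: zero_enat_def)
  then have "Max ?S \<in> ?S"
    using Max_in[OF fin] by blast
  then show ?thesis
    unfolding greatest_below_def using Max_ge[OF fin] by auto
qed

lemma greatest_belowD:
  assumes "greatest_below b Q r"
  shows "r \<le> b" "r \<noteq> \<infinity>" "r = enat i \<Longrightarrow> Q i" "Q j \<Longrightarrow> enat j \<le> b \<Longrightarrow> enat j \<le> r"
  using assms unfolding greatest_below_def by auto

text \<open>The mirror image of \<open>greedy\<close>, running down from \<open>top_index\<close>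
  inside I. The length 0 is always available and stands for a string still to be created, of length
  1 after lengthening. Here the upper index of a node chooses first, so it is the lower one that may
  need a second copy.\<close>

definition back_greedy :: "cartan_type \<Rightarrow> (nat \<Rightarrow> nat \<Rightarrow> int) \<Rightarrow> rigged_configuration \<Rightarrow> nat set \<Rightarrow> (nat \<Rightarrow> enat) \<Rightarrow> bool" where
  "back_greedy T p R I k \<longleftrightarrow> (\<forall>v. v \<notin> I \<longrightarrow> k v = \<infinity>) \<and> (\<forall>a\<in>nodes T.
      (a \<in> I \<longrightarrow> greatest_below (min (k (mid1 T a)) (k (mid2 T a)))
         (\<lambda>i. i = 0 \<or> (i, p a i) \<in># R a \<and> (k (upper T a) = enat i \<longrightarrow> 2 \<le> count (R a) (i, p a i))) (k a))
    \<and> (upper T a \<in> I \<longrightarrow> greatest_below (k (above T a)) (\<lambda>i. i = 0 \<or> (i, p a i) \<in># R a) (k (upper T a))))"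

lemma finite_lengths: "finite {i. i = 0 \<or> (i, f i) \<in># M \<and> P i}"
proof (rule finite_subset)
  show "{i. i = 0 \<or> (i, f i) \<in># M \<and> P i} \<subseteq> insert 0 (fst ` set_mset M)"
    by force
qed simp

text \<open>Recursion on the distance to \<open>top_index\<close>: all indices that a choice refers
  to lie above it. Each choice is specified by a relation, hence
  \<open>dependent_wf_choice\<close>.\<close>

lemma back_greedy_exists:
  assumes T: "valid_type T" and I: "index_ideal T I"
  shows "\<exists>k. back_greedy T p R I k"
proof -
  define P where "P k v r \<longleftrightarrow> (v \<notin> I \<longrightarrow> r = \<infinity>)
    \<and> (v \<in> I \<longrightarrow> v \<in> nodes T \<longrightarrow> greatest_below (min (k (mid1 T v)) (k (mid2 T v)))
         (\<lambda>i. i = 0 \<or> (i, p v i) \<in># R v \<and> (k (upper T v) = enat i \<longrightarrow> 2 \<le> count (R v) (i, p v i))) r)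
    \<and> (\<forall>a\<in>nodes T. v \<in> I \<longrightarrow> v = upper T a \<longrightarrow> greatest_below (k (above T a)) (\<lambda>i. i = 0 \<or> (i, p a i) \<in># R a) r)"
    for k :: "nat \<Rightarrow> enat" and v r
  have not_top: "v \<noteq> top_index T" if "v \<in> I" for v
    using that I by (auto simp: index_ideal_def)
  have "\<exists>k. \<forall>v. P k v (k v)"
  proof (rule dependent_wf_choice[of "measure (\<lambda>v. top_index T - v)"])
    fix f g :: "nat \<Rightarrow> enat" and v r
    assume fg: "\<And>z. (z, v) \<in> measure (\<lambda>v. top_index T - v) \<Longrightarrow> f z = g z"
    have 1: "f w = g w" if "v < w" "w \<le> top_index T" for w
      using fg[of w] that by simp
    have 2: "f (mid1 T v) = g (mid1 T v)" "f (mid2 T v) = g (mid2 T v)" "f (upper T v) = g (upper T v)"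
      if "v \<in> nodes T"
      using 1 index_order[OF T that] by blast+
    have 3: "f (above T a) = g (above T a)" if "v \<in> I" "a \<in> nodes T" "v = upper T a" for a
      using 1 index_order[OF T that(2)] that not_top by blast
    show "P f v r = P g v r"
      unfolding P_def using 2 3 by (intro conj_cong imp_cong ball_cong refl) auto
  next
    fix v f
    have Q: "\<exists>r. greatest_below b (\<lambda>i. i = 0 \<or> (i, p a i) \<in># R a \<and> S i) r" for b a S
      by (intro greatest_below_exists finite_lengths) simp
    consider "v \<notin> I" | "v \<in> I" "v \<in> nodes T" | a where "v \<in> I" "a \<in> nodes T" "v = upper T a"
    proof (cases "v \<in> I")
      case True
      then have "v < top_index T" "v \<noteq> 0"
        using I by (auto simp: index_ideal_def)
      with T show ?thesis
        by (cases rule: index_cases) (use that True in auto)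
    qed (rule that(1))
    then show "\<exists>r. P f v r"
    proof cases
      case 1
      then show ?thesis by (simp add: P_def)
    next
      case 2
      then have "v \<noteq> upper T a" if "a \<in> nodes T" for a
        using index_order(16)[OF T that] not_top by metis
      then show ?thesis
        using 2 Q[of _ v] by (auto simp: P_def)
    next
      case (3 a)
      then have "v \<notin> nodes T" "\<And>b. b \<in> nodes T \<Longrightarrow> v = upper T b \<Longrightarrow> b = a"
        using index_order(16)[OF T 3(2)] not_top upper_inj[OF T] by metis+
      moreover obtain r where "greatest_below (f (above T a)) (\<lambda>i. i = 0 \<or> (i, p a i) \<in># R a) r"
        using Q[of "f (above T a)" a "\<lambda>_. True"] by auto
      ultimately show ?thesis
        using 3 unfolding P_def by blast
    qed
  qed simp
  then obtain k where "\<And>v. P k v (k v)" by blast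
  then have "back_greedy T p R I k"
    unfolding back_greedy_def P_def by blast
  then show ?thesis by blast
qed

text \<open>The generating relations read from their lower end, the form in which
  \<open>back_greedy\<close> supplies inequalities.\<close>

lemma covers_back:
  assumes "valid_type T" "covers T v w"
  shows "w = top_index T \<or> v = 0 \<or> v \<in> nodes T \<and> (w = mid1 T v \<or> w = mid2 T v)
    \<or> (\<exists>b\<in>nodes T. v = upper T b \<and> w = above T b)"
proof (cases T)
  case (TypeA n)
  then show ?thesis using assms by (cases "v = 0") (auto simp: covers_def)
next
  case (TypeD n)
  obtain m where m: "n = m + 4"
    using assms(1) TypeD by (metis add.commute le_Suc_ex valid_type.simps(2))
  from assms(2) show ?thesis
    unfolding covers_def
  proof (elim disjE conjE bexE)
    assume w: "w \<in> nodes T" "v = lower T w"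
    show ?thesis
    proof (cases "w = m + 4")
      case True
      then have "v = m + 2" using w TypeD m by simp
      then show ?thesis using True TypeD m by simp
    next
      case False
      then have "v = w - 1" "w \<le> m + 3" "1 \<le> w" using w TypeD m by auto
      then show ?thesis using TypeD m by (cases "v = 0") auto
    qed
  next
    fix b assume b: "b \<in> nodes T" "w = upper T b" "v = mid1 T b" "upper T v = top_index T"
    show ?thesis
    proof (cases "b \<le> m + 2")
      case True
      then have "v = b + 1" using b(3) TypeD m by simp
      moreover have "b = m + 2"
      proof (rule ccontr)
        assume "b \<noteq> m + 2"
        then have "upper T v = 2 * m + 6 - b" using True TypeD m \<open>v = b + 1\<close> by simp
        then show False using b(4) TypeD m by simp
      qed
      ultimately show ?thesis using b(2) TypeD m by simp
    next
      case False
      then show ?thesis using b TypeD m by simp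
    qed
  next
    fix b assume b: "b \<in> nodes T" "w = upper T b" "v = mid2 T b"
    consider "b < m + 2" | "b = m + 2" | "b > m + 2" by linarith
    then show ?thesis
    proof cases
      case 1
      then have "Suc b \<in> nodes T" "v = upper T (Suc b)" "w = above T (Suc b)"
        using b TypeD m by auto
      then show ?thesis by blast
    next
      case 2
      then show ?thesis using b TypeD m by simp
    next
      case 3
      then show ?thesis using b TypeD m by simp
    qed
  qed
qed

context
  fixes T B R' I k and p' :: "nat \<Rightarrow> nat \<Rightarrow> int"
  defines "p' \<equiv> vac T B R'"
  assumes T: "valid_type T" and valid: "valid_rc T B R'" and I: "index_ideal T I"
    and dom: "\<And>a. a \<in> nodes T \<Longrightarrow> 0 \<le> rc_weight T B R' a + index_weight T I a"
    and k: "back_greedy T p' R' I k"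
begin

private lemma not_in: "v \<notin> I \<Longrightarrow> k v = \<infinity>"
  using k by (simp add: back_greedy_def)

private lemma first_spec: "a \<in> nodes T \<Longrightarrow> a \<in> I \<Longrightarrow> greatest_below (min (k (mid1 T a)) (k (mid2 T a)))
         (\<lambda>i. i = 0 \<or> (i, p' a i) \<in># R' a \<and> (k (upper T a) = enat i \<longrightarrow> 2 \<le> count (R' a) (i, p' a i))) (k a)"
  using k unfolding back_greedy_def by blast

private lemma second_spec: "a \<in> nodes T \<Longrightarrow> upper T a \<in> I \<Longrightarrow>
    greatest_below (k (above T a)) (\<lambda>i. i = 0 \<or> (i, p' a i) \<in># R' a) (k (upper T a))"
  using k unfolding back_greedy_def by blast

private lemma finite_iff: "v \<in> I \<longleftrightarrow> k v \<noteq> \<infinity>"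
proof (cases "v \<in> I")
  case True
  then have "v < top_index T" "v \<noteq> 0"
    using I by (auto simp: index_ideal_def)
  with T have "k v \<noteq> \<infinity>"
  proof (cases rule: index_cases)
    case 1
    then show ?thesis using \<open>v \<noteq> 0\<close> by blast
  next
    case 2
    then show ?thesis using greatest_belowD(2)[OF first_spec] True by blast
  next
    case (3 a)
    then show ?thesis using greatest_belowD(2)[OF second_spec] True by blast
  qed
  then show ?thesis using True by blast
qed (simp add: not_in)

private lemma not_ends: "0 \<notin> I" "top_index T \<notin> I"
  using I by (auto simp: index_ideal_def)

private lemma in_if_less: "k v < x \<Longrightarrow> v \<in> I"
  using not_in[of v] by (cases "v \<in> I") simp_all

private lemma first_le:
  assumes a: "a \<in> nodes T"
  shows "k a \<le> k (mid1 T a)" "k a \<le> k (mid2 T a)"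
proof -
  have "k a \<le> k (mid1 T a) \<and> k a \<le> k (mid2 T a)"
  proof (cases "a \<in> I")
    case True
    then show ?thesis using greatest_belowD(1)[OF first_spec[OF a]] by simp
  next
    case False
    then have "mid1 T a \<notin> I" "mid2 T a \<notin> I"
      using index_idealD(2,3)[OF I a] by blast+
    then show ?thesis by (simp add: not_in)
  qed
  then show "k a \<le> k (mid1 T a)" "k a \<le> k (mid2 T a)" by auto
qed

private lemma second_le:
  assumes a: "a \<in> nodes T"
  shows "k (upper T a) \<le> k (above T a)"
proof (cases "upper T a \<in> I")
  case True
  then show ?thesis using greatest_belowD(1)[OF second_spec[OF a]] by simp
next
  case False
  then have "above T a \<notin> I"
    using index_idealD(6)[OF I a] by blast
  then show ?thesis by (simp add: not_in)
qed

private lemma nonzero: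
  assumes a: "a \<in> nodes T"
  shows "a \<noteq> 0" "upper T a \<noteq> 0" "mid1 T a \<noteq> 0" "mid2 T a \<noteq> 0" "above T a \<noteq> 0"
proof -
  show "a \<noteq> 0" using a zero_notin_nodes by metis
  show "upper T a \<noteq> 0" "mid1 T a \<noteq> 0" "mid2 T a \<noteq> 0" using index_order(4-6)[OF T a] by auto
  show "above T a \<noteq> 0" using index_order(6,13,15)[OF T a] by (cases "upper T a = top_index T") auto
qed

text \<open>The lengths \<open>k\<close> are those of the strings to be lengthened, so the inverse step selects \<open>k + 1\<close>.\<close>

private definition l :: "nat \<Rightarrow> enat" where
  "l v = (if v = 0 then 1 else eSuc (k v))"

private lemma back_adm: "admissible T l"
proof (rule monotone_imp_admissible[OF T])
  show "l 0 = 1" by (simp add: l_def)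
  show "l (top_index T) = \<infinity>"
    using T not_in[OF not_ends(2)] by (cases T) (auto simp: l_def)
  show "l v \<le> l w" if vw: "covers T v w" for v w
    using covers_back[OF T vw]
  proof (elim disjE conjE bexE)
    assume "w = top_index T"
    then show ?thesis using \<open>l (top_index T) = \<infinity>\<close> by simp
  next
    assume "v = 0"
    then show ?thesis by (auto simp: l_def one_eSuc)
  next
    assume "v \<in> nodes T" "w = mid1 T v"
    then show ?thesis using first_le[of v] nonzero[of v] by (simp add: l_def)
  next
    assume "v \<in> nodes T" "w = mid2 T v"
    then show ?thesis using first_le[of v] nonzero[of v] by (simp add: l_def)
  next
    fix b assume b: "b \<in> nodes T" "v = upper T b" "w = above T b"
    then show ?thesis using second_le[of b] nonzero[of b] by (simp add: l_def)
  qed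
qed

private lemma eSuc_eq_Suc: "eSuc x = enat (Suc i) \<longleftrightarrow> x = enat i"
  by (cases x) (auto simp: eSuc_enat)

private lemma eSuc_le_iff: "eSuc x \<le> enat i \<longleftrightarrow> x < enat i"
  by (cases x) (auto simp: eSuc_enat)

private lemma eSuc_eq_infinity: "eSuc x = \<infinity> \<longleftrightarrow> x = \<infinity>"
  by (cases x) (auto simp: eSuc_enat)

private lemma supp: "support T l = I"
proof (intro set_eqI)
  fix v
  show "v \<in> support T l \<longleftrightarrow> v \<in> I"
    using I finite_iff[of v] by (auto simp: support_def l_def index_ideal_def eSuc_eq_infinity simp del: not_infinity_eq)
qed

private lemma l_eq: "a \<in> nodes T \<Longrightarrow> l a = eSuc (k a)" "a \<in> nodes T \<Longrightarrow> l (upper T a) = eSuc (k (upper T a))"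
  "a \<in> nodes T \<Longrightarrow> l (mid1 T a) = eSuc (k (mid1 T a))" "a \<in> nodes T \<Longrightarrow> l (mid2 T a) = eSuc (k (mid2 T a))"
  "a \<in> nodes T \<Longrightarrow> l (above T a) = eSuc (k (above T a))"
  using nonzero[of a] by (simp_all add: l_def)

private lemma count_shorten_sel:
  "a \<in> nodes T \<Longrightarrow> 1 \<le> i \<Longrightarrow> count (shorten (sel T l a)) i = of_bool (k a = enat i) + of_bool (k (upper T a) = enat i)"
  by (auto simp: count_shorten sel_def finite_length_count l_eq eSuc_eq_Suc)

private lemma first_available:
  assumes "a \<in> nodes T" "k a = enat i" "1 \<le> i"
  shows "(i, p' a i) \<in># R' a" "k (upper T a) = enat i \<Longrightarrow> 2 \<le> count (R' a) (i, p' a i)"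
proof -
  have "a \<in> I" using assms(2) finite_iff by simp
  note * = greatest_belowD(3)[OF first_spec[OF assms(1) this] assms(2)]
  show "(i, p' a i) \<in># R' a" "k (upper T a) = enat i \<Longrightarrow> 2 \<le> count (R' a) (i, p' a i)"
    using * assms(3) by auto
qed

private lemma second_available:
  assumes "a \<in> nodes T" "k (upper T a) = enat i" "1 \<le> i"
  shows "(i, p' a i) \<in># R' a"
proof -
  have "upper T a \<in> I" using assms(2) finite_iff by simp
  then show ?thesis
    using greatest_belowD(3)[OF second_spec[OF assms(1)] assms(2)] assms(3) by auto
qed

private lemma first_greatest:
  assumes a: "a \<in> nodes T" "(i, p' a i) \<in># R' a" "k a < enat i" "enat i \<le> k (mid1 T a)" "enat i \<le> k (mid2 T a)"
  shows "k (upper T a) = enat i \<and> count (R' a) (i, p' a i) = 1"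
proof -
  let ?Q = "\<lambda>i. i = 0 \<or> (i, p' a i) \<in># R' a \<and> (k (upper T a) = enat i \<longrightarrow> 2 \<le> count (R' a) (i, p' a i))"
  have "a \<in> I" by (rule in_if_less[OF a(3)])
  then have "greatest_below (min (k (mid1 T a)) (k (mid2 T a))) ?Q (k a)"
    by (rule first_spec[OF a(1)])
  then have "enat i \<le> k a" if "?Q i"
    using greatest_belowD(4)[of _ ?Q _ i] that a(4,5) by simp
  then have "\<not> ?Q i"
    using a(3) by (meson leD)
  then have "k (upper T a) = enat i" "\<not> 2 \<le> count (R' a) (i, p' a i)"
    using a(2) by auto
  moreover have "0 < count (R' a) (i, p' a i)"
    using a by simp
  ultimately show ?thesis by linarith
qed

private lemma second_greatest:
  assumes a: "a \<in> nodes T" "(i, p' a i) \<in># R' a" "k (upper T a) < enat i"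
  shows "k (above T a) < enat i"
proof (rule ccontr)
  assume "\<not> ?thesis"
  then have *: "enat i \<le> k (above T a)" by simp
  have "upper T a \<in> I" by (rule in_if_less[OF a(3)])
  then have "enat i \<le> k (upper T a)"
    using greatest_belowD(4)[OF second_spec[OF a(1)]] a(2) * by blast
  then show False
    using a(3) by (meson leD)
qed

private lemma p'_nonneg: "a \<in> nodes T \<Longrightarrow> 0 \<le> p' a i"
  using valid by (simp add: valid_rc_def valid_strings_def p'_def)

private lemma back_string_bounds: "a \<in> nodes T \<Longrightarrow> (i, x) \<in># R' a \<Longrightarrow> 1 \<le> i \<and> 0 \<le> x \<and> x \<le> p' a i"
  using valid valid_stringsD[of "R' a" "p' a"] unfolding valid_rc_def p'_def by blast

private lemma back_second_difference:
  "a \<in> nodes T \<Longrightarrow> 1 \<le> i \<Longrightarrow> p' a (i + 1) + p' a (i - 1) - 2 * p' a i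
    = 2 * int (count (shape R' a) i) - nbr_count T B (shape R') a i"
  unfolding p'_def by (rule vacancy_second_difference_nbr)

private lemma sel_subset: "image_mset (\<lambda>i. (i, p' a i)) (shorten (sel T l a)) \<subseteq># R' a"
proof (cases "a \<in> nodes T")
  case False
  then show ?thesis by (simp add: sel_def)
next
  case a: True
  show ?thesis
  proof (rule mset_subset_eqI)
    fix s :: "nat \<times> int"
    obtain i x where s: "s = (i, x)" by force
    show "count (image_mset (\<lambda>i. (i, p' a i)) (shorten (sel T l a))) s \<le> count (R' a) s"
    proof (cases "1 \<le> i \<and> x = p' a i")
      case True
      then have i: "1 \<le> i" by simp
      have "k a = enat i \<Longrightarrow> 1 \<le> count (R' a) (i, p' a i)" "k (upper T a) = enat i \<Longrightarrow> 1 \<le> count (R' a) (i, p' a i)"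
        using first_available(1)[OF a _ i] second_available[OF a _ i] by (simp_all add: Suc_leI)
      then show ?thesis
        using first_available(2)[OF a _ i] True
        by (auto simp: s count_image_graph count_shorten_sel[OF a i] of_bool_def)
    next
      case False
      have "0 \<notin># shorten (sel T l a)"
        by (simp add: in_shorten)
      then have "count (image_mset (\<lambda>i. (i, p' a i)) (shorten (sel T l a))) s = 0"
        using False by (cases "i = 0") (auto simp: s count_image_graph not_in_iff)
      then show ?thesis by simp
    qed
  qed
qed

private lemma back_slots_le_nbr_count:
  assumes a: "a \<in> nodes T" and i: "1 \<le> i"
  shows "of_bool (k (mid1 T a) = enat i) + of_bool (k (mid2 T a) = enat i) + of_bool (k (above T a) = enat i)
    \<le> nbr_count T B (shape R') a i"
proof -
  let ?X = "\<lambda>v. of_bool (k v = enat i) :: int"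
  have "?X b + ?X (upper T b) \<le> int (count (shape R' b) i)" if b: "b \<in> nodes T" for b
  proof -
    have "shorten (sel T l b) \<subseteq># shape R' b"
      using image_mset_subseteq_mono[OF sel_subset[of b], of fst] by (simp add: shape_def shape_graph)
    then have "count (shorten (sel T l b)) i \<le> count (shape R' b) i"
      by (rule mset_subset_eq_count)
    then show ?thesis
      using count_shorten_sel[OF b i] by (simp add: of_bool_def split: if_splits)
  qed
  moreover have "?X (top_index T) = 0" "?X 0 \<le> int (count_list B (1, i))"
    using not_in not_ends by auto
  ultimately have "?X (lower T a) + ?X (mid1 T a) + ?X (mid2 T a) + ?X (above T a)
      \<le> nbr_count T B (shape R') a i"
    by (intro nbr_count_ge[OF T a])
  moreover have "0 \<le> ?X (lower T a)" by simp
  ultimately show ?thesis by linarith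
qed

private lemma back_zero_strings:
  assumes "a \<in> nodes T" "p' a j = 0"
  shows "count (shape R' a) j = count (R' a) (j, p' a j)"
  unfolding shape_def
proof (rule count_shape_unique)
  fix y assume "(j, y) \<in># R' a"
  then show "y = p' a j" using back_string_bounds[OF assms(1)] assms(2) by fastforce
qed

text \<open>Dominance of the new weight enters here: if adding the letter lowers the weight at a by
  one, the old weight at a is at least 1, and so are the vacancy numbers for all large i.\<close>

private lemma vacancy_unbounded:
  assumes a: "a \<in> nodes T" and "index_weight T I a = - 1"
  shows "\<exists>N\<ge>i. 0 < p' a N"
proof -
  obtain N where "\<forall>i\<ge>N. p' a i = rc_weight T B R' a"
    using vacancy_eventually[OF a, of B R'] unfolding p'_def by blast
  then have "p' a (N + i) = rc_weight T B R' a" by simp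
  then have "0 < p' a (N + i)"
    using dom[OF a] assms(2) by simp
  then show ?thesis
    by (metis le_add2)
qed

text \<open>As in the forward direction, except that the range above the selected length may be
  unbounded. If it is bounded, the length chosen at the next index ends the run of zeros; if not,
  the positive stationary value of the vacancy numbers does.\<close>

private lemma back_vacancy_pos_second:
  assumes a: "a \<in> nodes T" and i: "k (upper T a) < enat i" "enat i \<le> k (above T a)"
  shows "0 < p' a i"
proof -
  have i1: "1 \<le> i"
    using i(1) by (cases "i = 0") (auto simp flip: zero_enat_def)
  have m: "int (count (shape R' a) j) = 0" if "i \<le> j" "enat j \<le> k (above T a)" "p' a j = 0" for j
  proof (rule ccontr)
    assume "int (count (shape R' a) j) \<noteq> 0"
    then have "(j, p' a j) \<in># R' a"
      using back_zero_strings[OF a that(3)] by (simp flip: count_greater_zero_iff)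
    moreover have "k (upper T a) < enat j"
      using i(1) that(1) by (meson enat_ord_simps(1) less_le_trans)
    ultimately show False
      using second_greatest[OF a] that(2) by (meson leD)
  qed
  show ?thesis
  proof (cases "k (above T a)")
    case (enat u)
    show ?thesis
    proof (rule zero_run_up[of "p' a" "\<lambda>i. int (count (shape R' a) i)" "nbr_count T B (shape R') a" i u])
      show "0 < nbr_count T B (shape R') a u"
        using back_slots_le_nbr_count[OF a, of u] enat i i1 by (auto simp: of_bool_def split: if_splits)
    qed (use i i1 enat m p'_nonneg[OF a] back_second_difference[OF a] nbr_count_nonneg in auto)
  next
    case infinity
    have up: "upper T a \<in> I" "above T a \<notin> I"
      using in_if_less[OF i(1)] infinity finite_iff[of "above T a"] by simp_all
    \<comment> \<open>All slots of a except \<open>above T a\<close> lie in I, which gives 1 + 1 + 1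
      - 2 - 2.\<close>
    then have "index_weight T I a = - 1"
      using a index_idealD[OF I a] by (auto simp: index_weight_def)
    then obtain N where "i \<le> N" "0 < p' a N"
      using vacancy_unbounded[OF a] by blast
    then show ?thesis
      by (intro zero_run_up_infinite[of "p' a" "\<lambda>i. int (count (shape R' a) i)" "nbr_count T B (shape R') a" i N])
       (use i1 infinity m p'_nonneg[OF a] back_second_difference[OF a] nbr_count_nonneg in auto)
  qed
qed

private lemma back_vacancy_pos_first:
  assumes a: "a \<in> nodes T" and i: "k a < enat i" "enat i \<le> k (mid1 T a)" "enat i \<le> k (mid2 T a)"
  shows "0 < p' a i"
proof -
  have i1: "1 \<le> i"
    using i(1) by (cases "i = 0") (auto simp flip: zero_enat_def)
  have above_mid: "k (mid1 T a) \<le> k (upper T a)" "k (mid2 T a) \<le> k (upper T a)"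
    using admissibleD(4,5)[OF back_adm a] by (simp_all add: l_eq a)
  have m: "int (count (shape R' a) j) = 0 \<or> k (upper T a) = enat j \<and> int (count (shape R' a) j) = 1"
    if "i \<le> j" "enat j \<le> k (mid1 T a)" "enat j \<le> k (mid2 T a)" "p' a j = 0" for j
  proof (cases "(j, p' a j) \<in># R' a")
    case True
    have "k a < enat j"
      using i(1) that(1) by (meson enat_ord_simps(1) less_le_trans)
    then show ?thesis
      using first_greatest[OF a True] that back_zero_strings[OF a that(4)] by simp
  next
    case False
    then show ?thesis
      using back_zero_strings[OF a that(4)] by (simp add: not_in_iff)
  qed
  show ?thesis
  proof (cases "min (k (mid1 T a)) (k (mid2 T a))")
    case (enat u)
    \<comment> \<open>Without a string selected at \<open>upper T a\<close> there is none to
      disregard; u + 1 then keeps v outside the run, which ends at u.\<close>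
    define v where "v = (case k (upper T a) of enat v \<Rightarrow> v | \<infinity> \<Rightarrow> u + 1)"
    have uv: "u \<le> v"
      using enat above_mid unfolding v_def min_def by (cases "k (upper T a)") (auto split: if_splits)
    have v: "k (upper T a) = enat j \<Longrightarrow> j = v" for j
      by (simp add: v_def)
    have iu: "i \<le> u" "k (mid1 T a) = enat u \<or> k (mid2 T a) = enat u" "enat u \<le> k (mid1 T a)" "enat u \<le> k (mid2 T a)"
      using enat i unfolding min_def by (auto split: if_splits)
    have both: "k (mid1 T a) = enat u" "k (mid2 T a) = enat u" "k (upper T a) = enat u" if "u = v"
    proof -
      show up: "k (upper T a) = enat u"
        using that by (cases "k (upper T a)") (auto simp: v_def)
      show "k (mid1 T a) = enat u" "k (mid2 T a) = enat u"
        using above_mid iu(3,4) unfolding up by (auto intro: antisym)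
    qed
    have slots: "of_bool (k (mid1 T a) = enat u) + of_bool (k (mid2 T a) = enat u) + of_bool (k (above T a) = enat u)
      \<le> nbr_count T B (shape R') a u"
      using back_slots_le_nbr_count[OF a, of u] iu i1 by simp
    show ?thesis
    proof (rule zero_run_up_except[of "p' a" "\<lambda>i. int (count (shape R' a) i)" "nbr_count T B (shape R') a" i u v])
      show "int (count (shape R' a) j) = 0 \<or> j = v \<and> int (count (shape R' a) j) = 1"
        if "i \<le> j" "j \<le> u" "p' a j = 0" for j
      proof -
        have "enat j \<le> k (mid1 T a)" "enat j \<le> k (mid2 T a)"
          using that(2) iu(3,4) by (meson enat_ord_simps(1) order_trans)+
        then show ?thesis using m[OF that(1) _ _ that(3)] v by blast
      qed
      show "0 < nbr_count T B (shape R') a u"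
        using slots iu(2) by (auto simp: of_bool_def split: if_splits)
      show "2 \<le> nbr_count T B (shape R') a v" if "u = v"
        using slots both[OF that] that by (auto simp: of_bool_def split: if_splits)
      \<comment> \<open>If both middle slots exhaust the value 2 of \<open>nbr_count\<close>, the
        index above has a length greater than v, so v + 1 lies in the range of
        \<open>back_vacancy_pos_second\<close>.\<close>
      show "0 < p' a (v + 1)" if uv: "u = v" "nbr_count T B (shape R') a v = 2"
      proof (rule back_vacancy_pos_second[OF a])
        show "k (upper T a) < enat (v + 1)"
          using both(3)[OF uv(1)] uv(1) by simp
        have "k (above T a) \<noteq> enat u"
          using slots both[OF uv(1)] uv by (auto simp: of_bool_def split: if_splits)
        moreover have "enat u \<le> k (above T a)"
          using second_le[OF a] both(3)[OF uv(1)] by simp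
        ultimately show "enat (v + 1) \<le> k (above T a)"
          using uv(1) by (cases "k (above T a)") auto
      qed
    qed (use uv iu i1 p'_nonneg[OF a] back_second_difference[OF a] nbr_count_nonneg in auto)
  next
    case infinity
    then have inf: "k (mid1 T a) = \<infinity>" "k (mid2 T a) = \<infinity>" "k (upper T a) = \<infinity>"
      using above_mid by (auto simp: min_def split: if_splits)
    then have "a \<in> I" "mid1 T a \<notin> I" "mid2 T a \<notin> I" "upper T a \<notin> I"
      using in_if_less[OF i(1)] finite_iff inf by (blast, metis+)
    \<comment> \<open>Only \<open>lower T a\<close> and a itself count, which gives 1 - 2.\<close>
    then have "index_weight T I a = - 1"
      using a index_idealD[OF I a] by (auto simp: index_weight_def)
    then obtain N where "i \<le> N" "0 < p' a N"
      using vacancy_unbounded[OF a] by blast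
    then show ?thesis
      by (intro zero_run_up_infinite[of "p' a" "\<lambda>i. int (count (shape R' a) i)" "nbr_count T B (shape R') a" i N])
       (use i1 inf m p'_nonneg[OF a] back_second_difference[OF a] nbr_count_nonneg in auto)
  qed
qed

lemma back_greedy_valid_step:
  "\<exists>R l. valid_step T l (vac T ((1, 1) # B) R) R p' R' \<and> valid_rc T ((1, 1) # B) R \<and> support T l = I"
proof -
  define K where "K a = R' a - image_mset (\<lambda>i. (i, p' a i)) (shorten (sel T l a))" for a
  define \<nu> where "\<nu> a = image_mset fst (K a) + sel T l a" for a
  \<comment> \<open>The riggings of R refer to its own vacancy numbers; these depend on the shape
    alone, so the shape is fixed before R.\<close>
  define p where "p = vacancy T (mult_array ((1, 1) # B)) \<nu>"
  define R where "R a = K a + image_mset (\<lambda>i. (i, p a i)) (sel T l a)" for a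
  have K: "R' a = K a + image_mset (\<lambda>i. (i, p' a i)) (shorten (sel T l a))" for a
    using sel_subset[of a] by (simp add: K_def)
  have KR: "(i, x) \<in># R' a" if "(i, x) \<in># K a" for i x a
    unfolding K[of a] using that by simp
  have shapes: "shape R b = image_mset fst (K b) + sel T l b" "shape R' b = image_mset fst (K b) + shorten (sel T l b)" for b
    unfolding shape_def R_def K[of b] by (simp_all add: shape_graph)
  have "shape R = \<nu>"
    by (auto simp: shapes \<nu>_def)
  then have p: "p = vac T ((1, 1) # B) R"
    by (simp add: p_def)
  have change: "p' a i = p a i + vacancy_change T l a i" if "a \<in> nodes T" for a i
    unfolding p'_def p by (rule vacancy_of_step[OF T back_adm that shapes])
  have s: "step T l p R p' R'"
    unfolding step_def using back_adm R_def K by blast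
  have pos: "0 < p' a i \<and> (i, p' a i) \<notin># K a" if a: "a \<in> nodes T" and change_pos: "0 < vacancy_change T l a i" for a i
  proof -
    consider "k a < enat i" "enat i \<le> k (mid1 T a)" "enat i \<le> k (mid2 T a)"
      | "k (upper T a) < enat i" "enat i \<le> k (above T a)"
      using vacancy_change_sign(3)[OF back_adm a change_pos] by (auto simp: l_eq a eSuc_le_iff)
    then show ?thesis
    proof cases
      case 1
      have "(i, p' a i) \<notin># K a"
      proof
        assume *: "(i, p' a i) \<in># K a"
        then have i: "1 \<le> i"
          using back_string_bounds[OF a KR] by blast
        have up: "k (upper T a) = enat i" and count: "count (R' a) (i, p' a i) = 1"
          using first_greatest[OF a KR[OF *] 1] by auto
        have "0 < count (image_mset (\<lambda>i. (i, p' a i)) (shorten (sel T l a))) (i, p' a i)"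
          using count_shorten_sel[OF a i] up by (simp add: count_image_graph)
        moreover have "count (R' a) (i, p' a i) = count (K a) (i, p' a i)
            + count (image_mset (\<lambda>i. (i, p' a i)) (shorten (sel T l a))) (i, p' a i)"
          by (subst K) (rule count_union)
        ultimately show False
          using * count by (simp flip: count_greater_zero_iff)
      qed
      then show ?thesis
        using back_vacancy_pos_first[OF a 1] by blast
    next
      case 2
      have "(i, p' a i) \<notin># K a"
        using second_greatest[OF a KR 2(1)] 2(2) by (meson leD)
      then show ?thesis
        using back_vacancy_pos_second[OF a 2] by blast
    qed
  qed
  have le: "vacancy_change T l a i \<le> 1" if a: "a \<in> nodes T" for a i
    using vacancy_change_sign(1)[OF back_adm a, of i] by linarith
  have p_nonneg: "0 \<le> p a i" if a: "a \<in> nodes T" for a i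
    using pos[OF a, of i] le[OF a, of i] change[OF a, of i] p'_nonneg[OF a, of i] by linarith
  have str: "1 \<le> i \<and> 0 \<le> x \<and> x \<le> p a i" if a: "a \<in> nodes T" and ix: "(i, x) \<in># R a" for a i x
  proof (cases "(i, x) \<in># K a")
    case True
    then have *: "1 \<le> i" "0 \<le> x" "x \<le> p' a i"
      using back_string_bounds[OF a KR] by blast+
    have "x \<le> p a i"
    proof (cases "0 < vacancy_change T l a i")
      case pos_case: True
      then have "x \<noteq> p' a i"
        using pos[OF a] True by blast
      then show ?thesis
        using * le[OF a, of i] change[OF a, of i] by linarith
    next
      case False
      then show ?thesis
        using * change[OF a, of i] by linarith
    qed
    then show ?thesis using * by blast
  next
    case False
    then have "x = p a i" "i \<in># sel T l a"
      using ix unfolding R_def by auto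
    then show ?thesis
      using p_nonneg[OF a] sel_ge_1[OF T back_adm] by simp
  qed
  have vs: "valid_strings (R a) (p a)" if a: "a \<in> nodes T" for a
    using p_nonneg[OF a] str[OF a] by (rule valid_stringsI)
  have "R a = {#}" if "a \<notin> nodes T" for a
  proof -
    have "R' a = {#}" using valid that by (simp add: valid_rc_def)
    then show ?thesis using K[of a] that by (simp add: sel_def R_def)
  qed
  then have "valid_rc T ((1, 1) # B) R"
    using vs unfolding valid_rc_def p by blast
  moreover have "valid_step T l p R p' R'"
    using s change vs T valid unfolding valid_step_def valid_rc_def p'_def by blast
  ultimately show ?thesis
    using supp unfolding p by blast
qed

end

text \<open>Consider the largest index at which two steps with the same result differ. The step with
  the larger length leaves a shortened singular string which, for the other step, lies in a range
  where the vacancy number rises; no kept string can be singular there.\<close>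

lemma valid_step_back_less:
  assumes s: "valid_step T l p R p' R'" and s2: "valid_step T l2 p2 R2 p' R'"
    and v: "v < top_index T" "v \<noteq> 0" "l v < l2 v" "l2 v \<noteq> \<infinity>"
    and eq: "\<And>w. v < w \<Longrightarrow> w \<le> top_index T \<Longrightarrow> l w = l2 w"
  shows False
proof -
  note T = valid_stepD(1)[OF s] and back_adm = valid_stepD(2)[OF s] and adm2 = valid_stepD(2)[OF s2]
  have split: "\<exists>i. l2 v = enat (i + 1) \<and> l v \<le> enat i \<and> 1 \<le> i" if "1 \<le> l v"
    using v that by (cases "l2 v"; cases "l v") (auto simp: one_enat_def intro!: exI[of _ "the_enat (l2 v) - 1"])
  from T v(1) show False
  proof (cases rule: index_cases)
    case 1
    then show ?thesis using v by blast
  next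
    case 2
    obtain i where i: "l2 v = enat (i + 1)" "l v \<le> enat i" "1 \<le> i"
      using split admissible_ge_1[OF T back_adm 2] by blast
    note o = index_order[OF T 2]
    have "enat i < l2 (mid1 T v)" "enat i < l2 (mid2 T v)"
      using admissibleD(2,3)[OF adm2 2] i(1) by (metis Suc_eq_plus1 Suc_ile_eq)+
    then have "enat i < l (mid1 T v)" "enat i < l (mid2 T v)"
      using eq o(4,5,7,8) by auto
    then have "l (upper T v) = enat (i + 1)" "count (R' v) (i, p' v i) = 1"
      using valid_step_first_back[OF s 2 valid_step_shortened(1)[OF s2 2 i(3) i(1)] i(2)] by auto
    moreover have "l2 (upper T v) = l (upper T v)"
      using eq[of "upper T v"] o(6,9) by simp
    ultimately show ?thesis
      using valid_step_shortened(3)[OF s2 2 i(3) _ i(1)] by simp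
  next
    case (3 a)
    have "1 \<le> l v"
      unfolding 3(2) using admissible_ge_1[OF T back_adm 3(1)] admissibleD(7)[OF back_adm 3(1)] by (rule order_trans)
    then obtain i where i: "l2 v = enat (i + 1)" "l v \<le> enat i" "1 \<le> i"
      using split by blast
    have "l (above T a) \<le> enat i"
      using valid_step_second_back[OF s 3(1) valid_step_shortened(2)[OF s2 3(1) i(3)]] i 3(2) by simp
    moreover have "l (above T a) = l2 (above T a)"
      using eq index_order(10,13)[OF T 3(1)] v(1) 3(2) by simp
    moreover have "l2 (upper T a) \<le> l2 (above T a)"
      by (rule admissibleD(6)[OF adm2 3(1)])
    ultimately show ?thesis
      using i(1) 3(2) by (metis Suc_eq_plus1 Suc_n_not_le_n enat_ord_simps(1) order_trans)
  qed
qed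

text \<open>The support fixes where the lengths are infinite; the finite ones are compared downwards
  from \<open>top_index\<close>.\<close>

lemma valid_step_back_unique:
  assumes s: "valid_step T l p R p' R'" and s2: "valid_step T l2 p2 R2 p' R'"
    and supp: "support T l = support T l2" and "v \<le> top_index T"
  shows "l v = l2 v"
  using assms(4)
proof (induction "top_index T - v" arbitrary: v rule: less_induct)
  case less
  note back_adm = valid_stepD(2)[OF s] and adm2 = valid_stepD(2)[OF s2]
  show ?case
  proof (cases "v = 0 \<or> v = top_index T")
    case True
    then show ?thesis using back_adm adm2 by (auto simp: admissible_def)
  next
    case False
    then have v: "v < top_index T" "v \<noteq> 0" using less by auto
    then have inf: "l v = \<infinity> \<longleftrightarrow> l2 v = \<infinity>"
    proof -
      have "v \<in> support T l \<longleftrightarrow> v \<in> support T l2" using supp by simp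
      then show ?thesis using v by (simp add: support_def del: not_infinity_eq)
    qed
    have eq: "l w = l2 w" if "v < w" "w \<le> top_index T" for w
      using less.hyps[of w] that v by simp
    have "\<not> l v < l2 v"
      using valid_step_back_less[OF s s2 v _ _ eq] inf by auto
    moreover have "\<not> l2 v < l v"
      using valid_step_back_less[OF s2 s v _ _ eq[symmetric]] inf by auto
    ultimately show ?thesis by simp
  qed
qed

lemma valid_step_back_inject:
  assumes s: "valid_step T l p R p' R'" and s2: "valid_step T l2 p2 R2 p' R'"
    and supp: "support T l = support T l2" and out: "\<And>a. a \<notin> nodes T \<Longrightarrow> R a = R2 a"
  shows "R = R2"
proof
  fix a
  note T = valid_stepD(1)[OF s]
  have l: "l v = l2 v" if "v \<le> top_index T" for v
    by (rule valid_step_back_unique[OF s s2 supp that])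
  then have sel: "sel T l = sel T l2"
    by (rule sel_cong[OF T])
  show "R a = R2 a"
  proof (cases "a \<in> nodes T")
    case a: True
    note o = index_order[OF T a]
    have "vacancy_change T l a i = vacancy_change T l2 a i" for i
      using l o(1,7-10,17) by (simp add: vacancy_change_def less_imp_le)
    then have p: "p a = p2 a"
      using valid_stepD(3)[OF s a] valid_stepD(3)[OF s2 a] by (auto simp: fun_eq_iff)
    obtain K where K: "R a = K + image_mset (\<lambda>i. (i, p a i)) (sel T l a)"
      "R' a = K + image_mset (\<lambda>i. (i, p' a i)) (shorten (sel T l a))"
      using valid_step_kept[OF s a] by metis
    obtain K2 where K2: "R2 a = K2 + image_mset (\<lambda>i. (i, p2 a i)) (sel T l2 a)"
      "R' a = K2 + image_mset (\<lambda>i. (i, p' a i)) (shorten (sel T l2 a))"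
      using valid_step_kept[OF s2 a] by metis
    have "K = K2"
      using K(2) K2(2) sel by simp
    then show ?thesis
      using K(1) K2(1) sel p by simp
  qed (rule out)
qed

section \<open>Letters as ideals of indices\<close>

text \<open>The indices of the arrows passed on the way from the letter 1 to x. In type D the
  letters n and -n give the two ideals that contain only one of the incomparable indices n - 1 and
  n.\<close>

fun ideal :: "cartan_type \<Rightarrow> int \<Rightarrow> nat set" where
  "ideal (TypeA n) x = {1..<nat x}"
| "ideal (TypeD n) x =
    (if 0 < x then {1..<nat x} else if x = - int n then {1..n - 2} \<union> {n} else {1..2 * n - 1 - nat (- x)})"

lemma ideal_index_ideal:
  assumes T: "valid_type T" and x: "x \<in> letters T"
  shows "index_ideal T (ideal T x)"
proof (cases T)
  case (TypeA n)
  then show ?thesis using x by (auto simp: index_ideal_def)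
next
  case (TypeD n)
  obtain m where m: "n = m + 4"
    using T TypeD by (metis add.commute le_Suc_ex valid_type.simps(2))
  consider "0 < x" "x \<le> int n" | "x = - int n" | "- int n < x" "x < 0"
    using x TypeD by fastforce
  then show ?thesis
  proof cases
    case 1
    then have "nat x \<le> m + 4" using m by simp
    then show ?thesis using 1 by (auto simp: index_ideal_def TypeD m)
  next
    case 2
    then show ?thesis by (auto simp: index_ideal_def TypeD m)
  next
    case 3
    define y where "y = nat (- x)"
    have "1 \<le> y" "y \<le> m + 3" using 3 m by (auto simp: y_def)
    moreover have "ideal T x = {1..2 * m + 7 - y}"
      using 3 by (simp add: TypeD m y_def add.commute)
    ultimately show ?thesis by (auto simp: index_ideal_def TypeD m)
  qed
qed

text \<open>An arrow of colour a subtracts the simple root at a, starting from the weight of the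
  letter 1.\<close>

lemma letter_wt_eq_index_weight:
  assumes T: "valid_type T" and x: "x \<in> letters T"
  shows "letter_wt T x = index_weight T (ideal T x)"
proof (cases T)
  case (TypeA n)
  have "letter_wt T x a = index_weight T (ideal T x) a" for a
    using x TypeA by (auto simp: index_weight_def)
  then show ?thesis by blast
next
  case (TypeD n)
  obtain m where m: "n = m + 4"
    using T TypeD by (metis add.commute le_Suc_ex valid_type.simps(2))
  have "letter_wt T x a = index_weight T (ideal T x) a" for a
  proof (cases "a \<in> nodes T")
    case a: True
    have low_slots: "lower T a = a - 1" "mid1 T a = a + 1" "mid2 T a = 2 * m + 6 - a" "upper T a = 2 * m + 7 - a"
      "above T a = 2 * m + 8 - a" if "a < m + 2"
      using that by (simp_all add: TypeD m add.commute)
    consider (cases) "a < m + 2 \<or> a = m + 2 \<or> a = m + 3 \<or> a = m + 4"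
      using a m TypeD by fastforce
    then have cases: "(a < m + 2 \<Longrightarrow> P) \<Longrightarrow> (a = m + 2 \<Longrightarrow> P) \<Longrightarrow> (a = m + 3 \<Longrightarrow> P) \<Longrightarrow> (a = m + 4 \<Longrightarrow> P) \<Longrightarrow> P" for P
      by blast
    consider "0 < x" "x \<le> int n" | "x = - int n" | "- int n < x" "x < 0"
      using x TypeD by fastforce
    then show ?thesis
    proof cases
      case 1
      define y where "y = nat x"
      then have y: "x = int y" "1 \<le> y" "y \<le> m + 4" using 1 m by auto
      have I: "ideal T x = {1..<y}"
        using y by (simp add: TypeD)
      show ?thesis
      proof (rule cases)
        assume 1: "a < m + 2"
        then have "2 * m + 6 - a \<notin> {1..<y}" "2 * m + 7 - a \<notin> {1..<y}" "2 * m + 8 - a \<notin> {1..<y}"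
          using y by auto
        then show ?thesis
          using a y(2,3) unfolding index_weight_def I low_slots[OF 1] unfolding y(1) using 1 by (auto simp: TypeD m of_bool_def)
      next
        assume 1: "a = m + 2"
        show ?thesis
          using a y(2,3) unfolding index_weight_def I unfolding y(1) using 1 by (auto simp: TypeD m of_bool_def)
      next
        assume 1: "a = m + 3"
        show ?thesis
          using a y(2,3) unfolding index_weight_def I unfolding y(1) using 1 by (auto simp: TypeD m of_bool_def)
      next
        assume 1: "a = m + 4"
        show ?thesis
          using a y(2,3) unfolding index_weight_def I unfolding y(1) using 1 by (auto simp: TypeD m of_bool_def)
      qed
    next
      case 2
      have I: "ideal T x = {1..m + 2} \<union> {m + 4}"
        using 2 by (simp add: TypeD m)
      show ?thesis
      proof (rule cases)
        assume 1: "a < m + 2"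
        then have "2 * m + 6 - a \<notin> {1..m + 2} \<union> {m + 4}" "2 * m + 7 - a \<notin> {1..m + 2} \<union> {m + 4}"
          "2 * m + 8 - a \<notin> {1..m + 2} \<union> {m + 4}"
          by auto
        moreover have "a \<in> {1..m + 2} \<union> {m + 4}" "a + 1 \<in> {1..m + 2} \<union> {m + 4}" "a - 1 \<in> insert 0 ({1..m + 2} \<union> {m + 4})"
          using 1 a TypeD by auto
        ultimately have "index_weight T (ideal T x) a = 0"
          unfolding index_weight_def I low_slots[OF 1] using a by (simp only: of_bool_def if_True if_False)
        moreover have "letter_wt T x a = 0"
          using 1 a by (simp add: TypeD m 2)
        ultimately show ?thesis by simp
      next
        assume 1: "a = m + 2"
        have "index_weight T (ideal T x) a = 0"
          using a unfolding index_weight_def I using 1 by (simp add: TypeD m)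
        moreover have "letter_wt T x a = 0"
          using 1 a by (simp add: TypeD m 2)
        ultimately show ?thesis by simp
      next
        assume 1: "a = m + 3"
        have "index_weight T (ideal T x) a = 1"
          using a unfolding index_weight_def I using 1 by (simp add: TypeD m)
        moreover have "letter_wt T x a = 1"
          using 1 a by (simp add: TypeD m 2)
        ultimately show ?thesis by simp
      next
        assume 1: "a = m + 4"
        have "index_weight T (ideal T x) a = - 1"
          using a unfolding index_weight_def I using 1 by (simp add: TypeD m)
        moreover have "letter_wt T x a = - 1"
          using 1 a by (simp add: TypeD m 2)
        ultimately show ?thesis by simp
      qed
    next
      case 3
      define y where "y = nat (- x)"
      have y: "x = - int y" "1 \<le> y" "y \<le> m + 3" using 3 m by (auto simp: y_def)
      have I: "ideal T x = {1..2 * m + 7 - y}"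
        using 3 by (simp add: TypeD m y_def add.commute)
      show ?thesis
      proof (rule cases)
        assume 1: "a < m + 2"
        then have "1 \<le> a" "2 * m + 6 - a \<in> {1..2 * m + 7 - y} \<longleftrightarrow> y \<le> a + 1" "2 * m + 7 - a \<in> {1..2 * m + 7 - y} \<longleftrightarrow> y \<le> a"
          "2 * m + 8 - a \<in> {1..2 * m + 7 - y} \<longleftrightarrow> y < a" "a \<in> {1..2 * m + 7 - y}" "a + 1 \<in> {1..2 * m + 7 - y}"
          "a - 1 \<in> insert 0 {1..2 * m + 7 - y}"
          using a y(2,3) TypeD by auto
        then show ?thesis
          using a y(2,3) unfolding index_weight_def I low_slots[OF 1] unfolding y(1) using 1 by (auto simp: TypeD m of_bool_def)
      next
        assume 1: "a = m + 2"
        show ?thesis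
          using a y(2,3) unfolding index_weight_def I unfolding y(1) using 1 by (auto simp: TypeD m of_bool_def)
      next
        assume 1: "a = m + 3"
        show ?thesis
          using a y(2,3) unfolding index_weight_def I unfolding y(1) using 1 by (auto simp: TypeD m of_bool_def)
      next
        assume 1: "a = m + 4"
        show ?thesis
          using a y(2,3) unfolding index_weight_def I unfolding y(1) using 1 by (auto simp: TypeD m of_bool_def)
      qed
    qed
  next
    case False
    then have "a \<notin> {1..n}" using TypeD by simp
    then show ?thesis unfolding index_weight_def TypeD letter_wt.simps nodes.simps by (simp only: if_False if_True not_False_eq_True)
  qed
  then show ?thesis by blast
qed

lemma letter_wt_inject:
  assumes T: "valid_type T" and x: "x \<in> letters T" "y \<in> letters T" and eq: "letter_wt T x = letter_wt T y"
  shows "x = y"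
proof (cases T)
  case (TypeA n)
  have False if "x \<in> letters T" "y \<in> letters T" "letter_wt T x = letter_wt T y" "x < y" for x y
  proof -
    have *: "int (nat x) = x" "1 \<le> nat x" "nat x \<le> n"
      using that(1,2,4) TypeA by auto
    then have "letter_wt T x (nat x) = 1" "letter_wt T y (nat x) \<le> 0"
      using that(4) by (simp_all add: TypeA)
    then show False using that(3) by simp
  qed
  then show ?thesis using x eq by (metis linorder_less_linear)
next
  case (TypeD n)
  then have n: "4 \<le> n" using T by simp
  \<comment> \<open>e x j is the j-th coordinate of the weight of x in the \<epsilon>-basis. The
    last two coefficients on fundamental weights are the difference and the sum of the last two
    coordinates; the others follow by descending induction.\<close>
  define e :: "int \<Rightarrow> nat \<Rightarrow> int" where "e x j = (if \<bar>x\<bar> = int j then sgn x else 0)" for x j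
  have w: "letter_wt T x a = (if a < n then e x a - e x (a + 1) else e x (n - 1) + e x n)" if "1 \<le> a" "a \<le> n" for x a
    using that n by (auto simp: e_def TypeD of_nat_diff)
  have eqs: "letter_wt T x a = letter_wt T y a" for a
    using eq by simp
  have "e x n = e y n" "e x (n - 1) = e y (n - 1)"
    using eqs[of n] eqs[of "n - 1"] n by (simp_all add: w)
  have "e x j = e y j" if "1 \<le> j" "j \<le> n" for j
    using that(2,1)
  proof (induction rule: inc_induct)
    case (step j)
    then show ?case using eqs[of j] by (simp add: w)
  qed (rule \<open>e x n = e y n\<close>)
  then have "e x (nat \<bar>x\<bar>) = e y (nat \<bar>x\<bar>)"
    using x(1) TypeD by auto
  then show ?thesis
    using x TypeD by (auto simp: e_def sgn_if split: if_splits)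
qed

lemma index_ideal_eq_letter:
  assumes T: "valid_type T" and I: "index_ideal T I"
  shows "\<exists>x\<in>letters T. I = ideal T x"
proof -
  have bounds: "v \<in> I \<Longrightarrow> 1 \<le> v \<and> v < top_index T" for v
    using I by (auto simp: index_ideal_def)
  \<comment> \<open>An ideal is determined by its first missing index, except when this is n - 1 in
    type D: the incomparable index n may then still belong to it.\<close>
  define a where "a = (LEAST v. 1 \<le> v \<and> v \<notin> I)"
  have "1 \<le> top_index T \<and> top_index T \<notin> I"
    using T bounds by (cases T) auto
  then have a: "1 \<le> a" "a \<notin> I" "a \<le> top_index T"
    unfolding a_def using LeastI[of "\<lambda>v. 1 \<le> v \<and> v \<notin> I" "top_index T"] Least_le[of "\<lambda>v. 1 \<le> v \<and> v \<notin> I" "top_index T"] by auto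
  have below: "v \<in> I" if "1 \<le> v" "v < a" for v
    using not_less_Least[of v "\<lambda>v. 1 \<le> v \<and> v \<notin> I"] that unfolding a_def by blast
  show ?thesis
  proof (cases T)
    case (TypeA n)
    have "v \<notin> I" if "a \<le> v" for v
      using that
    proof (induction rule: dec_induct)
      case (step v)
      show ?case
      proof
        assume "Suc v \<in> I"
        then have "lower T (Suc v) \<in> insert 0 I" "Suc v \<in> nodes T"
          using index_idealD(1)[OF I, of "Suc v"] bounds[of "Suc v"] TypeA by auto
        then show False using step a TypeA by auto
      qed
    qed (rule a)
    then have "I = {1..<a}"
      using below bounds by (meson atLeastLessThan_iff linorder_not_le subsetI subset_antisym)
    then have "I = ideal T (int a)" "int a \<in> letters T"
      using a TypeA by auto
    then show ?thesis by blast
  next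
    case (TypeD n)
    obtain m where m: "n = m + 4"
      using T TypeD by (metis add.commute le_Suc_ex valid_type.simps(2))
    have F1: "v \<in> I" if "Suc v \<in> I" "1 \<le> v" "v \<le> m + 2" for v
      using index_idealD(1)[OF I, of "Suc v"] that TypeD m by auto
    have F2: "m + 2 \<in> I" if "m + 4 \<in> I"
      using index_idealD(1)[OF I, of "m + 4"] that TypeD m by auto
    have "upper T (m + 2) = m + 5" "mid1 T (m + 2) = m + 3" "mid2 T (m + 2) = m + 4" "m + 2 \<in> nodes T"
      by (simp_all add: TypeD m)
    then have F3: "m + 3 \<in> I" "m + 4 \<in> I" if "m + 5 \<in> I"
      using index_idealD(4,5)[OF I, of "m + 2"] that by auto
    have F4: "v \<in> I" if "Suc v \<in> I" "m + 5 \<le> v" for v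
    proof -
      have "2 * m + 7 - v \<in> nodes T" "above T (2 * m + 7 - v) = Suc v" "upper T (2 * m + 7 - v) = v"
        using that bounds[of "Suc v"] TypeD m by auto
      then show ?thesis using index_idealD(6)[OF I, of "2 * m + 7 - v"] that by simp
    qed
    have high: "v \<notin> I" if "m + 5 \<notin> I" "m + 5 \<le> v" for v
      using that(2) by (induction rule: dec_induct) (use F4 that(1) in auto)
    have at_least: "v \<notin> I" if "a \<le> v" "\<not> (a = m + 3 \<and> v = m + 4)" for v
    proof (cases "a \<le> m + 2")
      case True
      have low: "v \<notin> I" if "a \<le> v" "v \<le> m + 3" for v
        using that
      proof (induction rule: dec_induct)
        case (step w)
        then show ?case using F1[of w] a by auto
      qed (rule a)
      have "m + 4 \<notin> I" "m + 5 \<notin> I"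
        using low[of "m + 2"] low[of "m + 3"] True F2 F3 by auto
      note no45 = this
      consider "v \<le> m + 3" | "v = m + 4" | "m + 5 \<le> v" by linarith
      then show ?thesis using low[OF that(1)] high[OF no45(2)] no45(1) by cases blast+
    next
      case False
      then consider "a = m + 3" | "a = m + 4" | "a \<ge> m + 5" by linarith
      then show ?thesis
      proof cases
        case 3
        show ?thesis
          using that(1) by (induction rule: dec_induct) (use a 3 F4 in auto)
      next
        case 1
        then have "v = m + 3 \<or> m + 5 \<le> v" using that by auto
        then show ?thesis using 1 F3(1) high[of v] a(2) by auto
      next
        case 2
        then have "v = m + 4 \<or> m + 5 \<le> v" using that by auto
        then show ?thesis using 2 F3(2) high[of v] a(2) by auto
      qed
    qed
    show ?thesis
    proof (cases "a = m + 3 \<and> m + 4 \<in> I")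
      case True
      have "I = {1..m + 2} \<union> {m + 4}"
      proof (intro set_eqI iffI)
        fix v assume "v \<in> I"
        then show "v \<in> {1..m + 2} \<union> {m + 4}"
          using bounds[of v] at_least[of v] True by force
      next
        fix v assume "v \<in> {1..m + 2} \<union> {m + 4}"
        then show "v \<in> I" using below[of v] True by auto
      qed
      then have "I = ideal T (- int n)" "- int n \<in> letters T"
        using TypeD m by auto
      then show ?thesis by blast
    next
      case False
      then have "v \<notin> I" if "a \<le> v" for v
        using at_least[OF that] by blast
      then have Ia: "I = {1..<a}"
        using below bounds by (meson atLeastLessThan_iff linorder_not_le subsetI subset_antisym)
      show ?thesis
      proof (cases "a \<le> n")
        case True
        then have "I = ideal T (int a)" "int a \<in> letters T"
          using Ia a TypeD by auto
        then show ?thesis by blast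
      next
        case False
        then have "I = ideal T (- (2 * int n - int a))" "- (2 * int n - int a) \<in> letters T"
          using Ia a TypeD m by auto
        then show ?thesis by blast
      qed
    qed
  qed
qed

lemma ideal_inject:
  assumes "valid_type T" "x \<in> letters T" "y \<in> letters T" "ideal T x = ideal T y"
  shows "x = y"
  using letter_wt_inject[OF assms(1-3)] letter_wt_eq_index_weight[OF assms(1)] assms by simp

section \<open>The bijectivity of \<open>\<delta>\<close>\<close>

lemma valid_step_imp_delta:
  assumes "valid_step T l (vac T ((1, 1) # B) R) R (vac T B R') R'"
  shows "delta T (mult_array ((1, 1) # B)) (mult_array B) R = R'"
proof (rule step_imp_delta)
  show T: "valid_type T" by (rule valid_stepD(1)[OF assms])
  show "step T l (vac T ((1, 1) # B) R) R (vac T B R') R'"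
    using assms by (simp add: valid_step_def)
  show "selected T (mult_array ((1, 1) # B)) R = sel T l"
    by (rule selected_eq_sel_greedy[OF T valid_step_greedy[OF assms]])
qed

lemma rc_weight_of_valid_step:
  assumes s: "valid_step T l (vac T ((1, 1) # B) R) R (vac T B R') R'"
  shows "rc_weight T ((1, 1) # B) R = (\<lambda>a. rc_weight T B R' a + index_weight T (support T l) a)"
proof
  fix a
  obtain K where K: "\<And>a. R a = K a + image_mset (\<lambda>i. (i, vac T ((1, 1) # B) R a i)) (sel T l a)"
    "\<And>a. R' a = K a + image_mset (\<lambda>i. (i, vac T B R' a i)) (shorten (sel T l a))"
    using s unfolding valid_step_def step_def by metis
  have "shape R b = image_mset fst (K b) + sel T l b" "shape R' b = image_mset fst (K b) + shorten (sel T l b)" for b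
    unfolding shape_def K(1)[of b] K(2)[of b] by (simp_all add: shape_graph)
  then show "rc_weight T ((1, 1) # B) R a = rc_weight T B R' a + index_weight T (support T l) a"
    by (rule rc_weight_of_step[OF valid_stepD(1,2)[OF s]])
qed

text \<open>The facts about one application of \<open>delta\<close>, with the removed letter x read
  off from the support of the lengths.\<close>

definition letter_step :: "cartan_type \<Rightarrow> int \<Rightarrow> kr_product \<Rightarrow> rigged_configuration \<Rightarrow> rigged_configuration \<Rightarrow> (nat \<Rightarrow> enat) \<Rightarrow> bool" where
  "letter_step T x B R R' l \<longleftrightarrow> x \<in> letters T \<and> valid_step T l (vac T ((1, 1) # B) R) R (vac T B R') R'
    \<and> valid_rc T ((1, 1) # B) R \<and> valid_rc T B R' \<and> support T l = ideal T x
    \<and> rc_weight T ((1, 1) # B) R = (\<lambda>a. rc_weight T B R' a + letter_wt T x a)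
    \<and> delta T (mult_array ((1, 1) # B)) (mult_array B) R = R'"

lemma letter_step_exists:
  assumes T: "valid_type T" and R: "valid_rc T ((1, 1) # B) R"
  shows "\<exists>x l. letter_step T x B R (delta T (mult_array ((1, 1) # B)) (mult_array B) R) l"
proof -
  define R' where "R' = delta T (mult_array ((1, 1) # B)) (mult_array B) R"
  define l where "l = lengths T (mult_array ((1, 1) # B)) R"
  have g: "greedy T (vac T ((1, 1) # B) R) R l"
    unfolding l_def by (rule lengths_greedy[OF T])
  have s: "valid_step T l (vac T ((1, 1) # B) R) R (vac T B R') R'" "valid_rc T B R'"
    unfolding R'_def by (rule greedy_valid_step[OF T R g])+
  obtain x where x: "x \<in> letters T" "support T l = ideal T x"
    using index_ideal_eq_letter[OF T index_ideal_support[OF T valid_stepD(2)[OF s(1)]]] by blast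
  have "letter_step T x B R R' l"
    unfolding letter_step_def using x s R rc_weight_of_valid_step[OF s(1)] letter_wt_eq_index_weight[OF T x(1)]
      valid_step_imp_delta[OF s(1)] by simp
  then show ?thesis unfolding R'_def by blast
qed

text \<open>The condition for putting a letter in front is that the weight stays dominant, just as
  in \<open>highest_Cons\<close> for highest weight words.\<close>

lemma letter_step_back_exists:
  assumes T: "valid_type T" and R': "valid_rc T B R'" and x: "x \<in> letters T"
    and dom: "(\<lambda>a. rc_weight T B R' a + letter_wt T x a) \<in> dominant_weights T"
  shows "\<exists>R l. letter_step T x B R R' l"
proof -
  have I: "index_ideal T (ideal T x)" by (rule ideal_index_ideal[OF T x])
  obtain k where k: "back_greedy T (vac T B R') R' (ideal T x) k"
    using back_greedy_exists[OF T I] by blast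
  have "0 \<le> rc_weight T B R' a + index_weight T (ideal T x) a" if "a \<in> nodes T" for a
    using dom that by (simp add: dominant_weights_def letter_wt_eq_index_weight[OF T x])
  then obtain R l where s: "valid_step T l (vac T ((1, 1) # B) R) R (vac T B R') R'"
    "valid_rc T ((1, 1) # B) R" "support T l = ideal T x"
    using back_greedy_valid_step[OF T R' I _ k] by blast
  have "letter_step T x B R R' l"
    unfolding letter_step_def using x s R' rc_weight_of_valid_step[OF s(1)] letter_wt_eq_index_weight[OF T x]
      valid_step_imp_delta[OF s(1)] by simp
  then show ?thesis by blast
qed

lemma letter_step_back_unique:
  assumes "letter_step T x B R R' l" "letter_step T x B R2 R' l2"
  shows "R = R2"
proof (rule valid_step_back_inject)
  show "valid_step T l (vac T ((1, 1) # B) R) R (vac T B R') R'"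
    "valid_step T l2 (vac T ((1, 1) # B) R2) R2 (vac T B R') R'"
    "support T l = support T l2"
    using assms by (auto simp: letter_step_def)
  show "R a = R2 a" if "a \<notin> nodes T" for a
    using assms that by (simp add: letter_step_def valid_rc_def)
qed

section \<open>Highest weight elements\<close>

text \<open>The string lengths E and F are explicit, so \<open>eps\<close> and \<open>phi\<close>
  need not be computed as maxima over iterates. The set S is there because
  \<open>tensor_power\<close> is meaningful only on lists of the right length.\<close>

definition seminormal_on :: "'b set \<Rightarrow> 'b crystal \<Rightarrow> nat \<Rightarrow> ('b \<Rightarrow> nat) \<Rightarrow> ('b \<Rightarrow> nat) \<Rightarrow> bool" where
  "seminormal_on S C i E F \<longleftrightarrow> (\<forall>b\<in>S. (ce C i b = None \<longleftrightarrow> E b = 0) \<and> (cf C i b = None \<longleftrightarrow> F b = 0)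
    \<and> (\<forall>b'. ce C i b = Some b' \<longrightarrow> b' \<in> S \<and> E b = Suc (E b') \<and> F b' = Suc (F b) \<and> cf C i b' = Some b)
    \<and> (\<forall>b'. cf C i b = Some b' \<longrightarrow> b' \<in> S \<and> F b = Suc (F b') \<and> E b' = Suc (E b) \<and> ce C i b' = Some b))"

lemma seminormal_onD:
  assumes "seminormal_on S C i E F" "b \<in> S"
  shows "ce C i b = None \<longleftrightarrow> E b = 0" "cf C i b = None \<longleftrightarrow> F b = 0"
    "ce C i b = Some b' \<Longrightarrow> b' \<in> S \<and> E b = Suc (E b') \<and> F b' = Suc (F b) \<and> cf C i b' = Some b"
    "cf C i b = Some b' \<Longrightarrow> b' \<in> S \<and> F b = Suc (F b') \<and> E b' = Suc (E b) \<and> ce C i b' = Some b"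
  using assms unfolding seminormal_on_def by blast+

lemma iterate_neq_None:
  assumes "\<And>b. b \<in> S \<Longrightarrow> g b = None \<longleftrightarrow> N b = 0"
    "\<And>b b'. b \<in> S \<Longrightarrow> g b = Some b' \<Longrightarrow> b' \<in> S \<and> N b = Suc (N b')"
    and "b \<in> S"
  shows "iterate g k b \<noteq> None \<longleftrightarrow> k \<le> N b"
  using assms(3)
proof (induction k arbitrary: b)
  case (Suc k)
  show ?case
  proof (cases "g b")
    case None
    then show ?thesis using assms(1)[OF Suc.prems] by simp
  next
    case (Some b')
    then have "b' \<in> S" "N b = Suc (N b')" using assms(2)[OF Suc.prems] by auto
    then show ?thesis using Some Suc.IH[of b'] by simp
  qed
qed simp

lemma Max_Collect_le: "Max {k. k \<le> (n :: nat)} = n"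
  by (rule Max_eqI) auto

lemma seminormal_on_eps_phi:
  assumes s: "seminormal_on S C i E F" and b: "b \<in> S"
  shows "eps C i b = E b" "phi C i b = F b"
proof -
  have "iterate (ce C i) k b \<noteq> None \<longleftrightarrow> k \<le> E b" for k
    by (rule iterate_neq_None[of S _ E]) (use seminormal_onD[OF s] b in blast)+
  then show "eps C i b = E b"
    unfolding eps_def by (simp only: Max_Collect_le)
  have "iterate (cf C i) k b \<noteq> None \<longleftrightarrow> k \<le> F b" for k
    by (rule iterate_neq_None[of S _ F]) (use seminormal_onD[OF s] b in blast)+
  then show "phi C i b = F b"
    unfolding phi_def by (simp only: Max_Collect_le)
qed

text \<open>The usual formula for string lengths in a tensor product; truncated subtraction supplies
  the positive part.\<close>

definition tensor_eps :: "('b \<Rightarrow> nat) \<Rightarrow> ('c \<Rightarrow> nat) \<Rightarrow> ('c \<Rightarrow> nat) \<Rightarrow> 'b \<times> 'c \<Rightarrow> nat" where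
  "tensor_eps E2 E1 F1 = (\<lambda>(b2, b1). E1 b1 + (E2 b2 - F1 b1))"

definition tensor_phi :: "('b \<Rightarrow> nat) \<Rightarrow> ('b \<Rightarrow> nat) \<Rightarrow> ('c \<Rightarrow> nat) \<Rightarrow> 'b \<times> 'c \<Rightarrow> nat" where
  "tensor_phi E2 F2 F1 = (\<lambda>(b2, b1). F2 b2 + (F1 b1 - E2 b2))"

lemma seminormal_on_tensor:
  assumes s2: "seminormal_on S2 C2 i E2 F2" and s1: "seminormal_on S1 C1 i E1 F1"
  shows "seminormal_on (S2 \<times> S1) (tensor C2 C1) i (tensor_eps E2 E1 F1) (tensor_phi E2 F2 F1)"
  unfolding seminormal_on_def
proof (intro ballI)
  fix b assume "b \<in> S2 \<times> S1"
  then obtain x y where b: "b = (x, y)" "x \<in> S2" "y \<in> S1" by blast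
  note x = seminormal_onD[OF s2 b(2)] and y = seminormal_onD[OF s1 b(3)]
  note ef = seminormal_on_eps_phi[OF s2] seminormal_on_eps_phi[OF s1]
  have e: "ce (tensor C2 C1) i (u, v) = (if E2 u > F1 v then map_option (\<lambda>b. (b, v)) (ce C2 i u)
        else map_option (\<lambda>b. (u, b)) (ce C1 i v))"
    "cf (tensor C2 C1) i (u, v) = (if E2 u \<ge> F1 v then map_option (\<lambda>b. (b, v)) (cf C2 i u)
        else map_option (\<lambda>b. (u, b)) (cf C1 i v))" if "u \<in> S2" "v \<in> S1" for u v
    using that by (simp_all add: tensor_def ef)
  show "(ce (tensor C2 C1) i b = None \<longleftrightarrow> tensor_eps E2 E1 F1 b = 0) \<and> (cf (tensor C2 C1) i b = None \<longleftrightarrow> tensor_phi E2 F2 F1 b = 0)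
    \<and> (\<forall>b'. ce (tensor C2 C1) i b = Some b' \<longrightarrow> b' \<in> S2 \<times> S1 \<and> tensor_eps E2 E1 F1 b = Suc (tensor_eps E2 E1 F1 b') \<and> tensor_phi E2 F2 F1 b' = Suc (tensor_phi E2 F2 F1 b) \<and> cf (tensor C2 C1) i b' = Some b)
    \<and> (\<forall>b'. cf (tensor C2 C1) i b = Some b' \<longrightarrow> b' \<in> S2 \<times> S1 \<and> tensor_phi E2 F2 F1 b = Suc (tensor_phi E2 F2 F1 b') \<and> tensor_eps E2 E1 F1 b' = Suc (tensor_eps E2 E1 F1 b) \<and> ce (tensor C2 C1) i b' = Some b)"
  proof (intro conjI allI impI)
    show "ce (tensor C2 C1) i b = None \<longleftrightarrow> tensor_eps E2 E1 F1 b = 0"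
      unfolding b(1) e(1)[OF b(2,3)] using x(1) y(1) by (auto simp: tensor_eps_def)
    show "cf (tensor C2 C1) i b = None \<longleftrightarrow> tensor_phi E2 F2 F1 b = 0"
      unfolding b(1) e(2)[OF b(2,3)] using x(2) y(2) by (auto simp: tensor_phi_def)
  next
    fix b' assume b': "ce (tensor C2 C1) i b = Some b'"
    have "b' \<in> S2 \<times> S1 \<and> tensor_eps E2 E1 F1 b = Suc (tensor_eps E2 E1 F1 b') \<and> tensor_phi E2 F2 F1 b' = Suc (tensor_phi E2 F2 F1 b) \<and> cf (tensor C2 C1) i b' = Some b"
    proof (cases "E2 x > F1 y")
      case True
      then obtain x' where x': "ce C2 i x = Some x'" "b' = (x', y)"
        using b' unfolding b(1) e(1)[OF b(2,3)] by auto
      then show ?thesis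
        using x(3)[OF x'(1)] True b e(2)[of x' y] by (auto simp: tensor_eps_def tensor_phi_def)
    next
      case False
      then obtain y' where y': "ce C1 i y = Some y'" "b' = (x, y')"
        using b' unfolding b(1) e(1)[OF b(2,3)] by auto
      then show ?thesis
        using y(3)[OF y'(1)] False b e(2)[of x y'] by (auto simp: tensor_eps_def tensor_phi_def)
    qed
    then show "b' \<in> S2 \<times> S1" "tensor_eps E2 E1 F1 b = Suc (tensor_eps E2 E1 F1 b')" "tensor_phi E2 F2 F1 b' = Suc (tensor_phi E2 F2 F1 b)" "cf (tensor C2 C1) i b' = Some b"
      by auto
  next
    fix b' assume b': "cf (tensor C2 C1) i b = Some b'"
    have "b' \<in> S2 \<times> S1 \<and> tensor_phi E2 F2 F1 b = Suc (tensor_phi E2 F2 F1 b') \<and> tensor_eps E2 E1 F1 b' = Suc (tensor_eps E2 E1 F1 b) \<and> ce (tensor C2 C1) i b' = Some b"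
    proof (cases "E2 x \<ge> F1 y")
      case True
      then obtain x' where x': "cf C2 i x = Some x'" "b' = (x', y)"
        using b' unfolding b(1) e(2)[OF b(2,3)] by auto
      then show ?thesis
        using x(4)[OF x'(1)] True b e(1)[of x' y] by (auto simp: tensor_eps_def tensor_phi_def)
    next
      case False
      then obtain y' where y': "cf C1 i y = Some y'" "b' = (x, y')"
        using b' unfolding b(1) e(2)[OF b(2,3)] by auto
      then show ?thesis
        using y(4)[OF y'(1)] False b e(1)[of x y'] by (auto simp: tensor_eps_def tensor_phi_def)
    qed
    then show "b' \<in> S2 \<times> S1" "tensor_phi E2 F2 F1 b = Suc (tensor_phi E2 F2 F1 b')" "tensor_eps E2 E1 F1 b' = Suc (tensor_eps E2 E1 F1 b)" "ce (tensor C2 C1) i b' = Some b"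
      by auto
  qed
qed

fun list_eps list_phi :: "('b \<Rightarrow> nat) \<Rightarrow> ('b \<Rightarrow> nat) \<Rightarrow> 'b list \<Rightarrow> nat" where
  "list_eps E F [] = 0"
| "list_eps E F (x # w) = list_eps E F w + (E x - list_phi E F w)"
| "list_phi E F [] = 0"
| "list_phi E F (x # w) = F x + (list_phi E F w - E x)"

lemma seminormal_on_tensor_power:
  assumes C: "seminormal_on UNIV C i E F"
  shows "seminormal_on {w. length w = k} (tensor_power C k) i (list_eps E F) (list_phi E F)"
proof (induction k)
  case 0
  then show ?case by (simp add: seminormal_on_def)
next
  case (Suc k)
  let ?P = "tensor C (tensor_power C k)"
  have P: "seminormal_on (UNIV \<times> {w. length w = k}) ?P i (tensor_eps E (list_eps E F) (list_phi E F)) (tensor_phi E F (list_phi E F))"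
    by (rule seminormal_on_tensor[OF C Suc.IH])
  show ?case
    unfolding seminormal_on_def
  proof (intro ballI)
    fix b assume "b \<in> {w :: 'a list. length w = Suc k}"
    then obtain x w where b: "b = x # w" "length w = k"
      by (cases b) auto
    note d = seminormal_onD[OF P, of "(x, w)"]
    have ce: "ce (tensor_power C (Suc k)) i (u # v) = map_option (\<lambda>(x, y). x # y) (ce ?P i (u, v))"
      and cf: "cf (tensor_power C (Suc k)) i (u # v) = map_option (\<lambda>(x, y). x # y) (cf ?P i (u, v))" for u v
      by (simp_all add: Let_def)
    have E: "list_eps E F (u # v) = tensor_eps E (list_eps E F) (list_phi E F) (u, v)"
      "list_phi E F (u # v) = tensor_phi E F (list_phi E F) (u, v)" for u v
      by (simp_all add: tensor_eps_def tensor_phi_def)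
    show "(ce (tensor_power C (Suc k)) i b = None \<longleftrightarrow> list_eps E F b = 0) \<and> (cf (tensor_power C (Suc k)) i b = None \<longleftrightarrow> list_phi E F b = 0)
      \<and> (\<forall>b'. ce (tensor_power C (Suc k)) i b = Some b' \<longrightarrow> b' \<in> {w. length w = Suc k} \<and> list_eps E F b = Suc (list_eps E F b') \<and> list_phi E F b' = Suc (list_phi E F b) \<and> cf (tensor_power C (Suc k)) i b' = Some b)
      \<and> (\<forall>b'. cf (tensor_power C (Suc k)) i b = Some b' \<longrightarrow> b' \<in> {w. length w = Suc k} \<and> list_phi E F b = Suc (list_phi E F b') \<and> list_eps E F b' = Suc (list_eps E F b) \<and> ce (tensor_power C (Suc k)) i b' = Some b)"
    proof (intro conjI allI impI)
      show "ce (tensor_power C (Suc k)) i b = None \<longleftrightarrow> list_eps E F b = 0"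
        unfolding b(1) ce E using d(1) b(2) by simp
      show "cf (tensor_power C (Suc k)) i b = None \<longleftrightarrow> list_phi E F b = 0"
        unfolding b(1) cf E using d(2) b(2) by simp
    next
      fix b' assume "ce (tensor_power C (Suc k)) i b = Some b'"
      then obtain x' w' where b': "ce ?P i (x, w) = Some (x', w')" "b' = x' # w'"
        unfolding b(1) ce by auto
      note d' = d(3)[OF _ b'(1)]
      show "b' \<in> {w. length w = Suc k}" "list_eps E F b = Suc (list_eps E F b')" "list_phi E F b' = Suc (list_phi E F b)" "cf (tensor_power C (Suc k)) i b' = Some b"
        unfolding b(1) b'(2) cf E using d' b(2) by simp_all
    next
      fix b' assume "cf (tensor_power C (Suc k)) i b = Some b'"
      then obtain x' w' where b': "cf ?P i (x, w) = Some (x', w')" "b' = x' # w'"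
        unfolding b(1) cf by auto
      note d' = d(4)[OF _ b'(1)]
      show "b' \<in> {w. length w = Suc k}" "list_phi E F b = Suc (list_phi E F b')" "list_eps E F b' = Suc (list_eps E F b)" "ce (tensor_power C (Suc k)) i b' = Some b"
        unfolding b(1) b'(2) ce E using d' b(2) by simp_all
    qed
  qed
qed

lemma seminormal_list_crystal:
  assumes C: "seminormal_on UNIV C i E F"
  shows "seminormal_on UNIV (list_crystal C) i (list_eps E F) (list_phi E F)"
  unfolding seminormal_on_def
proof (intro ballI)
  fix b :: "'a list"
  have ce: "ce (list_crystal C) i w = ce (tensor_power C (length w)) i w"
    and cf: "cf (list_crystal C) i w = cf (tensor_power C (length w)) i w" for w
    by (simp_all add: list_crystal_def)
  have len: "length w = length b" if "w \<in> {w. length w = length b}" for w :: "'a list"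
    using that by simp
  note d = seminormal_onD[OF seminormal_on_tensor_power[OF C, of "length b"], of b]
  show "(ce (list_crystal C) i b = None \<longleftrightarrow> list_eps E F b = 0) \<and> (cf (list_crystal C) i b = None \<longleftrightarrow> list_phi E F b = 0)
    \<and> (\<forall>b'. ce (list_crystal C) i b = Some b' \<longrightarrow> b' \<in> UNIV \<and> list_eps E F b = Suc (list_eps E F b') \<and> list_phi E F b' = Suc (list_phi E F b) \<and> cf (list_crystal C) i b' = Some b)
    \<and> (\<forall>b'. cf (list_crystal C) i b = Some b' \<longrightarrow> b' \<in> UNIV \<and> list_phi E F b = Suc (list_phi E F b') \<and> list_eps E F b' = Suc (list_eps E F b) \<and> ce (list_crystal C) i b' = Some b)"
    unfolding ce cf
  proof (intro conjI allI impI)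
    show "ce (tensor_power C (length b)) i b = None \<longleftrightarrow> list_eps E F b = 0"
      "cf (tensor_power C (length b)) i b = None \<longleftrightarrow> list_phi E F b = 0"
      by (rule d(1) d(2), simp)+
  next
    fix b' assume "ce (tensor_power C (length b)) i b = Some b'"
    note * = d(3)[OF _ this]
    show "b' \<in> UNIV" "list_eps E F b = Suc (list_eps E F b')" "list_phi E F b' = Suc (list_phi E F b)"
      "cf (tensor_power C (length b')) i b' = Some b"
      using * by simp_all
  next
    fix b' assume "cf (tensor_power C (length b)) i b = Some b'"
    note * = d(4)[OF _ this]
    show "b' \<in> UNIV" "list_phi E F b = Suc (list_phi E F b')" "list_eps E F b' = Suc (list_eps E F b)"
      "ce (tensor_power C (length b')) i b' = Some b"
      using * by simp_all
  qed
qed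

lemma list_crystal_Cons:
  assumes C: "seminormal_on UNIV C i E F"
  shows "ce (list_crystal C) i (x # w) = (if E x > list_phi E F w then map_option (\<lambda>y. y # w) (ce C i x)
      else map_option (\<lambda>v. x # v) (ce (list_crystal C) i w))"
    "cf (list_crystal C) i (x # w) = (if E x \<ge> list_phi E F w then map_option (\<lambda>y. y # w) (cf C i x)
      else map_option (\<lambda>v. x # v) (cf (list_crystal C) i w))"
proof -
  have "phi (tensor_power C (length w)) i w = list_phi E F w"
    by (rule seminormal_on_eps_phi[OF seminormal_on_tensor_power[OF C]]) simp
  moreover have "eps C i x = E x"
    by (rule seminormal_on_eps_phi[OF C]) simp
  ultimately show "ce (list_crystal C) i (x # w) = (if E x > list_phi E F w then map_option (\<lambda>y. y # w) (ce C i x)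
      else map_option (\<lambda>v. x # v) (ce (list_crystal C) i w))"
    "cf (list_crystal C) i (x # w) = (if E x \<ge> list_phi E F w then map_option (\<lambda>y. y # w) (cf C i x)
      else map_option (\<lambda>v. x # v) (cf (list_crystal C) i w))"
    by (simp_all add: list_crystal_def tensor_def Let_def option.map_comp comp_def)
qed

lemma wt_list_crystal: "wt (list_crystal C) b = (\<lambda>a. \<Sum>x\<leftarrow>b. wt C x a)"
proof -
  have "length b = k \<Longrightarrow> wt (tensor_power C k) b = (\<lambda>a. \<Sum>x\<leftarrow>b. wt C x a)" for k
  proof (induction k arbitrary: b)
    case (Suc k)
    then show ?case by (cases b) (auto simp: Let_def tensor_def)
  qed simp
  then show ?thesis by (simp add: list_crystal_def)
qed

lemma list_eps_phi_append:
  "list_eps E F (u @ v) = list_eps E F v + (list_eps E F u - list_phi E F v)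
   \<and> list_phi E F (u @ v) = list_phi E F u + (list_phi E F v - list_eps E F u)"
  by (induction u) auto

text \<open>Associativity of the tensor product: a path has the same string lengths as the word read
  from its columns, and \<open>ls\<close> and \<open>lb\<close> leave this word unchanged.\<close>

lemma list_eps_phi_concat:
  "list_eps (list_eps E F) (list_phi E F) b = list_eps E F (concat b)
   \<and> list_phi (list_eps E F) (list_phi E F) b = list_phi E F (concat b)"
  by (induction b) (auto simp: list_eps_phi_append)

definition letter_eps :: "cartan_type \<Rightarrow> nat \<Rightarrow> int \<Rightarrow> nat" where
  "letter_eps T i x = of_bool (letter_e T i x \<noteq> None)"

definition letter_phi :: "cartan_type \<Rightarrow> nat \<Rightarrow> int \<Rightarrow> nat" where
  "letter_phi T i x = of_bool (letter_f T i x \<noteq> None)"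

lemma seminormal_letter_crystal:
  assumes "valid_type T"
  shows "seminormal_on UNIV (letter_crystal T) i (letter_eps T i) (letter_phi T i)"
proof (cases T)
  case (TypeA n)
  then show ?thesis
    by (auto simp: seminormal_on_def letter_crystal_def letter_eps_def letter_phi_def)
next
  case (TypeD n)
  then have n: "4 \<le> n" using assms by simp
  consider "i \<in> {1..<n}" | "i = n" | "i \<notin> {1..n}" using n by fastforce
  then show ?thesis
  proof cases
    case 1
    then show ?thesis using TypeD
      by (auto simp: seminormal_on_def letter_crystal_def letter_eps_def letter_phi_def split: if_splits)
  next
    case 2
    then show ?thesis using TypeD n
      by (auto simp: seminormal_on_def letter_crystal_def letter_eps_def letter_phi_def split: if_splits)
  next
    case 3
    then show ?thesis using TypeD n
      by (auto simp: seminormal_on_def letter_crystal_def letter_eps_def letter_phi_def)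
  qed
qed

abbreviation word_eps :: "cartan_type \<Rightarrow> nat \<Rightarrow> int list \<Rightarrow> nat" where
  "word_eps T i \<equiv> list_eps (letter_eps T i) (letter_phi T i)"

abbreviation word_phi :: "cartan_type \<Rightarrow> nat \<Rightarrow> int list \<Rightarrow> nat" where
  "word_phi T i \<equiv> list_phi (letter_eps T i) (letter_phi T i)"

definition word_wt :: "cartan_type \<Rightarrow> int list \<Rightarrow> weight" where
  "word_wt T w = (\<lambda>a. \<Sum>x\<leftarrow>w. letter_wt T x a)"

lemma word_wt_simps [simp]: "word_wt T [] = (\<lambda>_. 0)" "word_wt T (x # w) = (\<lambda>a. letter_wt T x a + word_wt T w a)"
  by (auto simp: word_wt_def)

lemma eps_path_crystal:
  assumes "valid_type T"
  shows "eps (path_crystal T) i b = word_eps T i (concat (concat b))"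
proof -
  note s = seminormal_list_crystal[OF seminormal_list_crystal[OF seminormal_list_crystal[OF seminormal_letter_crystal[OF assms]]]]
  show ?thesis
    unfolding path_crystal_def tableau_crystal_def seminormal_on_eps_phi(1)[OF s UNIV_I]
    by (simp add: list_eps_phi_concat)
qed

lemma sum_list_map_concat: "(\<Sum>x\<leftarrow>concat b. f x) = (\<Sum>w\<leftarrow>b. \<Sum>x\<leftarrow>w. f x)"
  for f :: "'a \<Rightarrow> int"
  by (induction b) auto

lemma wt_path_crystal: "wt (path_crystal T) b = word_wt T (concat (concat b))"
  unfolding path_crystal_def tableau_crystal_def wt_list_crystal word_wt_def
  by (simp add: letter_crystal_def sum_list_map_concat)

lemma letter_phi_eps:
  assumes "valid_type T" "i \<in> nodes T"
  shows "int (letter_phi T i x) - int (letter_eps T i x) = letter_wt T x i"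
    "letter_eps T i x = 0 \<or> letter_phi T i x = 0" "letter_eps T i x \<le> 1" "letter_phi T i x \<le> 1"
proof -
  have "(letter_eps T i x = 0 \<or> letter_phi T i x = 0) \<and> int (letter_phi T i x) - int (letter_eps T i x) = letter_wt T x i"
  proof (cases T)
    case (TypeA n)
    then show ?thesis using assms by (auto simp: letter_eps_def letter_phi_def)
  next
    case (TypeD n)
    then have n: "4 \<le> n" using assms by simp
    consider "i \<in> {1..<n}" | "i = n" using assms TypeD by fastforce
    then show ?thesis
    proof cases
      case 1
      consider "x = int i" | "x = int i + 1" | "x = - int i" | "x = - int i - 1" | "\<bar>x\<bar> \<noteq> int i" "\<bar>x\<bar> \<noteq> int i + 1"
        by linarith
      then show ?thesis using 1 TypeD
        by cases (auto simp: letter_eps_def letter_phi_def)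
    next
      case 2
      have m: "int (n - 1) = int n - 1" using n by simp
      consider "x = int n" | "x = int n - 1" | "x = - int n" | "x = 1 - int n" | "\<bar>x\<bar> \<noteq> int n" "\<bar>x\<bar> \<noteq> int n - 1"
        by linarith
      then show ?thesis using 2 TypeD n m
        by cases (auto simp: letter_eps_def letter_phi_def)
    qed
  qed
  then show "letter_eps T i x = 0 \<or> letter_phi T i x = 0"
    "int (letter_phi T i x) - int (letter_eps T i x) = letter_wt T x i" by auto
qed (auto simp: letter_eps_def letter_phi_def)

lemma list_phi_eps:
  assumes "\<And>x. x \<in> set w \<Longrightarrow> int (F x) - int (E x) = h x"
  shows "int (list_phi E F w) - int (list_eps E F w) = (\<Sum>x\<leftarrow>w. h x)"
  using assms
proof (induction w)
  case (Cons x w)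
  then have "int (list_phi E F w) - int (list_eps E F w) = (\<Sum>x\<leftarrow>w. h x)" "int (F x) - int (E x) = h x"
    by simp_all
  then show ?case by simp
qed simp

section \<open>Highest weight words\<close>

definition highest :: "cartan_type \<Rightarrow> int list \<Rightarrow> bool" where
  "highest T w \<longleftrightarrow> (\<forall>i\<in>nodes T. word_eps T i w = 0)"

lemma highest_Nil [simp]: "highest T []"
  by (simp add: highest_def)

lemma letter_wt_outside: "a \<notin> nodes T \<Longrightarrow> letter_wt T x a = 0"
  by (cases T) auto

lemma word_wt_outside: "a \<notin> nodes T \<Longrightarrow> word_wt T w a = 0"
  by (induction w) (auto simp: letter_wt_outside)

lemma highest_word_phi:
  assumes "valid_type T" "highest T w" "i \<in> nodes T"
  shows "int (word_phi T i w) = word_wt T w i"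
  using list_phi_eps[of w "letter_phi T i" "letter_eps T i" "\<lambda>x. letter_wt T x i"] letter_phi_eps(1)[OF assms(1,3)] assms(2,3)
  by (simp add: highest_def word_wt_def)

lemma highest_dominant:
  assumes "valid_type T" "highest T w"
  shows "word_wt T w \<in> dominant_weights T"
proof -
  have "0 \<le> word_wt T w i" if "i \<in> nodes T" for i
    using highest_word_phi[OF assms that] by (metis of_nat_0_le_iff)
  then show ?thesis
    by (simp add: dominant_weights_def word_wt_outside)
qed

text \<open>If w is highest, \<open>word_phi\<close> at i is the i-th weight coefficient of w.
  String lengths of a letter are at most 1 and never both positive, so a letter in front creates no
  raising arrow exactly when the coefficient of the sum stays nonnegative.\<close>

lemma highest_Cons:
  assumes T: "valid_type T"
  shows "highest T (x # w) \<longleftrightarrow> highest T w \<and> word_wt T (x # w) \<in> dominant_weights T"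
proof (cases "highest T w")
  case True
  have "letter_eps T i x - word_phi T i w = 0 \<longleftrightarrow> 0 \<le> word_wt T (x # w) i" if i: "i \<in> nodes T" for i
  proof -
    have "letter_wt T x i + word_wt T w i = int (letter_phi T i x) - int (letter_eps T i x) + int (word_phi T i w)"
      using letter_phi_eps(1)[OF T i, of x] highest_word_phi[OF T True i] by simp
    then show ?thesis
      using letter_phi_eps(2,3)[OF T i, of x] by auto
  qed
  then have "highest T (x # w) \<longleftrightarrow> (\<forall>i\<in>nodes T. 0 \<le> word_wt T (x # w) i)"
    using True by (simp add: highest_def)
  then show ?thesis
    using True word_wt_outside[of _ T "x # w"] by (auto simp: dominant_weights_def)
next
  case False
  then show ?thesis by (auto simp: highest_def)
qed

lemma paths_iff:
  assumes "valid_type T"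
  shows "b \<in> paths T B lam \<longleftrightarrow> b \<in> elements T B \<and> highest T (concat (concat b)) \<and> word_wt T (concat (concat b)) = lam"
  using assms by (auto simp: paths_def highest_weight_elements_def eps_path_crystal wt_path_crystal highest_def)

subsection \<open>Weights below a dominant weight\<close>

definition min_eps :: "nat \<Rightarrow> weight \<Rightarrow> nat" where
  "min_eps i v = of_bool (v i = - 1)"

definition min_phi :: "nat \<Rightarrow> weight \<Rightarrow> nat" where
  "min_phi i v = of_bool (v i = 1)"

lemma seminormal_minuscule_crystal:
  assumes "i \<in> nodes T"
  shows "seminormal_on UNIV (minuscule_crystal T) i (min_eps i) (min_phi i)"
proof -
  have "simple_root T i i = 2"
    using assms by (simp add: simple_root_def cartan_def)
  then show ?thesis
    using assms by (auto simp: seminormal_on_def minuscule_crystal_def min_eps_def min_phi_def)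
qed

definition sum_wt :: "weight list \<Rightarrow> weight" where
  "sum_wt h = (\<lambda>a. \<Sum>v\<leftarrow>h. v a)"

text \<open>The bound on the coefficients is carried along because the minuscule crystal is defined
  on all weights, while phi - eps equals the coefficient only for the values -1, 0, 1.\<close>

definition min_highest :: "cartan_type \<Rightarrow> weight list \<Rightarrow> bool" where
  "min_highest T h \<longleftrightarrow> (\<forall>i\<in>nodes T. list_eps (min_eps i) (min_phi i) h = 0) \<and> (\<forall>v\<in>set h. \<forall>i\<in>nodes T. \<bar>v i\<bar> \<le> 1)"

lemma min_highest_phi:
  assumes "min_highest T h" "i \<in> nodes T"
  shows "int (list_phi (min_eps i) (min_phi i) h) = sum_wt h i"
proof -
  have "int (min_phi i v) - int (min_eps i v) = v i" if "v \<in> set h" for v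
  proof -
    have "\<bar>v i\<bar> \<le> 1" using assms that by (auto simp: min_highest_def)
    then have "v i = - 1 \<or> v i = 0 \<or> v i = 1" by linarith
    then show ?thesis by (auto simp: min_eps_def min_phi_def)
  qed
  then show ?thesis
    using list_phi_eps[of h "min_phi i" "min_eps i" "\<lambda>v. v i"] assms by (simp add: min_highest_def sum_wt_def)
qed

lemma min_highest_append: "min_highest T u \<Longrightarrow> min_highest T v \<Longrightarrow> min_highest T (u @ v)"
  by (simp add: min_highest_def list_eps_phi_append ball_Un)

lemma min_highest_concat: "(\<And>u. u \<in> set us \<Longrightarrow> min_highest T u) \<Longrightarrow> min_highest T (concat us)"
  by (induction us) (auto intro: min_highest_append simp: min_highest_def[of T "[]"])

lemma sum_wt_append: "sum_wt (u @ v) = (\<lambda>a. sum_wt u a + sum_wt v a)"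
  by (simp add: sum_wt_def)

lemma sum_wt_concat: "sum_wt (concat us) a = (\<Sum>u\<leftarrow>us. sum_wt u a)"
  by (induction us) (auto simp: sum_wt_append, simp add: sum_wt_def)

lemma letter_wt_fundamental:
  assumes "valid_type T" "k \<in> nodes T" "case T of TypeA n \<Rightarrow> True | TypeD n \<Rightarrow> k \<le> n - 2"
  shows "letter_wt T (int k) = (\<lambda>a. fundamental_weight k a - (if k = 1 then 0 else fundamental_weight (k - 1) a))"
proof
  fix a
  show "letter_wt T (int k) a = fundamental_weight k a - (if k = 1 then 0 else fundamental_weight (k - 1) a)"
  proof (cases T)
    case (TypeA n)
    consider "k = 1" | j where "k = Suc j" "1 \<le> j"
      using assms(2) TypeA by (cases k) fastforce+
    then show ?thesis using assms(2) TypeA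
      by cases (auto simp: fundamental_weight_def)
  next
    case (TypeD n)
    have n: "4 \<le> n" "k \<le> n - 2" "1 \<le> k" using assms TypeD by auto
    consider "a = 0" | "1 \<le> a" "a < n" | "a = n" | "a > n" by linarith
    then show ?thesis
    proof cases
      case 2
      consider "k = 1" | j where "k = Suc j" "1 \<le> j"
        using n by (cases k) fastforce+
      then show ?thesis using 2 TypeD n
        by cases (auto simp: fundamental_weight_def)
    next
      case 3
      then have "int k \<noteq> int n - 1" "int k \<noteq> int n" "k \<noteq> n" "k - 1 \<noteq> n" using n by auto
      then show ?thesis using 3 TypeD by (auto simp: fundamental_weight_def)
    next
      case 4
      then have "a \<noteq> k" "a \<noteq> k - 1" "\<not> a \<le> n" using n by auto
      then show ?thesis using TypeD by (simp add: fundamental_weight_def)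
    qed (use n TypeD in \<open>simp add: fundamental_weight_def\<close>)
  qed
qed

text \<open>The letter a + 1 has weight \<Lambda>_{a+1} - \<Lambda>_a for a >= 1. Its raising arrow,
  at node a, is blocked by the rest of the column, which has weight \<Lambda>_a.\<close>

lemma column_min_highest:
  assumes "valid_type T" "a \<in> nodes T" "case T of TypeA n \<Rightarrow> True | TypeD n \<Rightarrow> a \<le> n - 2"
  defines "h \<equiv> \<lambda>a. map (\<lambda>k. letter_wt T (int k)) (rev [1..<Suc a])"
  shows "min_highest T (h a) \<and> sum_wt (h a) = fundamental_weight a"
  using assms(2,3)
proof (induction a)
  case (Suc a)
  have w: "letter_wt T (int (Suc a)) = (\<lambda>b. fundamental_weight (Suc a) b - (if Suc a = 1 then 0 else fundamental_weight a b))"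
    using letter_wt_fundamental[OF assms(1) Suc.prems] by (simp only: diff_Suc_1)
  show ?case
  proof (cases "a = 0")
    case True
    then show ?thesis using w
      by (auto simp: h_def min_highest_def sum_wt_def min_eps_def fundamental_weight_def)
  next
    case False
    then have IH: "min_highest T (h a)" "sum_wt (h a) = fundamental_weight a"
      using Suc by (cases T; auto split: cartan_type.splits)+
    have h: "h (Suc a) = letter_wt T (int (Suc a)) # h a"
      by (simp add: h_def)
    have "list_eps (min_eps i) (min_phi i) (h (Suc a)) = 0" if i: "i \<in> nodes T" for i
    proof -
      have "int (list_phi (min_eps i) (min_phi i) (h a)) = (if i = a then 1 else 0)"
        using min_highest_phi[OF IH(1) i] IH(2) by (simp add: fundamental_weight_def)
      moreover have "min_eps i (letter_wt T (int (Suc a))) = (if i = a then 1 else 0)"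
        using False w by (simp add: min_eps_def fundamental_weight_def)
      ultimately show ?thesis
        using IH(1) i by (auto simp: h min_highest_def split: if_splits)
    qed
    moreover have "\<bar>letter_wt T (int (Suc a)) i\<bar> \<le> 1" for i
      unfolding w by (simp add: fundamental_weight_def)
    ultimately have "min_highest T (h (Suc a))"
      using IH(1) by (auto simp: min_highest_def h)
    moreover have "sum_wt (h (Suc a)) = fundamental_weight (Suc a)"
      using IH(2) w False unfolding h by (simp add: sum_wt_def fun_eq_iff)
    ultimately show ?thesis by simp
  qed
qed simp

lemma fundamental_element_min_highest:
  assumes "valid_type T" "a \<in> nodes T"
  shows "min_highest T (fundamental_element T a) \<and> sum_wt (fundamental_element T a) = fundamental_weight a"
proof -
  have "min_highest T [fundamental_weight a] \<and> sum_wt [fundamental_weight a] = fundamental_weight a"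
    by (auto simp: min_highest_def sum_wt_def min_eps_def fundamental_weight_def)
  then show ?thesis
    using column_min_highest[OF assms] by (cases T) auto
qed

lemma highest_element_min_highest:
  assumes T: "valid_type T" and mu: "\<mu> \<in> dominant_weights T"
  shows "min_highest T (highest_element T \<mu>)" "sum_wt (highest_element T \<mu>) = \<mu>"
proof -
  show "min_highest T (highest_element T \<mu>)"
    unfolding highest_element_def
    using fundamental_element_min_highest[OF T] by (intro min_highest_concat) (auto intro!: min_highest_concat)
  show "sum_wt (highest_element T \<mu>) = \<mu>"
  proof
    fix b
    have "sum_wt (highest_element T \<mu>) b = (\<Sum>a\<leftarrow>sorted_list_of_set (nodes T). int (nat (\<mu> a)) * sum_wt (fundamental_element T a) b)"
      unfolding highest_element_def sum_wt_concat by (simp add: comp_def sum_wt_concat sum_list_replicate)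
    also have "\<dots> = (\<Sum>a\<in>nodes T. int (nat (\<mu> a)) * sum_wt (fundamental_element T a) b)"
      by (simp add: sum_list_distinct_conv_sum_set)
    also have "\<dots> = (\<Sum>a\<in>nodes T. if a = b then \<mu> a else 0)"
      using fundamental_element_min_highest[OF T] mu
      by (intro sum.cong) (auto simp: fundamental_weight_def dominant_weights_def)
    also have "\<dots> = \<mu> b"
      using mu by (simp add: dominant_weights_def)
    finally show "sum_wt (highest_element T \<mu>) b = \<mu> b" .
  qed
qed

text \<open>The witness is the letter tensored with the highest weight element of B(\<mu>);
  dominance of the total weight makes it a highest weight element.\<close>

lemma weights_belowI:
  assumes T: "valid_type T" and mu: "\<mu> \<in> dominant_weights T" and x: "x \<in> letters T"
    and lam: "(\<lambda>a. letter_wt T x a + \<mu> a) \<in> dominant_weights T"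
  shows "\<mu> \<in> weights_below T (\<lambda>a. letter_wt T x a + \<mu> a)"
proof -
  let ?h = "highest_element T \<mu>"
  let ?M = "list_crystal (minuscule_crystal T)"
  note h = highest_element_min_highest[OF T mu]
  have "wt (tensor (letter_crystal T) ?M) (x, ?h) = (\<lambda>a. letter_wt T x a + \<mu> a)"
  proof -
    have "wt ?M ?h = sum_wt ?h"
      by (simp add: wt_list_crystal sum_wt_def minuscule_crystal_def)
    then show ?thesis using h(2) by (simp add: tensor_def letter_crystal_def)
  qed
  moreover have "eps (tensor (letter_crystal T) ?M) i (x, ?h) = 0" if i: "i \<in> nodes T" for i
  proof -
    have "seminormal_on (UNIV \<times> UNIV) (tensor (letter_crystal T) ?M) i
       (tensor_eps (letter_eps T i) (list_eps (min_eps i) (min_phi i)) (list_phi (min_eps i) (min_phi i)))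
       (tensor_phi (letter_eps T i) (letter_phi T i) (list_phi (min_eps i) (min_phi i)))"
      by (intro seminormal_on_tensor seminormal_letter_crystal[OF T] seminormal_list_crystal seminormal_minuscule_crystal[OF i])
    then have "eps (tensor (letter_crystal T) ?M) i (x, ?h)
      = list_eps (min_eps i) (min_phi i) ?h + (letter_eps T i x - list_phi (min_eps i) (min_phi i) ?h)"
      using seminormal_on_eps_phi(1) by (fastforce simp: tensor_eps_def)
    moreover have "int (list_phi (min_eps i) (min_phi i) ?h) = \<mu> i"
      using min_highest_phi[OF h(1) i] h(2) by simp
    moreover have "0 \<le> letter_wt T x i + \<mu> i" "0 \<le> \<mu> i"
      using lam mu i by (auto simp: dominant_weights_def)
    ultimately show ?thesis
      using letter_phi_eps[OF T i, of x] h(1) i by (auto simp: min_highest_def)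
  qed
  moreover have "(x, ?h) \<in> letters T \<times> highest_weight_crystal T \<mu>"
    using x by (auto simp: highest_weight_crystal_def intro: component.base)
  ultimately show ?thesis
    unfolding weights_below_def highest_weight_elements_def using mu by blast
qed

section \<open>One-row crystals\<close>

lemma letter_crystal_sel [simp]: "ce (letter_crystal T) = letter_e T" "cf (letter_crystal T) = letter_f T"
  by (simp_all add: letter_crystal_def)

lemma index_ideal_union: "index_ideal T I \<Longrightarrow> index_ideal T J \<Longrightarrow> index_ideal T (I \<union> J)"
  unfolding index_ideal_def by blast

lemma index_ideal_inter: "index_ideal T I \<Longrightarrow> index_ideal T J \<Longrightarrow> index_ideal T (I \<inter> J)"
  unfolding index_ideal_def by blast

lemma letter_f_ideal:
  assumes T: "valid_type T" and x: "x \<in> letters T" and i: "i \<in> nodes T" and f: "letter_f T i x = Some y"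
  shows "y \<in> letters T \<and> (\<exists>v. v \<notin> ideal T x \<and> ideal T y = insert v (ideal T x) \<and> (v = i \<or> v = upper T i))"
proof (cases T)
  case (TypeA n)
  then have "y = x + 1" "x = int i" using f i by (auto split: if_splits)
  then show ?thesis using TypeA i x by (auto intro!: exI[of _ i])
next
  case (TypeD n)
  obtain m where m: "n = m + 4"
    using T TypeD by (metis add.commute le_Suc_ex valid_type.simps(2))
  consider "i < n" "x = int i" "y = int i + 1" | "i < n" "x = - (int i + 1)" "y = - int i"
    | "i = n" "x = int n - 1" "y = - int n" | "i = n" "x = int n" "y = - (int n - 1)"
    using f i TypeD by (auto split: if_splits)
  then show ?thesis
  proof cases
    case 1
    then show ?thesis using i TypeD by (auto intro!: exI[of _ i])
  next
    case 2
    show ?thesis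
    proof (cases "i = n - 1")
      case True
      then have "ideal T x = {1..m + 2} \<union> {m + 4}" "ideal T y = {1..m + 4}" "i = m + 3"
        using 2 TypeD m by auto
      then show ?thesis using 2 i TypeD m by (auto intro!: exI[of _ i])
    next
      case False
      then have "ideal T x = {1..2 * m + 6 - i}" "ideal T y = {1..2 * m + 7 - i}" "upper T i = 2 * m + 7 - i" "i < m + 3"
        using 2 i TypeD m by auto
      then show ?thesis using 2 i TypeD m by (auto intro!: exI[of _ "upper T i"])
    qed
  next
    case 3
    then have "ideal T x = {1..m + 2}" "ideal T y = {1..m + 2} \<union> {m + 4}" "i = m + 4"
      using TypeD m by auto
    then show ?thesis using 3 TypeD m by (auto intro!: exI[of _ i])
  next
    case 4
    then have "ideal T x = {1..m + 3}" "ideal T y = {1..m + 4}" "i = m + 4"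
      using TypeD m by auto
    then show ?thesis using 4 TypeD m by (auto intro!: exI[of _ i])
  qed
qed

lemma index_weight_insert:
  assumes T: "valid_type T" and i: "i \<in> nodes T" and v: "v = i \<or> v = upper T i" "v \<notin> I" "v \<noteq> top_index T"
  shows "index_weight T (insert v I) i = index_weight T I i - 2"
proof -
  note o = index_order[OF T i]
  have "lower T i \<noteq> v" "mid1 T i \<noteq> v" "mid2 T i \<noteq> v" "above T i \<noteq> v" "i \<noteq> upper T i" "v \<noteq> 0"
    using o v i by (cases "upper T i = top_index T"; auto)+
  then show ?thesis
    using v i by (auto simp: index_weight_def)
qed

lemma letter_wt_range:
  assumes "valid_type T" "i \<in> nodes T"
  shows "\<bar>letter_wt T x i\<bar> \<le> 1" "letter_wt T x i = 1 \<longleftrightarrow> letter_phi T i x = 1" "letter_wt T x i = - 1 \<longleftrightarrow> letter_eps T i x = 1"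
  using letter_phi_eps[OF assms, of x] by auto

text \<open>Adding an index of colour i lowers the coefficient at i by 2. Coefficients of letters
  lie between -1 and 1, so it must have been 1 before.\<close>

lemma letter_phi_of_insert:
  assumes T: "valid_type T" and i: "i \<in> nodes T" and v: "v = i \<or> v = upper T i" and z: "z \<in> letters T" "v \<notin> ideal T z"
    and I: "index_ideal T (insert v (ideal T z))"
  shows "letter_phi T i z = 1"
proof -
  obtain z' where z': "z' \<in> letters T" "insert v (ideal T z) = ideal T z'"
    using index_ideal_eq_letter[OF T I] by blast
  have "v \<noteq> top_index T"
    using I by (auto simp: index_ideal_def)
  then have "letter_wt T z' i = letter_wt T z i - 2"
    unfolding letter_wt_eq_index_weight[OF T z'(1)] letter_wt_eq_index_weight[OF T z(1)] z'(2)[symmetric]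
    by (rule index_weight_insert[OF T i v z(2)])
  then show ?thesis
    using letter_wt_range(1)[OF T i, of z'] letter_wt_range(1,2)[OF T i, of z] by auto
qed

lemma letter_eps_of_remove:
  assumes T: "valid_type T" and i: "i \<in> nodes T" and v: "v = i \<or> v = upper T i" and z: "z \<in> letters T" "v \<in> ideal T z"
    and I: "index_ideal T (ideal T z - {v})"
  shows "letter_eps T i z = 1"
proof -
  obtain z' where z': "z' \<in> letters T" "ideal T z - {v} = ideal T z'"
    using index_ideal_eq_letter[OF T I] by blast
  have "v \<noteq> top_index T"
    using ideal_index_ideal[OF T z(1)] z(2) by (auto simp: index_ideal_def)
  then have "index_weight T (insert v (ideal T z')) i = index_weight T (ideal T z') i - 2"
    using z'(2) by (intro index_weight_insert[OF T i v]) auto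
  moreover have "insert v (ideal T z') = ideal T z"
    using z'(2) z(2) by auto
  ultimately have "letter_wt T z' i = letter_wt T z i + 2"
    unfolding letter_wt_eq_index_weight[OF T z'(1)] letter_wt_eq_index_weight[OF T z(1)] by simp
  then show ?thesis
    using letter_wt_range(1)[OF T i, of z'] letter_wt_range(1,3)[OF T i, of z] by auto
qed

abbreviation ideal_le :: "cartan_type \<Rightarrow> int \<Rightarrow> int \<Rightarrow> bool" where
  "ideal_le T x y \<equiv> ideal T x \<subseteq> ideal T y"

abbreviation word_crystal :: "cartan_type \<Rightarrow> int list crystal" where
  "word_crystal T \<equiv> list_crystal (letter_crystal T)"

text \<open>The description of B(s \<Lambda>_1) by weakly increasing rows. In type D inclusion of
  ideals leaves n and -n incomparable, which expresses that they do not occur together.\<close>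

definition rows :: "cartan_type \<Rightarrow> nat \<Rightarrow> int list set" where
  "rows T s = {w. length w = s \<and> set w \<subseteq> letters T \<and> sorted_wrt (ideal_le T) w}"

context
  fixes T i
  assumes T: "valid_type T" and i: "i \<in> nodes T"
begin

private lemma letter_inverse: "letter_e T i x = Some y \<Longrightarrow> letter_f T i y = Some x"
  using seminormal_onD(3)[OF seminormal_letter_crystal[OF T], of x i y] by (simp add: letter_crystal_def)

lemmas word_crystal_Cons = list_crystal_Cons[OF seminormal_letter_crystal[OF T]]

lemma word_f_sorted:
  assumes "set w \<subseteq> letters T" "sorted_wrt (ideal_le T) w" "cf (word_crystal T) i w = Some w'"
  shows "set w' \<subseteq> letters T \<and> sorted_wrt (ideal_le T) w' \<and> length w' = length w
    \<and> (w \<noteq> [] \<longrightarrow> ideal_le T (hd w) (hd w'))"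
  using assms
proof (induction w arbitrary: w')
  case Nil
  then show ?case by (simp add: list_crystal_def)
next
  case (Cons x w)
  have x: "x \<in> letters T" and w: "set w \<subseteq> letters T" "sorted_wrt (ideal_le T) w" and xw: "\<And>z. z \<in> set w \<Longrightarrow> ideal_le T x z"
    using Cons.prems by auto
  show ?case
  proof (cases "letter_eps T i x \<ge> word_phi T i w")
    case True
    then obtain y where y: "letter_f T i x = Some y" "w' = y # w"
      using Cons.prems(3) by (auto simp: word_crystal_Cons)
    obtain v where v: "v \<notin> ideal T x" "ideal T y = insert v (ideal T x)" "v = i \<or> v = upper T i" and yl: "y \<in> letters T"
      using letter_f_ideal[OF T x i y(1)] by blast
    \<comment> \<open>A letter with a lowering arrow has no raising arrow at the same node. That the
      operator acts on the head therefore means that the rest of the row has \<open>word_phi\<close>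
      0.\<close>
    have "letter_phi T i x \<noteq> 0"
      using y(1) by (simp add: letter_phi_def)
    then have "letter_eps T i x = 0"
      using letter_phi_eps(2)[OF T i, of x] by simp
    then have phi0: "word_phi T i w = 0"
      using True by simp
    have "ideal_le T y z" if z: "z \<in> set w" for z
    proof (cases w)
      case (Cons u w2)
      have u: "u \<in> letters T" "ideal_le T x u" "ideal_le T u z"
        using Cons w xw z by auto
      \<comment> \<open>Otherwise the union of the ideals of y and u would exceed that of u by the
        single index v of colour i, giving u a lowering arrow in spite of
        \<open>phi0\<close>.\<close>
      have "v \<in> ideal T u"
      proof (rule ccontr)
        assume vu: "v \<notin> ideal T u"
        have "index_ideal T (ideal T u \<union> ideal T y)"
          by (intro index_ideal_union ideal_index_ideal[OF T] u yl)
        moreover have "ideal T u \<union> ideal T y = insert v (ideal T u)"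
          using v(2) u(2) by auto
        ultimately have "letter_phi T i u = 1"
          using letter_phi_of_insert[OF T i v(3) u(1) vu] by simp
        then show False using phi0 Cons by simp
      qed
      then show ?thesis using v(2) u by auto
    qed (use z in simp)
    then show ?thesis
      using w yl y(2) v(2) by auto
  next
    case False
    then obtain w2 where w2: "cf (word_crystal T) i w = Some w2" "w' = x # w2"
      using Cons.prems(3) by (auto simp: word_crystal_Cons)
    note IH = Cons.IH[OF w w2(1)]
    have ne: "w \<noteq> []" using False by auto
    then have ne2: "w2 \<noteq> []" using IH by auto
    have "ideal_le T x z" if "z \<in> set w2" for z
    proof -
      have "ideal_le T (hd w2) z"
        using IH that ne2 by (cases w2) auto
      moreover have "ideal_le T x (hd w)" using ne xw by simp
      ultimately show ?thesis using IH ne by blast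
    qed
    then show ?thesis using IH x w2(2) by auto
  qed
qed

text \<open>The total size of the ideals drops with every raising operator; it is the measure for
  reaching the row 1 ... 1.\<close>

lemma word_e_sorted:
  assumes "set w \<subseteq> letters T" "sorted_wrt (ideal_le T) w" "ce (word_crystal T) i w = Some w'"
  shows "set w' \<subseteq> letters T \<and> sorted_wrt (ideal_le T) w' \<and> length w' = length w
    \<and> sum_list (map (\<lambda>x. card (ideal T x)) w) = Suc (sum_list (map (\<lambda>x. card (ideal T x)) w'))"
  using assms
proof (induction w arbitrary: w')
  case Nil
  then show ?case by (simp add: list_crystal_def)
next
  case (Cons x w)
  have x: "x \<in> letters T" and w: "set w \<subseteq> letters T" "sorted_wrt (ideal_le T) w" and xw: "\<And>z. z \<in> set w \<Longrightarrow> ideal_le T x z"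
    using Cons.prems by auto
  have fin: "finite (ideal T y)" if "y \<in> letters T" for y
    using ideal_index_ideal[OF T that] by (auto simp: index_ideal_def intro: finite_subset)
  have e_letter: "y0 \<in> letters T" if "letter_e T i y = Some y0" "y \<in> letters T" for y y0
    using that T i by (cases T) (auto split: if_splits)
  show ?case
  proof (cases "letter_eps T i x > word_phi T i w")
    case True
    then obtain y where y: "letter_e T i x = Some y" "w' = y # w"
      using Cons.prems(3) by (auto simp: word_crystal_Cons)
    have yl: "y \<in> letters T" by (rule e_letter[OF y(1) x])
    then obtain v where v: "v \<notin> ideal T y" "ideal T x = insert v (ideal T y)"
      using letter_f_ideal[OF T yl i letter_inverse[OF y(1)]] by blast
    have "ideal_le T y z" if "z \<in> set w" for z
      using xw[OF that] v by auto
    moreover have "card (ideal T x) = Suc (card (ideal T y))"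
      using v fin[OF yl] by simp
    ultimately show ?thesis
      using w yl y(2) by auto
  next
    case False
    then obtain w2 where w2: "ce (word_crystal T) i w = Some w2" "w' = x # w2"
      using Cons.prems(3) by (auto simp: word_crystal_Cons)
    note IH = Cons.IH[OF w w2(1)]
    obtain y wt where wy: "w = y # wt"
      using w2(1) by (cases w) (auto simp: list_crystal_def)
    have y: "y \<in> letters T" "ideal_le T x y" using wy w xw by auto
    have "w2 \<noteq> []" using IH wy by auto
    have "ideal_le T x (hd w2)"
    proof (cases "letter_eps T i y > word_phi T i wt")
      case True
      then obtain y0 where y0: "letter_e T i y = Some y0" "w2 = y0 # wt"
        using w2(1) wy by (auto simp: word_crystal_Cons)
      have y0l: "y0 \<in> letters T" by (rule e_letter[OF y0(1) y(1)])
      obtain v where v: "v \<notin> ideal T y0" "ideal T y = insert v (ideal T y0)" "v = i \<or> v = upper T i"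
        using letter_f_ideal[OF T y0l i letter_inverse[OF y0(1)]] by blast
      \<comment> \<open>Otherwise x has a raising arrow too. As the rest of the row has
        \<open>word_phi\<close> 0 at i, the operator would have acted on x.\<close>
      have "v \<notin> ideal T x"
      proof
        assume vx: "v \<in> ideal T x"
        have "index_ideal T (ideal T x \<inter> ideal T y0)"
          by (intro index_ideal_inter ideal_index_ideal[OF T] x y0l)
        moreover have "ideal T x \<inter> ideal T y0 = ideal T x - {v}"
          using v y(2) by auto
        ultimately have "letter_eps T i x = 1"
          using letter_eps_of_remove[OF T i v(3) x vx] by simp
        moreover have "letter_eps T i y = 1" "letter_phi T i y = 0"
          using True letter_phi_eps(2,3)[OF T i, of y] by auto
        ultimately show False
          using False True wy by simp
      qed
      then show ?thesis using y(2) v(2) y0(2) by auto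
    next
      case False
      then show ?thesis using w2(1) wy y(2) by (auto simp: word_crystal_Cons)
    qed
    then have "ideal_le T x z" if "z \<in> set w2" for z
      using IH that \<open>w2 \<noteq> []\<close> by (cases w2) auto
    then show ?thesis using IH x w2(2) by auto
  qed
qed

end

text \<open>The last letter is the rightmost tensor factor, whose raising arrows are never
  cancelled.\<close>

lemma word_eps_last:
  "w \<noteq> [] \<Longrightarrow> E (last w) \<le> list_eps E F w"
proof (induction w)
  case (Cons x w)
  then show ?case by (cases "w = []") auto
qed simp

lemma letter_e_exists:
  assumes "valid_type T" "z \<in> letters T" "z \<noteq> 1"
  shows "\<exists>i\<in>nodes T. letter_eps T i z = 1"
proof (cases T)
  case (TypeA n)
  then show ?thesis using assms by (intro bexI[of _ "nat (z - 1)"]) (auto simp: letter_eps_def)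
next
  case (TypeD n)
  then have n: "4 \<le> n" using assms by simp
  consider "1 < z" "z \<le> int n" | "z = - int n" | "- int n < z" "z < 0"
    using assms TypeD by fastforce
  then show ?thesis
  proof cases
    case 1
    then show ?thesis using TypeD by (intro bexI[of _ "nat (z - 1)"]) (auto simp: letter_eps_def)
  next
    case 2
    then show ?thesis using TypeD n by (intro bexI[of _ n]) (auto simp: letter_eps_def)
  next
    case 3
    then show ?thesis using TypeD by (intro bexI[of _ "nat (- z)"]) (auto simp: letter_eps_def)
  qed
qed

lemma one_letter: "valid_type T \<Longrightarrow> 1 \<in> letters T"
  by (cases T) auto

lemma ideal_one: "ideal T 1 = {}"
  by (cases T) auto

lemma component_word_crystal:
  assumes T: "valid_type T"
  shows "component (word_crystal T) (nodes T) (replicate s 1) = rows T s"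
proof (intro equalityI subsetI)
  fix w assume "w \<in> component (word_crystal T) (nodes T) (replicate s 1)"
  then show "w \<in> rows T s"
  proof induction
    case base
    then show ?case using one_letter[OF T]
      by (auto simp: rows_def sorted_wrt_iff_nth_less)
  next
    case (step b i b')
    then show ?case using word_f_sorted[OF T, of i b b'] by (simp add: rows_def)
  qed
next
  fix w assume "w \<in> rows T s"
  then show "w \<in> component (word_crystal T) (nodes T) (replicate s 1)"
  proof (induction "sum_list (map (\<lambda>x. card (ideal T x)) w)" arbitrary: w rule: less_induct)
    case less
    then have w: "set w \<subseteq> letters T" "sorted_wrt (ideal_le T) w" "length w = s"
      by (auto simp: rows_def)
    show ?case
    proof (cases "\<forall>x\<in>set w. x = 1")
      case True
      then have "w = replicate s 1"
        using w(3) by (metis replicate_eqI)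
      then show ?thesis by (simp add: component.base)
    next
      case False
      then obtain x where x: "x \<in> set w" "x \<noteq> 1" by blast
      then have ne: "w \<noteq> []" by auto
      then obtain u z where uz: "w = u @ [z]" by (metis append_butlast_last_id)
      have zl: "z \<in> letters T" using w uz by auto
      \<comment> \<open>The last letter has the largest ideal, so it differs from 1 if any letter
        does; by \<open>word_eps_last\<close> its raising arrow is visible in the whole row.\<close>
      have "z \<noteq> 1"
      proof
        assume "z = 1"
        then have "ideal T x \<subseteq> {}"
          using w(2) x uz ideal_one[of T] by (auto simp: sorted_wrt_append)
        moreover have "x \<in> letters T" using x w by auto
        ultimately show False
          using ideal_inject[OF T _ one_letter[OF T], of x] ideal_one[of T] x(2) by auto
      qed
      then obtain i where i: "i \<in> nodes T" "letter_eps T i z = 1"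
        using letter_e_exists[OF T zl] by blast
      have "word_eps T i w \<noteq> 0"
        using word_eps_last[OF ne, of "letter_eps T i" "letter_phi T i"] i(2) uz by simp
      note sn = seminormal_list_crystal[OF seminormal_letter_crystal[OF T], of i]
      then obtain w0 where w0: "ce (word_crystal T) i w = Some w0"
        using seminormal_onD(1)[OF sn, of w] \<open>word_eps T i w \<noteq> 0\<close> by auto
      have "w0 \<in> component (word_crystal T) (nodes T) (replicate s 1)"
        using word_e_sorted[OF T i(1) w(1,2) w0] w(3) by (intro less.hyps) (auto simp: rows_def)
      moreover have "cf (word_crystal T) i w0 = Some w"
        using seminormal_onD(3)[OF sn _ w0] by simp
      ultimately show ?thesis
        by (rule component.step[OF _ i(1)])
    qed
  qed
qed

abbreviation row_tableau :: "int list \<Rightarrow> tableau" where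
  "row_tableau w \<equiv> map (\<lambda>x. [x]) w"

lemma cf_tableau_row:
  assumes T: "valid_type T"
  shows "cf (tableau_crystal T) i (row_tableau w) = map_option row_tableau (cf (word_crystal T) i w)"
proof (induction w)
  case Nil
  then show ?case by (simp add: tableau_crystal_def list_crystal_def)
next
  case (Cons x w)
  note s1 = seminormal_letter_crystal[OF T, of i]
  have c: "cf (word_crystal T) i [x] = map_option (\<lambda>y. [y]) (cf (letter_crystal T) i x)"
    by (simp add: list_crystal_Cons[OF s1])
  have "concat (row_tableau w) = w" by (induction w) auto
  then have p: "list_phi (word_eps T i) (word_phi T i) (row_tableau w) = word_phi T i w"
    using list_eps_phi_concat[of "letter_eps T i" "letter_phi T i" "row_tableau w"] by simp
  show ?case
    using Cons c p unfolding tableau_crystal_def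
    by (simp add: list_crystal_Cons(2)[OF seminormal_list_crystal[OF s1]] list_crystal_Cons(2)[OF s1]
        option.map_comp comp_def)
qed

lemma component_row:
  assumes T: "valid_type T"
  shows "component (tableau_crystal T) (nodes T) (replicate s [1]) = row_tableau ` rows T s"
proof -
  have "component (tableau_crystal T) I (row_tableau u) = row_tableau ` component (word_crystal T) I u" for I u
  proof (intro equalityI subsetI)
    fix t assume "t \<in> component (tableau_crystal T) I (row_tableau u)"
    then show "t \<in> row_tableau ` component (word_crystal T) I u"
    proof induction
      case base
      then show ?case by (auto intro: component.base)
    next
      case (step b i b')
      then obtain w where w: "b = row_tableau w" "w \<in> component (word_crystal T) I u" by blast
      then obtain w' where "cf (word_crystal T) i w = Some w'" "b' = row_tableau w'"
        using step(3) by (auto simp: cf_tableau_row[OF T])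
      then show ?case using component.step[OF w(2) step(2)] by blast
    qed
  next
    fix t assume "t \<in> row_tableau ` component (word_crystal T) I u"
    then obtain w where w: "t = row_tableau w" "w \<in> component (word_crystal T) I u" by blast
    from w(2) show "t \<in> component (tableau_crystal T) I (row_tableau u)"
      unfolding w(1)
    proof induction
      case base
      show ?case by (rule component.base)
    next
      case (step b i b')
      have "cf (tableau_crystal T) i (row_tableau b) = Some (row_tableau b')"
        using step(3) by (simp add: cf_tableau_row[OF T])
      then show ?case by (rule component.step[OF step(4,2)])
    qed
  qed
  then have "component (tableau_crystal T) (nodes T) (row_tableau (replicate s 1)) = row_tableau ` rows T s"
    unfolding component_word_crystal[OF T, symmetric] .
  moreover have "row_tableau (replicate s 1) = replicate s [1]"
    by simp
  ultimately show ?thesis by (simp only:)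
qed

section \<open>Splitting tableaux\<close>

definition column_le :: "cartan_type \<Rightarrow> column \<Rightarrow> column \<Rightarrow> bool" where
  "column_le T c d \<longleftrightarrow> list_all2 (ideal_le T) c d"

lemma KR_D: "valid_type (TypeD n) \<Longrightarrow> KR (TypeD n) 1 s = row_tableau ` rows (TypeD n) s"
  using component_row[of "TypeD n" s] by simp

lemma ideal_le_A: "x \<in> letters (TypeA n) \<Longrightarrow> y \<in> letters (TypeA n) \<Longrightarrow> ideal_le (TypeA n) x y \<longleftrightarrow> x \<le> y"
  by auto

lemma KR_1_1:
  assumes T: "valid_type T"
  shows "KR T 1 1 = {[[x]] |x. x \<in> letters T}"
proof (cases T)
  case (TypeA n)
  then show ?thesis by (auto simp: length_Suc_conv)
next
  case (TypeD n)
  have "KR T 1 1 = row_tableau ` rows T 1" using KR_D[of n 1] T TypeD by (simp only:)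
  also have "rows T 1 = {[x] |x. x \<in> letters T}"
    by (auto simp: rows_def length_Suc_conv)
  finally show ?thesis by (simp add: Setcompr_eq_image image_image)
qed

lemma list_all2_trans_le: "list_all2 (\<le>) a b \<Longrightarrow> list_all2 (\<le>) b c \<Longrightarrow> list_all2 (\<le>) a (c :: int list)"
  by (rule list_all2_trans[of "(\<le>)" "(\<le>)" "(\<le>)"]) auto

text \<open>The order of columns is transitive, so the first column need only be compared with its
  right neighbour. This describes the image of \<open>ls\<close>.\<close>

lemma KR_split:
  assumes T: "valid_type T" and s: "2 \<le> s" and r: "case T of TypeA n \<Rightarrow> True | TypeD n \<Rightarrow> r = 1"
  shows "t \<in> KR T r s \<longleftrightarrow> (\<exists>c t'. t = c # t' \<and> [c] \<in> KR T r 1 \<and> t' \<in> KR T r (s - 1) \<and> column_le T c (hd t'))"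
proof (cases T)
  case (TypeA n)
  show ?thesis
  proof
    assume t: "t \<in> KR T r s"
    then obtain c t' where ct: "t = c # t'" "t' \<noteq> []" using TypeA s by (cases t; cases "tl t") auto
    have "list_all2 (ideal_le T) c (hd t')"
      unfolding list_all2_conv_all_nth
    proof (intro conjI allI impI)
      have le: "list_all2 (\<le>) c (hd t')" and len: "length c = r" and set: "set c \<subseteq> letters T" "set (hd t') \<subseteq> letters T"
        using t ct TypeA by auto
      show "length c = length (hd t')" using le by (rule list_all2_lengthD)
      fix i assume i: "i < length c"
      then have "c ! i \<le> hd t' ! i" "c ! i \<in> letters T" "hd t' ! i \<in> letters T"
        using le set by (auto simp: list_all2_conv_all_nth intro: nth_mem subsetD)
      then show "ideal_le T (c ! i) (hd t' ! i)" using ideal_le_A[of _ n] TypeA by simp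
    qed
    then show "\<exists>c t'. t = c # t' \<and> [c] \<in> KR T r 1 \<and> t' \<in> KR T r (s - 1) \<and> column_le T c (hd t')"
      using t ct TypeA by (auto simp: column_le_def)
  next
    assume "\<exists>c t'. t = c # t' \<and> [c] \<in> KR T r 1 \<and> t' \<in> KR T r (s - 1) \<and> column_le T c (hd t')"
    then obtain c t' where ct: "t = c # t'" "[c] \<in> KR T r 1" "t' \<in> KR T r (s - 1)" "column_le T c (hd t')" by blast
    have ne: "t' \<noteq> []" using ct(3) TypeA s by auto
    have le: "list_all2 (\<le>) c (hd t')"
      unfolding list_all2_conv_all_nth
    proof (intro conjI allI impI)
      have le: "list_all2 (ideal_le T) c (hd t')" and set: "set c \<subseteq> letters T" "set (hd t') \<subseteq> letters T"
        using ct ne TypeA by (auto simp: column_le_def)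
      show "length c = length (hd t')" using le by (rule list_all2_lengthD)
      fix i assume i: "i < length c"
      then have "ideal_le T (c ! i) (hd t' ! i)" "c ! i \<in> letters T" "hd t' ! i \<in> letters T"
        using le set by (auto simp: list_all2_conv_all_nth intro: nth_mem subsetD)
      then show "c ! i \<le> hd t' ! i" using ideal_le_A[of _ n] TypeA by simp
    qed
    have "list_all2 (\<le>) c d" if "d \<in> set t'" for d
    proof (cases "d = hd t'")
      case False
      then have "list_all2 (\<le>) (hd t') d" using that ct(3) ne TypeA by (cases t') auto
      then show ?thesis using le list_all2_trans_le by blast
    qed (use le in simp)
    then show "t \<in> KR T r s"
      using ct TypeA s by auto
  qed
next
  case (TypeD n)
  then have r1: "r = 1" using r by simp
  have K: "KR T r k = row_tableau ` rows T k" for k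
    using KR_D[of n k] T TypeD r1 by (simp only:)
  have rows: "w \<in> rows T s \<longleftrightarrow> (\<exists>x w'. w = x # w' \<and> [x] \<in> rows T 1 \<and> w' \<in> rows T (s - 1) \<and> ideal_le T x (hd w'))" for w
  proof
    assume "w \<in> rows T s"
    then show "\<exists>x w'. w = x # w' \<and> [x] \<in> rows T 1 \<and> w' \<in> rows T (s - 1) \<and> ideal_le T x (hd w')"
      using s by (cases w; cases "tl w") (auto simp: rows_def)
  next
    assume "\<exists>x w'. w = x # w' \<and> [x] \<in> rows T 1 \<and> w' \<in> rows T (s - 1) \<and> ideal_le T x (hd w')"
    then show "w \<in> rows T s"
      using s by (cases "tl w") (auto simp: rows_def, blast)
  qed
  show ?thesis
  proof
    assume "t \<in> KR T r s"
    then obtain w where w: "t = row_tableau w" "w \<in> rows T s"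
      unfolding K by blast
    then obtain x w' where xw: "w = x # w'" "[x] \<in> rows T 1" "w' \<in> rows T (s - 1)" "ideal_le T x (hd w')"
      using rows[of w] by blast
    have "w' \<noteq> []" using xw(3) s by (auto simp: rows_def)
    then have "column_le T [x] (hd (row_tableau w'))"
      using xw(4) by (simp add: column_le_def hd_map)
    moreover have "t = [x] # row_tableau w'" "[[x]] \<in> KR T r 1" "row_tableau w' \<in> KR T r (s - 1)"
      unfolding K using w(1) xw by (auto intro: rev_image_eqI)
    ultimately show "\<exists>c t'. t = c # t' \<and> [c] \<in> KR T r 1 \<and> t' \<in> KR T r (s - 1) \<and> column_le T c (hd t')"
      by blast
  next
    assume "\<exists>c t'. t = c # t' \<and> [c] \<in> KR T r 1 \<and> t' \<in> KR T r (s - 1) \<and> column_le T c (hd t')"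
    then obtain c t' where ct: "t = c # t'" "[c] \<in> KR T r 1" "t' \<in> KR T r (s - 1)" "column_le T c (hd t')"
      by blast
    obtain w1 where w1: "[c] = row_tableau w1" "w1 \<in> rows T 1"
      using ct(2) unfolding K by (rule imageE)
    obtain w' where w': "t' = row_tableau w'" "w' \<in> rows T (s - 1)"
      using ct(3) unfolding K by (rule imageE)
    obtain x where x: "w1 = [x]" "c = [x]" using w1(1) by (cases w1) auto
    have "w' \<noteq> []" using w'(2) s by (auto simp: rows_def)
    then have "ideal_le T x (hd w')"
      using ct(4) x(2) w'(1) by (simp add: column_le_def hd_map)
    then have "x # w' \<in> rows T s"
      using rows[of "x # w'"] w1(2) w'(2) x(1) by blast
    then show "t \<in> KR T r s"
      unfolding K using ct(1) x(2) w'(1) by (auto intro: rev_image_eqI)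
  qed
qed

lemma KR_column_split:
  assumes "2 \<le> r"
  shows "t \<in> KR (TypeA n) r 1 \<longleftrightarrow>
    (\<exists>x c. t = [x # c] \<and> [[x]] \<in> KR (TypeA n) 1 1 \<and> [c] \<in> KR (TypeA n) (r - 1) 1 \<and> x > hd c)"
proof
  assume "t \<in> KR (TypeA n) r 1"
  then show "\<exists>x c. t = [x # c] \<and> [[x]] \<in> KR (TypeA n) 1 1 \<and> [c] \<in> KR (TypeA n) (r - 1) 1 \<and> x > hd c"
    using assms by (cases t; cases "hd t"; cases "tl (hd t)") auto
next
  assume "\<exists>x c. t = [x # c] \<and> [[x]] \<in> KR (TypeA n) 1 1 \<and> [c] \<in> KR (TypeA n) (r - 1) 1 \<and> x > hd c"
  then obtain x c where xc: "t = [x # c]" "[[x]] \<in> KR (TypeA n) 1 1" "[c] \<in> KR (TypeA n) (r - 1) 1" "x > hd c" by blast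
  then show "t \<in> KR (TypeA n) r 1"
    using assms by (cases c) auto
qed

lemma KR_A_1: "t \<in> KR (TypeA n) r 1 \<Longrightarrow> \<exists>c. t = [c] \<and> length c = r"
  by (auto simp: length_Suc_conv)

lemma elements_Nil: "elements T [] = {[]}"
  by (auto simp: elements_def)

lemma elements_Cons: "b \<in> elements T ((r, s) # B) \<longleftrightarrow> (\<exists>t b'. b = t # b' \<and> t \<in> KR T r s \<and> b' \<in> elements T B)"
  by (auto simp: elements_def list_all2_Cons2)

section \<open>Splitting off a column\<close>

lemma vac_split:
  assumes "2 \<le> s"
  shows "vac T ((r, 1) # (r, s - 1) # B) R a i = vac T ((r, s) # B) R a i + of_bool (a = r \<and> 1 \<le> i \<and> i < s)"
proof -
  have "min i 1 + min i (s - 1) = min i s + of_bool (1 \<le> i \<and> i < s)"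
    using assms by auto
  then have "int (min i 1) + int (min i (s - 1)) = int (min i s) + of_bool (1 \<le> i \<and> i < s)"
    by (metis of_nat_add of_nat_of_bool)
  then show ?thesis
    by (auto simp: vacancy_eq)
qed

lemma rc_weight_split:
  assumes "2 \<le> s"
  shows "rc_weight T ((r, 1) # (r, s - 1) # B) R = rc_weight T ((r, s) # B) R"
  using assms by (auto simp: rc_weight_def of_nat_diff)

text \<open>Unsplitting lowers p_i at node r by one for 1 <= i < s and changes no other vacancy
  number. This is harmless exactly if these values are positive and no string of such a length is
  singular.\<close>

lemma valid_rc_split:
  fixes B :: kr_product and R :: rigged_configuration
  assumes s: "2 \<le> s" and r: "r \<in> nodes T"
  defines "p \<equiv> vac T ((r, 1) # (r, s - 1) # B) R"
  shows "valid_rc T ((r, s) # B) R \<longleftrightarrow> valid_rc T ((r, 1) # (r, s - 1) # B) R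
    \<and> (\<forall>i. 1 \<le> i \<and> i < s \<longrightarrow> 0 < p r i \<and> (i, p r i) \<notin># R r)"
proof -
  have vac: "vac T ((r, s) # B) R a i = p a i - of_bool (a = r \<and> 1 \<le> i \<and> i < s)" for a i
    unfolding p_def using vac_split[OF s, of T r B R a i] by simp
  show ?thesis
  proof (intro iffI conjI allI impI)
    assume v: "valid_rc T ((r, s) # B) R"
    have vs: "valid_strings (R a) (vac T ((r, s) # B) R a)" if "a \<in> nodes T" for a
      using v that by (simp add: valid_rc_def)
    have "valid_strings (R a) (p a)" if a: "a \<in> nodes T" for a
    proof (rule valid_stringsI)
      show "0 \<le> p a i" for i
        using valid_stringsD(1)[OF vs[OF a], of i] by (auto simp: vac of_bool_def split: if_splits)
      show "1 \<le> i \<and> 0 \<le> x \<and> x \<le> p a i" if "(i, x) \<in># R a" for i x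
        using valid_stringsD(2)[OF vs[OF a] that] by (auto simp: vac of_bool_def split: if_splits)
    qed
    then show "valid_rc T ((r, 1) # (r, s - 1) # B) R"
      using v unfolding valid_rc_def p_def by blast
    fix i assume i: "1 \<le> i \<and> i < s"
    show "0 < p r i"
      using valid_stringsD(1)[OF vs[OF r], of i] i by (simp add: vac)
    show "(i, p r i) \<notin># R r"
      using valid_stringsD(2)[OF vs[OF r], of i "p r i"] i by (auto simp: vac)
  next
    assume A: "valid_rc T ((r, 1) # (r, s - 1) # B) R \<and> (\<forall>i. 1 \<le> i \<and> i < s \<longrightarrow> 0 < p r i \<and> (i, p r i) \<notin># R r)"
    then have vs: "valid_strings (R a) (p a)" if "a \<in> nodes T" for a
      using that by (simp add: valid_rc_def p_def)
    have "valid_strings (R a) (vac T ((r, s) # B) R a)" if a: "a \<in> nodes T" for a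
    proof (rule valid_stringsI)
      show "0 \<le> vac T ((r, s) # B) R a i" for i
        using valid_stringsD(1)[OF vs[OF a], of i] A by (auto simp: vac of_bool_def)
      show "1 \<le> i \<and> 0 \<le> x \<and> x \<le> vac T ((r, s) # B) R a i" if ix: "(i, x) \<in># R a" for i x
      proof (cases "a = r \<and> 1 \<le> i \<and> i < s")
        case True
        then have "x \<noteq> p a i" using A ix by auto
        then show ?thesis
          using valid_stringsD(2)[OF vs[OF a] ix] True by (simp add: vac)
      next
        case False
        then show ?thesis
          using valid_stringsD(2)[OF vs[OF a] ix] by (simp only: vac) simp
      qed
    qed
    then show "valid_rc T ((r, s) # B) R"
      using A unfolding valid_rc_def by blast
  qed
qed

lemma admissible_one_le:
  assumes T: "valid_type T" and l: "admissible T l" and a: "a \<in> nodes T"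
  shows "l 1 \<le> l a"
  using a
proof (induction a rule: less_induct)
  case (less a)
  show ?case
  proof (cases "a = 1")
    case False
    then have "lower T a \<in> nodes T" "lower T a < a"
      using index_order(1-3)[OF T less.prems] by auto
    then show ?thesis
      using less.IH admissibleD(1)[OF l less.prems] by (blast intro: order_trans)
  qed simp
qed

text \<open>A string shortened in the first step is singular afterwards, hence available to the second step; read
  backwards, the strings of the second step are available to the first. This compares the
  selected lengths of two successive steps.\<close>

context
  fixes T s l l' p p' R R' q p'' R''
  assumes s: "2 \<le> (s :: nat)" and s1: "valid_step T l p R p' R'" and s2: "valid_step T l' q R' p'' R''"
    and q: "\<And>a i. a \<in> nodes T \<Longrightarrow> q a i = p' a i + of_bool (a = 1 \<and> 1 \<le> i \<and> i < s - 1)"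
begin

private lemma T: "valid_type T" by (rule valid_stepD(1)[OF s1])

private lemma both_adm: "admissible T l" "admissible T l'"
  by (rule valid_stepD(2)[OF s1] valid_stepD(2)[OF s2])+

private lemma singular_long:
  assumes a: "a \<in> nodes T" and i: "(i, q a i) \<in># R' a"
  shows "q a i = p' a i" "a = 1 \<Longrightarrow> s - 1 \<le> i"
proof -
  have "q a i \<le> p' a i"
    using valid_stringsD(2)[OF valid_stepD(7)[OF s1 a] i] by simp
  then have "\<not> (a = 1 \<and> 1 \<le> i \<and> i < s - 1)"
    using q[OF a, of i] by auto
  moreover have "1 \<le> i"
    using valid_stringsD(2)[OF valid_stepD(7)[OF s1 a] i] by simp
  ultimately show "q a i = p' a i" "a = 1 \<Longrightarrow> s - 1 \<le> i"
    using q[OF a, of i] by auto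
qed

text \<open>Upward induction. All lengths of the first step are at least s, and q differs from p'
  only for lengths below s - 1, so the string shortened at v is singular for the second step. The
  lengths below v are at most j by induction, so the second search meets it.\<close>

lemma second_step_less:
  assumes long: "enat s \<le> l 1"
  shows "1 \<le> v \<Longrightarrow> v < top_index T \<Longrightarrow> l v = enat (Suc j) \<Longrightarrow> l' v \<le> enat j"
proof (induction v arbitrary: j rule: less_induct)
  case (less v)
  have IH: "l' w \<le> enat j" if w: "w < v" "1 \<le> w" "l w \<le> enat (Suc j)" for w
  proof -
    obtain k where k: "l w = enat k" "k \<le> Suc j"
      using w(3) by (cases "l w") auto
    show ?thesis
    proof (cases k)
      case 0
      have "w < top_index T" using w less by simp
      with T have "1 \<le> l w"
      proof (cases rule: index_cases)
        case (3 a)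
        then show ?thesis
          using admissible_ge_1[OF T both_adm(1) 3(1)] admissibleD(7)[OF both_adm(1) 3(1)] by (metis order_trans)
      qed (use w admissible_ge_1[OF T both_adm(1)] in auto)
      then show ?thesis using k 0 by (simp add: one_enat_def)
    next
      case (Suc k')
      then have "l' w \<le> enat k'"
        using less.IH[of w k'] w less.prems(2) k by simp
      then show ?thesis using k Suc by (meson Suc_le_mono enat_ord_simps(1) order_trans)
    qed
  qed
  have pq: "q a j = p' a j" "1 \<le> j" if "a \<in> nodes T" "l a \<le> enat (Suc j)" for a
  proof -
    have "enat s \<le> enat (Suc j)"
      using long admissible_one_le[OF T both_adm(1) that(1)] that(2) by (meson order_trans)
    then show "q a j = p' a j" "1 \<le> j" using q[OF that(1)] s by auto
  qed
  from T less.prems(2) show ?case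
  proof (cases rule: index_cases)
    case 1
    then show ?thesis using less.prems by simp
  next
    case 2
    have "l' (lower T v) \<le> enat j"
    proof (cases "lower T v = 0")
      case True
      then have "l' (lower T v) = 1" using both_adm by (simp add: admissible_def)
      then show ?thesis using pq(2)[OF 2] less.prems(3) by (simp add: one_enat_def)
    next
      case False
      then show ?thesis
        using IH[of "lower T v"] index_order(1)[OF T 2] admissibleD(1)[OF both_adm(1) 2] less.prems(3) by simp
    qed
    moreover have "(j, q v j) \<in># R' v"
      using valid_step_shortened(1)[OF s1 2] pq[OF 2] less.prems(3) by simp
    ultimately show ?thesis
      using valid_step_first[OF s2 2] by blast
  next
    case (3 a)
    note o = index_order[OF T 3(1)] and d = admissibleD[OF both_adm(1) 3(1)]
    have lv: "l (upper T a) = enat (Suc j)" using less.prems 3 by simp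
    have up: "upper T a \<noteq> top_index T" using less.prems 3 by simp
    have la: "l a \<le> enat (Suc j)" using d(7) lv by simp
    have mids: "l' (mid1 T a) \<le> enat j" "l' (mid2 T a) \<le> enat j"
      using IH[of "mid1 T a"] IH[of "mid2 T a"] o(4,5,11,12) up d(4,5) lv 3(2) by simp_all
    have la': "l' a \<le> enat j"
      using IH[of a] o(4,11) up la 3 zero_notin_nodes[of T] by (cases a) auto
    have sing: "(j, q a j) \<in># R' a"
      using valid_step_shortened(2)[OF s1 3(1)] pq[OF 3(1) la] lv by simp
    show ?thesis
    proof (rule ccontr)
      assume "\<not> l' v \<le> enat j"
      then have "enat j < l' (upper T a)" using 3(2) by simp
      then have *: "l' a = enat j" "count (R' a) (j, q a j) = 1"
        using valid_step_second[OF s2 3(1) sing mids] by auto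
      \<comment> \<open>The one singular string of length j has gone to the lower index a of the
        second step. Had the first step taken a shorter string at a, the second would be below j
        there; so the first step shortened two strings to length j.\<close>
      have "l a = enat (Suc j)"
      proof (rule ccontr)
        assume "l a \<noteq> enat (Suc j)"
        then obtain k where k: "l a = enat k" "k \<le> j"
          using la by (cases "l a") auto
        have "1 \<le> k" using admissible_ge_1[OF T both_adm(1) 3(1)] k by (simp add: one_enat_def)
        then have "l' a \<le> enat (k - 1)"
          using less.IH[of a "k - 1"] o(4,11) up 3 k less.prems(2) zero_notin_nodes[of T] by (cases a) auto
        then show False using *(1) k \<open>1 \<le> k\<close> by simp
      qed
      then have "2 \<le> count (R' a) (j, p' a j)"
        using valid_step_shortened(3)[OF s1 3(1)] pq[OF 3(1) la] lv by simp
      then show False using * pq[OF 3(1) la] by simp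
    qed
  qed
qed

text \<open>Downward induction: a string of the second step that is at least as long as that of the
  first would be singular in a range where the first step leaves no singular string, or only a
  single copy that is needed twice.\<close>

lemma second_step_less_back:
  assumes supp: "support T l \<subseteq> support T l'"
  shows "v \<in> support T l \<Longrightarrow> l' v < l v"
proof (induction "top_index T - v" arbitrary: v rule: less_induct)
  case less
  have v: "1 \<le> v" "v < top_index T" "l v \<noteq> \<infinity>" "l' v \<noteq> \<infinity>"
    using less.prems supp by (auto simp: support_def)
  have IH: "l' w < l w" if "v < w" "w \<le> top_index T" "l w \<noteq> \<infinity>" for w
  proof -
    have "w \<noteq> top_index T" using that both_adm by (auto simp: admissible_def)
    then have "w \<in> support T l" using that v by (simp add: support_def)
    then show ?thesis using less.hyps[of w] that v by simp
  qed
  obtain i where i: "l' v = enat i" using v by auto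
  have bound: "enat i < l w" if "v < w" "w \<le> top_index T" "l' v \<le> l' w" for w
    using IH[OF that(1,2)] that(3) i by (cases "l w = \<infinity>") auto
  show ?case
  proof (rule ccontr)
    assume "\<not> l' v < l v"
    then have lv: "l v \<le> enat i" using i by simp
    from T v(2) show False
    proof (cases rule: index_cases)
      case 1
      then show ?thesis using v by simp
    next
      case 2
      note o = index_order[OF T 2] and d = admissibleD[OF both_adm(2) 2]
      have sing: "(i, q v i) \<in># R' v"
        by (rule valid_step_selected(1)[OF s2 2 i])
      then have sing': "(i, p' v i) \<in># R' v" and qp: "q v i = p' v i"
        using singular_long(1)[OF 2] by auto
      have *: "l (upper T v) = enat (i + 1)" "count (R' v) (i, p' v i) = 1"
        using valid_step_first_back[OF s1 2 sing' lv bound bound] o(4,5,7,8) d(2,3) by auto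
      then have "l' (upper T v) < enat (i + 1)"
        using IH[of "upper T v"] o(6,9) by simp
      then have "l' (upper T v) = enat i"
        using d(7) i by (cases "l' (upper T v)") auto
      then have "2 \<le> count (R' v) (i, q v i)"
        using valid_step_selected(3)[OF s2 2] i by blast
      then show False using * qp by simp
    next
      case (3 a)
      have up: "upper T a \<noteq> top_index T" using v 3 by simp
      note o = index_order[OF T 3(1)] and d = admissibleD[OF both_adm(2) 3(1)]
      have "(i, q a i) \<in># R' a"
        using valid_step_selected(2)[OF s2 3(1)] i 3(2) by simp
      then have "(i, p' a i) \<in># R' a"
        using singular_long(1)[OF 3(1)] by auto
      then have "l (above T a) \<le> enat i"
        using valid_step_second_back[OF s1 3(1)] lv 3(2) by simp
      moreover have "enat i < l (above T a)"
        using bound[of "above T a"] o(10,13) up d(6) 3(2) by simp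
      ultimately show False by simp
    qed
  qed
qed

text \<open>Both sides are equivalent to \<open>enat s \<le> l 1\<close>. The left side is the
  validity condition of \<open>valid_rc_split\<close>; inclusion of supports is the inequality
  between the two removed letters.\<close>

lemma row_criterion:
  shows "(\<forall>i. 1 \<le> i \<and> i < s \<longrightarrow> 0 < p 1 i \<and> (i, p 1 i) \<notin># R 1) \<longleftrightarrow> support T l \<subseteq> support T l'"
proof
  have 1: "1 \<in> nodes T" by (rule one_in_nodes[OF T])
  assume A: "\<forall>i. 1 \<le> i \<and> i < s \<longrightarrow> 0 < p 1 i \<and> (i, p 1 i) \<notin># R 1"
  have "enat s \<le> l 1"
  proof (cases "l 1")
    case (enat i)
    then have "(i, p 1 i) \<in># R 1"
      by (rule valid_step_selected(1)[OF s1 1])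
    moreover have "1 \<le> i"
      using admissible_ge_1[OF T both_adm(1) 1] enat by (simp add: one_enat_def)
    ultimately show ?thesis using A enat by auto
  qed simp
  then have less: "1 \<le> v \<Longrightarrow> v < top_index T \<Longrightarrow> l v = enat (Suc j) \<Longrightarrow> l' v \<le> enat j" for v j
    by (rule second_step_less)
  show "support T l \<subseteq> support T l'"
  proof
    fix v assume v: "v \<in> support T l"
    then obtain k where k: "l v = enat k" "1 \<le> v" "v < top_index T" by (auto simp: support_def)
    have "1 \<le> l v"
      using T k(3)
    proof (cases rule: index_cases)
      case (3 a)
      then show ?thesis
        using admissible_ge_1[OF T both_adm(1) 3(1)] admissibleD(7)[OF both_adm(1) 3(1)] by (metis order_trans)
    qed (use k(2) admissible_ge_1[OF T both_adm(1)] in auto)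
    then obtain j where "l v = enat (Suc j)"
      using k(1) by (cases k) (auto simp: one_enat_def)
    then have "l' v \<le> enat j" using less k by blast
    then have "l' v \<noteq> \<infinity>" by (cases "l' v") auto
    then show "v \<in> support T l'" using k by (simp add: support_def)
  qed
next
  have 1: "1 \<in> nodes T" by (rule one_in_nodes[OF T])
  assume A: "support T l \<subseteq> support T l'"
  have long: "enat s \<le> l 1"
  proof (cases "l 1 = \<infinity>")
    case False
    then have "1 \<in> support T l"
      using index_order(17)[OF T 1] by (simp add: support_def)
    then have less: "l' 1 < l 1"
      by (rule second_step_less_back[OF A])
    then obtain i where i: "l' 1 = enat i" by (cases "l' 1") auto
    then have "(i, q 1 i) \<in># R' 1"
      by (rule valid_step_selected(1)[OF s2 1])
    then have "s - 1 \<le> i"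
      using singular_long(2)[OF 1] by blast
    then show ?thesis using less i s by (cases "l 1") auto
  qed simp
  show "\<forall>i. 1 \<le> i \<and> i < s \<longrightarrow> 0 < p 1 i \<and> (i, p 1 i) \<notin># R 1"
  proof (intro allI impI)
    fix i assume i: "1 \<le> i \<and> i < s"
    have low: "l (lower T 1) = 1"
      using index_order(2)[OF T 1] both_adm by (simp add: admissible_def)
    have i1: "l (lower T 1) \<le> enat i" "enat i < l 1"
      unfolding low using i less_le_trans[of "enat i" "enat s", OF _ long] by (auto simp: one_enat_def)
    have "(i, p 1 i) \<notin># R 1"
      using valid_step_first[OF s1 1 _ i1(1)] i1(2) by (meson leD)
    moreover have "p' 1 i = p 1 i - 1"
      using valid_stepD(3)[OF s1 1, of i] vacancy_change_cases(2)[OF both_adm(1) 1 i1] by simp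
    ultimately show "0 < p 1 i \<and> (i, p 1 i) \<notin># R 1"
      using valid_stepD(5)[OF s1 1, of i] by linarith
  qed
qed

end

section \<open>Columns in type \<open>A\<close>\<close>

text \<open>The map i with the vacancy function as a parameter; by \<open>vac_add_short\<close>
  those of the unsplit and of the split product agree.\<close>

definition add_short :: "nat \<Rightarrow> (nat \<Rightarrow> nat \<Rightarrow> int) \<Rightarrow> rigged_configuration \<Rightarrow> rigged_configuration" where
  "add_short t p R = (\<lambda>a. if 1 \<le> a \<and> a < t then add_mset (1, p a 1) (R a) else R a)"

definition column_rest :: "nat \<Rightarrow> kr_product \<Rightarrow> kr_product" where
  "column_rest r B = (if r = 1 then B else (r - 1, 1) # B)"

text \<open>For r >= 2 the sum of the simple roots at nodes below r is \<Lambda>_1 + \<Lambda>_{r-1}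
  - \<Lambda>_r. This is also the change of the factors under \<open>lb\<close>, so the added
  strings of length 1 leave all vacancy numbers as they were.\<close>

lemma cartan_sum_below:
  assumes "1 \<le> a" "a \<le> n" "1 \<le> r" "r \<le> n"
  shows "(\<Sum>b\<in>{1..n}. cartan (TypeA n) a b * of_bool (1 \<le> b \<and> b < r))
    = (if r = 1 then 0 else of_bool (a = 1) + of_bool (a = r - 1) - of_bool (a = r))"
  unfolding cartan_sum_A[OF assms(1,2)] using assms by (auto simp: of_bool_def)

context
  fixes n r :: nat and B :: kr_product
  assumes r: "1 \<le> r" "r \<le> n"
begin

abbreviation (input) "A \<equiv> TypeA n"

lemma vac_add_short:
  assumes a: "a \<in> nodes A"
  shows "vac A ((1, 1) # column_rest r B) (add_short r x R) a i = vac A ((r, 1) # B) R a i"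
proof -
  define Z :: "nat \<Rightarrow> int" where "Z b = of_bool (1 \<le> b \<and> b < r)" for b
  have shape: "part_sum (shape (add_short r x R) b) i = Z b * int (min i 1) + part_sum (shape R b) i" for b
    by (auto simp: shape_def add_short_def Z_def)
  have "(\<Sum>b\<in>nodes A. cartan A a b * part_sum (shape (add_short r x R) b) i)
      = (\<Sum>b\<in>nodes A. cartan A a b * Z b * int (min i 1) + cartan A a b * part_sum (shape R b) i)"
    unfolding shape by (simp add: distrib_left mult.assoc)
  then have "(\<Sum>b\<in>nodes A. cartan A a b * part_sum (shape (add_short r x R) b) i)
      = (\<Sum>b\<in>{1..n}. cartan A a b * of_bool (1 \<le> b \<and> b < r)) * int (min i 1) + (\<Sum>b\<in>nodes A. cartan A a b * part_sum (shape R b) i)"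
    by (simp only: sum.distrib sum_distrib_right Z_def nodes.simps)
  moreover have "1 \<le> a" "a \<le> n" using a by auto
  ultimately have sum: "(\<Sum>b\<in>nodes A. cartan A a b * part_sum (shape (add_short r x R) b) i)
      = (if r = 1 then 0 else of_bool (a = 1) + of_bool (a = r - 1) - of_bool (a = r)) * int (min i 1)
        + (\<Sum>b\<in>nodes A. cartan A a b * part_sum (shape R b) i)"
    using cartan_sum_below[of a n r] r by simp
  show ?thesis
    unfolding vacancy_eq sum by (cases "r = 1"; cases "a = 1"; cases "a = r - 1"; cases "a = r") (auto simp: column_rest_def)
qed

lemma rc_i_eq_add_short:
  assumes "2 \<le> r"
  shows "rc_i A (mult_array ((1, 1) # (r - 1, 1) # B)) r R = add_short r (vac A ((r, 1) # B) R) R"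
proof -
  let ?\<nu> = "\<lambda>a. if 1 \<le> a \<and> a < r then add_mset 1 (shape R a) else shape R a"
  have rest: "column_rest r B = (r - 1, 1) # B" using assms by (simp add: column_rest_def)
  have "?\<nu> = shape (add_short r (\<lambda>_ _. 0) R)"
    by (auto simp: shape_def add_short_def)
  then have "vacancy A (mult_array ((1, 1) # (r - 1, 1) # B)) ?\<nu> a 1 = vac A ((r, 1) # B) R a 1" if "1 \<le> a" "a < r" for a
    using vac_add_short[of a "\<lambda>_ _. 0" R 1] that r unfolding rest by simp
  then show ?thesis
    unfolding rc_i_def add_short_def Let_def by auto
qed

lemma rc_weight_add_short: "rc_weight A ((1, 1) # column_rest r B) (add_short r x R) = rc_weight A ((r, 1) # B) R"
proof
  fix a
  show "rc_weight A ((1, 1) # column_rest r B) (add_short r x R) a = rc_weight A ((r, 1) # B) R a"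
  proof (cases "a \<in> nodes A")
    case True
    obtain N1 N2 where "\<forall>i\<ge>N1. vac A ((1, 1) # column_rest r B) (add_short r x R) a i = rc_weight A ((1, 1) # column_rest r B) (add_short r x R) a"
      "\<forall>i\<ge>N2. vac A ((r, 1) # B) R a i = rc_weight A ((r, 1) # B) R a"
      using vacancy_eventually[OF True] by metis
    then show ?thesis
      using vac_add_short[OF True, of x R "N1 + N2"] by simp
  qed (simp only: rc_weight_def if_False)
qed

lemma valid_rc_add_short:
  "valid_rc A ((1, 1) # column_rest r B) (add_short r (vac A ((r, 1) # B) R) R) \<longleftrightarrow> valid_rc A ((r, 1) # B) R"
proof -
  let ?p = "vac A ((r, 1) # B) R"
  let ?S = "add_short r ?p R"
  have p: "vac A ((1, 1) # column_rest r B) ?S a = ?p a" if "a \<in> nodes A" for a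
    using vac_add_short[OF that] by blast
  have "valid_strings (?S a) (?p a) \<longleftrightarrow> valid_strings (R a) (?p a)" for a
    by (auto simp: valid_strings_def add_short_def)
  moreover have "?S a = R a" if "a \<notin> nodes A" for a
    using that r by (auto simp: add_short_def)
  ultimately show ?thesis
    unfolding valid_rc_def using p by auto
qed

end

text \<open>One step of removing a column of height \<open>t\<close> entry by entry: the map \<open>i\<close> followed by \<open>\<delta>\<close>.\<close>

definition column_step :: "nat \<Rightarrow> nat \<Rightarrow> (nat \<Rightarrow> enat) \<Rightarrow> (nat \<Rightarrow> nat \<Rightarrow> int) \<Rightarrow> rigged_configuration
    \<Rightarrow> (nat \<Rightarrow> nat \<Rightarrow> int) \<Rightarrow> rigged_configuration \<Rightarrow> bool" where
  "column_step n t l p R p' R' \<longleftrightarrow> 1 \<le> t \<and> t \<le> n \<and> valid_step (TypeA n) l p (add_short t p R) p' R'"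

lemma valid_step_cong:
  assumes "valid_step T l p R p' R'" "\<And>a i. a \<in> nodes T \<Longrightarrow> p a i = q a i" "\<And>a i. a \<in> nodes T \<Longrightarrow> p' a i = q' a i"
  shows "valid_step T l q R q' R'"
proof -
  have "step T l q R q' R'"
    unfolding step_def
  proof (intro conjI allI)
    show "admissible T l" by (rule valid_stepD(2)[OF assms(1)])
    fix a
    obtain K where K: "R a = K + image_mset (\<lambda>i. (i, p a i)) (sel T l a)"
      "R' a = K + image_mset (\<lambda>i. (i, p' a i)) (shorten (sel T l a))"
      using assms(1) unfolding valid_step_def step_def by meson
    show "\<exists>K. R a = K + image_mset (\<lambda>i. (i, q a i)) (sel T l a) \<and> R' a = K + image_mset (\<lambda>i. (i, q' a i)) (shorten (sel T l a))"
    proof (cases "a \<in> nodes T")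
      case True
      then show ?thesis using K assms(2,3) by auto
    next
      case False
      then show ?thesis using K by (auto simp: sel_def)
    qed
  qed
  moreover have "p a = q a" "p' a = q' a" if "a \<in> nodes T" for a
    using assms(2,3) that by blast+
  ultimately show ?thesis
    using assms(1) unfolding valid_step_def by metis
qed

context
  fixes n t l p R p' R'
  assumes step: "column_step n t l p R p' R'"
begin

private lemma s: "valid_step (TypeA n) l p (add_short t p R) p' R'"
  using step by (simp add: column_step_def)

private lemma t: "1 \<le> t" "t \<le> n"
  using step by (auto simp: column_step_def)

private lemma column_adm: "admissible (TypeA n) l"
  by (rule valid_stepD(2)[OF s])

lemma column_step_zero [simp]: "l 0 = 1"
  using column_adm by (simp add: admissible_def)

lemma column_step_top [simp]: "l (Suc n) = \<infinity>"
  using column_adm by (simp add: admissible_def)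

lemma column_step_mono: "a \<le> n \<Longrightarrow> l a \<le> l (Suc a)"
proof (cases "a = n")
  case False
  assume "a \<le> n"
  then show ?thesis
    using admissibleD(1)[OF column_adm, of "Suc a"] False by simp
qed simp

lemma column_step_mono': "a \<le> b \<Longrightarrow> b \<le> Suc n \<Longrightarrow> l a \<le> l b"
  by (induction rule: dec_induct) (auto intro: order_trans column_step_mono)

lemma column_step_ge_1: "a \<le> n \<Longrightarrow> 1 \<le> l a"
  using column_step_mono'[of 0 a] by simp

text \<open>At the nodes below t the search finds the added singular strings of length 1 at
  once.\<close>

lemma column_step_below: "a < t \<Longrightarrow> l a = 1"
proof (induction a)
  case (Suc a)
  then have "(1, p (Suc a) 1) \<in># add_short t p R (Suc a)"
    by (simp add: add_short_def)
  moreover have "Suc a \<in> nodes (TypeA n)" using Suc t by simp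
  ultimately have "l (Suc a) \<le> enat 1"
    using valid_step_first[OF s, of "Suc a" 1] Suc by (simp add: one_enat_def)
  then show ?case
    using column_step_ge_1[of "Suc a"] Suc.prems t by (simp add: one_enat_def)
qed simp

lemma column_step_first:
  assumes "t \<le> a" "a \<le> n" "(i, p a i) \<in># R a" "l (a - 1) \<le> enat i"
  shows "l a \<le> enat i"
  using valid_step_first[OF s, of a i] assms t by (simp add: add_short_def)

text \<open>In type A nothing is selected at \<open>upper\<close>, so the exception in
  \<open>valid_step_first_back\<close> cannot occur.\<close>

lemma column_step_back:
  assumes "1 \<le> a" "a \<le> n" "(i, p' a i) \<in># R' a" "l a \<le> enat i"
  shows "l (Suc a) \<le> enat i"
proof (rule ccontr)
  assume "\<not> ?thesis"
  then have "enat i < l (Suc a)" by simp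
  then have "l (upper (TypeA n) a) = enat (i + 1)"
    using valid_step_first_back[OF s, of a i] assms by simp
  then show False by simp
qed

lemma column_step_shortened:
  assumes "1 \<le> a" "a \<le> n" "l a = enat (Suc i)" "1 \<le> i"
  shows "(i, p' a i) \<in># R' a"
  using valid_step_shortened(1)[OF s, of a i] assms by simp

lemma column_step_selected:
  assumes "t \<le> a" "a \<le> n" "l a = enat i"
  shows "(i, p a i) \<in># R a"
  using valid_step_selected(1)[OF s, of a i] assms t by (simp add: add_short_def)

lemma column_step_nonneg: "a \<in> nodes (TypeA n) \<Longrightarrow> 0 \<le> p' a i"
  by (rule valid_stepD(5)[OF s])

lemma column_step_bound: "a \<in> nodes (TypeA n) \<Longrightarrow> (i, x) \<in># R' a \<Longrightarrow> 1 \<le> i \<and> x \<le> p' a i"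
  using valid_stringsD(2)[OF valid_stepD(7)[OF s]] by blast

lemma column_step_vacancy:
  assumes "1 \<le> a" "a \<le> n"
  shows "enat i < l (a - 1) \<Longrightarrow> p' a i = p a i" "l (a - 1) \<le> enat i \<Longrightarrow> enat i < l a \<Longrightarrow> p' a i = p a i - 1"
    "l (Suc a) \<le> enat i \<Longrightarrow> p' a i = p a i"
proof -
  have a: "a \<in> nodes (TypeA n)" using assms by simp
  note v = vacancy_change_cases[OF column_adm a, of i] and d = valid_stepD(3)[OF s a, of i]
  show "enat i < l (a - 1) \<Longrightarrow> p' a i = p a i" "l (a - 1) \<le> enat i \<Longrightarrow> enat i < l a \<Longrightarrow> p' a i = p a i - 1"
    "l (Suc a) \<le> enat i \<Longrightarrow> p' a i = p a i"
    using v(1,2,4) d by simp_all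
qed

text \<open>The balance of singular strings of length i where the vacancy number does not change.
  Below t the step consumes the string that \<open>add_short\<close> put in, so neither side records
  it there.\<close>

lemma column_step_count:
  assumes a: "1 \<le> a" "a \<le> n" and i: "1 \<le> i" "p' a i = p a i"
  shows "count (R' a) (i, p' a i) + of_bool (t \<le> a \<and> l a = enat i)
    = count (R a) (i, p a i) + of_bool (t \<le> a \<and> l a = enat (Suc i))"
proof -
  have aT: "a \<in> nodes (TypeA n)" using a by simp
  obtain K where K: "add_short t p R a = K + image_mset (\<lambda>i. (i, p a i)) (sel (TypeA n) l a)"
    "R' a = K + image_mset (\<lambda>i. (i, p' a i)) (shorten (sel (TypeA n) l a))"
    using valid_step_kept[OF s aT] by metis
  have sel: "sel (TypeA n) l a = finite_length (l a)"
    using aT by (simp add: sel_def)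
  have c1: "count (add_short t p R a) (i, p a i) = count K (i, p a i) + of_bool (l a = enat i)"
    unfolding K(1) sel by (simp add: count_image_graph finite_length_count)
  have c2: "count (R' a) (i, p' a i) = count K (i, p a i) + of_bool (l a = enat (Suc i))"
    unfolding K(2) sel using i by (simp add: count_image_graph count_shorten finite_length_count)
  show ?thesis
  proof (cases "t \<le> a")
    case True
    then have "add_short t p R a = R a" by (simp add: add_short_def)
    then show ?thesis using c1 c2 True by simp
  next
    case False
    then have "add_short t p R a = add_mset (1, p a 1) (R a)" "l a = enat 1"
      using a column_step_below[of a] by (auto simp: add_short_def one_enat_def)
    then show ?thesis using c1 c2 False i by (cases "i = 1") auto
  qed
qed

lemma column_step_support: "support (TypeA n) l = ideal (TypeA n) x \<Longrightarrow> 1 \<le> x \<Longrightarrow> 1 \<le> a \<Longrightarrow> a \<le> n \<Longrightarrow> l a = \<infinity> \<longleftrightarrow> x \<le> int a"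
proof -
  assume A: "support (TypeA n) l = ideal (TypeA n) x" "1 \<le> x" "1 \<le> a" "a \<le> n"
  then have "a \<in> support (TypeA n) l \<longleftrightarrow> a < nat x" by simp
  then show ?thesis using A(2-4) by (auto simp: support_def)
qed

end

text \<open>Consecutive entries of a column strictly decrease, in terms of the selected lengths.\<close>

lemma column_step_next:
  assumes s1: "column_step n (Suc t) l p R p1 R1" and s2: "column_step n t l2 p1 R1 p2 R2"
    and a: "t \<le> a" "a \<le> n"
  shows "l (Suc a) \<le> l2 a"
  using a
proof (induction a rule: dec_induct)
  case base
  show ?case
  proof (cases "l2 t")
    case (enat i)
    have t: "1 \<le> t" "t \<le> n" using s2 by (auto simp: column_step_def)
    have "(i, p1 t i) \<in># R1 t"
      using column_step_selected[OF s2 _ t(2) enat] by simp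
    moreover have "l t \<le> enat i"
      using column_step_below[OF s1, of t] column_step_ge_1[OF s2 t(2)] enat by simp
    ultimately show ?thesis
      using column_step_back[OF s1 t] enat by simp
  qed simp
next
  case (step a)
  then have IH: "l (Suc a) \<le> l2 a" by simp
  show ?case
  proof (cases "l2 (Suc a)")
    case (enat i)
    have "(i, p1 (Suc a) i) \<in># R1 (Suc a)"
      using column_step_selected[OF s2 _ step.prems enat] step.hyps by simp
    moreover have "l (Suc a) \<le> enat i"
      using IH column_step_mono[OF s2, of a] step.prems enat by (auto intro: order_trans)
    ultimately show ?thesis
      using column_step_back[OF s1 _ step.prems] enat by simp
  qed simp
qed

text \<open>If the entries decrease, the second step has length \<infinity> at node y while the
  first is still finite there. From y the inequality \<open>l c \<le> l2 (c - 1)\<close> is carried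
  down to c = t, where \<open>l2 (t - 1)\<close> is 1.\<close>

lemma column_step_next_back:
  assumes s1: "valid_step (TypeA n) l p R p1 R1" and s2: "column_step n t l2 p1 R1 p2 R2"
    and x: "support (TypeA n) l = ideal (TypeA n) x" and y: "support (TypeA n) l2 = ideal (TypeA n) y"
    and xy: "1 \<le> y" "y < x" "x \<le> int n + 1" and a: "1 \<le> a" "a \<le> t"
  shows "l a = 1"
proof -
  have s1': "column_step n 1 l p R p1 R1"
  proof -
    have "add_short 1 p R = R" by (auto simp: add_short_def)
    then show ?thesis using s1 s2 by (simp add: column_step_def)
  qed
  have t: "1 \<le> t" "t \<le> n" using s2 by (auto simp: column_step_def)
  define b where "b = nat y"
  have b: "1 \<le> b" "b \<le> n" using xy by (auto simp: b_def)
  have l2b: "l2 b = \<infinity>" and lb: "l b \<noteq> \<infinity>"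
    using column_step_support[OF s2 y xy(1) b] column_step_support[OF s1' x _ b] xy by (auto simp: b_def)
  have tb: "t \<le> b"
  proof (rule ccontr)
    assume "\<not> t \<le> b"
    then show False using column_step_below[OF s2, of b] l2b by simp
  qed
  \<comment> \<open>Otherwise the string shortened at c by the first step would be available to the
    second, which would then select a length below \<open>l c\<close>.\<close>
  have key: "l c \<le> l2 (c - 1)" if c: "t \<le> c" "c \<le> n" and lc: "l c \<noteq> \<infinity>" "l c \<le> l2 c" for c
  proof -
    obtain j where j: "l c = enat j" using lc by auto
    have j1: "1 \<le> j" using column_step_ge_1[OF s1' c(2)] j by (simp add: one_enat_def)
    show ?thesis
    proof (cases "j = 1")
      case True
      then show ?thesis using j column_step_ge_1[OF s2, of "c - 1"] c by (simp add: one_enat_def)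
    next
      case False
      then have sing: "(j - 1, p1 c (j - 1)) \<in># R1 c"
        using column_step_shortened[OF s1' _ c(2), of "j - 1"] t c j j1 by simp
      have "\<not> l2 (c - 1) \<le> enat (j - 1)"
      proof
        assume "l2 (c - 1) \<le> enat (j - 1)"
        then have "l2 c \<le> enat (j - 1)"
          using column_step_first[OF s2 c sing] by blast
        then have "l c \<le> enat (j - 1)" using lc(2) by (rule order_trans[rotated])
        then show False using j j1 by simp
      qed
      then show ?thesis using j by (cases "l2 (c - 1)") auto
    qed
  qed
  have "l c \<le> l2 (c - 1)" if "t \<le> c" "c \<le> b" for c
    using that(2,1)
  proof (induction rule: inc_induct)
    case base
    then show ?case using key[of b] b lb l2b by simp
  next
    case (step c)
    have "l (Suc c) \<noteq> \<infinity>"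
    proof
      assume "l (Suc c) = \<infinity>"
      then have "l b = \<infinity>"
        using column_step_mono'[OF s1', of "Suc c" b] step.hyps b by simp
      then show False using lb by simp
    qed
    moreover have "l c \<le> l (Suc c)" using column_step_mono[OF s1', of c] step.hyps b by simp
    moreover have "l (Suc c) \<le> l2 c" using step by simp
    ultimately show ?case
      using key[of c] step b by (cases "l c = \<infinity>") (auto intro: order_trans)
  qed
  then have "l t \<le> 1"
    using tb column_step_below[OF s2, of "t - 1"] t by fastforce
  moreover have "l a \<le> l t" using column_step_mono'[OF s1', of a t] a t by simp
  ultimately show ?thesis
    using column_step_ge_1[OF s1', of a] a t by simp
qed

text \<open>The column criterion rests on families \<open>gs\<close> of lengths, one for each entry of a column, of strings
  that are singular simultaneously: successive steps consume the members of a nested family one by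
  one, each step selecting lengths at most those of the member it consumes.\<close>

definition supports :: "nat \<Rightarrow> (nat \<Rightarrow> nat \<Rightarrow> int) \<Rightarrow> rigged_configuration \<Rightarrow> (nat \<Rightarrow> enat) list \<Rightarrow> bool" where
  "supports n p R gs \<longleftrightarrow> (\<forall>a\<in>{1..n}. \<forall>i\<ge>1. count_list (map (\<lambda>g. g a) gs) (enat i) \<le> count (R a) (i, p a i))"

lemma supportsI:
  assumes "\<And>a i h. 1 \<le> a \<Longrightarrow> a \<le> n \<Longrightarrow> 1 \<le> i \<Longrightarrow> h \<in> set gs \<Longrightarrow> h a = enat i
    \<Longrightarrow> count_list (map (\<lambda>g. g a) gs) (enat i) \<le> count (R a) (i, p a i)"
  shows "supports n p R gs"
  unfolding supports_def
proof (intro ballI allI impI)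
  fix a i :: nat assume a: "a \<in> {1..n}" "1 \<le> i"
  show "count_list (map (\<lambda>g. g a) gs) (enat i) \<le> count (R a) (i, p a i)"
  proof (cases "\<exists>h\<in>set gs. h a = enat i")
    case True
    then show ?thesis using assms a by auto
  next
    case False
    then have "enat i \<notin> set (map (\<lambda>g. g a) gs)" by auto
    then have "count_list (map (\<lambda>g. g a) gs) (enat i) = 0" by (simp add: count_list_0_iff)
    then show ?thesis by simp
  qed
qed

lemma supportsD:
  "supports n p R gs \<Longrightarrow> 1 \<le> a \<Longrightarrow> a \<le> n \<Longrightarrow> 1 \<le> i
    \<Longrightarrow> count_list (map (\<lambda>g. g a) gs) (enat i) \<le> count (R a) (i, p a i)"
  by (simp add: supports_def)

lemma supports_mem:
  assumes "supports n p R gs" "1 \<le> a" "a \<le> n" "1 \<le> i" "h \<in> set gs" "h a = enat i"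
  shows "(i, p a i) \<in># R a"
proof -
  have "enat i \<in> set (map (\<lambda>g. g a) gs)" using rev_image_eqI[OF assms(5), of "enat i" "\<lambda>g. g a"] assms(6) by simp
  then have "count_list (map (\<lambda>g. g a) gs) (enat i) \<noteq> 0" by (simp add: count_list_0_iff)
  then show ?thesis using supportsD[OF assms(1-4)] by (simp flip: count_greater_zero_iff)
qed

lemma supports_shift:
  assumes "supports n p R gs" "\<And>a i h. 1 \<le> a \<Longrightarrow> a \<le> n \<Longrightarrow> 1 \<le> i \<Longrightarrow> h \<in> set gs \<Longrightarrow> h a = enat i \<Longrightarrow> q a i = p a i"
  shows "supports n q R gs"
proof (rule supportsI)
  fix a i h assume *: "1 \<le> a" "a \<le> n" "1 \<le> i" "h \<in> set gs" "h a = enat i"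
  show "count_list (map (\<lambda>g. g a) gs) (enat i) \<le> count (R a) (i, q a i)"
    using supportsD[OF assms(1) *(1-3)] assms(2)[OF *] by simp
qed

text \<open>The shift by one node is that of \<open>column_step_next\<close>: entries strictly
  decrease along a column read upwards, and each step at node a is at least as long as its
  predecessor at a + 1.\<close>

definition nested :: "nat \<Rightarrow> (nat \<Rightarrow> enat) list \<Rightarrow> bool" where
  "nested n gs \<longleftrightarrow> sorted_wrt (\<lambda>g h. \<forall>a\<le>n. g (Suc a) \<le> h a) gs
    \<and> (\<forall>g\<in>set gs. g (Suc n) = \<infinity> \<and> (\<forall>a\<le>n. g a \<le> g (Suc a)))"

lemma nested_mono:
  assumes "nested n gs" "g \<in> set gs" "a \<le> b" "b \<le> Suc n"
  shows "g a \<le> g b"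
  using assms(3,4)
proof (induction rule: dec_induct)
  case (step b)
  then show ?case using assms(1,2) unfolding nested_def by (meson Suc_le_mono le_SucI le_trans order_trans Suc_leD)
qed simp

text \<open>The member g bounds the greedy choice from above, since its finite lengths are singular.
  A later member h has \<open>g (Suc a) \<le> h a\<close>, so the vacancy number at its length is
  unchanged. It can lose a copy only if \<open>l a\<close>, \<open>g a\<close> and
  \<open>h a\<close> coincide, and then the lost copy is that of g.\<close>

lemma consume_forward:
  assumes s: "column_step n t l p R p' R'" and sup: "supports n p R (g # gs)" and nest: "nested n (g # gs)"
    and pos: "\<And>a. t \<le> a \<Longrightarrow> a \<le> n \<Longrightarrow> 1 \<le> g a"
  shows "(\<forall>a. t \<le> a \<and> a \<le> n \<longrightarrow> l a \<le> g a) \<and> supports n p' R' gs"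
proof -
  have t: "1 \<le> t" "t \<le> n" using s by (auto simp: column_step_def)
  have le: "l a \<le> g a" if "t \<le> a" "a \<le> n" for a
    using that
  proof (induction a rule: dec_induct)
    case base
    show ?case
    proof (cases "g t")
      case (enat i)
      have i: "1 \<le> i" using pos[of t] t enat by (simp add: one_enat_def)
      have "(i, p t i) \<in># R t"
        using supports_mem[OF sup t i, of g] enat by simp
      moreover have "l (t - 1) \<le> enat i"
        using column_step_below[OF s, of "t - 1"] t i by (simp add: one_enat_def)
      ultimately show ?thesis
        using column_step_first[OF s order_refl t(2)] enat by simp
    qed simp
  next
    case (step a)
    show ?case
    proof (cases "g (Suc a)")
      case (enat i)
      have i: "1 \<le> i" using pos[of "Suc a"] step enat by (simp add: one_enat_def)
      have "(i, p (Suc a) i) \<in># R (Suc a)"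
        using supports_mem[OF sup _ step.prems i, of g] enat by simp
      moreover have "l a \<le> enat i"
        using step nested_mono[OF nest, of g a "Suc a"] enat by (auto intro: order_trans)
      ultimately show ?thesis
        using column_step_first[OF s _ step.prems, of i] step.hyps enat by simp
    qed simp
  qed
  have "supports n p' R' gs"
  proof (rule supportsI)
    fix a i h assume a: "1 \<le> a" "a \<le> n" "1 \<le> i" and h: "h \<in> set gs" "h a = enat i"
    have "g (Suc a) \<le> h a"
      using nest h(1) a unfolding nested_def by auto
    then have gh: "g (Suc a) \<le> enat i"
      using h(2) by simp
    have "a \<noteq> n"
      using gh nest unfolding nested_def by auto
    have lS: "l (Suc a) \<le> enat i"
    proof (cases "t \<le> Suc a")
      case True
      then show ?thesis using le[of "Suc a"] gh a \<open>a \<noteq> n\<close> by (auto intro: order_trans)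
    next
      case False
      then show ?thesis using column_step_below[OF s, of "Suc a"] a by (simp add: one_enat_def)
    qed
    have pp: "p' a i = p a i"
      by (rule column_step_vacancy(3)[OF s a(1,2) lS])
    have c: "count (R' a) (i, p' a i) + of_bool (t \<le> a \<and> l a = enat i) \<ge> count (R a) (i, p a i)"
      using column_step_count[OF s a(1-3) pp] by linarith
    have cg: "count_list (map (\<lambda>g. g a) (g # gs)) (enat i) = of_bool (g a = enat i) + count_list (map (\<lambda>g. g a) gs) (enat i)"
      by simp
    have "g a = enat i" if "t \<le> a" "l a = enat i"
    proof -
      have "enat i \<le> g a" using le[of a] that a by simp
      moreover have "g a \<le> enat i"
        using nested_mono[OF nest, of g a "Suc a"] gh a by (auto intro: order_trans)
      ultimately show ?thesis by simp
    qed
    then show "count_list (map (\<lambda>g. g a) gs) (enat i) \<le> count (R' a) (i, p' a i)"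
      using c cg supportsD[OF sup a] by (cases "t \<le> a \<and> l a = enat i") auto
  qed
  then show ?thesis using le by blast
qed

text \<open>The length after removal of a box. The value 0 stands for a string that has disappeared;
  \<open>supports\<close> looks at lengths i >= 1.\<close>

definition dec :: "enat \<Rightarrow> enat" where
  "dec e = (case e of enat i \<Rightarrow> enat (i - 1) | \<infinity> \<Rightarrow> \<infinity>)"

lemma dec_simps [simp]: "dec (enat i) = enat (i - 1)" "dec \<infinity> = \<infinity>" "dec 1 = 0"
  by (simp_all add: dec_def one_enat_def zero_enat_def)

lemma dec_mono: "x \<le> y \<Longrightarrow> dec x \<le> dec y"
  by (cases x; cases y) auto

lemma dec_eq_enat: "1 \<le> i \<Longrightarrow> dec e = enat i \<longleftrightarrow> e = enat (Suc i)"
  by (cases e) auto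

text \<open>The strings shortened by the step join the family as its last member. The finite nonzero
  lengths of the old members lie below \<open>l (a - 1)\<close>, where the step changes no vacancy
  number and selects nothing.\<close>

lemma extend_forward:
  assumes s: "column_step n t l p R p' R'" and sup: "supports n p R gs"
    and less: "\<And>g a i. g \<in> set gs \<Longrightarrow> 1 \<le> a \<Longrightarrow> a \<le> n \<Longrightarrow> 1 \<le> i \<Longrightarrow> g a = enat i \<Longrightarrow> enat i < l (a - 1)"
  shows "supports n p' R' (gs @ [\<lambda>a. dec (l a)])"
proof (rule supportsI)
  fix a i h assume a: "1 \<le> a" "a \<le> n" "1 \<le> i" and h: "h \<in> set (gs @ [\<lambda>a. dec (l a)])" "h a = enat i"
  have cg: "count_list (map (\<lambda>g. g a) (gs @ [\<lambda>a. dec (l a)])) (enat i)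
      = count_list (map (\<lambda>g. g a) gs) (enat i) + of_bool (l a = enat (Suc i))"
    using a(3) by (simp add: dec_eq_enat)
  have ta: "t \<le> a" if "l a = enat (Suc i)"
    using column_step_below[OF s, of a] that a(3) by (cases "t \<le> a") (auto simp: one_enat_def)
  show "count_list (map (\<lambda>g. g a) (gs @ [\<lambda>a. dec (l a)])) (enat i) \<le> count (R' a) (i, p' a i)"
  proof (cases "\<exists>g\<in>set gs. g a = enat i")
    case True
    then have il: "enat i < l (a - 1)" using less a by blast
    have pp: "p' a i = p a i"
      by (rule column_step_vacancy(1)[OF s a(1,2) il])
    have "l (a - 1) \<le> l a"
      using column_step_mono[OF s, of "a - 1"] a by simp
    then have "l a \<noteq> enat i" using il by auto
    then show ?thesis
      using column_step_count[OF s a pp] supportsD[OF sup a] cg ta by (cases "l a = enat (Suc i)") auto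
  next
    case False
    then have "enat i \<notin> set (map (\<lambda>g. g a) gs)" by auto
    then have "count_list (map (\<lambda>g. g a) gs) (enat i) = 0" by (simp add: count_list_0_iff)
    moreover have "0 < count (R' a) (i, p' a i)" if "l a = enat (Suc i)"
      using column_step_shortened[OF s a(1,2) that a(3)] by simp
    ultimately show ?thesis
      unfolding cg by (cases "l a = enat (Suc i)") (simp_all add: Suc_leI)
  qed
qed

text \<open>The strings that the step selected become the first member of the family before it.
  Values below t are set to 0: there the selected strings come from \<open>add_short\<close> and are
  not strings of R.\<close>

lemma extend_backward:
  assumes s: "column_step n t l p R p' R'" and sup: "supports n p' R' gs"
    and le: "\<And>g a i. g \<in> set gs \<Longrightarrow> 1 \<le> a \<Longrightarrow> a \<le> n \<Longrightarrow> 1 \<le> i \<Longrightarrow> g a = enat i \<Longrightarrow> l (Suc a) \<le> enat i"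
  shows "supports n p R ((\<lambda>a. if a < t then 0 else l a) # gs)"
proof (rule supportsI)
  fix a i h assume a: "1 \<le> a" "a \<le> n" "1 \<le> i"
    and h: "h \<in> set ((\<lambda>a. if a < t then 0 else l a) # gs)" "h a = enat i"
  have cg: "count_list (map (\<lambda>g. g a) ((\<lambda>a. if a < t then 0 else l a) # gs)) (enat i)
      = count_list (map (\<lambda>g. g a) gs) (enat i) + of_bool (t \<le> a \<and> l a = enat i)"
    using a(3) by (auto simp: zero_enat_def)
  show "count_list (map (\<lambda>g. g a) ((\<lambda>a. if a < t then 0 else l a) # gs)) (enat i) \<le> count (R a) (i, p a i)"
  proof (cases "\<exists>g\<in>set gs. g a = enat i")
    case True
    then have il: "l (Suc a) \<le> enat i" using le a by blast
    have pp: "p' a i = p a i"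
      by (rule column_step_vacancy(3)[OF s a(1,2) il])
    have "l a \<le> l (Suc a)"
      using column_step_mono[OF s, of a] a by simp
    then have "l a \<le> enat i" using il by (rule order_trans)
    then have "l a \<noteq> enat (Suc i)" by auto
    then show ?thesis
      using column_step_count[OF s a pp] supportsD[OF sup a] cg by auto
  next
    case False
    then have "enat i \<notin> set (map (\<lambda>g. g a) gs)" by auto
    then have "count_list (map (\<lambda>g. g a) gs) (enat i) = 0" by (simp add: count_list_0_iff)
    moreover have "0 < count (R a) (i, p a i)" if "t \<le> a" "l a = enat i"
      using column_step_selected[OF s that(1) a(2) that(2)] by simp
    ultimately show ?thesis
      unfolding cg by (cases "t \<le> a \<and> l a = enat i") (auto simp: Suc_leI)
  qed
qed

text \<open>Undoing the step takes away a shortened string of length \<open>l a - 1\<close>. If an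
  earlier member has this length at a, then so does g, and the copy that is lost is that of
  g.\<close>

lemma consume_backward:
  assumes s: "column_step n t l p R p' R'" and sup: "supports n p' R' (gs @ [g])" and nest: "nested n (gs @ [g])"
    and zero: "\<And>a. a < t \<Longrightarrow> g a = 0" and fin: "\<And>a. t \<le> a \<Longrightarrow> a \<le> n \<Longrightarrow> l a \<noteq> \<infinity> \<Longrightarrow> g a \<noteq> \<infinity>"
  shows "(\<forall>a. t \<le> a \<and> a \<le> n \<and> l a \<noteq> \<infinity> \<longrightarrow> g a < l a) \<and> supports n p R gs"
proof -
  have t: "1 \<le> t" "t \<le> n" using s by (auto simp: column_step_def)
  have less: "g a < l a" if "t \<le> a" "a \<le> Suc n" "a \<le> n \<Longrightarrow> l a \<noteq> \<infinity>" "a = Suc n \<Longrightarrow> False" for a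
    using that(2,1,3,4)
  proof (induction a rule: inc_induct)
    case base
    then show ?case by blast
  next
    case (step a)
    then have a: "1 \<le> a" "a \<le> n" "l a \<noteq> \<infinity>" using t by auto
    obtain i where i: "g a = enat i" using fin[OF step.prems(1) a(2,3)] by auto
    show ?case
    proof (rule ccontr)
      assume "\<not> g a < l a"
      then have li: "l a \<le> enat i" using i by simp
      then have i1: "1 \<le> i"
        using column_step_ge_1[OF s a(2)] by (metis enat_ord_simps(1) one_enat_def order_trans)
      have "(i, p' a i) \<in># R' a"
        using supports_mem[OF sup a(1,2) i1, of g] i by simp
      then have lS: "l (Suc a) \<le> enat i"
        by (rule column_step_back[OF s a(1,2) _ li])
      then have fin_S: "l (Suc a) \<noteq> \<infinity>"
        by (cases "l (Suc a)") auto
      then have "a \<noteq> n"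
        using column_step_top[OF s] by metis
      then have "g (Suc a) < l (Suc a)"
        using step fin_S a by simp
      moreover have "g a \<le> g (Suc a)"
        using nested_mono[OF nest, of g a "Suc a"] a by simp
      ultimately show False using lS i by (simp add: leD)
    qed
  qed
  have "supports n p R gs"
  proof (rule supportsI)
    fix a i h assume a: "1 \<le> a" "a \<le> n" "1 \<le> i" and h: "h \<in> set gs" "h a = enat i"
    have hg: "h (Suc b) \<le> g b" if "b \<le> n" for b
      using nest h(1) that unfolding nested_def by (auto simp: sorted_wrt_append)
    have hg': "h a \<le> g (a - 1)"
      using hg[of "a - 1"] a by simp
    have ta: "t < a"
    proof (rule ccontr)
      assume "\<not> t < a"
      then have "g (a - 1) = 0" using zero[of "a - 1"] a by simp
      then show False using hg' h(2) a(3) by (simp add: zero_enat_def)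
    qed
    have il: "enat i < l (a - 1)"
    proof (cases "l (a - 1) = \<infinity>")
      case False
      then have "g (a - 1) < l (a - 1)" using less[of "a - 1"] ta a by simp
      then show ?thesis using hg' h(2) by (simp add: le_less_trans)
    qed simp
    have pp: "p' a i = p a i"
      by (rule column_step_vacancy(1)[OF s a(1,2) il])
    have cg: "count_list (map (\<lambda>g. g a) (gs @ [g])) (enat i) = count_list (map (\<lambda>g. g a) gs) (enat i) + of_bool (g a = enat i)"
      by simp
    have "g a = enat i" if "l a = enat (Suc i)"
    proof -
      have "g a < enat (Suc i)" using less[of a] that ta a by simp
      moreover have "enat i \<le> g a"
      proof -
        have "h a \<le> h (Suc a)" using nested_mono[OF nest, of h a "Suc a"] h a by simp
        then show ?thesis using hg[of a] a h(2) by (auto intro: order_trans)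
      qed
      ultimately show ?thesis by (cases "g a") auto
    qed
    then show "count_list (map (\<lambda>g. g a) gs) (enat i) \<le> count (R a) (i, p a i)"
      using column_step_count[OF s a pp] cg supportsD[OF sup a] less_imp_le[OF ta]
      by (cases "l a = enat (Suc i)") auto
  qed
  moreover have "g a < l a" if "t \<le> a" "a \<le> n" "l a \<noteq> \<infinity>" for a
    by (rule less) (use that in auto)
  ultimately show ?thesis by blast
qed

section \<open>Removal of a whole column, entry by entry\<close>

inductive column_chain :: "nat \<Rightarrow> nat \<Rightarrow> (nat \<Rightarrow> nat \<Rightarrow> int) \<Rightarrow> rigged_configuration \<Rightarrow> (nat \<Rightarrow> enat) list
    \<Rightarrow> (nat \<Rightarrow> nat \<Rightarrow> int) \<Rightarrow> rigged_configuration \<Rightarrow> bool" for n where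
  Nil: "column_chain n 0 p R [] p R"
| Cons: "column_step n (Suc t) l p R p1 R1 \<Longrightarrow> column_chain n t p1 R1 lls p2 R2 \<Longrightarrow> column_chain n (Suc t) p R (l # lls) p2 R2"

lemma column_chain_length: "column_chain n t p R lls p' R' \<Longrightarrow> length lls = t"
  by (induction rule: column_chain.induct) auto

lemma column_chain_SucE:
  assumes "column_chain n (Suc t) p R lls p' R'"
  obtains l lls' p1 R1 where "lls = l # lls'" "column_step n (Suc t) l p R p1 R1" "column_chain n t p1 R1 lls' p' R'"
  using assms by (cases rule: column_chain.cases) auto

lemma column_chain_bound:
  assumes "column_chain n t p R lls p' R'" "1 \<le> t" "a \<in> nodes (TypeA n)" "(i, x) \<in># R' a"
  shows "x \<le> p' a i"
  using assms
proof (induction rule: column_chain.induct)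
  case (Cons t l p R p1 R1 lls p2 R2)
  show ?case
  proof (cases "t = 0")
    case True
    then have "p2 = p1" "R2 = R1" using Cons.hyps(2) by (auto elim: column_chain.cases)
    then show ?thesis using column_step_bound[OF Cons.hyps(1)] Cons.prems by blast
  qed (use Cons in auto)
qed simp

lemma column_chain_later:
  assumes "column_chain n t p R lls p' R'" "column_step n (Suc t) l0 p0 R0 p R" "l \<in> set lls" "t \<le> a" "a \<le> n"
  shows "l0 (Suc a) \<le> l a"
  using assms
proof (induction arbitrary: l0 p0 R0 a rule: column_chain.induct)
  case (Cons t l1 p R p1 R1 lls p2 R2)
  have 1: "l0 (Suc a) \<le> l1 a"
    by (rule column_step_next[OF Cons.prems(1) Cons.hyps(1) Cons.prems(3,4)])
  show ?case
  proof (cases "l = l1")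
    case False
    then have "l1 (Suc a) \<le> l a"
      using Cons.IH[OF Cons.hyps(1)] Cons.prems by simp
    then show ?thesis
      using 1 column_step_mono[OF Cons.hyps(1) Cons.prems(4)] by (meson order_trans)
  qed (use 1 in simp)
qed simp

lemma column_chain_below:
  "column_chain n t p R lls p' R' \<Longrightarrow> j < t \<Longrightarrow> a < t - j \<Longrightarrow> (lls ! j) a = 1"
proof (induction arbitrary: j rule: column_chain.induct)
  case (Cons t l p R p1 R1 lls p2 R2)
  then show ?case by (cases j) (auto simp: column_step_below[OF Cons.hyps(1)])
qed simp

lemma column_chain_ge:
  "column_chain n t p R lls p' R' \<Longrightarrow> e \<le> hd lls t \<Longrightarrow> j < t \<Longrightarrow> t - j \<le> a \<Longrightarrow> a \<le> n \<Longrightarrow> e \<le> (lls ! j) a"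
proof (induction arbitrary: j rule: column_chain.induct)
  case (Cons t l p R p1 R1 lls p2 R2)
  show ?case
  proof (cases j)
    case 0
    then show ?thesis
      using Cons.prems column_step_mono'[OF Cons.hyps(1), of "Suc t" a] by (auto intro: order_trans)
  next
    case (Suc j')
    then have "0 < t" using Cons.prems by simp
    then obtain t' where t': "t = Suc t'" by (cases t) auto
    obtain l2 lls' p3 R3 where l2: "lls = l2 # lls'" "column_step n t l2 p1 R1 p3 R3"
      using Cons.hyps(2) unfolding t' by (elim column_chain_SucE) auto
    have "l (Suc t) \<le> l2 t"
      using column_step_next[OF Cons.hyps(1) l2(2), of t] l2(2) by (simp add: column_step_def)
    then have "e \<le> hd lls t" using Cons.prems(1) l2(1) by (auto intro: order_trans)
    then show ?thesis using Cons.IH[of j'] Cons.prems Suc by simp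
  qed
qed simp

lemma nested_dec: "column_chain n t p R lls p' R' \<Longrightarrow> nested n (map (\<lambda>l a. dec (l a)) lls)"
proof (induction rule: column_chain.induct)
  case (Cons t l p R p1 R1 lls p2 R2)
  have "dec (l (Suc a)) \<le> dec (k a)" if k: "k \<in> set lls" "a \<le> n" for k a
  proof (cases "t \<le> a")
    case True
    show ?thesis by (rule dec_mono[OF column_chain_later[OF Cons.hyps(2,1) k(1) True k(2)]])
  next
    case False
    then have "l (Suc a) = 1" using column_step_below[OF Cons.hyps(1), of "Suc a"] by simp
    then show ?thesis by simp
  qed
  moreover have "dec (l (Suc n)) = \<infinity>" using column_step_top[OF Cons.hyps(1)] by simp
  moreover have "dec (l a) \<le> dec (l (Suc a))" if "a \<le> n" for a
    by (rule dec_mono[OF column_step_mono[OF Cons.hyps(1) that]])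
  ultimately show ?case
    using Cons.IH unfolding nested_def by auto
qed (simp add: nested_def)

text \<open>The selected lengths, with 0 at the strings that the map i added. The entry at position
  j is removed when t - j entries are left, whence the decreasing bound.\<close>

fun cut :: "nat \<Rightarrow> (nat \<Rightarrow> enat) list \<Rightarrow> (nat \<Rightarrow> enat) list" where
  "cut t [] = []"
| "cut t (l # lls) = (\<lambda>a. if a < t then 0 else l a) # cut (t - 1) lls"

lemma length_cut [simp]: "length (cut t lls) = length lls"
  by (induction lls arbitrary: t) auto

lemma nth_cut: "j < length lls \<Longrightarrow> (cut t lls ! j) a = (if a < t - j then 0 else (lls ! j) a)"
  by (induction lls arbitrary: t j) (auto simp: nth_Cons split: nat.splits)

lemma in_cut:
  assumes "g \<in> set (cut t lls)"
  shows "\<exists>l\<in>set lls. \<exists>u\<le>t. g = (\<lambda>a. if a < u then 0 else l a)"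
  using assms
proof (induction lls arbitrary: t)
  case (Cons l lls)
  then consider "g = (\<lambda>a. if a < t then 0 else l a)" | "g \<in> set (cut (t - 1) lls)" by auto
  then show ?case
  proof cases
    case 2
    then obtain k u where "k \<in> set lls" "u \<le> t - 1" "g = (\<lambda>a. if a < u then 0 else k a)"
      using Cons.IH by blast
    then show ?thesis by (intro bexI[of _ k] exI[of _ u]) auto
  qed auto
qed simp

lemma nested_cut: "column_chain n t p R lls p' R' \<Longrightarrow> nested n (cut t lls)"
proof (induction rule: column_chain.induct)
  case (Cons t l p R p1 R1 lls p2 R2)
  let ?g = "\<lambda>a. if a < Suc t then 0 else l a"
  have t: "Suc t \<le> n" using Cons.hyps(1) by (simp add: column_step_def)
  have "?g (Suc a) \<le> h a" if h: "h \<in> set (cut t lls)" "a \<le> n" for h a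
  proof -
    obtain k u where k: "k \<in> set lls" "u \<le> t" "h = (\<lambda>a. if a < u then 0 else k a)"
      using in_cut[OF h(1)] by blast
    show ?thesis
    proof (cases "t \<le> a")
      case True
      then show ?thesis using column_chain_later[OF Cons.hyps(2,1) k(1) True h(2)] k by simp
    qed simp
  qed
  moreover have "?g (Suc n) = \<infinity>" using column_step_top[OF Cons.hyps(1)] t by simp
  moreover have "?g a \<le> ?g (Suc a)" if "a \<le> n" for a
    using column_step_mono[OF Cons.hyps(1) that] by simp
  ultimately show ?case
    using Cons.IH unfolding nested_def by auto
qed (simp add: nested_def)

text \<open>Later steps of a column select beyond the strings left by earlier ones, so the shortened
  strings of all its entries accumulate in one family.\<close>

lemma column_chain_extend_forward:
  assumes "column_chain n t p R lls p' R'" "supports n p R gs"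
    and "\<And>g a i. t \<noteq> 0 \<Longrightarrow> g \<in> set gs \<Longrightarrow> 1 \<le> a \<Longrightarrow> a \<le> n \<Longrightarrow> 1 \<le> i \<Longrightarrow> g a = enat i \<Longrightarrow> enat i < hd lls (a - 1)"
  shows "supports n p' R' (gs @ map (\<lambda>l a. dec (l a)) lls)"
  using assms
proof (induction arbitrary: gs rule: column_chain.induct)
  case (Cons t l p R p1 R1 lls p2 R2)
  have less: "enat i < l (a - 1)" if "g \<in> set gs" "1 \<le> a" "a \<le> n" "1 \<le> i" "g a = enat i" for g a i
    using Cons.prems(2) that by simp
  have "supports n p1 R1 (gs @ [\<lambda>a. dec (l a)])"
    by (rule extend_forward[OF Cons.hyps(1) Cons.prems(1) less])
  then have "supports n p2 R2 ((gs @ [\<lambda>a. dec (l a)]) @ map (\<lambda>l a. dec (l a)) lls)"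
  proof (rule Cons.IH)
    fix g a i assume t: "t \<noteq> 0" and g: "g \<in> set (gs @ [\<lambda>a. dec (l a)])" and a: "1 \<le> a" "a \<le> n" "1 \<le> i" "g a = enat i"
    obtain t' where t': "t = Suc t'" using t by (cases t) auto
    obtain l2 lls' p3 R3 where l2: "lls = l2 # lls'" "column_step n t l2 p1 R1 p3 R3"
      using Cons.hyps(2) unfolding t' by (elim column_chain_SucE) auto
    have next_le: "l a \<le> l2 (a - 1)" if "Suc t \<le> a"
      using column_step_next[OF Cons.hyps(1) l2(2), of "a - 1"] that a by simp
    have "enat i < l a \<and> Suc t \<le> a"
    proof (cases "g \<in> set gs")
      case True
      then have il: "enat i < l (a - 1)" using less a by blast
      have "Suc t \<le> a"
      proof (rule ccontr)
        assume "\<not> Suc t \<le> a"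
        then have "l (a - 1) = 1" using column_step_below[OF Cons.hyps(1), of "a - 1"] by simp
        then show False using il a(3) by (simp add: one_enat_def)
      qed
      moreover have "l (a - 1) \<le> l a" using column_step_mono[OF Cons.hyps(1), of "a - 1"] a by simp
      ultimately show ?thesis using il by (auto intro: less_le_trans)
    next
      case False
      then have la: "l a = enat (Suc i)" using g a(3,4) by (simp add: dec_eq_enat)
      then have "Suc t \<le> a" using column_step_below[OF Cons.hyps(1), of a] a(3)
        by (cases "Suc t \<le> a") (auto simp: one_enat_def)
      then show ?thesis using la by simp
    qed
    then show "enat i < hd lls (a - 1)"
      using next_le l2(1) by (auto intro: less_le_trans)
  qed
  then show ?case by simp
qed simp

lemma column_chain_consume_forward:
  assumes "column_chain n t p R lls p' R'" "supports n p R gs" "nested n gs" "length gs = t"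
    and "\<And>j a. j < t \<Longrightarrow> t - j \<le> a \<Longrightarrow> a \<le> n \<Longrightarrow> 1 \<le> (gs ! j) a"
  shows "\<forall>j<t. \<forall>a. t - j \<le> a \<and> a \<le> n \<longrightarrow> (lls ! j) a \<le> (gs ! j) a"
  using assms
proof (induction arbitrary: gs rule: column_chain.induct)
  case (Cons t l p R p1 R1 lls p2 R2)
  obtain g gs' where gs: "gs = g # gs'" using Cons.prems(3) by (cases gs) auto
  have *: "(\<forall>a. Suc t \<le> a \<and> a \<le> n \<longrightarrow> l a \<le> g a) \<and> supports n p1 R1 gs'"
    using consume_forward[OF Cons.hyps(1)] Cons.prems(1,2) Cons.prems(4)[of 0] unfolding gs by simp
  have "\<forall>j<t. \<forall>a. t - j \<le> a \<and> a \<le> n \<longrightarrow> (lls ! j) a \<le> (gs' ! j) a"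
  proof (rule Cons.IH)
    show "supports n p1 R1 gs'" using * by blast
    show "nested n gs'" using Cons.prems(2) unfolding gs nested_def by simp
    show "length gs' = t" using Cons.prems(3) gs by simp
    show "1 \<le> (gs' ! j) a" if "j < t" "t - j \<le> a" "a \<le> n" for j a
      using Cons.prems(4)[of "Suc j" a] that gs by simp
  qed
  then show ?case using * unfolding gs by (auto simp: nth_Cons split: nat.splits)
qed simp

lemma column_chain_extend_backward:
  "column_chain n t p R lls p' R' \<Longrightarrow> supports n p R (cut t lls)"
proof (induction rule: column_chain.induct)
  case (Nil p R)
  then show ?case by (simp add: supports_def)
next
  case (Cons t l p R p1 R1 lls p2 R2)
  have "supports n p R ((\<lambda>a. if a < Suc t then 0 else l a) # cut t lls)"
  proof (rule extend_backward[OF Cons.hyps(1) Cons.IH])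
    fix g a i assume g: "g \<in> set (cut t lls)" and a: "1 \<le> a" "a \<le> n" "1 \<le> i" "g a = enat i"
    obtain k u where k: "k \<in> set lls" "u \<le> t" "g = (\<lambda>a. if a < u then 0 else k a)"
      using in_cut[OF g] by blast
    show "l (Suc a) \<le> enat i"
    proof (cases "t \<le> a")
      case True
      then show ?thesis using column_chain_later[OF Cons.hyps(2,1) k(1) True a(2)] k a by simp
    next
      case False
      then show ?thesis using column_step_below[OF Cons.hyps(1), of "Suc a"] a by (simp add: one_enat_def)
    qed
  qed
  then show ?case by simp
qed

lemma column_chain_consume_backward:
  assumes "column_chain n t p R lls p' R'" "supports n p' R' (pre @ gs)" "nested n (pre @ gs)" "length gs = t"
    and "\<And>j a. j < t \<Longrightarrow> a < t - j \<Longrightarrow> (gs ! j) a = 0"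
    and "\<And>j a. j < t \<Longrightarrow> t - j \<le> a \<Longrightarrow> a \<le> n \<Longrightarrow> (lls ! j) a \<noteq> \<infinity> \<Longrightarrow> (gs ! j) a \<noteq> \<infinity>"
  shows "supports n p R pre \<and> (t \<noteq> 0 \<longrightarrow> (\<forall>a. t \<le> a \<and> a \<le> n \<and> hd lls a \<noteq> \<infinity> \<longrightarrow> hd gs a < hd lls a))"
  using assms
proof (induction arbitrary: pre gs rule: column_chain.induct)
  case (Cons t l p R p1 R1 lls p2 R2)
  obtain g gs' where gs: "gs = g # gs'" using Cons.prems(3) by (cases gs) auto
  have "supports n p1 R1 (pre @ [g]) \<and> (t \<noteq> 0 \<longrightarrow> (\<forall>a. t \<le> a \<and> a \<le> n \<and> hd lls a \<noteq> \<infinity> \<longrightarrow> hd gs' a < hd lls a))"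
  proof (rule Cons.IH)
    show "supports n p2 R2 ((pre @ [g]) @ gs')" "nested n ((pre @ [g]) @ gs')" "length gs' = t"
      using Cons.prems(1-3) gs by simp_all
    show "(gs' ! j) a = 0" if "j < t" "a < t - j" for j a
      using Cons.prems(4)[of "Suc j" a] that gs by simp
    show "(gs' ! j) a \<noteq> \<infinity>" if "j < t" "t - j \<le> a" "a \<le> n" "(lls ! j) a \<noteq> \<infinity>" for j a
      using Cons.prems(5)[of "Suc j" a] that gs by simp
  qed
  then have sup: "supports n p1 R1 (pre @ [g])" by blast
  have nest: "nested n (pre @ [g])"
    using Cons.prems(2) unfolding gs nested_def by (auto simp: sorted_wrt_append)
  have "(\<forall>a. Suc t \<le> a \<and> a \<le> n \<and> l a \<noteq> \<infinity> \<longrightarrow> g a < l a) \<and> supports n p R pre"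
  proof (rule consume_backward[OF Cons.hyps(1) sup nest])
    show "g a = 0" if "a < Suc t" for a
      using Cons.prems(4)[of 0 a] that gs by simp
    show "g a \<noteq> \<infinity>" if "Suc t \<le> a" "a \<le> n" "l a \<noteq> \<infinity>" for a
      using Cons.prems(5)[of 0 a] that gs by simp
  qed
  then show ?case using gs by simp
qed simp

text \<open>Both sides are equivalent to \<open>enat s \<le> l r\<close> for the first step l. From
  left to right, the strings shortened by the first column form a nested family that the second
  column consumes. From right to left, the strings selected by the second column are singular when
  the first is finished and are consumed by undoing it.\<close>

lemma column_criterion:
  assumes s: "2 \<le> (s :: nat)" and r: "1 \<le> r" "r \<le> n"
    and c1: "column_chain n r p R lls p1 R1" and c2: "column_chain n r q R1 lls' p2 R2"
    and q: "\<And>a i. a \<in> nodes (TypeA n) \<Longrightarrow> q a i = p1 a i + of_bool (a = r \<and> 1 \<le> i \<and> i < s - 1)"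
  shows "(\<forall>i. 1 \<le> i \<and> i < s \<longrightarrow> 0 < p r i \<and> (i, p r i) \<notin># R r) \<longleftrightarrow>
    (\<forall>j<r. \<forall>a. 1 \<le> a \<and> a \<le> n \<and> (lls ! j) a \<noteq> \<infinity> \<longrightarrow> (lls' ! j) a \<noteq> \<infinity>)"
proof -
  obtain r' where r': "r = Suc r'" using r by (cases r) auto
  obtain l ls0 p3 R3 where l: "lls = l # ls0" "column_step n r l p R p3 R3"
    using c1 unfolding r' by (elim column_chain_SucE) auto
  have len: "length lls = r" "length lls' = r" using c1 c2 by (auto dest: column_chain_length)
  \<comment> \<open>Below s - 1 the vacancy numbers q exceed p1 by one at node r, so no string of
    such a length can be singular for q.\<close>
  have long: "q r i = p1 r i \<and> s - 1 \<le> i" if "(i, q r i) \<in># R1 r" "1 \<le> i" for i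
  proof -
    have rA: "r \<in> nodes (TypeA n)" using r by simp
    have "q r i \<le> p1 r i" by (rule column_chain_bound[OF c1 r(1) rA that(1)])
    then show ?thesis using q[OF rA, of i] that(2) by (auto simp: of_bool_def split: if_splits)
  qed
  show ?thesis
  proof
    assume C: "\<forall>i. 1 \<le> i \<and> i < s \<longrightarrow> 0 < p r i \<and> (i, p r i) \<notin># R r"
    have lr: "enat s \<le> l r"
    proof (cases "l r")
      case (enat i)
      have "1 \<le> i" using column_step_ge_1[OF l(2) r(2)] enat by (simp add: one_enat_def)
      then show ?thesis using C column_step_selected[OF l(2) order_refl r(2) enat] enat by auto
    qed simp
    then have ge: "enat s \<le> (lls ! j) a" if "j < r" "r - j \<le> a" "a \<le> n" for j a
      using column_chain_ge[OF c1 _ that] l(1) by simp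
    let ?gs = "map (\<lambda>l a. dec (l a)) lls"
    have "supports n p1 R1 ([] @ ?gs)"
      by (rule column_chain_extend_forward[OF c1]) (auto simp: supports_def)
    then have sup: "supports n p1 R1 ?gs" by simp
    have "supports n q R1 ?gs"
    proof (rule supports_shift[OF sup])
      fix a i h assume a: "1 \<le> a" "a \<le> n" "1 \<le> i" and h: "h \<in> set ?gs" "h a = enat i"
      obtain j where j: "j < r" "h = (\<lambda>a. dec ((lls ! j) a))" using h(1) len by (auto simp: in_set_conv_nth)
      show "q a i = p1 a i"
      proof (cases "a = r")
        case True
        then have "enat s \<le> (lls ! j) r" using ge[of j r] j r by simp
        moreover have "(lls ! j) r = enat (Suc i)" using h(2) a(3) j True by (simp add: dec_eq_enat)
        ultimately show ?thesis using q[of a i] a True by auto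
      next
        case False
        then show ?thesis using q[of a i] a by simp
      qed
    qed
    then have le: "\<forall>j<r. \<forall>a. r - j \<le> a \<and> a \<le> n \<longrightarrow> (lls' ! j) a \<le> (?gs ! j) a"
    proof (rule column_chain_consume_forward[OF c2 _ nested_dec[OF c1]])
      show "length ?gs = r" using len by simp
      show "1 \<le> (?gs ! j) a" if "j < r" "r - j \<le> a" "a \<le> n" for j a
        using ge[OF that] that len s by (cases "(lls ! j) a") (auto simp: one_enat_def)
    qed
    show "\<forall>j<r. \<forall>a. 1 \<le> a \<and> a \<le> n \<and> (lls ! j) a \<noteq> \<infinity> \<longrightarrow> (lls' ! j) a \<noteq> \<infinity>"
    proof (intro allI impI)
      fix j a assume j: "j < r" and a: "1 \<le> a \<and> a \<le> n \<and> (lls ! j) a \<noteq> \<infinity>"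
      show "(lls' ! j) a \<noteq> \<infinity>"
      proof (cases "a < r - j")
        case True
        then show ?thesis using column_chain_below[OF c2 j True] by simp
      next
        case False
        then have le_dec: "(lls' ! j) a \<le> dec ((lls ! j) a)" using le j a len by simp
        obtain k where "(lls ! j) a = enat k" using a by auto
        then have "(lls' ! j) a \<le> enat (k - 1)" using le_dec by simp
        then show ?thesis by (cases "(lls' ! j) a") auto
      qed
    qed
  next
    assume A: "\<forall>j<r. \<forall>a. 1 \<le> a \<and> a \<le> n \<and> (lls ! j) a \<noteq> \<infinity> \<longrightarrow> (lls' ! j) a \<noteq> \<infinity>"
    have supq: "supports n q R1 (cut r lls')"
      by (rule column_chain_extend_backward[OF c2])
    have sup1: "supports n p1 R1 ([] @ cut r lls')"
    proof (simp, rule supports_shift[OF supq])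
      fix a i h assume a: "1 \<le> a" "a \<le> n" "1 \<le> i" and h: "h \<in> set (cut r lls')" "h a = enat i"
      show "p1 a i = q a i"
      proof (cases "a = r")
        case True
        then show ?thesis using long[of i] supports_mem[OF supq a h] a by simp
      next
        case False
        then show ?thesis using q[of a i] a by simp
      qed
    qed
    have "supports n p R [] \<and> (r \<noteq> 0 \<longrightarrow> (\<forall>a. r \<le> a \<and> a \<le> n \<and> hd lls a \<noteq> \<infinity> \<longrightarrow> hd (cut r lls') a < hd lls a))"
    proof (rule column_chain_consume_backward[OF c1 sup1])
      show "nested n ([] @ cut r lls')" using nested_cut[OF c2] by simp
      show "length (cut r lls') = r" using len by simp
      show "(cut r lls' ! j) a = 0" if "j < r" "a < r - j" for j a
        using that len by (simp add: nth_cut)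
      show "(cut r lls' ! j) a \<noteq> \<infinity>" if "j < r" "r - j \<le> a" "a \<le> n" "(lls ! j) a \<noteq> \<infinity>" for j a
        using A that len by (simp add: nth_cut)
    qed
    then have less: "l r \<noteq> \<infinity> \<Longrightarrow> hd (cut r lls') r < l r" using r l(1) by auto
    obtain l' ls1 where l': "lls' = l' # ls1" using len r by (cases lls') auto
    have lr: "enat s \<le> l r"
    proof (cases "l r = \<infinity>")
      case False
      then have "l' r < l r" using less l' by simp
      then obtain i where i: "l' r = enat i" by (cases "l' r") auto
      obtain p4 R4 where "column_step n r l' q R1 p4 R4"
        using c2 l' unfolding r' by (elim column_chain_SucE) auto
      then have "(i, q r i) \<in># R1 r" "1 \<le> i"
        using column_step_selected[of n r l' q R1 p4 R4 r i] column_step_ge_1[of n r l' q R1 p4 R4 r] r i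
        by (auto simp: one_enat_def)
      then have "s - 1 \<le> i" using long by blast
      then show ?thesis using \<open>l' r < l r\<close> i s by (cases "l r") auto
    qed simp
    show "\<forall>i. 1 \<le> i \<and> i < s \<longrightarrow> 0 < p r i \<and> (i, p r i) \<notin># R r"
    proof (intro allI impI)
      fix i assume i: "1 \<le> i \<and> i < s"
      have low: "l (r - 1) = 1" using column_step_below[OF l(2), of "r - 1"] r by simp
      have i1: "l (r - 1) \<le> enat i" "enat i < l r"
        unfolding low using i less_le_trans[of "enat i" "enat s", OF _ lr] by (auto simp: one_enat_def)
      have "(i, p r i) \<notin># R r"
        using column_step_first[OF l(2) order_refl r(2) _ i1(1)] i1(2) by (meson leD)
      moreover have "p3 r i = p r i - 1"
        by (rule column_step_vacancy(2)[OF l(2) r i1])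
      moreover have "0 \<le> p3 r i" using column_step_nonneg[OF l(2), of r] r by simp
      ultimately show "0 < p r i \<and> (i, p r i) \<notin># R r" by linarith
    qed
  qed
qed

section \<open>The bijection\<close>

definition path_word :: "path \<Rightarrow> int list" where
  "path_word b = concat (concat b)"

definition highest_paths :: "cartan_type \<Rightarrow> kr_product \<Rightarrow> path set" where
  "highest_paths T B = {b \<in> elements T B. highest T (path_word b)}"

abbreviation path_wt :: "cartan_type \<Rightarrow> path \<Rightarrow> weight" where
  "path_wt T b \<equiv> word_wt T (path_word b)"

lemma paths_eq: "valid_type T \<Longrightarrow> paths T B lam = {b \<in> highest_paths T B. path_wt T b = lam}"
  by (auto simp: paths_iff highest_paths_def path_word_def)

text \<open>For \<open>r \<ge> 1\<close> the measure of \<open>B\<^sup>r\<^sup>,\<^sup>s\<close> is \<open>2 r s - 1\<close>; the maximum makes the recursion terminate for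
  the junk value \<open>r = 0\<close> too.\<close>

fun factor_measure :: "nat \<times> nat \<Rightarrow> nat" where
  "factor_measure (r, s) = s * max (2 * r - 1) 1 + (s - 1)"

definition product_measure :: "kr_product \<Rightarrow> nat" where
  "product_measure B = (\<Sum>f\<leftarrow>B. factor_measure f)"

text \<open>The length breaks ties: a factor with s = 0 has measure 0, and its removal must still
  decrease.\<close>

definition product_rel :: "(kr_product \<times> kr_product) set" where
  "product_rel = measures [product_measure, length]"

text \<open>For r >= 1 both splittings preserve the total of r s and increase the number of factors,
  so the -1 per factor in 2 r s - 1 makes the measure fall.\<close>

lemma product_rel:
  "2 \<le> s \<Longrightarrow> ((r, 1) # (r, s - 1) # B, (r, s) # B) \<in> product_rel"
  "2 \<le> r \<Longrightarrow> ((1, 1) # (r - 1, 1) # B, (r, 1) # B) \<in> product_rel"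
  "(B, f # B) \<in> product_rel"
proof -
  have Cons: "product_measure (g # C) = factor_measure g + product_measure C" for g C
    by (simp add: product_measure_def)
  have less: "product_measure C < product_measure D \<Longrightarrow> (C, D) \<in> product_rel" for C D
    by (simp add: product_rel_def)
  show "(B, f # B) \<in> product_rel"
    by (cases "factor_measure f") (simp_all add: product_rel_def Cons)
  show "((r, 1) # (r, s - 1) # B, (r, s) # B) \<in> product_rel" if s: "2 \<le> s"
  proof (rule less)
    define g where "g = max (2 * r - 1) 1"
    obtain k where k: "s = 2 + k" using le_Suc_ex[OF s] by blast
    have "factor_measure (r, 1) = g" "factor_measure (r, s - 1) = (1 + k) * g + k" "factor_measure (r, s) = (2 + k) * g + (1 + k)"
      by (simp_all add: g_def k)
    then show "product_measure ((r, 1) # (r, s - 1) # B) < product_measure ((r, s) # B)"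
      unfolding Cons by (simp add: algebra_simps)
  qed
  show "((1, 1) # (r - 1, 1) # B, (r, 1) # B) \<in> product_rel" if "2 \<le> r"
    by (rule less) (use that in \<open>auto simp: Cons max_def\<close>)
qed

lemma wf_product_rel: "wf product_rel"
  by (simp add: product_rel_def)

text \<open>For \<open>ls\<close> the configuration is that of the split path; in the other cases it
  is the unique preimage under i or \<open>delta\<close>. As \<open>delta\<close> forgets the letter
  that it removes, the weight is prescribed as well.\<close>

function rc_of :: "cartan_type \<Rightarrow> kr_product \<Rightarrow> path \<Rightarrow> rigged_configuration" where
  "rc_of T [] b = empty_rc"
| "rc_of T ((r, s) # B) b =
    (if 2 \<le> s then rc_of T ((r, 1) # (r, s - 1) # B) (ls b)
     else if s = 1 \<and> 2 \<le> r then
       (THE R. valid_rc T ((r, 1) # B) R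
          \<and> rc_i T (mult_array ((1, 1) # (r - 1, 1) # B)) r R = rc_of T ((1, 1) # (r - 1, 1) # B) (lb b))
     else (THE R. valid_rc T ((1, 1) # B) R \<and> rc_weight T ((1, 1) # B) R = path_wt T b
          \<and> delta T (mult_array ((1, 1) # B)) (mult_array B) R = rc_of T B (lh b)))"
  by pat_completeness auto
termination
  by (relation "inv_image product_rel (\<lambda>(T, B, b). B)") (auto simp: wf_product_rel intro: product_rel simp del: One_nat_def)

declare rc_of.simps(2) [simp del]

text \<open>Besides bijectivity this records how values arise from smaller products, because the
  splitting criteria follow several successive removals.\<close>

definition rc_of_correct :: "cartan_type \<Rightarrow> kr_product \<Rightarrow> bool" where
  "rc_of_correct T B \<longleftrightarrow> bij_betw (rc_of T B) (highest_paths T B) {R. valid_rc T B R}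
    \<and> (\<forall>b\<in>highest_paths T B. rc_weight T B (rc_of T B b) = path_wt T b)
    \<and> (\<forall>B' b. B = (1, 1) # B' \<longrightarrow> b \<in> highest_paths T B \<longrightarrow>
         (\<exists>x b' l. b = [[x]] # b' \<and> b' \<in> highest_paths T B' \<and> letter_step T x B' (rc_of T B b) (rc_of T B' b') l))
    \<and> (\<forall>n r B' b. T = TypeA n \<longrightarrow> B = (r, 1) # B' \<longrightarrow> 2 \<le> r \<longrightarrow> b \<in> highest_paths T B \<longrightarrow>
         lb b \<in> highest_paths T ((1, 1) # (r - 1, 1) # B')
         \<and> rc_i T (mult_array ((1, 1) # (r - 1, 1) # B')) r (rc_of T B b) = rc_of T ((1, 1) # (r - 1, 1) # B') (lb b))
    \<and> (\<forall>r s B' b. B = (r, s) # B' \<longrightarrow> 2 \<le> s \<longrightarrow> b \<in> highest_paths T B \<longrightarrow>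
         ls b \<in> highest_paths T ((r, 1) # (r, s - 1) # B'))"

lemma rc_of_correctD:
  assumes "rc_of_correct T B"
  shows "bij_betw (rc_of T B) (highest_paths T B) {R. valid_rc T B R}"
    "b \<in> highest_paths T B \<Longrightarrow> rc_weight T B (rc_of T B b) = path_wt T b"
    "b \<in> highest_paths T B \<Longrightarrow> valid_rc T B (rc_of T B b)"
  using assms unfolding rc_of_correct_def by (auto dest: bij_betwE)

lemma rc_of_letter:
  assumes "rc_of_correct T ((1, 1) # B')" "b \<in> highest_paths T ((1, 1) # B')"
  shows "\<exists>x b' l. b = [[x]] # b' \<and> b' \<in> highest_paths T B' \<and> letter_step T x B' (rc_of T ((1, 1) # B') b) (rc_of T B' b') l"
  using assms unfolding rc_of_correct_def by blast

lemma rc_of_column: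
  assumes "rc_of_correct (TypeA n) ((r, 1) # B')" "2 \<le> r" "b \<in> highest_paths (TypeA n) ((r, 1) # B')"
  shows "lb b \<in> highest_paths (TypeA n) ((1, 1) # (r - 1, 1) # B')"
    "rc_i (TypeA n) (mult_array ((1, 1) # (r - 1, 1) # B')) r (rc_of (TypeA n) ((r, 1) # B') b)
      = rc_of (TypeA n) ((1, 1) # (r - 1, 1) # B') (lb b)"
  using assms unfolding rc_of_correct_def by blast+

lemma rc_of_split: "2 \<le> s \<Longrightarrow> rc_of T ((r, s) # B) b = rc_of T ((r, 1) # (r, s - 1) # B) (ls b)"
  by (simp add: rc_of.simps(2))

text \<open>In type A, q extended by 0 at both ends is convex, and being nonnegative it vanishes. In
  type D the chain up to n - 2 is treated likewise, with the inequalities at the spin nodes in place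
  of the right end.\<close>

lemma cartan_nonpos_imp_zero:
  fixes q :: "nat \<Rightarrow> int"
  assumes T: "valid_type T" and q: "\<And>b. 0 \<le> q b" and le: "\<And>a. a \<in> nodes T \<Longrightarrow> (\<Sum>b\<in>nodes T. cartan T a b * q b) \<le> 0"
    and b: "b \<in> nodes T"
  shows "q b = 0"
proof -
  define e where "e a = (if a \<in> nodes T then q a else 0)" for a
  have e: "e 0 = 0" "\<And>a. 0 \<le> e a" using q by (auto simp: e_def)
  show ?thesis
  proof (cases T)
    case (TypeA n)
    have conv: "2 * e a \<le> e (a - 1) + e (a + 1)" if "1 \<le> a" "a \<le> n" for a
    proof -
      have "2 * q a - (if a = 1 then 0 else q (a - 1)) - (if a = n then 0 else q (a + 1)) \<le> 0"
        using le[of a] that cartan_sum_A[of a n q] TypeA by simp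
      then show ?thesis using that TypeA by (auto simp: e_def split: if_splits)
    qed
    have mono: "e (Suc a) \<le> e a" if "a \<le> n" for a
      using that
    proof (induction rule: inc_induct)
      case base
      then show ?case using q[of n] TypeA by (simp add: e_def)
    next
      case (step a)
      then show ?case using conv[of "Suc a"] by simp
    qed
    have "e a \<le> e 0" if "a \<le> n" for a
      using that
    proof (induction a)
      case (Suc a)
      then show ?case using mono[of a] by simp
    qed simp
    then have "e b = 0" using e(1) e(2)[of b] b TypeA by (simp add: antisym)
    then show ?thesis using b by (simp add: e_def)
  next
    case (TypeD n)
    obtain m where m: "n = m + 4"
      using T TypeD by (metis add.commute le_Suc_ex valid_type.simps(2))
    have sum: "2 * q a - (if a = n then q (n - 2) else if a = 1 then 0 else q (a - 1))
      - (if a \<ge> n - 1 then 0 else q (a + 1)) - (if a = n - 2 then q n else 0) \<le> 0" if "1 \<le> a" "a \<le> n" for a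
      using le[of a] that cartan_sum_D[of a n q] TypeD m by simp
    have spin: "2 * q (m + 3) \<le> q (m + 2)" "2 * q (m + 4) \<le> q (m + 2)" "2 * q (m + 2) \<le> q (m + 1) + q (m + 3) + q (m + 4)"
    proof -
      have m3: "m + 3 = Suc (Suc (Suc m))" and m4: "m + 4 = Suc (Suc (Suc (Suc m)))" by simp_all
      show "2 * q (m + 3) \<le> q (m + 2)" "2 * q (m + 4) \<le> q (m + 2)" "2 * q (m + 2) \<le> q (m + 1) + q (m + 3) + q (m + 4)"
        using sum[of "m + 3"] sum[of "m + 4"] sum[of "m + 2"] unfolding m m3 m4 by simp_all
    qed
    have conv: "2 * e a \<le> e (a - 1) + e (a + 1)" if "1 \<le> a" "a \<le> m + 1" for a
    proof -
      have "a \<noteq> n" "\<not> n - 1 \<le> a" "a \<noteq> n - 2" using that m by auto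
      then have "2 * q a - (if a = 1 then 0 else q (a - 1)) - q (a + 1) \<le> 0"
        using sum[of a] that m by simp
      moreover have "e a = q a" "e (a + 1) = q (a + 1)" "e (a - 1) = (if a = 1 then 0 else q (a - 1))"
        using that TypeD m by (auto simp: e_def)
      ultimately show ?thesis by simp
    qed
    have mono: "e (Suc a) \<le> e a" if "a \<le> m + 1" for a
      using that
    proof (induction rule: inc_induct)
      case base
      have "q (m + 2) \<le> q (m + 1)" using spin by linarith
      then show ?case using TypeD m by (simp add: e_def)
    next
      case (step a)
      then show ?case using conv[of "Suc a"] by simp
    qed
    have "e a \<le> e 0" if "a \<le> m + 2" for a
      using that
    proof (induction a)
      case (Suc a)
      then show ?case using mono[of a] by simp
    qed simp
    then have low: "q a = 0" if "1 \<le> a" "a \<le> m + 2" for a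
      using that e(1) q[of a] TypeD m by (fastforce simp: e_def)
    then have "q (m + 3) = 0" "q (m + 4) = 0"
      using spin(1,2) low[of "m + 2"] q[of "m + 3"] q[of "m + 4"] by auto
    moreover consider "1 \<le> b" "b \<le> m + 2" | "b = m + 3" | "b = m + 4"
      using b TypeD m by fastforce
    ultimately show ?thesis
      using low by cases auto
  qed
qed

text \<open>Without factors the weight is minus the Cartan matrix applied to the sizes of the
  partitions; its dominance forces all sizes to be 0.\<close>

lemma valid_rc_Nil:
  assumes T: "valid_type T"
  shows "valid_rc T [] R \<longleftrightarrow> R = empty_rc"
proof
  assume R: "valid_rc T [] R"
  have dom: "rc_weight T [] R \<in> dominant_weights T" by (rule rc_weight_dominant[OF R])
  have "(\<Sum>b\<in>nodes T. cartan T a b * int (\<Sum>\<^sub># (shape R b))) \<le> 0" if "a \<in> nodes T" for a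
    using dom that by (auto simp: dominant_weights_def rc_weight_def)
  from this have zero: "int (\<Sum>\<^sub># (shape R b)) = 0" if "b \<in> nodes T" for b
    by (rule cartan_nonpos_imp_zero[where q = "\<lambda>b. int (\<Sum>\<^sub># (shape R b))", OF T of_nat_0_le_iff _ that])
  have "R b = {#}" for b
  proof (cases "b \<in> nodes T")
    case True
    have "s \<notin># R b" for s
    proof
      assume s: "s \<in># R b"
      obtain i x where ix: "s = (i, x)" by force
      then have "i \<in># shape R b" using s by (force simp: shape_def)
      moreover have "\<Sum>\<^sub># (shape R b) = 0"
        using zero[OF True] by (simp only: of_nat_eq_0_iff)
      ultimately have "i = 0" by simp
      moreover have "1 \<le> i"
        using R True s ix valid_stringsD(2) unfolding valid_rc_def by blast
      ultimately show False by simp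
    qed
    then show ?thesis by (meson multiset_nonemptyE)
  next
    case False
    then show ?thesis using R by (simp add: valid_rc_def)
  qed
  then show "R = empty_rc" by (auto simp: empty_rc_def)
next
  assume "R = empty_rc"
  then show "valid_rc T [] R"
    by (simp add: valid_rc_def valid_strings_def empty_rc_def vacancy_eq shape_def)
qed

lemma rc_weight_Nil: "rc_weight T [] empty_rc = (\<lambda>_. 0)"
  by (auto simp: rc_weight_def empty_rc_def shape_def)

lemma highest_paths_Nil: "highest_paths T [] = {[]}"
  by (auto simp: highest_paths_def elements_Nil path_word_def)

section \<open>The empty product and products beginning with a single letter\<close>

lemma rc_of_Nil_correct:
  assumes T: "valid_type T"
  shows "rc_of_correct T []"
  unfolding rc_of_correct_def highest_paths_Nil valid_rc_Nil[OF T]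
  by (auto simp: bij_betw_def rc_weight_Nil path_word_def)

lemma highest_paths_letter:
  assumes T: "valid_type T"
  shows "b \<in> highest_paths T ((1, 1) # B') \<longleftrightarrow>
    (\<exists>x b'. b = [[x]] # b' \<and> x \<in> letters T \<and> b' \<in> highest_paths T B' \<and> (\<lambda>a. path_wt T b' a + letter_wt T x a) \<in> dominant_weights T)"
  by (auto simp: highest_paths_def elements_Cons KR_1_1[OF T, simplified] path_word_def highest_Cons[OF T] add.commute)

lemma path_wt_letter: "path_wt T ([[x]] # b') = (\<lambda>a. path_wt T b' a + letter_wt T x a)"
  by (auto simp: path_word_def)

text \<open>The weight determines the removed letter, and the letter together with the result
  determines the source.\<close>

lemma letter_step_unique:
  assumes T: "valid_type T" and s: "letter_step T x B R R' l" and R2: "valid_rc T ((1, 1) # B) R2"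
    "rc_weight T ((1, 1) # B) R2 = rc_weight T ((1, 1) # B) R"
    "delta T (mult_array ((1, 1) # B)) (mult_array B) R2 = R'"
  shows "R2 = R"
proof -
  obtain x2 l2 where s2: "letter_step T x2 B R2 R' l2"
    using letter_step_exists[OF T R2(1)] R2(3) by blast
  have "letter_wt T x2 = letter_wt T x"
    using s s2 R2(2) by (auto simp: letter_step_def fun_eq_iff)
  then have "x2 = x"
    using letter_wt_inject[OF T] s s2 by (auto simp: letter_step_def)
  then show ?thesis
    using letter_step_back_unique s s2 by blast
qed

lemma rc_of_letter_step:
  assumes T: "valid_type T" and IH: "rc_of_correct T B'" and b: "[[x]] # b' \<in> highest_paths T ((1, 1) # B')"
  shows "\<exists>l. letter_step T x B' (rc_of T ((1, 1) # B') ([[x]] # b')) (rc_of T B' b') l"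
proof -
  let ?b = "[[x]] # b'" and ?R' = "rc_of T B' b'"
  have x: "x \<in> letters T" and b': "b' \<in> highest_paths T B'" and dom: "(\<lambda>a. path_wt T b' a + letter_wt T x a) \<in> dominant_weights T"
    using b by (auto simp: highest_paths_letter[OF T, simplified])
  have R': "valid_rc T B' ?R'" "rc_weight T B' ?R' = path_wt T b'"
    using rc_of_correctD(2,3)[OF IH b'] by auto
  obtain R l where s: "letter_step T x B' R ?R' l"
    using letter_step_back_exists[OF T R'(1) x] dom R'(2) by auto
  have wt: "rc_weight T ((1, 1) # B') R = path_wt T ?b"
    using s R'(2) by (simp add: letter_step_def path_wt_letter)
  have "rc_of T ((1, 1) # B') ?b = (THE R. valid_rc T ((1, 1) # B') R \<and> rc_weight T ((1, 1) # B') R = path_wt T ?b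
          \<and> delta T (mult_array ((1, 1) # B')) (mult_array B') R = ?R')"
    by (simp add: rc_of.simps(2) lh_def)
  also have "\<dots> = R"
  proof (rule the_equality)
    show "valid_rc T ((1, 1) # B') R \<and> rc_weight T ((1, 1) # B') R = path_wt T ?b \<and> delta T (mult_array ((1, 1) # B')) (mult_array B') R = ?R'"
      using s wt by (simp add: letter_step_def)
    show "R2 = R" if "valid_rc T ((1, 1) # B') R2 \<and> rc_weight T ((1, 1) # B') R2 = path_wt T ?b \<and> delta T (mult_array ((1, 1) # B')) (mult_array B') R2 = ?R'" for R2
      using letter_step_unique[OF T s] that wt by simp
  qed
  finally show ?thesis using s by auto
qed

lemma rc_of_letter_correct:
  assumes T: "valid_type T" and IH: "rc_of_correct T B'"
  shows "rc_of_correct T ((1, 1) # B')"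
proof -
  let ?B = "(1, 1) # B'"
  note step = rc_of_letter_step[OF T IH]
  have "bij_betw (rc_of T ?B) (highest_paths T ?B) {R. valid_rc T ?B R}"
    unfolding bij_betw_def
  proof (intro conjI inj_onI equalityI subsetI)
    fix b c assume b: "b \<in> highest_paths T ?B" and c: "c \<in> highest_paths T ?B" and eq: "rc_of T ?B b = rc_of T ?B c"
    obtain x b' where x: "b = [[x]] # b'" "b' \<in> highest_paths T B'" "x \<in> letters T" using b highest_paths_letter[OF T] by blast
    obtain y c' where y: "c = [[y]] # c'" "c' \<in> highest_paths T B'" "y \<in> letters T" using c highest_paths_letter[OF T] by blast
    obtain l where l: "letter_step T x B' (rc_of T ?B b) (rc_of T B' b') l" using step b x(1) by blast
    obtain l2 where l2: "letter_step T y B' (rc_of T ?B b) (rc_of T B' c') l2" using step c y(1) eq by metis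
    have R': "rc_of T B' b' = rc_of T B' c'" using l l2 by (simp add: letter_step_def)
    then have "b' = c'" using rc_of_correctD(1)[OF IH] x(2) y(2) by (meson bij_betw_imp_inj_on inj_onD)
    moreover have "letter_wt T x = letter_wt T y" using l l2 R' by (auto simp: letter_step_def fun_eq_iff)
    then have "x = y" using letter_wt_inject[OF T x(3) y(3)] by blast
    ultimately show "b = c" using x y by simp
  next
    fix R assume "R \<in> rc_of T ?B ` highest_paths T ?B"
    then obtain b where b: "b \<in> highest_paths T ?B" "R = rc_of T ?B b" by blast
    then obtain x b' where "b = [[x]] # b'" using highest_paths_letter[OF T] by blast
    then obtain l where "letter_step T x B' R (rc_of T B' b') l" using step b by blast
    then show "R \<in> {R. valid_rc T ?B R}" by (simp add: letter_step_def)
  next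
    fix R assume "R \<in> {R. valid_rc T ?B R}"
    then have R: "valid_rc T ?B R" by simp
    obtain x l where s: "letter_step T x B' R (delta T (mult_array ?B) (mult_array B') R) l"
      using letter_step_exists[OF T R] by blast
    let ?R' = "delta T (mult_array ?B) (mult_array B') R"
    have "valid_rc T B' ?R'" using s by (simp add: letter_step_def)
    then have "?R' \<in> rc_of T B' ` highest_paths T B'"
      using bij_betw_imp_surj_on[OF rc_of_correctD(1)[OF IH]] by simp
    then obtain b' where b': "b' \<in> highest_paths T B'" "rc_of T B' b' = ?R'"
      by (elim imageE) simp
    have wt: "rc_weight T ?B R = (\<lambda>a. path_wt T b' a + letter_wt T x a)"
      using s rc_of_correctD(2)[OF IH b'(1)] b'(2) by (simp add: letter_step_def)
    have x: "x \<in> letters T" using s by (simp add: letter_step_def)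
    have b: "[[x]] # b' \<in> highest_paths T ?B"
      using highest_paths_letter[OF T] x b' rc_weight_dominant[OF R] wt by auto
    obtain l2 where s2: "letter_step T x B' (rc_of T ?B ([[x]] # b')) ?R' l2" using step[OF b] b'(2) by auto
    have "R = rc_of T ?B ([[x]] # b')" by (rule letter_step_back_unique[OF s s2])
    then show "R \<in> rc_of T ?B ` highest_paths T ?B" using b by blast
  qed
  moreover have "rc_weight T ?B (rc_of T ?B b) = path_wt T b
      \<and> (\<exists>x b' l. b = [[x]] # b' \<and> b' \<in> highest_paths T B' \<and> letter_step T x B' (rc_of T ?B b) (rc_of T B' b') l)"
    if b: "b \<in> highest_paths T ?B" for b
  proof -
    obtain x b' where x: "b = [[x]] # b'" "b' \<in> highest_paths T B'" using b highest_paths_letter[OF T] by blast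
    then obtain l where s: "letter_step T x B' (rc_of T ?B b) (rc_of T B' b') l" using step b by blast
    moreover have "rc_weight T ?B (rc_of T ?B b) = path_wt T b"
      using s rc_of_correctD(2)[OF IH x(2)] x(1) by (simp add: letter_step_def path_wt_letter)
    ultimately show ?thesis using x by blast
  qed
  ultimately show ?thesis
    unfolding rc_of_correct_def by auto
qed

section \<open>The images of \<open>lb\<close> and \<open>ls\<close>\<close>

lemma in_KR_products_Cons:
  "f # B \<in> KR_products T \<longleftrightarrow> [f] \<in> KR_products T \<and> B \<in> KR_products T"
  by (cases T) auto

lemma highest_paths_ConsE:
  assumes "b \<in> highest_paths T ((r, s) # B)"
  obtains t b' where "b = t # b'" "t \<in> KR T r s" "b' \<in> elements T B" "highest T (path_word b)"
  using assms unfolding highest_paths_def elements_Cons by blast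

text \<open>Translates \<open>lb\<close> followed by \<open>lh\<close> into the map i followed by
  \<open>delta\<close>. For r = 1 the column is used up, which \<open>column_rest\<close> and the
  case distinction in b2 absorb.\<close>

lemma column_extract:
  assumes T: "valid_type (TypeA n)" and r: "1 \<le> r" "r \<le> n"
    and c1: "rc_of_correct (TypeA n) ((r, 1) # B)" and c2: "2 \<le> r \<Longrightarrow> rc_of_correct (TypeA n) ((1, 1) # (r - 1, 1) # B)"
    and b: "b \<in> highest_paths (TypeA n) ((r, 1) # B)"
  defines "R \<equiv> rc_of (TypeA n) ((r, 1) # B) b"
  obtains x c b' b2 l where "b = [x # c] # b'" "x \<in> letters (TypeA n)" "b2 = (if r = 1 then b' else [c] # b')"
    "length c = r - 1" "b2 \<in> highest_paths (TypeA n) (column_rest r B)" "support (TypeA n) l = ideal (TypeA n) x"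
    "column_step n r l (vac (TypeA n) ((r, 1) # B) R) R
       (vac (TypeA n) (column_rest r B) (rc_of (TypeA n) (column_rest r B) b2)) (rc_of (TypeA n) (column_rest r B) b2)"
proof -
  let ?T = "TypeA n" and ?B = "(r, 1) # B"
  let ?S = "add_short r (vac ?T ?B R) R"
  have "\<exists>x c b' b2 l. b = [x # c] # b' \<and> length c = r - 1 \<and> b2 = (if r = 1 then b' else [c] # b')
      \<and> b2 \<in> highest_paths ?T (column_rest r B) \<and> letter_step ?T x (column_rest r B) ?S (rc_of ?T (column_rest r B) b2) l"
  proof (cases "r = 1")
    case True
    then obtain x b' l where "b = [[x]] # b'" "b' \<in> highest_paths ?T B" "letter_step ?T x B R (rc_of ?T B b') l"
      using rc_of_letter[of ?T B b] c1 b unfolding R_def by auto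
    moreover have "?S = R" using True by (auto simp: add_short_def)
    ultimately show ?thesis using True by (auto simp: column_rest_def)
  next
    case False
    then have r2: "2 \<le> r" using r by simp
    have rest: "column_rest r B = (r - 1, 1) # B" using False by (simp add: column_rest_def)
    obtain t b' where t: "b = t # b'" "t \<in> KR ?T r 1"
      using b by (rule highest_paths_ConsE)
    then obtain c0 where c0: "t = [c0]" "length c0 = r" using KR_A_1[OF t(2)] by blast
    then obtain x c where xc: "c0 = x # c" "length c = r - 1" using r by (cases c0) auto
    have lb: "lb b = [[x]] # [c] # b'" using t c0 xc by (simp add: lb_def)
    note col = rc_of_column[OF c1 r2 b]
    have S: "rc_of ?T ((1, 1) # (r - 1, 1) # B) (lb b) = ?S"
      using col(2) rc_i_eq_add_short[OF r r2, of B R] unfolding R_def by simp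
    obtain x0 b0 l where l: "lb b = [[x0]] # b0" "b0 \<in> highest_paths ?T ((r - 1, 1) # B)"
      "letter_step ?T x0 ((r - 1, 1) # B) ?S (rc_of ?T ((r - 1, 1) # B) b0) l"
      using rc_of_letter[OF c2[OF r2] col(1)] unfolding S by blast
    moreover have "x0 = x" "b0 = [c] # b'" using l(1) lb by auto
    ultimately have "letter_step ?T x ((r - 1, 1) # B) ?S (rc_of ?T ((r - 1, 1) # B) ([c] # b')) l"
      "[c] # b' \<in> highest_paths ?T ((r - 1, 1) # B)" by auto
    then show ?thesis using False t c0 xc unfolding rest by auto
  qed
  then obtain x c b' b2 l where *: "b = [x # c] # b'" "length c = r - 1" "b2 = (if r = 1 then b' else [c] # b')"
      "b2 \<in> highest_paths ?T (column_rest r B)" "letter_step ?T x (column_rest r B) ?S (rc_of ?T (column_rest r B) b2) l"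
    by blast
  have "valid_step ?T l (vac ?T ?B R) ?S (vac ?T (column_rest r B) (rc_of ?T (column_rest r B) b2)) (rc_of ?T (column_rest r B) b2)"
  proof (rule valid_step_cong)
    show "valid_step ?T l (vac ?T ((1, 1) # column_rest r B) ?S) ?S (vac ?T (column_rest r B) (rc_of ?T (column_rest r B) b2)) (rc_of ?T (column_rest r B) b2)"
      using *(5) unfolding letter_step_def by blast
  qed (use vac_add_short[OF r, of _ B "vac ?T ?B R" R] in auto)
  then have "column_step n r l (vac ?T ?B R) R (vac ?T (column_rest r B) (rc_of ?T (column_rest r B) b2)) (rc_of ?T (column_rest r B) b2)"
    using r by (simp add: column_step_def)
  moreover have "x \<in> letters ?T" "support ?T l = ideal ?T x"
    using *(5) by (auto simp: letter_step_def)
  ultimately show ?thesis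
    using that * by blast
qed

lemma column_chain_of_path:
  assumes T: "valid_type (TypeA n)" and "1 \<le> r" "r \<le> n"
    and "\<And>k. 1 \<le> k \<Longrightarrow> k \<le> r \<Longrightarrow> rc_of_correct (TypeA n) ((k, 1) # B)"
    and "\<And>k. 2 \<le> k \<Longrightarrow> k \<le> r \<Longrightarrow> rc_of_correct (TypeA n) ((1, 1) # (k - 1, 1) # B)"
    and "b \<in> highest_paths (TypeA n) ((r, 1) # B)"
  shows "\<exists>c b' lls. b = [c] # b' \<and> length c = r \<and> b' \<in> highest_paths (TypeA n) B
    \<and> column_chain n r (vac (TypeA n) ((r, 1) # B) (rc_of (TypeA n) ((r, 1) # B) b)) (rc_of (TypeA n) ((r, 1) # B) b) lls
        (vac (TypeA n) B (rc_of (TypeA n) B b')) (rc_of (TypeA n) B b')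
    \<and> (\<forall>j<r. support (TypeA n) (lls ! j) = ideal (TypeA n) (c ! j) \<and> c ! j \<in> letters (TypeA n))"
  using assms(2-)
proof (induction r arbitrary: b)
  case (Suc r)
  let ?T = "TypeA n"
  have c: "rc_of_correct ?T ((Suc r, 1) # B)" "2 \<le> Suc r \<Longrightarrow> rc_of_correct ?T ((1, 1) # (Suc r - 1, 1) # B)"
    using Suc.prems(1,2) Suc.prems(3)[of "Suc r"] Suc.prems(4)[of "Suc r"] by auto
  obtain x c b' b2 l where x: "b = [x # c] # b'" "x \<in> letters ?T" "b2 = (if Suc r = 1 then b' else [c] # b')"
    "length c = Suc r - 1" "b2 \<in> highest_paths ?T (column_rest (Suc r) B)" "support ?T l = ideal ?T x"
    "column_step n (Suc r) l (vac ?T ((Suc r, 1) # B) (rc_of ?T ((Suc r, 1) # B) b)) (rc_of ?T ((Suc r, 1) # B) b)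
       (vac ?T (column_rest (Suc r) B) (rc_of ?T (column_rest (Suc r) B) b2)) (rc_of ?T (column_rest (Suc r) B) b2)"
    by (rule column_extract[OF T Suc.prems(1,2) c Suc.prems(5)])
  show ?case
  proof (cases "r = 0")
    case True
    then have "column_rest (Suc r) B = B" "b2 = b'" "c = []" using x by (auto simp: column_rest_def)
    then show ?thesis
      using x True column_chain.Cons[OF x(7)[unfolded True] column_chain.Nil] by (intro exI[of _ "x # c"] exI[of _ b'] exI[of _ "[l]"]) auto
  next
    case False
    then have rest: "column_rest (Suc r) B = (r, 1) # B" "b2 = [c] # b'" using x by (auto simp: column_rest_def)
    have "b2 \<in> highest_paths ?T ((r, 1) # B)" using x(5) rest(1) by simp
    then obtain c2 b3 lls where y: "b2 = [c2] # b3" "length c2 = r" "b3 \<in> highest_paths ?T B"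
      "column_chain n r (vac ?T ((r, 1) # B) (rc_of ?T ((r, 1) # B) b2)) (rc_of ?T ((r, 1) # B) b2) lls
        (vac ?T B (rc_of ?T B b3)) (rc_of ?T B b3)"
      "\<forall>j<r. support ?T (lls ! j) = ideal ?T (c2 ! j) \<and> c2 ! j \<in> letters ?T"
      using Suc.IH[of b2] Suc.prems(2-4) False by auto
    have "c2 = c" "b3 = b'" using y(1) rest(2) by auto
    moreover have "column_chain n (Suc r) (vac ?T ((Suc r, 1) # B) (rc_of ?T ((Suc r, 1) # B) b)) (rc_of ?T ((Suc r, 1) # B) b) (l # lls)
        (vac ?T B (rc_of ?T B b3)) (rc_of ?T B b3)"
      using column_chain.Cons[OF x(7)[unfolded rest(1)] y(4)] .
    ultimately show ?thesis
      using x(1,2,6) y by (intro exI[of _ "x # c"] exI[of _ b'] exI[of _ "l # lls"]) (auto simp: nth_Cons split: nat.splits)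
  qed
qed simp

text \<open>A preimage under i exists exactly if singular strings of length 1 can be taken away at
  all nodes below r. The comparison of successive steps shows that this happens exactly when the
  entries decrease.\<close>

lemma column_image:
  assumes T: "valid_type (TypeA n)" and r: "2 \<le> r" "r \<le> n"
    and c1: "rc_of_correct (TypeA n) ((1, 1) # (r - 1, 1) # B)" and c2: "rc_of_correct (TypeA n) ((r - 1, 1) # B)"
    and c3: "3 \<le> r \<Longrightarrow> rc_of_correct (TypeA n) ((1, 1) # (r - 2, 1) # B)"
    and b: "b \<in> highest_paths (TypeA n) ((1, 1) # (r - 1, 1) # B)"
  defines "R \<equiv> rc_of (TypeA n) ((1, 1) # (r - 1, 1) # B) b"
  shows "\<exists>x c b'. b = [[x]] # [c] # b' \<and>
    (hd c < x \<longleftrightarrow> (\<exists>R0. valid_rc (TypeA n) ((r, 1) # B) R0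
        \<and> rc_i (TypeA n) (mult_array ((1, 1) # (r - 1, 1) # B)) r R0 = R))"
proof -
  let ?T = "TypeA n"
  let ?B1 = "(1, 1) # (r - 1, 1) # B"
  have r1: "1 \<le> r" "1 \<le> r - 1" "r - 1 \<le> n" using r by auto
  have rest: "column_rest r B = (r - 1, 1) # B" using r by (simp add: column_rest_def)
  obtain x b2 l where x: "b = [[x]] # b2" "b2 \<in> highest_paths ?T ((r - 1, 1) # B)"
    "letter_step ?T x ((r - 1, 1) # B) R (rc_of ?T ((r - 1, 1) # B) b2) l"
    using rc_of_letter[OF c1 b] unfolding R_def by auto
  define R1 where "R1 = rc_of ?T ((r - 1, 1) # B) b2"
  have c3': "2 \<le> r - 1 \<Longrightarrow> rc_of_correct ?T ((1, 1) # (r - 1 - 1, 1) # B)"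
    using c3 by (simp add: numeral_2_eq_2)
  obtain y c b' b3 l2 where y: "b2 = [y # c] # b'" "y \<in> letters ?T" "b3 = (if r - 1 = 1 then b' else [c] # b')"
    "length c = r - 1 - 1" "b3 \<in> highest_paths ?T (column_rest (r - 1) B)" "support ?T l2 = ideal ?T y"
    "column_step n (r - 1) l2 (vac ?T ((r - 1, 1) # B) R1) R1
       (vac ?T (column_rest (r - 1) B) (rc_of ?T (column_rest (r - 1) B) b3)) (rc_of ?T (column_rest (r - 1) B) b3)"
    unfolding R1_def by (rule column_extract[OF T r1(2,3) c2 c3' x(2)])
  have s1: "valid_step ?T l (vac ?T ?B1 R) R (vac ?T ((r - 1, 1) # B) R1) R1" and sx: "support ?T l = ideal ?T x" and xl: "x \<in> letters ?T"
    and vR: "valid_rc ?T ?B1 R"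
    using x(3) unfolding R1_def letter_step_def by auto
  have xy: "1 \<le> y" "y \<le> int n + 1" "1 \<le> x" "x \<le> int n + 1" using xl y(2) by auto
  have "y < x \<longleftrightarrow> (\<exists>R0. valid_rc ?T ((r, 1) # B) R0 \<and> rc_i ?T (mult_array ?B1) r R0 = R)"
  proof
    assume yx: "y < x"
    define p where "p = vac ?T ?B1 R"
    have one: "(1, p a 1) \<in># R a" if "1 \<le> a" "a < r" for a
    proof -
      have "l a = enat 1"
        using column_step_next_back[OF s1 y(7) sx y(6) xy(1) yx xy(4), of a] that by (simp add: one_enat_def)
      then show ?thesis
        unfolding p_def using valid_step_selected(1)[OF s1, of a 1] that r by simp
    qed
    define R0 where "R0 a = (if 1 \<le> a \<and> a < r then R a - {#(1, p a 1)#} else R a)" for a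
    have R: "R = add_short r p R0"
      using one by (auto simp: add_short_def R0_def)
    have p: "p a i = vac ?T ((r, 1) # B) R0 a i" if "a \<in> nodes ?T" for a i
    proof -
      have "vac ?T ?B1 R a i = vac ?T ((1, 1) # column_rest r B) (add_short r p R0) a i"
        unfolding rest R[symmetric] ..
      then show ?thesis
        using vac_add_short[OF r1(1) r(2) that, of B p R0 i] unfolding p_def by simp
    qed
    have R': "R = add_short r (vac ?T ((r, 1) # B) R0) R0"
    proof
      fix a
      show "R a = add_short r (vac ?T ((r, 1) # B) R0) R0 a"
        by (subst R) (use p[of a 1] r in \<open>auto simp: add_short_def\<close>)
    qed
    have "valid_rc ?T ((r, 1) # B) R0"
      using valid_rc_add_short[OF r1(1) r(2), of B R0] vR unfolding rest R'[symmetric] by simp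
    moreover have "rc_i ?T (mult_array ?B1) r R0 = R"
      using rc_i_eq_add_short[OF r1(1) r(2,1), of B R0] R' by simp
    ultimately show "\<exists>R0. valid_rc ?T ((r, 1) # B) R0 \<and> rc_i ?T (mult_array ?B1) r R0 = R" by blast
  next
    assume "\<exists>R0. valid_rc ?T ((r, 1) # B) R0 \<and> rc_i ?T (mult_array ?B1) r R0 = R"
    then obtain R0 where R0: "R = add_short r (vac ?T ((r, 1) # B) R0) R0"
      using rc_i_eq_add_short[OF r1(1) r(2,1), of B] by auto
    have "valid_step ?T l (vac ?T ((r, 1) # B) R0) (add_short r (vac ?T ((r, 1) # B) R0) R0) (vac ?T ((r - 1, 1) # B) R1) R1"
    proof -
      have "vac ?T ?B1 R a i = vac ?T ((r, 1) # B) R0 a i" if "a \<in> nodes ?T" for a i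
        using vac_add_short[OF r1(1) r(2) that, of B "vac ?T ((r, 1) # B) R0" R0 i] unfolding rest R0[symmetric] .
      then have "valid_step ?T l (vac ?T ((r, 1) # B) R0) R (vac ?T ((r - 1, 1) # B) R1) R1"
        by (intro valid_step_cong[OF s1]) auto
      then show ?thesis using R0 by simp
    qed
    then have s1': "column_step n (Suc (r - 1)) l (vac ?T ((r, 1) # B) R0) R0 (vac ?T ((r - 1, 1) # B) R1) R1"
      using r by (simp add: column_step_def)
    show "y < x"
    proof (rule ccontr)
      assume "\<not> y < x"
      \<comment> \<open>The first step has length \<infinity> at x = a + 1, a node or the virtual
        top. \<open>column_step_next\<close> passes this on to the second step at node a, so y <=
        a.\<close>
      define a where "a = nat x - 1"
      \<comment> \<open>At all nodes below r the first step has length 1, so they belong to the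
        ideal of x.\<close>
      have rx: "int r \<le> x"
      proof (rule ccontr)
        assume "\<not> int r \<le> x"
        then have "nat x < Suc (r - 1)" "1 \<le> nat x" "nat x \<le> n" using xy r by auto
        then show False
          using column_step_below[OF s1', of "nat x"] column_step_support[OF s1' sx xy(3), of "nat x"] xy(3) by simp
      qed
      then have a: "r - 1 \<le> a" "a \<le> n" "Suc a = nat x" "1 \<le> a" using xy r by (auto simp: a_def)
      have "l (Suc a) = \<infinity>"
      proof (cases "Suc a \<le> n")
        case True
        then show ?thesis using column_step_support[OF s1' sx xy(3), of "Suc a"] a by simp
      next
        case False
        then have "Suc a = Suc n" using a by simp
        then show ?thesis using column_step_top[OF s1'] by simp
      qed
      then have "l2 a = \<infinity>"
        using column_step_next[OF s1' y(7) a(1,2)] by simp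
      then have "y \<le> int a"
        using column_step_support[OF y(7,6) xy(1) a(4,2)] by simp
      then show False using \<open>\<not> y < x\<close> a by simp
    qed
  qed
  then show ?thesis using x(1) y(1) by auto
qed

lemma split_image_row:
  assumes T: "valid_type T" and s: "2 \<le> s"
    and c1: "rc_of_correct T ((1, 1) # (1, s - 1) # B)"
    and c2: "rc_of_correct T ((1, s - 1) # B)"
    and c3: "3 \<le> s \<Longrightarrow> rc_of_correct T ((1, 1) # (1, s - 2) # B)"
    and b: "b \<in> highest_paths T ((1, 1) # (1, s - 1) # B)"
  shows "\<exists>c t b'. b = [c] # t # b' \<and>
    (column_le T c (hd t) \<longleftrightarrow> valid_rc T ((1, s) # B) (rc_of T ((1, 1) # (1, s - 1) # B) b))"
proof -
  let ?B1 = "(1, 1) # (1, s - 1) # B"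
  define R where "R = rc_of T ?B1 b"
  obtain x b2 l where x: "b = [[x]] # b2" "b2 \<in> highest_paths T ((1, s - 1) # B)"
    "letter_step T x ((1, s - 1) # B) R (rc_of T ((1, s - 1) # B) b2) l"
    using rc_of_letter[OF c1 b] unfolding R_def by auto
  define R1 where "R1 = rc_of T ((1, s - 1) # B) b2"
  obtain t b' where t: "b2 = t # b'" using x(2) by (rule highest_paths_ConsE)
  \<comment> \<open>For s = 2 the next factor is already B^{1,1}. Otherwise one more
    \<open>ls\<close> exposes its first letter and raises the vacancy numbers at node 1 by one for 1
    <= i < s - 1. Both cases fit this form.\<close>
  have "\<exists>X y l2 R2. letter_step T y X R1 R2 l2 \<and> hd t = [y]
    \<and> (\<forall>a i. vac T ((1, 1) # X) R1 a i = vac T ((1, s - 1) # B) R1 a i + of_bool (a = 1 \<and> 1 \<le> i \<and> i < s - 1))"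
  proof (cases "s = 2")
    case True
    then obtain y b3 l2 where "b2 = [[y]] # b3" "letter_step T y B R1 (rc_of T B b3) l2"
      using rc_of_letter[of T B b2] c2 x(2) unfolding R1_def by auto
    moreover have "\<not> (1 \<le> i \<and> i < s - 1)" for i :: nat using True by auto
    ultimately show ?thesis using t True by (intro exI[of _ B] exI[of _ y] exI[of _ l2] exI[of _ "rc_of T B b3"]) auto
  next
    case False
    then have s3: "2 \<le> s - 1" "s - 1 - 1 = s - 2" using s by auto
    have lsb: "ls b2 \<in> highest_paths T ((1, 1) # (1, s - 1 - 1) # B)"
      using c2 x(2) s3(1) unfolding rc_of_correct_def by blast
    have R1: "R1 = rc_of T ((1, 1) # (1, s - 2) # B) (ls b2)"
      unfolding R1_def using rc_of_split[OF s3(1), of T 1 B b2] s3(2) by simp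
    have "3 \<le> s" using s False by simp
    from rc_of_letter[OF c3[OF this] lsb[unfolded s3(2)], folded R1]
    obtain y b3 l2 where "ls b2 = [[y]] # b3" "letter_step T y ((1, s - 2) # B) R1 (rc_of T ((1, s - 2) # B) b3) l2"
      by blast
    moreover from this(1) have "hd t = [y]" using t by (simp add: ls_def)
    moreover have "vac T ((1, 1) # (1, s - 2) # B) R1 a i = vac T ((1, s - 1) # B) R1 a i + of_bool (a = 1 \<and> 1 \<le> i \<and> i < s - 1)" for a i
      using vac_split[OF s3(1), of T 1 B R1 a i] s3(2) by simp
    ultimately show ?thesis by blast
  qed
  then obtain X y l2 R2 where y: "letter_step T y X R1 R2 l2" "hd t = [y]"
    "\<forall>a i. vac T ((1, 1) # X) R1 a i = vac T ((1, s - 1) # B) R1 a i + of_bool (a = 1 \<and> 1 \<le> i \<and> i < s - 1)"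
    by metis
  have s1: "valid_step T l (vac T ?B1 R) R (vac T ((1, s - 1) # B) R1) R1" and s2: "valid_step T l2 (vac T ((1, 1) # X) R1) R1 (vac T X R2) R2"
    and vR: "valid_rc T ?B1 R"
    using x(3) y(1) unfolding R1_def letter_step_def by auto
  have "valid_rc T ((1, s) # B) R \<longleftrightarrow> support T l \<subseteq> support T l2"
    using valid_rc_split[OF s one_in_nodes[OF T], of B R] row_criterion[OF s s1 s2 y(3)[rule_format]] vR by simp
  also have "\<dots> \<longleftrightarrow> column_le T [x] (hd t)"
    using x(3) y(1,2) by (simp add: letter_step_def column_le_def)
  finally show ?thesis using x(1) t unfolding R_def by blast
qed

text \<open>Two whole columns are removed one after the other, so correctness is required for all
  products met on the way. Inclusion of supports at each position is the inequality between the two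
  entries.\<close>

lemma split_image_column:
  assumes T: "valid_type (TypeA n)" and s: "2 \<le> s" and r: "1 \<le> r" "r \<le> n"
    and c1: "\<And>k. 1 \<le> k \<Longrightarrow> k \<le> r \<Longrightarrow> rc_of_correct (TypeA n) ((k, 1) # (r, s - 1) # B)"
      "\<And>k. 2 \<le> k \<Longrightarrow> k \<le> r \<Longrightarrow> rc_of_correct (TypeA n) ((1, 1) # (k - 1, 1) # (r, s - 1) # B)"
    and c2: "rc_of_correct (TypeA n) ((r, s - 1) # B)"
    and c3: "\<And>k. 1 \<le> k \<Longrightarrow> k \<le> r \<Longrightarrow> rc_of_correct (TypeA n) ((k, 1) # (if s = 2 then B else (r, s - 2) # B))"
      "\<And>k. 2 \<le> k \<Longrightarrow> k \<le> r \<Longrightarrow> rc_of_correct (TypeA n) ((1, 1) # (k - 1, 1) # (if s = 2 then B else (r, s - 2) # B))"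
    and b: "b \<in> highest_paths (TypeA n) ((r, 1) # (r, s - 1) # B)"
  shows "\<exists>c t b'. b = [c] # t # b' \<and>
    (column_le (TypeA n) c (hd t) \<longleftrightarrow> valid_rc (TypeA n) ((r, s) # B) (rc_of (TypeA n) ((r, 1) # (r, s - 1) # B) b))"
proof -
  let ?T = "TypeA n"
  let ?B1 = "(r, 1) # (r, s - 1) # B"
  define R where "R = rc_of ?T ?B1 b"
  obtain c b2 lls where c: "b = [c] # b2" "length c = r" "b2 \<in> highest_paths ?T ((r, s - 1) # B)"
    "column_chain n r (vac ?T ?B1 R) R lls (vac ?T ((r, s - 1) # B) (rc_of ?T ((r, s - 1) # B) b2)) (rc_of ?T ((r, s - 1) # B) b2)"
    "\<forall>j<r. support ?T (lls ! j) = ideal ?T (c ! j) \<and> c ! j \<in> letters ?T"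
    using column_chain_of_path[OF T r c1 b] unfolding R_def by blast
  define R1 where "R1 = rc_of ?T ((r, s - 1) # B) b2"
  obtain t b' where t: "b2 = t # b'" using c(3) by (rule highest_paths_ConsE)
  define X where "X = (if s = 2 then B else (r, s - 2) # B)"
  define b3 where "b3 = (if s = 2 then b2 else ls b2)"
  have s3: "2 \<le> s - 1" "s - 1 - 1 = s - 2" if "s \<noteq> 2" using s that by auto
  have b3: "b3 \<in> highest_paths ?T ((r, 1) # X)"
  proof (cases "s = 2")
    case False
    have "ls b2 \<in> highest_paths ?T ((r, 1) # (r, s - 1 - 1) # B)"
      using c2 c(3) s3(1)[OF False] unfolding rc_of_correct_def by blast
    then show ?thesis using False s3(2) by (simp add: b3_def X_def)
  qed (use c(3) in \<open>simp add: b3_def X_def\<close>)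
  have R1: "R1 = rc_of ?T ((r, 1) # X) b3"
  proof (cases "s = 2")
    case False
    then show ?thesis
      unfolding R1_def b3_def X_def using rc_of_split[OF s3(1), of ?T r B b2] s3(2) by simp
  qed (simp add: R1_def b3_def X_def)
  have q: "vac ?T ((r, 1) # X) R1 a i = vac ?T ((r, s - 1) # B) R1 a i + of_bool (a = r \<and> 1 \<le> i \<and> i < s - 1)" for a i
    using vac_split[OF s3(1), of ?T r B R1 a i] s3(2) by (cases "s = 2") (auto simp: X_def)
  obtain d b4 lls2 where d: "b3 = [d] # b4" "length d = r"
    "column_chain n r (vac ?T ((r, 1) # X) R1) R1 lls2 (vac ?T X (rc_of ?T X b4)) (rc_of ?T X b4)"
    "\<forall>j<r. support ?T (lls2 ! j) = ideal ?T (d ! j) \<and> d ! j \<in> letters ?T"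
    using column_chain_of_path[OF T r c3[folded X_def] b3] unfolding R1[symmetric] by blast
  have hd: "hd t = d"
    using d(1) t unfolding b3_def by (auto simp: ls_def split: if_splits)
  have rA: "r \<in> nodes ?T" using r by simp
  have vR: "valid_rc ?T ?B1 R"
    unfolding R_def using rc_of_correctD(3)[OF c1(1)[OF r(1) order_refl] b] .
  have supp: "(\<forall>a. 1 \<le> a \<and> a \<le> n \<and> (lls ! j) a \<noteq> \<infinity> \<longrightarrow> (lls2 ! j) a \<noteq> \<infinity>) \<longleftrightarrow> ideal ?T (c ! j) \<subseteq> ideal ?T (d ! j)" if "j < r" for j
  proof -
    have "ideal ?T (c ! j) = support ?T (lls ! j)" "ideal ?T (d ! j) = support ?T (lls2 ! j)"
      using c(5) d(4) that by auto
    then show ?thesis by (auto simp: support_def less_Suc_eq_le simp del: not_infinity_eq)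
  qed
  have "valid_rc ?T ((r, s) # B) R \<longleftrightarrow> (\<forall>i. 1 \<le> i \<and> i < s \<longrightarrow> 0 < vac ?T ?B1 R r i \<and> (i, vac ?T ?B1 R r i) \<notin># R r)"
    using valid_rc_split[OF s rA, of B R] vR by simp
  also have "\<dots> \<longleftrightarrow> (\<forall>j<r. \<forall>a. 1 \<le> a \<and> a \<le> n \<and> (lls ! j) a \<noteq> \<infinity> \<longrightarrow> (lls2 ! j) a \<noteq> \<infinity>)"
    by (rule column_criterion[OF s r c(4)[folded R1_def] d(3) q])
  also have "\<dots> \<longleftrightarrow> column_le ?T c (hd t)"
    using supp c(2) d(2) unfolding hd column_le_def list_all2_conv_all_nth by auto
  finally show ?thesis using c(1) t unfolding R_def by blast
qed

text \<open>The riggings of the added strings can be computed from the result, so the same strings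
  are taken away on both sides.\<close>

lemma add_short_inject:
  assumes r: "1 \<le> r" "r \<le> n"
    and eq: "add_short r (vac (TypeA n) ((r, 1) # B) R1) R1 = add_short r (vac (TypeA n) ((r, 1) # B) R2) R2"
  shows "R1 = R2"
proof
  fix a
  let ?p = "\<lambda>R. vac (TypeA n) ((r, 1) # B) R"
  have p: "?p R1 a i = ?p R2 a i" if "a \<in> nodes (TypeA n)" for i
    using vac_add_short[OF r that, of B "?p R1" R1 i] vac_add_short[OF r that, of B "?p R2" R2 i]
    unfolding eq by simp
  then show "R1 a = R2 a"
    using fun_cong[OF eq, of a] r by (auto simp: add_short_def split: if_splits)
qed

lemma rc_i_inject:
  assumes "2 \<le> r" "r \<le> n"
    "rc_i (TypeA n) (mult_array ((1, 1) # (r - 1, 1) # B)) r R1 = rc_i (TypeA n) (mult_array ((1, 1) # (r - 1, 1) # B)) r R2"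
  shows "R1 = R2"
  using add_short_inject[of r n B R1 R2] assms rc_i_eq_add_short[of r n B] by simp

lemma rc_i_valid_weight:
  fixes B :: kr_product
  assumes r: "2 \<le> r" "r \<le> n"
  defines "S \<equiv> \<lambda>R. rc_i (TypeA n) (mult_array ((1, 1) # (r - 1, 1) # B)) r R"
  shows "valid_rc (TypeA n) ((1, 1) # (r - 1, 1) # B) (S R) \<longleftrightarrow> valid_rc (TypeA n) ((r, 1) # B) R"
    "rc_weight (TypeA n) ((1, 1) # (r - 1, 1) # B) (S R) = rc_weight (TypeA n) ((r, 1) # B) R"
proof -
  have r1: "1 \<le> r" using r by simp
  have rest: "(r - 1, 1) # B = column_rest r B" using r by (simp add: column_rest_def)
  have S: "S R = add_short r (vac (TypeA n) ((r, 1) # B) R) R"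
    unfolding S_def by (rule rc_i_eq_add_short[OF r1 r(2,1)])
  show "valid_rc (TypeA n) ((1, 1) # (r - 1, 1) # B) (S R) \<longleftrightarrow> valid_rc (TypeA n) ((r, 1) # B) R"
    unfolding S rest by (rule valid_rc_add_short[OF r1 r(2)])
  show "rc_weight (TypeA n) ((1, 1) # (r - 1, 1) # B) (S R) = rc_weight (TypeA n) ((r, 1) # B) R"
    unfolding S rest by (rule rc_weight_add_short[OF r1 r(2)])
qed

section \<open>Correctness for columns and for wider rectangles\<close>

lemma highest_paths_column:
  assumes "2 \<le> r"
  shows "b \<in> highest_paths (TypeA n) ((r, 1) # B) \<longleftrightarrow>
    (\<exists>x c b'. b = [x # c] # b' \<and> hd c < x \<and> [[x]] # [c] # b' \<in> highest_paths (TypeA n) ((1, 1) # (r - 1, 1) # B))"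
  unfolding highest_paths_def elements_Cons mem_Collect_eq KR_column_split[OF assms]
  by (fastforce simp: path_word_def simp del: KR.simps)

lemma highest_paths_split:
  assumes "valid_type T" "2 \<le> s" "case T of TypeA n \<Rightarrow> True | TypeD n \<Rightarrow> r = 1"
  shows "b \<in> highest_paths T ((r, s) # B) \<longleftrightarrow>
    (\<exists>c t b'. b = (c # t) # b' \<and> column_le T c (hd t) \<and> [c] # t # b' \<in> highest_paths T ((r, 1) # (r, s - 1) # B))"
  unfolding highest_paths_def elements_Cons mem_Collect_eq KR_split[OF assms]
  by (fastforce simp: path_word_def simp del: KR.simps)

lemma rc_of_column_correct:
  assumes T: "valid_type (TypeA n)" and r: "2 \<le> r" "r \<le> n"
    and c1: "rc_of_correct (TypeA n) ((1, 1) # (r - 1, 1) # B)" and c2: "rc_of_correct (TypeA n) ((r - 1, 1) # B)"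
    and c3: "3 \<le> r \<Longrightarrow> rc_of_correct (TypeA n) ((1, 1) # (r - 2, 1) # B)"
  shows "rc_of_correct (TypeA n) ((r, 1) # B)"
proof -
  let ?T = "TypeA n" and ?B = "(r, 1) # B"
  let ?B1 = "(1, 1) # (r - 1, 1) # B"
  define S where "S = rc_i ?T (mult_array ?B1) r"
  have inject: "R = R'" if "S R = S R'" for R R'
    by (rule rc_i_inject[OF r that[unfolded S_def]])
  have lb: "\<exists>x c b'. b = [x # c] # b' \<and> hd c < x \<and> lb b = [[x]] # [c] # b' \<and> lb b \<in> highest_paths ?T ?B1"
    if "b \<in> highest_paths ?T ?B" for b
    using that unfolding highest_paths_column[OF r(1)] by (auto simp: lb_def)
  have wt: "path_wt ?T (lb b) = path_wt ?T b" if "b \<in> highest_paths ?T ?B" for b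
    using lb[OF that] by (auto simp: path_word_def)
  have step: "valid_rc ?T ?B (rc_of ?T ?B b) \<and> S (rc_of ?T ?B b) = rc_of ?T ?B1 (lb b)" if b: "b \<in> highest_paths ?T ?B" for b
  proof -
    obtain x c b' where x: "hd c < x" "lb b = [[x]] # [c] # b'" "lb b \<in> highest_paths ?T ?B1" using lb[OF b] by blast
    obtain y d b2 where y: "lb b = [[y]] # [d] # b2" "hd d < y \<longleftrightarrow> (\<exists>R0. valid_rc ?T ?B R0 \<and> S R0 = rc_of ?T ?B1 (lb b))"
      using column_image[OF T r c1 c2 c3 x(3)] unfolding S_def by blast
    have "hd d < y" using x(1,2) y(1) by simp
    then obtain R0 where R0: "valid_rc ?T ?B R0 \<and> S R0 = rc_of ?T ?B1 (lb b)" using y(2) by blast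
    have the: "rc_of ?T ?B b = (THE R. valid_rc ?T ?B R \<and> S R = rc_of ?T ?B1 (lb b))"
      unfolding rc_of.simps(2)[of ?T r 1 B b] S_def using r by simp
    show ?thesis
      unfolding the
    proof (rule theI[of "\<lambda>R. valid_rc ?T ?B R \<and> S R = rc_of ?T ?B1 (lb b)", OF R0])
      show "R = R0" if "valid_rc ?T ?B R \<and> S R = rc_of ?T ?B1 (lb b)" for R
        by (rule inject) (simp only: that R0)
    qed
  qed
  have "bij_betw (rc_of ?T ?B) (highest_paths ?T ?B) {R. valid_rc ?T ?B R}"
    unfolding bij_betw_def
  proof (intro conjI inj_onI equalityI subsetI)
    fix b c assume b: "b \<in> highest_paths ?T ?B" and c: "c \<in> highest_paths ?T ?B" and eq: "rc_of ?T ?B b = rc_of ?T ?B c"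
    have "rc_of ?T ?B1 (lb b) = rc_of ?T ?B1 (lb c)"
      unfolding conjunct2[OF step[OF b], symmetric] conjunct2[OF step[OF c], symmetric] eq ..
    then have "lb b = lb c"
      using lb[OF b] lb[OF c] bij_betw_imp_inj_on[OF rc_of_correctD(1)[OF c1]] by (meson inj_onD)
    then show "b = c" using lb[OF b] lb[OF c] by auto
  next
    fix R assume "R \<in> rc_of ?T ?B ` highest_paths ?T ?B"
    then show "R \<in> {R. valid_rc ?T ?B R}" using step by auto
  next
    fix R assume "R \<in> {R. valid_rc ?T ?B R}"
    then have R: "valid_rc ?T ?B R" by simp
    then have "valid_rc ?T ?B1 (S R)" unfolding S_def by (simp only: rc_i_valid_weight(1)[OF r])
    then have "S R \<in> rc_of ?T ?B1 ` highest_paths ?T ?B1"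
      using bij_betw_imp_surj_on[OF rc_of_correctD(1)[OF c1]] by simp
    then obtain b1 where b1: "b1 \<in> highest_paths ?T ?B1" "S R = rc_of ?T ?B1 b1" by (elim imageE)
    obtain y d b2 where y: "b1 = [[y]] # [d] # b2" "hd d < y \<longleftrightarrow> (\<exists>R0. valid_rc ?T ?B R0 \<and> S R0 = rc_of ?T ?B1 b1)"
      using column_image[OF T r c1 c2 c3 b1(1)] unfolding S_def by blast
    then have "hd d < y" using R b1(2) by metis
    then have b: "[y # d] # b2 \<in> highest_paths ?T ?B"
      unfolding highest_paths_column[OF r(1)] using b1(1) y(1) by blast
    have "S (rc_of ?T ?B ([y # d] # b2)) = S R"
      unfolding conjunct2[OF step[OF b]] b1(2) y(1) by (simp add: lb_def)
    then have "R = rc_of ?T ?B ([y # d] # b2)" by (rule inject[OF sym])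
    then show "R \<in> rc_of ?T ?B ` highest_paths ?T ?B" using b by blast
  qed
  moreover have "rc_weight ?T ?B (rc_of ?T ?B b) = path_wt ?T b" if b: "b \<in> highest_paths ?T ?B" for b
  proof -
    have "rc_weight ?T ?B (rc_of ?T ?B b) = rc_weight ?T ?B1 (S (rc_of ?T ?B b))"
      unfolding S_def by (rule rc_i_valid_weight(2)[OF r, symmetric])
    also have "\<dots> = path_wt ?T (lb b)"
      using step[OF b] rc_of_correctD(2)[OF c1] lb[OF b] by metis
    finally show ?thesis using wt[OF b] by simp
  qed
  ultimately show ?thesis
    unfolding rc_of_correct_def using r lb step unfolding S_def by auto
qed

lemma rc_of_split_correct:
  assumes T: "valid_type T" and s: "2 \<le> s" and r: "r \<in> nodes T" "case T of TypeA n \<Rightarrow> True | TypeD n \<Rightarrow> r = 1"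
    and c1: "rc_of_correct T ((r, 1) # (r, s - 1) # B)"
    and image: "\<And>b. b \<in> highest_paths T ((r, 1) # (r, s - 1) # B) \<Longrightarrow> \<exists>c t b'. b = [c] # t # b'
      \<and> (column_le T c (hd t) \<longleftrightarrow> valid_rc T ((r, s) # B) (rc_of T ((r, 1) # (r, s - 1) # B) b))"
  shows "rc_of_correct T ((r, s) # B)"
proof -
  let ?B = "(r, s) # B"
  let ?B1 = "(r, 1) # (r, s - 1) # B"
  have eq: "rc_of T ?B b = rc_of T ?B1 (ls b)" for b by (rule rc_of_split[OF s])
  have lls: "\<exists>c t b'. b = (c # t) # b' \<and> column_le T c (hd t) \<and> ls b = [c] # t # b' \<and> ls b \<in> highest_paths T ?B1"
    if "b \<in> highest_paths T ?B" for b
    using that unfolding highest_paths_split[OF T s r(2)] by (auto simp: ls_def)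
  have wt: "path_wt T (ls b) = path_wt T b" if "b \<in> highest_paths T ?B" for b
    using lls[OF that] by (auto simp: path_word_def)
  have valid: "valid_rc T ?B (rc_of T ?B b)" if b: "b \<in> highest_paths T ?B" for b
  proof -
    obtain c t b' where c: "column_le T c (hd t)" "ls b = [c] # t # b'" "ls b \<in> highest_paths T ?B1" using lls[OF b] by blast
    obtain d u b2 where "ls b = [d] # u # b2" "column_le T d (hd u) \<longleftrightarrow> valid_rc T ?B (rc_of T ?B1 (ls b))"
      using image[OF c(3)] by blast
    then show ?thesis using c(1,2) unfolding eq by simp
  qed
  have "bij_betw (rc_of T ?B) (highest_paths T ?B) {R. valid_rc T ?B R}"
    unfolding bij_betw_def
  proof (intro conjI inj_onI equalityI subsetI)
    fix b c assume b: "b \<in> highest_paths T ?B" and c: "c \<in> highest_paths T ?B" and "rc_of T ?B b = rc_of T ?B c"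
    then have "ls b = ls c"
      using lls[OF b] lls[OF c] bij_betw_imp_inj_on[OF rc_of_correctD(1)[OF c1]] unfolding eq by (meson inj_onD)
    then show "b = c" using lls[OF b] lls[OF c] by auto
  next
    fix R assume "R \<in> rc_of T ?B ` highest_paths T ?B"
    then show "R \<in> {R. valid_rc T ?B R}" using valid by auto
  next
    fix R assume "R \<in> {R. valid_rc T ?B R}"
    then have R: "valid_rc T ?B R" by simp
    then have "valid_rc T ?B1 R" using valid_rc_split[OF s r(1)] by blast
    then have "R \<in> rc_of T ?B1 ` highest_paths T ?B1"
      using bij_betw_imp_surj_on[OF rc_of_correctD(1)[OF c1]] by simp
    then obtain b1 where b1: "b1 \<in> highest_paths T ?B1" "R = rc_of T ?B1 b1" by (elim imageE)
    obtain d u b2 where y: "b1 = [d] # u # b2" "column_le T d (hd u) \<longleftrightarrow> valid_rc T ?B (rc_of T ?B1 b1)"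
      using image[OF b1(1)] by blast
    then have b: "(d # u) # b2 \<in> highest_paths T ?B"
      unfolding highest_paths_split[OF T s r(2)] using b1 R by blast
    have "R = rc_of T ?B ((d # u) # b2)" unfolding eq using b1(2) y(1) by (simp add: ls_def)
    then show "R \<in> rc_of T ?B ` highest_paths T ?B" using b by blast
  qed
  moreover have "rc_weight T ?B (rc_of T ?B b) = path_wt T b" if b: "b \<in> highest_paths T ?B" for b
  proof -
    have "rc_weight T ?B (rc_of T ?B b) = rc_weight T ?B1 (rc_of T ?B1 (ls b))"
      unfolding eq by (rule rc_weight_split[OF s, symmetric])
    also have "\<dots> = path_wt T (ls b)"
      using rc_of_correctD(2)[OF c1] lls[OF b] by blast
    finally show ?thesis using wt[OF b] by simp
  qed
  ultimately show ?thesis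
    unfolding rc_of_correct_def using s lls by auto
qed

section \<open>Existence and uniqueness\<close>

lemma factor_measure_eq: "1 \<le> r \<Longrightarrow> 1 \<le> s \<Longrightarrow> Suc (factor_measure (r, s)) = 2 * (r * s)"
proof -
  assume "1 \<le> r" "1 \<le> s"
  then obtain k m where "r = 1 + k" "s = 1 + m" by (meson le_Suc_ex)
  then show ?thesis by (simp add: algebra_simps max_def)
qed

lemma product_measure_Cons: "product_measure (f # B) = factor_measure f + product_measure B"
  by (simp add: product_measure_def)

text \<open>The induction is on the measure and not along \<open>product_rel\<close>, because the
  splitting criteria refer to products reached by several splittings and removals.\<close>

lemma rc_of_correct:
  assumes T: "valid_type T" and B: "B \<in> KR_products T"
  shows "rc_of_correct T B"
  using B
proof (induction B rule: measure_induct_rule[of product_measure])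
  case (less B)
  note IH = less.IH and B = less.prems
  show ?case
  proof (cases B)
    case Nil
    then show ?thesis using rc_of_Nil_correct[OF T] by simp
  next
    case (Cons f B')
    obtain r s where f: "f = (r, s)" by (cases f)
    have rs: "1 \<le> r" "1 \<le> s" and B': "B' \<in> KR_products T" and r: "r \<in> nodes T" "case T of TypeA n \<Rightarrow> True | TypeD n \<Rightarrow> r = 1"
      using B T Cons f by (cases T; auto)+
    have size: "Suc (product_measure B) = 2 * (r * s) + product_measure B'"
      using factor_measure_eq[OF rs] unfolding Cons f product_measure_Cons by simp
    have IH': "rc_of_correct T C" if "C \<in> KR_products T" "product_measure C < product_measure B" for C
      using IH that by blast
    show ?thesis
    proof (cases "s = 1")
      case s1: True
      show ?thesis
      proof (cases "r = 1")
        case True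
        have "product_measure B' < product_measure B" using size s1 True by simp
        then have "rc_of_correct T B'" by (rule IH'[OF B'])
        then show ?thesis using rc_of_letter_correct[OF T] unfolding Cons f s1 True by blast
      next
        case False
        then obtain n where n: "T = TypeA n" using r(2) by (cases T) auto
        have r2: "2 \<le> r" "r \<le> n" using False rs r n by auto
        have m: "Suc (factor_measure (a, 1)) = 2 * a" if "1 \<le> a" for a
          using factor_measure_eq[OF that, of 1] by simp
        have size: "Suc (product_measure B) = 2 * r + product_measure B'" using size s1 by simp
        have 1: "rc_of_correct T ((1, 1) # (r - 1, 1) # B')"
        proof (rule IH')
          show "(1, 1) # (r - 1, 1) # B' \<in> KR_products T" using B' n r2 by auto
          show "product_measure ((1, 1) # (r - 1, 1) # B') < product_measure B"
            using size m[of 1] m[of "r - 1"] r2 s1 unfolding product_measure_Cons by linarith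
        qed
        have 2: "rc_of_correct T ((r - 1, 1) # B')"
        proof (rule IH')
          show "(r - 1, 1) # B' \<in> KR_products T" using B' n r2 by auto
          show "product_measure ((r - 1, 1) # B') < product_measure B"
            using size m[of "r - 1"] r2 s1 unfolding product_measure_Cons by linarith
        qed
        have 3: "rc_of_correct T ((1, 1) # (r - 2, 1) # B')" if r3: "3 \<le> r"
        proof (rule IH')
          show "(1, 1) # (r - 2, 1) # B' \<in> KR_products T" using B' n r2 r3 by auto
          show "product_measure ((1, 1) # (r - 2, 1) # B') < product_measure B"
            using size m[of 1] m[of "r - 2"] r3 s1 unfolding product_measure_Cons by linarith
        qed
        show ?thesis
          using rc_of_column_correct[OF T[unfolded n] r2 1[unfolded n] 2[unfolded n] 3[unfolded n]] unfolding Cons f s1 n .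
      qed
    next
      case False
      then have s2: "2 \<le> s" using rs by simp
      define P where "P = r * (s - 1)"
      have rsP: "r * s = r + P" using rs by (cases s) (auto simp: P_def)
      have m1: "Suc (factor_measure (r, s - 1)) = 2 * P"
        using factor_measure_eq[OF rs(1), of "s - 1"] s2 by (simp add: P_def)
      have m: "Suc (factor_measure (a, 1)) = 2 * a" if "1 \<le> a" for a
        using factor_measure_eq[OF that, of 1] by simp
      have P: "r \<le> P" using s2 by (cases s) (auto simp: P_def)
      define X where "X = (if s = 2 then B' else (r, s - 2) # B')"
      have mX: "product_measure X < factor_measure (r, s - 1) + product_measure B'"
      proof (cases "s = 2")
        case True
        then show ?thesis using m1 P rs by (simp add: X_def del: factor_measure.simps)
      next
        case False
        then have "1 \<le> s - 2" using s2 by simp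
        from factor_measure_eq[OF rs(1) this] have "Suc (factor_measure (r, s - 2)) = 2 * (r * (s - 2))" .
        moreover have "P = r * (s - 2) + r" using False s2 by (simp add: P_def diff_mult_distrib2 algebra_simps)
        ultimately show ?thesis using m1 rs False by (simp add: X_def product_measure_Cons del: factor_measure.simps)
      qed
      have cons: "(a, k) # C \<in> KR_products T" if "C \<in> KR_products T" "a \<le> r" "1 \<le> a" "1 \<le> k" for a k C
        using that B Cons f by (cases T) auto
      have X: "X \<in> KR_products T" using cons[OF B'] B' rs s2 by (simp add: X_def)
      have Y: "(r, s - 1) # B' \<in> KR_products T" using cons[OF B'] rs s2 by simp
      have single: "rc_of_correct T ((k, 1) # (r, s - 1) # B')" "rc_of_correct T ((k, 1) # X)" if "1 \<le> k" "k \<le> r" for k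
        using that cons[OF Y] cons[OF X] m[of k] m1 mX size rsP
        by (auto intro!: IH' simp: product_measure_Cons simp del: factor_measure.simps)
      have double: "rc_of_correct T ((1, 1) # (k - 1, 1) # (r, s - 1) # B')" "rc_of_correct T ((1, 1) # (k - 1, 1) # X)" if "2 \<le> k" "k \<le> r" for k
      proof -
        have k: "1 \<le> k - 1" "k - 1 \<le> r" using that by auto
        have "(1, 1) # (k - 1, 1) # (r, s - 1) # B' \<in> KR_products T" "(1, 1) # (k - 1, 1) # X \<in> KR_products T"
          using cons[OF cons[OF Y k(2,1)]] cons[OF cons[OF X k(2,1)]] rs by auto
        moreover have "factor_measure (1, 1) + (factor_measure (k - 1, 1) + (factor_measure (r, s - 1) + product_measure B')) < product_measure B"
          "factor_measure (1, 1) + (factor_measure (k - 1, 1) + product_measure X) < product_measure B"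
          using m[OF order_refl] m[OF k(1)] m1 mX size rsP that by linarith+
        ultimately show "rc_of_correct T ((1, 1) # (k - 1, 1) # (r, s - 1) # B')" "rc_of_correct T ((1, 1) # (k - 1, 1) # X)"
          by (auto intro!: IH' simp: product_measure_Cons simp del: factor_measure.simps)
      qed
      have last: "rc_of_correct T ((r, s - 1) # B')"
        using Y m1 size rsP rs by (auto intro!: IH' simp: product_measure_Cons simp del: factor_measure.simps)
      have "\<exists>c t b'. b = [c] # t # b' \<and> (column_le T c (hd t) \<longleftrightarrow> valid_rc T ((r, s) # B') (rc_of T ((r, 1) # (r, s - 1) # B') b))"
        if b: "b \<in> highest_paths T ((r, 1) # (r, s - 1) # B')" for b
      proof (cases T)
        case (TypeA n)
        have "r \<le> n" using r TypeA by simp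
        then show ?thesis
          using split_image_column[OF T[unfolded TypeA] s2 rs(1) _ single(1)[unfolded TypeA] double(1)[unfolded TypeA] last[unfolded TypeA]
              single(2)[unfolded TypeA X_def] double(2)[unfolded TypeA X_def] b[unfolded TypeA]]
          unfolding TypeA by blast
      next
        case (TypeD n)
        then have r1: "r = 1" using r by simp
        have "rc_of_correct T ((1, 1) # (1, s - 2) # B')" if "3 \<le> s"
          using single(2)[of 1] that unfolding X_def r1 by simp
        then show ?thesis
          using split_image_row[OF T s2 single(1)[OF order_refl rs(1), unfolded r1] last[unfolded r1] _ b[unfolded r1]] unfolding r1 by blast
      qed
      then show ?thesis
        using rc_of_split_correct[OF T s2 r single(1)[OF rs(1) order_refl]] unfolding Cons f by blast
    qed
  qed
qed

lemma bij_betw_rc_of: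
  assumes T: "valid_type T" and B: "B \<in> KR_products T" and lam: "lam \<in> dominant_weights T"
  shows "bij_betw (rc_of T B) (paths T B lam) (RC T (mult_array B) lam)"
proof -
  note c = rc_of_correctD[OF rc_of_correct[OF T B]]
  have RC: "RC T (mult_array B) lam = {R. valid_rc T B R \<and> rc_weight T B R = lam}"
    using RC_iff[OF lam] by blast
  have "rc_of T B ` paths T B lam = RC T (mult_array B) lam"
    using c(2,3) bij_betw_imp_surj_on[OF c(1)] unfolding RC paths_eq[OF T] by (auto 4 3)
  moreover have "inj_on (rc_of T B) (paths T B lam)"
    using bij_betw_imp_inj_on[OF c(1)] by (rule inj_on_subset) (auto simp: paths_eq[OF T])
  ultimately show ?thesis by (simp add: bij_betw_def)
qed

text \<open>The weight to be exhibited is that of the path without its leftmost letter.\<close>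

lemma rc_of_lh:
  assumes T: "valid_type T" and B: "(1, 1) # B' \<in> KR_products T" and b: "b \<in> paths T ((1, 1) # B') lam"
  shows "\<exists>\<mu>\<in>weights_below T lam. lh b \<in> paths T B' \<mu>
    \<and> rc_of T B' (lh b) = delta T (mult_array ((1, 1) # B')) (mult_array B') (rc_of T ((1, 1) # B') b)"
proof -
  have hb: "b \<in> highest_paths T ((1, 1) # B')" and lam: "path_wt T b = lam" using b by (auto simp: paths_eq[OF T])
  obtain x b' l where x: "b = [[x]] # b'" "b' \<in> highest_paths T B'" "letter_step T x B' (rc_of T ((1, 1) # B') b) (rc_of T B' b') l"
    using rc_of_letter[OF rc_of_correct[OF T B] hb] by blast
  have lam': "lam = (\<lambda>a. letter_wt T x a + path_wt T b' a)"
    using lam x(1) path_wt_letter[of T x b'] by (auto simp: add.commute)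
  have "path_wt T b \<in> dominant_weights T" "path_wt T b' \<in> dominant_weights T"
    using hb x(2) highest_dominant[OF T] by (auto simp: highest_paths_def)
  then have "path_wt T b' \<in> weights_below T lam"
    using weights_belowI[OF T, of "path_wt T b'" x] x(3) lam lam' by (simp add: letter_step_def)
  moreover have "lh b = b'" using x(1) by (simp add: lh_def)
  ultimately show ?thesis
    using x(2,3) by (intro bexI[of _ "path_wt T b'"]) (auto simp: paths_eq[OF T] letter_step_def)
qed

lemma rc_of_ls:
  assumes T: "valid_type T" and B: "(r, s) # B' \<in> KR_products T" and s: "2 \<le> s" and b: "b \<in> paths T ((r, s) # B') lam"
  shows "ls b \<in> paths T ((r, 1) # (r, s - 1) # B') lam"
    "rc_of T ((r, 1) # (r, s - 1) # B') (ls b) = rc_of T ((r, s) # B') b"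
proof -
  have hb: "b \<in> highest_paths T ((r, s) # B')" and lam: "path_wt T b = lam" using b by (auto simp: paths_eq[OF T])
  have r: "case T of TypeA n \<Rightarrow> True | TypeD n \<Rightarrow> r = 1" using B by (cases T) auto
  show "ls b \<in> paths T ((r, 1) # (r, s - 1) # B') lam"
    using hb lam unfolding highest_paths_split[OF T s r] paths_eq[OF T] by (auto simp: ls_def path_word_def)
  show "rc_of T ((r, 1) # (r, s - 1) # B') (ls b) = rc_of T ((r, s) # B') b"
    by (rule rc_of_split[OF s, symmetric])
qed

lemma rc_of_lb:
  assumes T: "valid_type (TypeA n)" and B: "(r, 1) # B' \<in> KR_products (TypeA n)" and r: "2 \<le> r" and b: "b \<in> paths (TypeA n) ((r, 1) # B') lam"
  shows "lb b \<in> paths (TypeA n) ((1, 1) # (r - 1, 1) # B') lam"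
    "rc_of (TypeA n) ((1, 1) # (r - 1, 1) # B') (lb b)
      = rc_i (TypeA n) (mult_array ((1, 1) # (r - 1, 1) # B')) r (rc_of (TypeA n) ((r, 1) # B') b)"
proof -
  have hb: "b \<in> highest_paths (TypeA n) ((r, 1) # B')" and lam: "path_wt (TypeA n) b = lam" using b by (auto simp: paths_eq[OF T])
  show "lb b \<in> paths (TypeA n) ((1, 1) # (r - 1, 1) # B') lam"
    using hb lam unfolding highest_paths_column[OF r] paths_eq[OF T] by (auto simp: lb_def path_word_def)
  show "rc_of (TypeA n) ((1, 1) # (r - 1, 1) # B') (lb b)
      = rc_i (TypeA n) (mult_array ((1, 1) # (r - 1, 1) # B')) r (rc_of (TypeA n) ((r, 1) # B') b)"
    by (rule rc_of_column(2)[OF rc_of_correct[OF T B] r hb, symmetric])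
qed

text \<open>Each rule fixes the value at B from a smaller product: \<open>ls\<close> directly,
  \<open>lb\<close> by injectivity of i, and \<open>lh\<close> because the result of
  \<open>delta\<close> and the weight leave one configuration. Membership in \<open>RC\<close>
  supplies that weight.\<close>

lemma rc_of_unique:
  fixes \<phi> :: "kr_product \<times> weight \<Rightarrow> path \<Rightarrow> rigged_configuration"
  assumes T: "valid_type T"
    and RC: "\<And>B lam b. B \<in> KR_products T \<Longrightarrow> lam \<in> dominant_weights T \<Longrightarrow> b \<in> paths T B lam \<Longrightarrow> \<phi> (B, lam) b \<in> RC T (mult_array B) lam"
    and Nil: "\<phi> ([], (\<lambda>_. 0)) [] = empty_rc"
    and lh: "\<And>B lam b. (1, 1) # B \<in> KR_products T \<Longrightarrow> lam \<in> dominant_weights T \<Longrightarrow> b \<in> paths T ((1, 1) # B) lam \<Longrightarrow>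
      \<exists>\<mu>\<in>weights_below T lam. lh b \<in> paths T B \<mu> \<and> \<phi> (B, \<mu>) (lh b) = delta T (mult_array ((1, 1) # B)) (mult_array B) (\<phi> ((1, 1) # B, lam) b)"
    and ls: "\<And>r s B lam b. 2 \<le> s \<Longrightarrow> (r, s) # B \<in> KR_products T \<Longrightarrow> lam \<in> dominant_weights T \<Longrightarrow> b \<in> paths T ((r, s) # B) lam \<Longrightarrow>
      \<phi> ((r, 1) # (r, s - 1) # B, lam) (ls b) = rc_j (\<phi> ((r, s) # B, lam) b)"
    and lb: "\<And>n r B lam b. T = TypeA n \<Longrightarrow> 2 \<le> r \<Longrightarrow> (r, 1) # B \<in> KR_products T \<Longrightarrow> lam \<in> dominant_weights T \<Longrightarrow> b \<in> paths T ((r, 1) # B) lam \<Longrightarrow>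
      \<phi> ((1, 1) # (r - 1, 1) # B, lam) (lb b) = rc_i T (mult_array ((1, 1) # (r - 1, 1) # B)) r (\<phi> ((r, 1) # B, lam) b)"
    and "B \<in> KR_products T" "lam \<in> dominant_weights T" "b \<in> paths T B lam"
  shows "\<phi> (B, lam) b = rc_of T B b"
  using assms(7-)
proof (induction B arbitrary: lam b rule: wf_induct_rule[OF wf_product_rel])
  case (1 B)
  note B = "1.prems"(1) and lam = "1.prems"(2) and b = "1.prems"(3)
  show ?case
  proof (cases B)
    case Nil2: Nil
    then have "b = []" "lam = (\<lambda>_. 0)"
      using b by (auto simp: paths_eq[OF T] highest_paths_Nil path_word_def word_wt_def)
    then show ?thesis using Nil2 Nil by simp
  next
    case (Cons f B')
    obtain r s where f: "f = (r, s)" by (cases f)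
    have rs: "1 \<le> r" "1 \<le> s" and B': "B' \<in> KR_products T" 
      using B Cons f by (cases T; auto)+
    consider "2 \<le> s" | "s = 1" "2 \<le> r" | "s = 1" "r = 1" using rs by linarith
    then show ?thesis
    proof cases
      case s: 1
      let ?B1 = "(r, 1) # (r, s - 1) # B'"
      have B1: "?B1 \<in> KR_products T" using B s Cons f by (cases T) auto
      have "\<phi> (B, lam) b = \<phi> (?B1, lam) (ls b)"
        using ls[OF s, of r B' lam b] B lam b Cons f by (simp add: rc_j_def)
      also have "\<dots> = rc_of T ?B1 (ls b)"
        using 1(1)[of ?B1 lam "ls b"] product_rel(1)[OF s] B1 lam rc_of_ls(1)[OF T, of r s B' b lam] B b s Cons f by simp
      finally show ?thesis using rc_of_split[OF s] Cons f by simp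
    next
      case r: 2
      then obtain n where n: "T = TypeA n" using B Cons f by (cases T) auto
      have rn: "r \<le> n" using B Cons f n by auto
      let ?B1 = "(1, 1) # (r - 1, 1) # B'"
      have B1: "?B1 \<in> KR_products T" using B r Cons f n by auto
      have Br: "(r, 1) # B' \<in> KR_products (TypeA n)" and br: "b \<in> paths (TypeA n) ((r, 1) # B') lam"
        using B b Cons f r n by simp_all
      note lb' = rc_of_lb[OF T[unfolded n] Br r(2) br]
      have "rc_i T (mult_array ?B1) r (\<phi> (B, lam) b) = \<phi> (?B1, lam) (lb b)"
        using lb[OF n r(2), of B' lam b] B lam b Cons f r by simp
      also have "\<dots> = rc_of T ?B1 (lb b)"
        using 1(1)[of ?B1 lam "lb b"] product_rel(2)[OF r(2)] B1 lam lb'(1) Cons f r n by simp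
      also have "\<dots> = rc_i T (mult_array ?B1) r (rc_of T B b)"
        using lb'(2) Cons f r n by simp
      finally show ?thesis unfolding n by (rule rc_i_inject[OF r(2) rn])
    next
      case r: 3
      have B1: "B = (1, 1) # B'" using Cons f r by simp
      obtain \<mu> where mu: "\<mu> \<in> weights_below T lam" "lh b \<in> paths T B' \<mu>"
        "\<phi> (B', \<mu>) (lh b) = delta T (mult_array B) (mult_array B') (\<phi> (B, lam) b)"
        using lh[of B' lam b] B lam b unfolding B1 by blast
      have "\<mu> \<in> dominant_weights T" using mu(1) by (simp add: weights_below_def)
      then have IH: "\<phi> (B', \<mu>) (lh b) = rc_of T B' (lh b)"
        using 1(1)[of B' \<mu> "lh b"] product_rel(3) B' mu(2) unfolding B1 by simp
      have hb: "b \<in> highest_paths T ((1, 1) # B')" and wt: "path_wt T b = lam"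
        using b by (auto simp: paths_eq[OF T] B1)
      obtain x b' l where x: "b = [[x]] # b'" "letter_step T x B' (rc_of T B b) (rc_of T B' b') l"
        using rc_of_letter[OF rc_of_correct[OF T] hb] B unfolding B1 by blast
      have valid: "valid_rc T B (\<phi> (B, lam) b)" "rc_weight T B (\<phi> (B, lam) b) = lam"
        using RC[OF B lam b] RC_iff[OF lam] by auto
      have "rc_weight T B (rc_of T B b) = lam"
        using rc_of_correctD(2)[OF rc_of_correct[OF T B]] hb wt unfolding B1 by blast
      moreover have "lh b = b'" using x(1) by (simp add: lh_def)
      ultimately show ?thesis
        using letter_step_unique[OF T x(2), of "\<phi> (B, lam) b"] valid mu(3) IH unfolding B1 by simp
    qed
  qed
qed

theorem proposition8p1:
  fixes T :: cartan_type
  assumes "valid_type T"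
  shows "\<exists>!\<phi> :: kr_product \<times> weight \<Rightarrow> path \<Rightarrow> rigged_configuration.
    \<phi> \<in> (\<Pi>\<^sub>E (B, lam)\<in>KR_products T \<times> dominant_weights T.
            paths T B lam \<rightarrow>\<^sub>E RC T (mult_array B) lam)
    \<and> (\<forall>B\<in>KR_products T. \<forall>lam\<in>dominant_weights T.
          bij_betw (\<phi> (B, lam)) (paths T B lam) (RC T (mult_array B) lam))
    \<and> \<phi> ([], (\<lambda>_. 0)) [] = empty_rc
    \<and> (\<forall>B' lam. \<forall>B. B = (1, 1) # B' \<and> B \<in> KR_products T \<and> lam \<in> dominant_weights T \<longrightarrow>
          (\<forall>b\<in>paths T B lam. \<exists>\<mu>\<in>weights_below T lam.
             lh b \<in> paths T B' \<mu>
             \<and> \<phi> (B', \<mu>) (lh b) = delta T (mult_array B) (mult_array B') (\<phi> (B, lam) b)))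
    \<and> (\<forall>r s B' lam. \<forall>B lsB. B = (r, s) # B' \<and> s \<ge> 2 \<and> lsB = (r, 1) # (r, s - 1) # B'
          \<and> B \<in> KR_products T \<and> lam \<in> dominant_weights T \<longrightarrow>
          (\<forall>b\<in>paths T B lam.
             ls b \<in> paths T lsB lam
             \<and> \<phi> (lsB, lam) (ls b) = rc_j (\<phi> (B, lam) b)))
    \<and> (\<forall>n r B' lam. \<forall>B lbB. T = TypeA n \<and> B = (r, 1) # B' \<and> r \<ge> 2
          \<and> lbB = (1, 1) # (r - 1, 1) # B'
          \<and> B \<in> KR_products T \<and> lam \<in> dominant_weights T \<longrightarrow>
          (\<forall>b\<in>paths T B lam.
             lb b \<in> paths T lbB lam
             \<and> \<phi> (lbB, lam) (lb b) = rc_i T (mult_array lbB) r (\<phi> (B, lam) b)))"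
  (is "\<exists>!\<phi>. ?P \<phi>")
proof -
  note T = assms
  \<comment> \<open>Restricting to the index set and to each set of paths makes the family
    extensional, so that uniqueness is equality of functions.\<close>
  define \<psi> where "\<psi> = (\<lambda>(B, lam)\<in>KR_products T \<times> dominant_weights T. \<lambda>b\<in>paths T B lam. rc_of T B b)"
  have psi: "\<psi> (B, lam) = restrict (rc_of T B) (paths T B lam)" if "B \<in> KR_products T" "lam \<in> dominant_weights T" for B lam
    using that by (simp add: \<psi>_def)
  have psi_b: "\<psi> (B, lam) b = rc_of T B b" if "B \<in> KR_products T" "lam \<in> dominant_weights T" "b \<in> paths T B lam" for B lam b
    using that by (simp add: psi)
  have bij: "bij_betw (\<psi> (B, lam)) (paths T B lam) (RC T (mult_array B) lam)"
    if "B \<in> KR_products T" "lam \<in> dominant_weights T" for B lam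
    using bij_betw_rc_of[OF T that] psi[OF that] by simp
  have PiE: "\<psi> \<in> (\<Pi>\<^sub>E (B, lam)\<in>KR_products T \<times> dominant_weights T. paths T B lam \<rightarrow>\<^sub>E RC T (mult_array B) lam)"
  proof (rule PiE_I)
    show "\<psi> x \<in> (case x of (B, lam) \<Rightarrow> paths T B lam \<rightarrow>\<^sub>E RC T (mult_array B) lam)" if "x \<in> KR_products T \<times> dominant_weights T" for x
    proof (cases x)
      case (Pair B lam)
      then have *: "B \<in> KR_products T" "lam \<in> dominant_weights T" using that by auto
      have "rc_of T B \<in> paths T B lam \<rightarrow> RC T (mult_array B) lam"
        using bij_betw_imp_funcset[OF bij_betw_rc_of[OF T *]] .
      then show ?thesis using Pair psi[OF *] by simp
    qed
    show "\<psi> x = undefined" if "x \<notin> KR_products T \<times> dominant_weights T" for x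
      using that by (simp add: \<psi>_def)
  qed
  show ?thesis
  proof (rule ex1I[of _ \<psi>])
    show "?P \<psi>"
    proof (intro conjI)
      show "\<psi> ([], (\<lambda>_. 0)) [] = empty_rc"
      proof -
        have "[] \<in> KR_products T" by (cases T) auto
        moreover have "(\<lambda>_. 0) \<in> dominant_weights T" by (simp add: dominant_weights_def)
        moreover have "[] \<in> paths T [] (\<lambda>_. 0)"
          by (simp add: paths_eq[OF T] highest_paths_Nil path_word_def word_wt_def)
        ultimately show ?thesis by (simp add: psi_b)
      qed
      show "\<forall>B' lam. \<forall>B. B = (1, 1) # B' \<and> B \<in> KR_products T \<and> lam \<in> dominant_weights T \<longrightarrow>
          (\<forall>b\<in>paths T B lam. \<exists>\<mu>\<in>weights_below T lam.
             lh b \<in> paths T B' \<mu>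
             \<and> \<psi> (B', \<mu>) (lh b) = delta T (mult_array B) (mult_array B') (\<psi> (B, lam) b))"
      proof (intro allI impI ballI, elim conjE)
        fix B' lam B b
        assume B: "B = (1, 1) # B'" "B \<in> KR_products T" and lam: "lam \<in> dominant_weights T" and b: "b \<in> paths T B lam"
        have B': "B' \<in> KR_products T" using B in_KR_products_Cons by blast
        obtain \<mu> where mu: "\<mu> \<in> weights_below T lam" "lh b \<in> paths T B' \<mu>"
          "rc_of T B' (lh b) = delta T (mult_array B) (mult_array B') (rc_of T B b)"
          using rc_of_lh[OF T, of B' b lam] B b by blast
        then have "\<mu> \<in> dominant_weights T" by (simp add: weights_below_def)
        then show "\<exists>\<mu>\<in>weights_below T lam. lh b \<in> paths T B' \<mu>
             \<and> \<psi> (B', \<mu>) (lh b) = delta T (mult_array B) (mult_array B') (\<psi> (B, lam) b)"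
          using mu psi_b[OF B(2) lam b] psi_b[OF B' _ mu(2)] by auto
      qed
      show "\<forall>r s B' lam. \<forall>B lsB. B = (r, s) # B' \<and> s \<ge> 2 \<and> lsB = (r, 1) # (r, s - 1) # B'
          \<and> B \<in> KR_products T \<and> lam \<in> dominant_weights T \<longrightarrow>
          (\<forall>b\<in>paths T B lam.
             ls b \<in> paths T lsB lam
             \<and> \<psi> (lsB, lam) (ls b) = rc_j (\<psi> (B, lam) b))"
      proof (intro allI impI ballI, elim conjE)
        fix r s B' lam B lsB b
        assume B: "B = (r, s) # B'" "2 \<le> s" and B1: "lsB = (r, 1) # (r, s - 1) # B'" and BT: "B \<in> KR_products T"
          and lam: "lam \<in> dominant_weights T" and b: "b \<in> paths T B lam"
        have B1T: "lsB \<in> KR_products T" using BT B B1 by (cases T) auto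
        note lls = rc_of_ls[OF T BT[unfolded B(1)] B(2) b[unfolded B(1)], folded B1 B(1)]
        show "ls b \<in> paths T lsB lam \<and> \<psi> (lsB, lam) (ls b) = rc_j (\<psi> (B, lam) b)"
          using lls psi_b[OF BT lam b] psi_b[OF B1T lam lls(1)] by (simp add: rc_j_def)
      qed
      show "\<forall>n r B' lam. \<forall>B lbB. T = TypeA n \<and> B = (r, 1) # B' \<and> r \<ge> 2
          \<and> lbB = (1, 1) # (r - 1, 1) # B'
          \<and> B \<in> KR_products T \<and> lam \<in> dominant_weights T \<longrightarrow>
          (\<forall>b\<in>paths T B lam.
             lb b \<in> paths T lbB lam
             \<and> \<psi> (lbB, lam) (lb b) = rc_i T (mult_array lbB) r (\<psi> (B, lam) b))"
      proof (intro allI impI ballI, elim conjE)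
        fix n r B' lam B lbB b
        assume n: "T = TypeA n" and B: "B = (r, 1) # B'" "2 \<le> r" and B1: "lbB = (1, 1) # (r - 1, 1) # B'" and BT: "B \<in> KR_products T"
          and lam: "lam \<in> dominant_weights T" and b: "b \<in> paths T B lam"
        have B1T: "lbB \<in> KR_products T" using BT B B1 n by auto
        note lb = rc_of_lb[OF T[unfolded n] BT[unfolded B(1) n] B(2) b[unfolded B(1) n], folded n B1 B(1)]
        show "lb b \<in> paths T lbB lam \<and> \<psi> (lbB, lam) (lb b) = rc_i T (mult_array lbB) r (\<psi> (B, lam) b)"
          using lb psi_b[OF BT lam b] psi_b[OF B1T lam lb(1)] by simp
      qed
      show "\<forall>B\<in>KR_products T. \<forall>lam\<in>dominant_weights T. bij_betw (\<psi> (B, lam)) (paths T B lam) (RC T (mult_array B) lam)"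
        using bij by blast
    qed (rule PiE)
    fix \<phi> assume P: "?P \<phi>"
    have \<phi>: "\<phi> \<in> (\<Pi>\<^sub>E (B, lam)\<in>KR_products T \<times> dominant_weights T. paths T B lam \<rightarrow>\<^sub>E RC T (mult_array B) lam)"
      using P by (rule conjunct1)
    have fn: "\<phi> (B, lam) \<in> paths T B lam \<rightarrow>\<^sub>E RC T (mult_array B) lam" if "B \<in> KR_products T" "lam \<in> dominant_weights T" for B lam
      using PiE_mem[OF \<phi>, of "(B, lam)"] that by simp
    have eq: "\<phi> (B, lam) b = rc_of T B b" if "B \<in> KR_products T" "lam \<in> dominant_weights T" "b \<in> paths T B lam" for B lam b
    proof (rule rc_of_unique[OF T _ _ _ _ _ that])
      show "\<phi> (B, lam) b \<in> RC T (mult_array B) lam" if "B \<in> KR_products T" "lam \<in> dominant_weights T" "b \<in> paths T B lam" for B lam b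
        using PiE_mem[OF fn[OF that(1,2)] that(3)] .
      show "\<phi> ([], (\<lambda>_. 0)) [] = empty_rc"
        by (rule P[THEN conjunct2, THEN conjunct2, THEN conjunct1])
      note clauses = P[THEN conjunct2, THEN conjunct2, THEN conjunct2]
      show "\<exists>\<mu>\<in>weights_below T lam. lh b \<in> paths T B \<mu> \<and> \<phi> (B, \<mu>) (lh b) = delta T (mult_array ((1, 1) # B)) (mult_array B) (\<phi> ((1, 1) # B, lam) b)"
        if "(1, 1) # B \<in> KR_products T" "lam \<in> dominant_weights T" "b \<in> paths T ((1, 1) # B) lam" for B lam b
        using clauses[THEN conjunct1, rule_format, of "(1, 1) # B" B lam b] that by simp
      show "\<phi> ((r, 1) # (r, s - 1) # B, lam) (ls b) = rc_j (\<phi> ((r, s) # B, lam) b)"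
        if "2 \<le> s" "(r, s) # B \<in> KR_products T" "lam \<in> dominant_weights T" "b \<in> paths T ((r, s) # B) lam" for r s B lam b
        using clauses[THEN conjunct2, THEN conjunct1, rule_format, of "(r, s) # B" r s B "(r, 1) # (r, s - 1) # B" lam b] that by simp
      show "\<phi> ((1, 1) # (r - 1, 1) # B, lam) (lb b) = rc_i T (mult_array ((1, 1) # (r - 1, 1) # B)) r (\<phi> ((r, 1) # B, lam) b)"
        if "T = TypeA n" "2 \<le> r" "(r, 1) # B \<in> KR_products T" "lam \<in> dominant_weights T" "b \<in> paths T ((r, 1) # B) lam" for n r B lam b
        using clauses[THEN conjunct2, THEN conjunct2, rule_format, of n "(r, 1) # B" r B "(1, 1) # (r - 1, 1) # B" lam b] that by simp
    qed
    show "\<phi> = \<psi>"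
    proof (rule PiE_ext[OF \<phi> PiE])
      fix z assume z: "z \<in> KR_products T \<times> dominant_weights T"
      obtain B lam where BL: "z = (B, lam)" "B \<in> KR_products T" "lam \<in> dominant_weights T" using z by blast
      show "\<phi> z = \<psi> z"
      proof
        fix b
        show "\<phi> z b = \<psi> z b"
          using eq[OF BL(2,3), of b] psi[OF BL(2,3)] PiE_arb[OF fn[OF BL(2,3)], of b] BL(1)
          by (cases "b \<in> paths T B lam") simp_all
      qed
    qed
  qed
qed

end
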